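(* Let $k$ be a commutative unital ring, $\mathcal{H}$ a Hopf algebra over $k$ with bijective antipode $S$, and $C$ a left $\mathcal{H}$-comodule coalgebra. For $p,q\ge 0$ put $(C\natural\mathcal{H})_{p,q}=\mathcal{H}^{\otimes(p+1)}\otimes C^{\otimes(q+1)}$, writing elements as $(g_0,\dots,g_p\mid a_0,\dots,a_q)$. Define operators (in the $q$-direction) $$\tau_{p,q}(g_0,\dots,g_p\mid a_0,\dots,a_q)=(S^{-1}(a_0^{(\bar 1)})\cdot(g_0,\dots,g_p)\mid a_1,\dots,a_q,a_0^{(\bar 0)}),$$ $$\sigma^i_{p,q}(g_0,\dots,g_p\mid a_0,\dots,a_q)=\epsilon(a_{i+1})\,(g_0,\dots,g_p\mid a_0,\dots,a_i,a_{i+2},\dots,a_q),\quad 0\le i<q,$$ $$\partial^i_{p,q}(g_0,\dots,g_p\mid a_0,\dots,a_q)=(g_0,\dots,g_p\mid a_0,\dots,a_i^{(0)},a_i^{(1)},\dots,a_q),\quad 0\le i\le q,$$ $$\partial^{q+1}_{p,q}(g_0,\dots,g_p\mid a_0,\dots,a_q)=(S^{-1}(a_0^{(0)(\bar 1)})\cdot(g_0,\dots,g_p)\mid a_0^{(1)},a_1,\dots,a_q,a_0^{(0)(\bar 0)}),$$ and (in the $p$-direction) $$\bar\tau_{p,q}(g_0,\dots,g_p\mid a_0,\dots,a_q)=(g_1,\dots,g_p,(a_0^{(\bar 1)}\cdots a_q^{(\bar 1)})g_0\mid a_0^{(\bar 0)},\dots,a_q^{(\bar 0)}),$$ $$\bar\sigma^i_{p,q}(g_0,\dots,g_p\mid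 a_0,\dots,a_q)=\epsilon(g_{i+1})\,(g_0,\dots,g_i,g_{i+2},\dots,g_p\mid a_0,\dots,a_q),\quad 0\le i<p,$$ $$\bar\partial^i_{p,q}(g_0,\dots,g_p\mid a_0,\dots,a_q)=(g_0,\dots,g_i^{(0)},g_i^{(1)},\dots,g_p\mid a_0,\dots,a_q),\quad 0\le i\le p,$$ $$\bar\partial^{p+1}_{p,q}(g_0,\dots,g_p\mid a_0,\dots,a_q)=(g_0^{(1)},g_1,\dots,g_p,(a_0^{(\bar 1)}\cdots a_q^{(\bar 1)})g_0^{(0)}\mid a_0^{(\bar 0)},\dots,a_q^{(\bar 0)}).$$ Then $C\natural\mathcal{H}=\{(C\natural\mathcal{H})_{p,q}\}_{p,q\ge0}$ with these operators is a cocylindrical module over $k$.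
   Context: All tensor products are over $k$. Sweedler notation (summation understood): $\Delta(h)=h^{(0)}\otimes h^{(1)}$ for coproducts, with counit $\epsilon$; a left $\mathcal{H}$-coaction $\rho:M\to\mathcal{H}\otimes M$ is written $\rho(m)=m^{(\bar 1)}\otimes m^{(\bar 0)}$. The action on tensors is $h\cdot(g_0,\dots,g_p)=(h^{(0)}g_0,\dots,h^{(p)}g_p)$. A coalgebra $C$ (coassociative, counital) is a left $\mathcal{H}$-comodule coalgebra if it is a left $\mathcal{H}$-comodule and, for all $a\in C$, $a^{(0)(\bar 1)}a^{(1)(\bar 1)}\otimes a^{(0)(\bar 0)}\otimes a^{(1)(\bar 0)}=a^{(\bar 1)}\otimes a^{(\bar 0)(0)}\otimes a^{(\bar 0)(1)}$ and $a^{(\bar 1)}\epsilon(a^{(\bar 0)})=\epsilon(a)1_{\mathcal{H}}$. A paracocyclic module is a sequence of $k$-modules $A_n$, $n\ge0$, with cofaces $\partial^i:A_n\to A_{n+1}$ ($0\le i\le n+1$), codegeneracies $\sigma^i:A_n\to A_{n-1}$ ($0\le i\le n-1$) satisfying the cosimplicial identities, and automorphisms $\tau_n:A_n\to A_n$ with $\tau_{n+1}\partial^i=\partial^{i-1}\tau_n$ ($1\le i\le n+1$), $\tau_{n+1}\partial^0=\partial^{n+1}$, $\tau_{n-1}\sigma^i=\sigma^{i-1}\tau_n$ ($1\le i\le n-1$), $\tau_{n-1}\sigma^0=\sigma^{n-1}\tau_n^2$. A bi-paracocyclic module is a family $A(p,q)$ with operators $\partial,\sigma,\tau$ making $A(p,\bullet)$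 paracocyclic for each $p$, and operators $\bar\partial,\bar\sigma,\bar\tau$ making $A(\bullet,q)$ paracocyclic for each $q$, such that every unbarred operator commutes with every barred operator. It is cocylindrical if $\bar\tau_{p,q}^{\,p+1}\tau_{p,q}^{\,q+1}=\mathrm{id}$ for all $p,q\ge0$. *)

theory Defs
  imports "HOL-Algebra.Module" "HOL-Algebra.AbelCoset"
begin

section \<open>Linear maps, free modules, quotient modules\<close>

text \<open>
  A ring or module is a record with an explicit carrier. Functions between such structures only
  matter on the carriers, and all equations below are relativised accordingly.
\<close>

definition lin_maps ::
  "('k, _) ring_scheme \<Rightarrow> ('k, 'a, _) module_scheme \<Rightarrow> ('k, 'b, _) module_scheme \<Rightarrow> ('a \<Rightarrow> 'b) set"
  where "lin_maps k M N = {f.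
     f \<in> carrier M \<rightarrow> carrier N \<and>
     (\<forall>x\<in>carrier M. \<forall>y\<in>carrier M. f (x \<oplus>\<^bsub>M\<^esub> y) = f x \<oplus>\<^bsub>N\<^esub> f y) \<and>
     (\<forall>r\<in>carrier k. \<forall>x\<in>carrier M. f (r \<odot>\<^bsub>M\<^esub> x) = r \<odot>\<^bsub>N\<^esub> f x)}"

definition regular_module :: "('k, _) ring_scheme \<Rightarrow> ('k, 'k) module"
  where "regular_module k =
    \<lparr>carrier = carrier k, mult = mult k, one = \<one>\<^bsub>k\<^esub>, zero = \<zero>\<^bsub>k\<^esub>, add = add k, smult = mult k\<rparr>"

text \<open>
  In the next two records the fields mult and one are irrelevant: only the module
  structure is used.
\<close>

definition free_module :: "('k, _) ring_scheme \<Rightarrow> 'x set \<Rightarrow> ('k, 'x \<Rightarrow> 'k) module"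
  where "free_module k X =
    \<lparr>carrier = {f. range f \<subseteq> carrier k \<and> finite {x. f x \<noteq> \<zero>\<^bsub>k\<^esub>} \<and> {x. f x \<noteq> \<zero>\<^bsub>k\<^esub>} \<subseteq> X},
     mult = (\<lambda>_ _. undefined), one = undefined,
     zero = (\<lambda>_. \<zero>\<^bsub>k\<^esub>), add = (\<lambda>f g x. f x \<oplus>\<^bsub>k\<^esub> g x), smult = (\<lambda>r f x. r \<otimes>\<^bsub>k\<^esub> f x)\<rparr>"

definition free_gen :: "('k, _) ring_scheme \<Rightarrow> 'x \<Rightarrow> ('x \<Rightarrow> 'k)"
  where "free_gen k x = (\<lambda>y. if y = x then \<one>\<^bsub>k\<^esub> else \<zero>\<^bsub>k\<^esub>)"

definition quotient_module :: "('k, 'a, _) module_scheme \<Rightarrow> 'a set \<Rightarrow> ('k, 'a set) module"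
  where "quotient_module M N =
    \<lparr>carrier = a_rcosets\<^bsub>M\<^esub> N, mult = (\<lambda>_ _. undefined), one = undefined,
     zero = N, add = set_add M, smult = (\<lambda>r X. \<Union>x\<in>X. N +>\<^bsub>M\<^esub> (r \<odot>\<^bsub>M\<^esub> x))\<rparr>"

definition generated_submodule ::
  "('k, _) ring_scheme \<Rightarrow> ('k, 'a, _) module_scheme \<Rightarrow> 'a set \<Rightarrow> 'a set"
  where "generated_submodule k M R = \<Inter>{N. submodule N k M \<and> R \<subseteq> N}"

section \<open>Tensor products\<close>

text \<open>
  The term tensor k M p N q is the tensor product, over k, of p copies of M followed by
  q copies of N: the quotient of the free module on the tuples (x1, ..., xp | y1, ..., yq),
  encoded as pairs of lists, by the submodule expressing additivity and homogeneity in every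
  slot. In particular tensor k M 1 N 1 is the binary tensor product of M and N.
\<close>

type_synonym ('k, 'm, 'n) tensor_elem = "('m list \<times> 'n list \<Rightarrow> 'k) set"

definition tensor_gens ::
  "('k, 'm, _) module_scheme \<Rightarrow> nat \<Rightarrow> ('k, 'n, _) module_scheme \<Rightarrow> nat \<Rightarrow> ('m list \<times> 'n list) set"
  where "tensor_gens M p N q =
    {(xs, ys). length xs = p \<and> set xs \<subseteq> carrier M \<and> length ys = q \<and> set ys \<subseteq> carrier N}"

definition tensor_rels ::
  "('k, _) ring_scheme \<Rightarrow> ('k, 'm, _) module_scheme \<Rightarrow> nat \<Rightarrow> ('k, 'n, _) module_scheme \<Rightarrow> nat
    \<Rightarrow> ('m list \<times> 'n list \<Rightarrow> 'k) set"
  where "tensor_rels k M p N q =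
    (let G = tensor_gens M p N q; F = free_module k G; e = (\<lambda>xs ys. free_gen k (xs, ys)) in
       {e (xs[i := x \<oplus>\<^bsub>M\<^esub> x']) ys \<ominus>\<^bsub>F\<^esub> (e (xs[i := x]) ys \<oplus>\<^bsub>F\<^esub> e (xs[i := x']) ys) | xs ys i x x'.
          (xs, ys) \<in> G \<and> i < p \<and> x \<in> carrier M \<and> x' \<in> carrier M}
     \<union> {e (xs[i := r \<odot>\<^bsub>M\<^esub> x]) ys \<ominus>\<^bsub>F\<^esub> (r \<odot>\<^bsub>F\<^esub> e (xs[i := x]) ys) | xs ys i r x.
          (xs, ys) \<in> G \<and> i < p \<and> r \<in> carrier k \<and> x \<in> carrier M}
     \<union> {e xs (ys[j := y \<oplus>\<^bsub>N\<^esub> y']) \<ominus>\<^bsub>F\<^esub> (e xs (ys[j := y]) \<oplus>\<^bsub>F\<^esub> e xs (ys[j := y'])) | xs ys j y y'.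
          (xs, ys) \<in> G \<and> j < q \<and> y \<in> carrier N \<and> y' \<in> carrier N}
     \<union> {e xs (ys[j := r \<odot>\<^bsub>N\<^esub> y]) \<ominus>\<^bsub>F\<^esub> (r \<odot>\<^bsub>F\<^esub> e xs (ys[j := y])) | xs ys j r y.
          (xs, ys) \<in> G \<and> j < q \<and> r \<in> carrier k \<and> y \<in> carrier N})"

definition tensor_null ::
  "('k, _) ring_scheme \<Rightarrow> ('k, 'm, _) module_scheme \<Rightarrow> nat \<Rightarrow> ('k, 'n, _) module_scheme \<Rightarrow> nat
    \<Rightarrow> ('m list \<times> 'n list \<Rightarrow> 'k) set"
  where "tensor_null k M p N q =
    generated_submodule k (free_module k (tensor_gens M p N q)) (tensor_rels k M p N q)"

definition tensor ::
  "('k, _) ring_scheme \<Rightarrow> ('k, 'm, _) module_scheme \<Rightarrow> nat \<Rightarrow> ('k, 'n, _) module_scheme \<Rightarrow> nat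
    \<Rightarrow> ('k, ('k, 'm, 'n) tensor_elem) module"
  where "tensor k M p N q =
    quotient_module (free_module k (tensor_gens M p N q)) (tensor_null k M p N q)"

definition pure_tensor ::
  "('k, _) ring_scheme \<Rightarrow> ('k, 'm, _) module_scheme \<Rightarrow> ('k, 'n, _) module_scheme
    \<Rightarrow> 'm list \<Rightarrow> 'n list \<Rightarrow> ('k, 'm, 'n) tensor_elem"
  where "pure_tensor k M N xs ys =
    tensor_null k M (length xs) N (length ys)
      +>\<^bsub>free_module k (tensor_gens M (length xs) N (length ys))\<^esub> free_gen k (xs, ys)"

text \<open>
  If F is multilinear on tuples with values in the module L, then lin_ext k L t F is the value
  at t of the unique linear map on the tensor product sending each pure tensor (xs | ys) to F xs ys.
  It is evaluated on a chosen representative of the coset t; for multilinear F the choice is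
  irrelevant.
\<close>

definition lin_ext ::
  "('k, _) ring_scheme \<Rightarrow> ('k, 'l, _) module_scheme \<Rightarrow> ('k, 'm, 'n) tensor_elem
    \<Rightarrow> ('m list \<Rightarrow> 'n list \<Rightarrow> 'l) \<Rightarrow> 'l"
  where "lin_ext k L t F =
    (let f = (SOME f. f \<in> t)
     in \<Oplus>\<^bsub>L\<^esub>g\<in>{g. f g \<noteq> \<zero>\<^bsub>k\<^esub>}. f g \<odot>\<^bsub>L\<^esub> F (fst g) (snd g))"

text \<open>
  Sweedler notation: if t is an element of a binary tensor product, written t' \<otimes> t'' with summation
  understood, then sweedler k L t (\<lambda>x y. F x y) is the sum F t' t'' in L.
\<close>

definition sweedler ::
  "('k, _) ring_scheme \<Rightarrow> ('k, 'l, _) module_scheme \<Rightarrow> ('k, 'm, 'n) tensor_elem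
    \<Rightarrow> ('m \<Rightarrow> 'n \<Rightarrow> 'l) \<Rightarrow> 'l"
  where "sweedler k L t F = lin_ext k L t (\<lambda>xs ys. F (hd xs) (hd ys))"

section \<open>Coalgebras, Hopf algebras and comodule coalgebras\<close>

record ('k, 'c) coalgebra = "('k, 'c) module" +
  comult :: "'c \<Rightarrow> ('k, 'c, 'c) tensor_elem" (\<open>\<Delta>\<index>\<close>)
  counit :: "'c \<Rightarrow> 'k" (\<open>\<epsilon>\<index>\<close>)

locale coalgebra = module k C for k (structure) and C :: "('k, 'c, 'z) coalgebra_scheme" +
  assumes comult_linear: "\<Delta>\<^bsub>C\<^esub> \<in> lin_maps k C (tensor k C 1 C 1)"
    and counit_linear: "\<epsilon>\<^bsub>C\<^esub> \<in> lin_maps k C (regular_module k)"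
    and coassoc: "a \<in> carrier C \<Longrightarrow>
      sweedler k (tensor k C 3 C 0) (\<Delta>\<^bsub>C\<^esub> a) (\<lambda>x y.
        sweedler k (tensor k C 3 C 0) (\<Delta>\<^bsub>C\<^esub> x) (\<lambda>u v. pure_tensor k C C [u, v, y] []))
    = sweedler k (tensor k C 3 C 0) (\<Delta>\<^bsub>C\<^esub> a) (\<lambda>x y.
        sweedler k (tensor k C 3 C 0) (\<Delta>\<^bsub>C\<^esub> y) (\<lambda>u v. pure_tensor k C C [x, u, v] []))"
    and counit_left: "a \<in> carrier C \<Longrightarrow> sweedler k C (\<Delta>\<^bsub>C\<^esub> a) (\<lambda>x y. \<epsilon>\<^bsub>C\<^esub> x \<odot>\<^bsub>C\<^esub> y) = a"
    and counit_right: "a \<in> carrier C \<Longrightarrow> sweedler k C (\<Delta>\<^bsub>C\<^esub> a) (\<lambda>x y. \<epsilon>\<^bsub>C\<^esub> y \<odot>\<^bsub>C\<^esub> x) = a"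

record ('k, 'h) hopf_algebra = "('k, 'h) coalgebra" +
  antipode :: "'h \<Rightarrow> 'h"

locale hopf_algebra = ring H + coalgebra k H
  for k (structure) and H :: "('k, 'h, 'z) hopf_algebra_scheme" +
  assumes smult_mult_left: "\<lbrakk>r \<in> carrier k; x \<in> carrier H; y \<in> carrier H\<rbrakk> \<Longrightarrow>
      (r \<odot>\<^bsub>H\<^esub> x) \<otimes>\<^bsub>H\<^esub> y = r \<odot>\<^bsub>H\<^esub> (x \<otimes>\<^bsub>H\<^esub> y)"
    and smult_mult_right: "\<lbrakk>r \<in> carrier k; x \<in> carrier H; y \<in> carrier H\<rbrakk> \<Longrightarrow>
      x \<otimes>\<^bsub>H\<^esub> (r \<odot>\<^bsub>H\<^esub> y) = r \<odot>\<^bsub>H\<^esub> (x \<otimes>\<^bsub>H\<^esub> y)"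
    and comult_one: "\<Delta>\<^bsub>H\<^esub> \<one>\<^bsub>H\<^esub> = pure_tensor k H H [\<one>\<^bsub>H\<^esub>] [\<one>\<^bsub>H\<^esub>]"
    and comult_mult: "\<lbrakk>x \<in> carrier H; y \<in> carrier H\<rbrakk> \<Longrightarrow>
      \<Delta>\<^bsub>H\<^esub> (x \<otimes>\<^bsub>H\<^esub> y) =
        sweedler k (tensor k H 1 H 1) (\<Delta>\<^bsub>H\<^esub> x) (\<lambda>x0 x1.
          sweedler k (tensor k H 1 H 1) (\<Delta>\<^bsub>H\<^esub> y) (\<lambda>y0 y1.
            pure_tensor k H H [x0 \<otimes>\<^bsub>H\<^esub> y0] [x1 \<otimes>\<^bsub>H\<^esub> y1]))"
    and counit_one: "\<epsilon>\<^bsub>H\<^esub> \<one>\<^bsub>H\<^esub> = \<one>"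
    and counit_mult: "\<lbrakk>x \<in> carrier H; y \<in> carrier H\<rbrakk> \<Longrightarrow> \<epsilon>\<^bsub>H\<^esub> (x \<otimes>\<^bsub>H\<^esub> y) = \<epsilon>\<^bsub>H\<^esub> x \<otimes> \<epsilon>\<^bsub>H\<^esub> y"
    and antipode_linear: "antipode H \<in> lin_maps k H H"
    and antipode_left: "h \<in> carrier H \<Longrightarrow>
      sweedler k H (\<Delta>\<^bsub>H\<^esub> h) (\<lambda>x y. antipode H x \<otimes>\<^bsub>H\<^esub> y) = \<epsilon>\<^bsub>H\<^esub> h \<odot>\<^bsub>H\<^esub> \<one>\<^bsub>H\<^esub>"
    and antipode_right: "h \<in> carrier H \<Longrightarrow>
      sweedler k H (\<Delta>\<^bsub>H\<^esub> h) (\<lambda>x y. x \<otimes>\<^bsub>H\<^esub> antipode H y) = \<epsilon>\<^bsub>H\<^esub> h \<odot>\<^bsub>H\<^esub> \<one>\<^bsub>H\<^esub>"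

record ('k, 'h, 'c) comodule_coalgebra = "('k, 'c) coalgebra" +
  coaction :: "'c \<Rightarrow> ('k, 'h, 'c) tensor_elem" (\<open>\<rho>\<index>\<close>)

locale left_comodule = H: coalgebra k H + M: module k M
  for k (structure) and H :: "('k, 'h, 'z) coalgebra_scheme" and M :: "('k, 'm, 'y) module_scheme"
    and coact :: "'m \<Rightarrow> ('k, 'h, 'm) tensor_elem" +
  assumes coaction_linear: "coact \<in> lin_maps k M (tensor k H 1 M 1)"
    and coaction_coassoc: "m \<in> carrier M \<Longrightarrow>
      sweedler k (tensor k H 2 M 1) (coact m) (\<lambda>h n.
        sweedler k (tensor k H 2 M 1) (\<Delta>\<^bsub>H\<^esub> h) (\<lambda>u v. pure_tensor k H M [u, v] [n]))
    = sweedler k (tensor k H 2 M 1) (coact m) (\<lambda>h n.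
        sweedler k (tensor k H 2 M 1) (coact n) (\<lambda>u l. pure_tensor k H M [h, u] [l]))"
    and coaction_counit: "m \<in> carrier M \<Longrightarrow> sweedler k M (coact m) (\<lambda>h n. \<epsilon>\<^bsub>H\<^esub> h \<odot>\<^bsub>M\<^esub> n) = m"

locale comodule_coalgebra =
  H: hopf_algebra k H + C: coalgebra k C + left_comodule k H C "\<rho>\<^bsub>C\<^esub>"
  for k (structure) and H :: "('k, 'h, 'z) hopf_algebra_scheme"
    and C :: "('k, 'h, 'c, 'y) comodule_coalgebra_scheme" +
  assumes coaction_comult: "a \<in> carrier C \<Longrightarrow>
      sweedler k (tensor k H 1 C 2) (\<Delta>\<^bsub>C\<^esub> a) (\<lambda>x y.
        sweedler k (tensor k H 1 C 2) (\<rho>\<^bsub>C\<^esub> x) (\<lambda>g b.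
          sweedler k (tensor k H 1 C 2) (\<rho>\<^bsub>C\<^esub> y) (\<lambda>h c.
            pure_tensor k H C [g \<otimes>\<^bsub>H\<^esub> h] [b, c])))
    = sweedler k (tensor k H 1 C 2) (\<rho>\<^bsub>C\<^esub> a) (\<lambda>h b.
        sweedler k (tensor k H 1 C 2) (\<Delta>\<^bsub>C\<^esub> b) (\<lambda>x y. pure_tensor k H C [h] [x, y]))"
    and coaction_counit_C: "a \<in> carrier C \<Longrightarrow>
      sweedler k H (\<rho>\<^bsub>C\<^esub> a) (\<lambda>h b. \<epsilon>\<^bsub>C\<^esub> b \<odot>\<^bsub>H\<^esub> h) = \<epsilon>\<^bsub>C\<^esub> a \<odot>\<^bsub>H\<^esub> \<one>\<^bsub>H\<^esub>"

section \<open>Paracocyclic and cocylindrical modules\<close>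

text \<open>
  d n i is the coface from A n to A (n + 1), s n i the codegeneracy from A n to A (n - 1),
  and t n the paracocyclic operator on A n.
\<close>

locale paracocyclic_module =
  fixes k :: "('k, 'z) ring_scheme" and A :: "nat \<Rightarrow> ('k, 'a, 'y) module_scheme"
    and d s :: "nat \<Rightarrow> nat \<Rightarrow> 'a \<Rightarrow> 'a" and t :: "nat \<Rightarrow> 'a \<Rightarrow> 'a"
  assumes is_module: "module k (A n)"
    and d_linear: "i \<le> n + 1 \<Longrightarrow> d n i \<in> lin_maps k (A n) (A (n + 1))"
    and s_linear: "i < n \<Longrightarrow> s n i \<in> lin_maps k (A n) (A (n - 1))"
    and t_linear: "t n \<in> lin_maps k (A n) (A n)"
    and t_bij: "bij_betw (t n) (carrier (A n)) (carrier (A n))"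
    and d_d: "\<lbrakk>i < j; j \<le> n + 2; x \<in> carrier (A n)\<rbrakk> \<Longrightarrow>
      d (n + 1) j (d n i x) = d (n + 1) i (d n (j - 1) x)"
    and s_s: "\<lbrakk>i \<le> j; j + 1 < n; x \<in> carrier (A n)\<rbrakk> \<Longrightarrow>
      s (n - 1) j (s n i x) = s (n - 1) i (s n (j + 1) x)"
    and s_d_less: "\<lbrakk>i < j; j \<le> n; x \<in> carrier (A n)\<rbrakk> \<Longrightarrow>
      s (n + 1) j (d n i x) = d (n - 1) i (s n (j - 1) x)"
    and s_d_id: "\<lbrakk>i = j \<or> i = j + 1; j \<le> n; x \<in> carrier (A n)\<rbrakk> \<Longrightarrow> s (n + 1) j (d n i x) = x"
    and s_d_greater: "\<lbrakk>j + 1 < i; i \<le> n + 1; x \<in> carrier (A n)\<rbrakk> \<Longrightarrow>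
      s (n + 1) j (d n i x) = d (n - 1) (i - 1) (s n j x)"
    and t_d: "\<lbrakk>1 \<le> i; i \<le> n + 1; x \<in> carrier (A n)\<rbrakk> \<Longrightarrow>
      t (n + 1) (d n i x) = d n (i - 1) (t n x)"
    and t_d_0: "x \<in> carrier (A n) \<Longrightarrow> t (n + 1) (d n 0 x) = d n (n + 1) x"
    and t_s: "\<lbrakk>1 \<le> i; i < n; x \<in> carrier (A n)\<rbrakk> \<Longrightarrow>
      t (n - 1) (s n i x) = s n (i - 1) (t n x)"
    and t_s_0: "\<lbrakk>1 \<le> n; x \<in> carrier (A n)\<rbrakk> \<Longrightarrow>
      t (n - 1) (s n 0 x) = s n (n - 1) (t n (t n x))"

text \<open>
  d, s, t act in the second index and db, sb, tb (the barred operators) in the first one; in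
  both families the first two arguments are the bidegree of the source.
\<close>

locale bi_paracocyclic_module =
  fixes k :: "('k, 'z) ring_scheme" and A :: "nat \<Rightarrow> nat \<Rightarrow> ('k, 'a, 'y) module_scheme"
    and d s :: "nat \<Rightarrow> nat \<Rightarrow> nat \<Rightarrow> 'a \<Rightarrow> 'a" and t :: "nat \<Rightarrow> nat \<Rightarrow> 'a \<Rightarrow> 'a"
    and db sb :: "nat \<Rightarrow> nat \<Rightarrow> nat \<Rightarrow> 'a \<Rightarrow> 'a" and tb :: "nat \<Rightarrow> nat \<Rightarrow> 'a \<Rightarrow> 'a"
  assumes paracocyclic: "paracocyclic_module k (A p) (d p) (s p) (t p)"
    and paracocyclic_bar:
      "paracocyclic_module k (\<lambda>p. A p q) (\<lambda>p. db p q) (\<lambda>p. sb p q) (\<lambda>p. tb p q)"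
    and d_db: "\<lbrakk>i \<le> q + 1; j \<le> p + 1; x \<in> carrier (A p q)\<rbrakk> \<Longrightarrow>
      d (p + 1) q i (db p q j x) = db p (q + 1) j (d p q i x)"
    and d_sb: "\<lbrakk>i \<le> q + 1; j < p; x \<in> carrier (A p q)\<rbrakk> \<Longrightarrow>
      d (p - 1) q i (sb p q j x) = sb p (q + 1) j (d p q i x)"
    and d_tb: "\<lbrakk>i \<le> q + 1; x \<in> carrier (A p q)\<rbrakk> \<Longrightarrow>
      d p q i (tb p q x) = tb p (q + 1) (d p q i x)"
    and s_db: "\<lbrakk>i < q; j \<le> p + 1; x \<in> carrier (A p q)\<rbrakk> \<Longrightarrow>
      s (p + 1) q i (db p q j x) = db p (q - 1) j (s p q i x)"
    and s_sb: "\<lbrakk>i < q; j < p; x \<in> carrier (A p q)\<rbrakk> \<Longrightarrow>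
      s (p - 1) q i (sb p q j x) = sb p (q - 1) j (s p q i x)"
    and s_tb: "\<lbrakk>i < q; x \<in> carrier (A p q)\<rbrakk> \<Longrightarrow>
      s p q i (tb p q x) = tb p (q - 1) (s p q i x)"
    and t_db: "\<lbrakk>j \<le> p + 1; x \<in> carrier (A p q)\<rbrakk> \<Longrightarrow>
      t (p + 1) q (db p q j x) = db p q j (t p q x)"
    and t_sb: "\<lbrakk>j < p; x \<in> carrier (A p q)\<rbrakk> \<Longrightarrow>
      t (p - 1) q (sb p q j x) = sb p q j (t p q x)"
    and t_tb: "x \<in> carrier (A p q) \<Longrightarrow> t p q (tb p q x) = tb p q (t p q x)"

locale cocylindrical_module = bi_paracocyclic_module +
  assumes cylindrical: "x \<in> carrier (A p q) \<Longrightarrow>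
    (tb p q ^^ (p + 1)) ((t p q ^^ (q + 1)) x) = x"

section \<open>The operators on the crossed product\<close>

definition antipode_inv :: "('k, 'h, _) hopf_algebra_scheme \<Rightarrow> 'h \<Rightarrow> 'h"
  where "antipode_inv H = inv_into (carrier H) (antipode H)"

text \<open>
  The iterated coproduct of h, an element of the tensor power of H with n + 1 factors.
\<close>

primrec iter_comult ::
  "('k, _) ring_scheme \<Rightarrow> ('k, 'h, _) coalgebra_scheme \<Rightarrow> nat \<Rightarrow> 'h \<Rightarrow> ('k, 'h, 'h) tensor_elem"
  where
    "iter_comult k H 0 h = pure_tensor k H H [h] []"
  | "iter_comult k H (Suc n) h =
      sweedler k (tensor k H (n + 2) H 0) (\<Delta>\<^bsub>H\<^esub> h) (\<lambda>x y.
        lin_ext k (tensor k H (n + 2) H 0) (iter_comult k H n y) (\<lambda>hs _.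
          pure_tensor k H H (x # hs) []))"

text \<open>The element (h\<sqdot>(g0, ..., gp) | a0, ..., aq), with h acting diagonally.\<close>

definition diag_act ::
  "('k, _) ring_scheme \<Rightarrow> ('k, 'h, _) hopf_algebra_scheme \<Rightarrow> ('k, 'h, 'c, _) comodule_coalgebra_scheme
    \<Rightarrow> 'h \<Rightarrow> 'h list \<Rightarrow> 'c list \<Rightarrow> ('k, 'h, 'c) tensor_elem"
  where "diag_act k H C h gs as =
    lin_ext k (tensor k H (length gs) C (length as)) (iter_comult k H (length gs - 1) h) (\<lambda>hs _.
      pure_tensor k H C (map2 (mult H) hs gs) as)"

text \<open>The element a0^(1) ... aq^(1) \<otimes> a0^(0) \<otimes> ... \<otimes> aq^(0), superscripts denoting the coaction.\<close>

primrec diag_coaction ::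
  "('k, _) ring_scheme \<Rightarrow> ('k, 'h, _) hopf_algebra_scheme \<Rightarrow> ('k, 'h, 'c, _) comodule_coalgebra_scheme
    \<Rightarrow> 'c list \<Rightarrow> ('k, 'h, 'c) tensor_elem"
  where
    "diag_coaction k H C [] = pure_tensor k H C [\<one>\<^bsub>H\<^esub>] []"
  | "diag_coaction k H C (a # as) =
      sweedler k (tensor k H 1 C (length as + 1)) (\<rho>\<^bsub>C\<^esub> a) (\<lambda>h b.
        lin_ext k (tensor k H 1 C (length as + 1)) (diag_coaction k H C as) (\<lambda>us bs.
          pure_tensor k H C [h \<otimes>\<^bsub>H\<^esub> hd us] (b # bs)))"

definition CH ::
  "('k, _) ring_scheme \<Rightarrow> ('k, 'h, _) hopf_algebra_scheme \<Rightarrow> ('k, 'h, 'c, _) comodule_coalgebra_scheme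
    \<Rightarrow> nat \<Rightarrow> nat \<Rightarrow> ('k, ('k, 'h, 'c) tensor_elem) module"
  where "CH k H C p q = tensor k H (p + 1) C (q + 1)"

definition CH_tau where
  "CH_tau k H C p q t = lin_ext k (CH k H C p q) t (\<lambda>gs as.
     sweedler k (CH k H C p q) (\<rho>\<^bsub>C\<^esub> (hd as)) (\<lambda>h b.
       diag_act k H C (antipode_inv H h) gs (tl as @ [b])))"

definition CH_sigma where
  "CH_sigma k H C p q i t = lin_ext k (CH k H C p (q - 1)) t (\<lambda>gs as.
     \<epsilon>\<^bsub>C\<^esub> (as ! (i + 1)) \<odot>\<^bsub>CH k H C p (q - 1)\<^esub>
       pure_tensor k H C gs (take (i + 1) as @ drop (i + 2) as))"

definition CH_partial where
  "CH_partial k H C p q i t = lin_ext k (CH k H C p (q + 1)) t (\<lambda>gs as.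
     if i \<le> q then
       sweedler k (CH k H C p (q + 1)) (\<Delta>\<^bsub>C\<^esub> (as ! i)) (\<lambda>x y.
         pure_tensor k H C gs (take i as @ [x, y] @ drop (i + 1) as))
     else
       sweedler k (CH k H C p (q + 1)) (\<Delta>\<^bsub>C\<^esub> (hd as)) (\<lambda>x y.
         sweedler k (CH k H C p (q + 1)) (\<rho>\<^bsub>C\<^esub> x) (\<lambda>h b.
           diag_act k H C (antipode_inv H h) gs (y # tl as @ [b]))))"

definition CH_tau_bar where
  "CH_tau_bar k H C p q t = lin_ext k (CH k H C p q) t (\<lambda>gs as.
     lin_ext k (CH k H C p q) (diag_coaction k H C as) (\<lambda>us bs.
       pure_tensor k H C (tl gs @ [hd us \<otimes>\<^bsub>H\<^esub> hd gs]) bs))"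

definition CH_sigma_bar where
  "CH_sigma_bar k H C p q i t = lin_ext k (CH k H C (p - 1) q) t (\<lambda>gs as.
     \<epsilon>\<^bsub>H\<^esub> (gs ! (i + 1)) \<odot>\<^bsub>CH k H C (p - 1) q\<^esub>
       pure_tensor k H C (take (i + 1) gs @ drop (i + 2) gs) as)"

definition CH_partial_bar where
  "CH_partial_bar k H C p q i t = lin_ext k (CH k H C (p + 1) q) t (\<lambda>gs as.
     if i \<le> p then
       sweedler k (CH k H C (p + 1) q) (\<Delta>\<^bsub>H\<^esub> (gs ! i)) (\<lambda>x y.
         pure_tensor k H C (take i gs @ [x, y] @ drop (i + 1) gs) as)
     else
       sweedler k (CH k H C (p + 1) q) (\<Delta>\<^bsub>H\<^esub> (hd gs)) (\<lambda>x y.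
         lin_ext k (CH k H C (p + 1) q) (diag_coaction k H C as) (\<lambda>us bs.
           pure_tensor k H C (y # tl gs @ [hd us \<otimes>\<^bsub>H\<^esub> x]) bs)))"

end

theory Submission
  imports Defs
begin

text \<open>
  Identities between linear maps on a tensor product may be checked on pure tensors, where they
  become identities between nested Sweedler sums. Such sums may be interchanged freely, and the
  (co)algebra axioms may be applied inside them as soon as the summand is multilinear.

  The operator $\tau$ has the inverse
  $\omega(g \mid a_0, \dots, a_q) = (a_q^{(\bar 1)} \cdot g \mid a_q^{(\bar 0)}, a_0, \dots, a_{q-1})$,
  in which no antipode occurs. All relations for $\tau$ are therefore proved for $\omega$ first; the
  antipode is used only for $\omega\tau = \tau\omega = \mathrm{id}$, where it suffices that $S$ is
  antimultiplicative. Since the last coface is $\tau\partial^0$, the identities involving it are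
  formal consequences of the others.

  Finally, $\bar\tau^{p+1}$ and $\omega^{q+1}$ both send $(g \mid a)$ to $(u \cdot g \mid a^{(\bar 0)})$, where
  $u \otimes a^{(\bar 0)}$ is the diagonal coaction of $a$. This is the cylindrical condition, and it
  also shows that $\bar\tau$ is bijective.
\<close>

section \<open>Linear maps and free modules\<close>

text \<open>\<open>lin_ext\<close> sums over a representative picked by \<open>SOME\<close>.
  Congruence, moving a linear map inside, linearity in a parameter and interchange of two sums
  therefore hold termwise. Multilinearity of the integrand enters where the tensor itself varies or
  is pure, and where an axiom is transported: an axiom is an equation in one fixed tensor power, and
  the linear map induced by the integrand carries it to the target module.

  Actions and diagonal coactions are written with a continuation K, so that a composite of operators
  becomes a nest of sums in the single target module and no intermediate tensor product of mixed
  shape has to be formed.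

  The detour through \<omega> avoids a real obstacle. Comparing \<tau> directly with the barred
  cyclic operator brings in the coproduct of S^{-1}(h), that is, anticomultiplicativity of the
  inverse antipode. With \<omega> in its place both composites are regroupings of the same iterated
  coaction, and coassociativity decides. Relations then pass from \<omega> to \<tau> by
  conjugation.\<close>

lemma lin_mapsI:
  assumes "\<And>x. x \<in> carrier M \<Longrightarrow> f x \<in> carrier N"
    and "\<And>x y. \<lbrakk>x \<in> carrier M; y \<in> carrier M\<rbrakk> \<Longrightarrow> f (x \<oplus>\<^bsub>M\<^esub> y) = f x \<oplus>\<^bsub>N\<^esub> f y"
    and "\<And>r x. \<lbrakk>r \<in> carrier k; x \<in> carrier M\<rbrakk> \<Longrightarrow> f (r \<odot>\<^bsub>M\<^esub> x) = r \<odot>\<^bsub>N\<^esub> f x"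
  shows "f \<in> lin_maps k M N"
  using assms by (auto simp: lin_maps_def)

lemma lin_mapsD:
  assumes "f \<in> lin_maps k M N"
  shows lin_closed: "x \<in> carrier M \<Longrightarrow> f x \<in> carrier N"
    and lin_add: "\<lbrakk>x \<in> carrier M; y \<in> carrier M\<rbrakk> \<Longrightarrow> f (x \<oplus>\<^bsub>M\<^esub> y) = f x \<oplus>\<^bsub>N\<^esub> f y"
    and lin_smult: "\<lbrakk>r \<in> carrier k; x \<in> carrier M\<rbrakk> \<Longrightarrow> f (r \<odot>\<^bsub>M\<^esub> x) = r \<odot>\<^bsub>N\<^esub> f x"
  using assms by (auto simp: lin_maps_def)

lemma lin_comp:
  assumes "g \<in> lin_maps k N L" "f \<in> lin_maps k M N"
  shows "(\<lambda>x. g (f x)) \<in> lin_maps k M L"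
  by (rule lin_mapsI) (simp_all add: lin_mapsD[OF assms(1)] lin_mapsD[OF assms(2)])

lemma lin_maps_cong:
  assumes M: "module k M" and fg: "\<And>x. x \<in> carrier M \<Longrightarrow> f x = g x"
  shows "f \<in> lin_maps k M N \<longleftrightarrow> g \<in> lin_maps k M N"
proof -
  interpret module k M by fact
  show ?thesis using fg by (auto simp: lin_maps_def Pi_iff)
qed

lemma lin_zero:
  assumes "module k M" "module k N" and f: "f \<in> lin_maps k M N"
  shows "f \<zero>\<^bsub>M\<^esub> = \<zero>\<^bsub>N\<^esub>"
proof -
  interpret M: module k M by fact
  interpret N: module k N by fact
  have "f (\<zero>\<^bsub>k\<^esub> \<odot>\<^bsub>M\<^esub> \<zero>\<^bsub>M\<^esub>) = \<zero>\<^bsub>k\<^esub> \<odot>\<^bsub>N\<^esub> f \<zero>\<^bsub>M\<^esub>"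
    by (intro lin_smult[OF f]) auto
  then show ?thesis using lin_closed[OF f, of "\<zero>\<^bsub>M\<^esub>"] by simp
qed

text \<open>Stated for abelian monoids because one use is evaluation of functions at a point, whose
  target is the ring itself rather than a module. On an infinite index set both sums are zero by
  convention, so preservation of zero covers that case.\<close>

lemma additive_finsum:
  assumes "abelian_monoid M" "abelian_monoid N"
    and c: "\<And>x. x \<in> carrier M \<Longrightarrow> f x \<in> carrier N"
    and a: "\<And>x y. \<lbrakk>x \<in> carrier M; y \<in> carrier M\<rbrakk> \<Longrightarrow> f (x \<oplus>\<^bsub>M\<^esub> y) = f x \<oplus>\<^bsub>N\<^esub> f y"
    and z: "f \<zero>\<^bsub>M\<^esub> = \<zero>\<^bsub>N\<^esub>"
    and h: "h \<in> A \<rightarrow> carrier M"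
  shows "f (finsum M h A) = finsum N (\<lambda>i. f (h i)) A"
proof -
  interpret M: abelian_monoid M by fact
  interpret N: abelian_monoid N by fact
  show ?thesis using h
  proof (induction A rule: infinite_finite_induct)
    case (insert i A)
    then have "h \<in> A \<rightarrow> carrier M" "h i \<in> carrier M" by auto
    moreover from this have "(\<lambda>i. f (h i)) \<in> A \<rightarrow> carrier N" "f (h i) \<in> carrier N"
      by (auto intro!: c)
    ultimately show ?case using insert by (simp add: a)
  qed (auto simp: z)
qed

lemma lin_finsum:
  assumes M: "module k M" and N: "module k N" and f: "f \<in> lin_maps k M N" and h: "h \<in> A \<rightarrow> carrier M"
  shows "f (finsum M h A) = finsum N (\<lambda>i. f (h i)) A"
proof -
  interpret M: module k M by fact
  interpret N: module k N by fact
  show ?thesis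
    by (rule additive_finsum)
      (use f h lin_zero[OF M N f] in \<open>auto intro: lin_mapsD M.abelian_monoid_axioms N.abelian_monoid_axioms\<close>)
qed

lemma (in abelian_monoid) finsum_swap:
  assumes "finite A" "finite B" and h: "\<And>i j. \<lbrakk>i \<in> A; j \<in> B\<rbrakk> \<Longrightarrow> h i j \<in> carrier G"
  shows "(\<Oplus>i\<in>A. \<Oplus>j\<in>B. h i j) = (\<Oplus>j\<in>B. \<Oplus>i\<in>A. h i j)"
  using assms(1) h
proof (induction A rule: finite_induct)
  case (insert i A)
  have "(\<Oplus>i\<in>insert i A. \<Oplus>j\<in>B. h i j) = (\<Oplus>j\<in>B. h i j) \<oplus> (\<Oplus>i\<in>A. \<Oplus>j\<in>B. h i j)"
    using insert by (intro finsum_insert) (auto intro!: finsum_closed)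
  also have "\<dots> = (\<Oplus>j\<in>B. h i j) \<oplus> (\<Oplus>j\<in>B. \<Oplus>i\<in>A. h i j)"
    using insert by simp
  also have "\<dots> = (\<Oplus>j\<in>B. h i j \<oplus> (\<Oplus>i\<in>A. h i j))"
    using insert by (intro finsum_addf[symmetric]) (auto intro!: finsum_closed)
  also have "\<dots> = (\<Oplus>j\<in>B. \<Oplus>i\<in>insert i A. h i j)"
    using insert by (intro finsum_cong') (auto intro!: finsum_closed finsum_insert[symmetric])
  finally show ?case .
qed simp

lemma foldSetD_cong:
  assumes "(A, x) \<in> foldSetD D f e" "\<And>a. a \<in> A \<Longrightarrow> f a = g a"
  shows "(A, x) \<in> foldSetD D g e"
  using assms by (induction) (auto intro: foldSetD.intros)

text \<open>The fold consults the summand only at the indices it inserts, so agreement on A alone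
  decides the sum. Integrands can thus be rewritten before their values are known to lie in the
  carrier.\<close>

lemma finsum_cong_strong:
  assumes "\<And>a. a \<in> A \<Longrightarrow> f a = g a"
  shows "finsum G f A = finsum G g A"
proof -
  have "(A, x) \<in> foldSetD D ((\<oplus>\<^bsub>G\<^esub>) \<circ> f) e \<longleftrightarrow> (A, x) \<in> foldSetD D ((\<oplus>\<^bsub>G\<^esub>) \<circ> g) e" for x D e
    using assms by (auto elim!: foldSetD_cong)
  then show ?thesis by (simp add: finsum_def finprod_def foldD_def)
qed

section \<open>Universal property of the free module\<close>

definition free_ext where
  "free_ext k L F f = (\<Oplus>\<^bsub>L\<^esub>g\<in>{g. f g \<noteq> \<zero>\<^bsub>k\<^esub>}. f g \<odot>\<^bsub>L\<^esub> F g)"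

lemma free_module_simps:
  "carrier (free_module k X) = {f. range f \<subseteq> carrier k \<and> finite {x. f x \<noteq> \<zero>\<^bsub>k\<^esub>} \<and> {x. f x \<noteq> \<zero>\<^bsub>k\<^esub>} \<subseteq> X}"
  "\<zero>\<^bsub>free_module k X\<^esub> = (\<lambda>_. \<zero>\<^bsub>k\<^esub>)"
  "f \<oplus>\<^bsub>free_module k X\<^esub> g = (\<lambda>x. f x \<oplus>\<^bsub>k\<^esub> g x)"
  "r \<odot>\<^bsub>free_module k X\<^esub> f = (\<lambda>x. r \<otimes>\<^bsub>k\<^esub> f x)"
  by (simp_all add: free_module_def)

lemma free_moduleD:
  assumes "f \<in> carrier (free_module k X)"
  shows "f x \<in> carrier k" "finite {x. f x \<noteq> \<zero>\<^bsub>k\<^esub>}" "f x \<noteq> \<zero>\<^bsub>k\<^esub> \<Longrightarrow> x \<in> X"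
  using assms by (auto simp: free_module_simps)

context cring
begin

lemma free_module_closed:
  assumes "f \<in> carrier (free_module R X)" "g \<in> carrier (free_module R X)" "r \<in> carrier R"
  shows "(\<lambda>x. f x \<oplus> g x) \<in> carrier (free_module R X)"
    and "(\<lambda>x. r \<otimes> f x) \<in> carrier (free_module R X)"
    and "(\<lambda>x. \<ominus> f x) \<in> carrier (free_module R X)"
proof -
  note D = free_moduleD[OF assms(1)] free_moduleD[OF assms(2)]
  have "{x. f x \<oplus> g x \<noteq> \<zero>} \<subseteq> {x. f x \<noteq> \<zero>} \<union> {x. g x \<noteq> \<zero>}"
    by auto
  then show "(\<lambda>x. f x \<oplus> g x) \<in> carrier (free_module R X)"
    using D by (auto simp: free_module_simps intro: finite_subset)
  have "{x. r \<otimes> f x \<noteq> \<zero>} \<subseteq> {x. f x \<noteq> \<zero>}" using assms(3) by auto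
  then show "(\<lambda>x. r \<otimes> f x) \<in> carrier (free_module R X)"
    using D assms(3) by (auto simp: free_module_simps intro: finite_subset)
  have "{x. \<ominus> f x \<noteq> \<zero>} \<subseteq> {x. f x \<noteq> \<zero>}" by auto
  then show "(\<lambda>x. \<ominus> f x) \<in> carrier (free_module R X)"
    using D by (auto simp: free_module_simps intro: finite_subset)
qed

lemma free_module_module: "module R (free_module R X)"
proof (rule moduleI)
  show "cring R" by (rule is_cring)
  show "abelian_group (free_module R X)"
  proof (rule abelian_groupI)
    show "\<zero>\<^bsub>free_module R X\<^esub> \<in> carrier (free_module R X)"
      by (auto simp: free_module_simps)
  next
    fix f assume f: "f \<in> carrier (free_module R X)"
    show "\<exists>g\<in>carrier (free_module R X). g \<oplus>\<^bsub>free_module R X\<^esub> f = \<zero>\<^bsub>free_module R X\<^esub>"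
      using free_module_closed(3)[OF f f zero_closed] free_moduleD(1)[OF f]
      by (intro bexI[of _ "\<lambda>x. \<ominus> f x"]) (auto simp: free_module_simps(2-4) l_neg)
  qed (auto simp: free_module_simps(2-4) free_moduleD(1) a_ac intro: free_module_closed(1)[OF _ _ zero_closed])
qed (auto simp: free_module_simps(2-4) free_moduleD(1) free_module_closed l_distr r_distr m_assoc)

lemma free_gen_closed: "x \<in> X \<Longrightarrow> free_gen R x \<in> carrier (free_module R X)"
  by (auto simp: free_module_simps free_gen_def)

end

context module
begin

text \<open>Indices outside the support contribute zero. A common finite index set may thus replace
  the supports, which makes the sums for f, g and f + g comparable.\<close>

lemma free_ext_superset:
  assumes f: "f \<in> carrier (free_module R X)" and A: "finite A" "{x. f x \<noteq> \<zero>} \<subseteq> A"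
    and F: "F \<in> A \<rightarrow> carrier M"
  shows "free_ext R M F f = (\<Oplus>\<^bsub>M\<^esub>g\<in>A. f g \<odot>\<^bsub>M\<^esub> F g)"
  unfolding free_ext_def using assms
  by (intro M.add.finprod_mono_neutral_cong_left) (auto intro!: smult_closed smult_l_null simp: free_moduleD(1))

lemma free_ext_lin:
  assumes F: "F \<in> X \<rightarrow> carrier M"
  shows "free_ext R M F \<in> lin_maps R (free_module R X) M"
proof (rule lin_mapsI)
  fix f assume f: "f \<in> carrier (free_module R X)"
  show "free_ext R M F f \<in> carrier M"
    unfolding free_ext_def using F
    by (intro M.finsum_closed) (auto intro!: smult_closed simp: free_moduleD(1)[OF f] dest: free_moduleD(3)[OF f])
  {
    fix g assume g: "g \<in> carrier (free_module R X)"
    let ?A = "{x. f x \<noteq> \<zero>} \<union> {x. g x \<noteq> \<zero>}"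
    have A: "finite ?A" "?A \<subseteq> X" using free_moduleD[OF f] free_moduleD[OF g] by auto
    then have FA: "F \<in> ?A \<rightarrow> carrier M" using F by blast
    have "free_ext R M F (f \<oplus>\<^bsub>free_module R X\<^esub> g)
        = (\<Oplus>\<^bsub>M\<^esub>x\<in>?A. (f x \<oplus> g x) \<odot>\<^bsub>M\<^esub> F x)"
      unfolding free_module_simps(3)
      by (rule free_ext_superset[OF free_module_closed(1)[OF f g R.zero_closed]]) (use A FA in auto)
    also have "\<dots> = (\<Oplus>\<^bsub>M\<^esub>x\<in>?A. f x \<odot>\<^bsub>M\<^esub> F x \<oplus>\<^bsub>M\<^esub> g x \<odot>\<^bsub>M\<^esub> F x)"
      using FA free_moduleD(1)[OF f] free_moduleD(1)[OF g]
      by (intro M.finsum_cong') (auto simp: smult_l_distr Pi_iff)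
    also have "\<dots> = (\<Oplus>\<^bsub>M\<^esub>x\<in>?A. f x \<odot>\<^bsub>M\<^esub> F x) \<oplus>\<^bsub>M\<^esub> (\<Oplus>\<^bsub>M\<^esub>x\<in>?A. g x \<odot>\<^bsub>M\<^esub> F x)"
      using FA free_moduleD(1)[OF f] free_moduleD(1)[OF g]
      by (intro M.finsum_addf) (auto simp: Pi_iff)
    also have "\<dots> = free_ext R M F f \<oplus>\<^bsub>M\<^esub> free_ext R M F g"
      using A FA f g by (simp add: free_ext_superset[of _ X ?A])
    finally show "free_ext R M F (f \<oplus>\<^bsub>free_module R X\<^esub> g) = free_ext R M F f \<oplus>\<^bsub>M\<^esub> free_ext R M F g" .
  }
  fix r assume r: "r \<in> carrier R"
  let ?A = "{x. f x \<noteq> \<zero>}"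
  have A: "finite ?A" "?A \<subseteq> X" using free_moduleD[OF f] by auto
  then have FA: "F \<in> ?A \<rightarrow> carrier M" using F by blast
  have "free_ext R M F (r \<odot>\<^bsub>free_module R X\<^esub> f) = (\<Oplus>\<^bsub>M\<^esub>x\<in>?A. (r \<otimes> f x) \<odot>\<^bsub>M\<^esub> F x)"
    unfolding free_module_simps(4)
    by (rule free_ext_superset[OF free_module_closed(2)[OF f f r]]) (use A FA r in auto)
  also have "\<dots> = (\<Oplus>\<^bsub>M\<^esub>x\<in>?A. r \<odot>\<^bsub>M\<^esub> (f x \<odot>\<^bsub>M\<^esub> F x))"
    using FA free_moduleD(1)[OF f] r
    by (intro M.finsum_cong') (auto simp: smult_assoc1 Pi_iff)
  also have "\<dots> = r \<odot>\<^bsub>M\<^esub> free_ext R M F f"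
    unfolding free_ext_def using A FA free_moduleD(1)[OF f] r
    by (intro finsum_smult_ldistr[symmetric]) (auto simp: Pi_iff)
  finally show "free_ext R M F (r \<odot>\<^bsub>free_module R X\<^esub> f) = r \<odot>\<^bsub>M\<^esub> free_ext R M F f" .
qed

lemma free_ext_gen:
  assumes "x \<in> X" "F x \<in> carrier M"
  shows "free_ext R M F (free_gen R x) = F x"
proof -
  have "free_ext R M F (free_gen R x) = (\<Oplus>\<^bsub>M\<^esub>g\<in>{x}. free_gen R x g \<odot>\<^bsub>M\<^esub> F g)"
    using assms by (intro free_ext_superset[OF free_gen_closed[of x X]]) (auto simp: free_gen_def)
  also have "\<dots> = F x" using assms by (simp add: free_gen_def)
  finally show ?thesis .
qed

end

text \<open>A finitely supported function is the combination of its generators. The sum in the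
  function module is evaluated at x, evaluation being additive, and only the summand with index x
  survives.\<close>

lemma (in cring) free_ext_free_gen:
  assumes f: "f \<in> carrier (free_module R X)"
  shows "free_ext R (free_module R X) (free_gen R) f = f"
proof
  fix x
  interpret F: module R "free_module R X" by (rule free_module_module)
  let ?A = "{x. f x \<noteq> \<zero>}"
  have gen: "free_gen R g \<in> carrier (free_module R X)" if "g \<in> ?A" for g
    using that free_moduleD(3)[OF f] by (auto intro: free_gen_closed)
  have "(\<Oplus>\<^bsub>free_module R X\<^esub>g\<in>?A. f g \<odot>\<^bsub>free_module R X\<^esub> free_gen R g) x
      = (\<Oplus>g\<in>?A. (f g \<odot>\<^bsub>free_module R X\<^esub> free_gen R g) x)"
    by (rule additive_finsum[OF F.M.abelian_monoid_axioms abelian_monoid_axioms])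
      (use gen f in \<open>auto simp: free_module_simps(2-4) free_moduleD(1) intro!: free_module_closed\<close>)
  also have "\<dots> = (\<Oplus>g\<in>?A. if x = g then f g else \<zero>)"
    using f by (intro finsum_cong') (auto simp: free_module_simps(2-4) free_moduleD(1) free_gen_def)
  also have "\<dots> = f x"
  proof (cases "x \<in> ?A")
    case True
    then show ?thesis using add.finprod_singleton[of x ?A f] free_moduleD[OF f] by auto
  next
    case False
    then have "(\<Oplus>g\<in>?A. if x = g then f g else \<zero>) = (\<Oplus>g\<in>?A. \<zero>)"
      by (intro finsum_cong') auto
    then show ?thesis using False by simp
  qed
  finally show "free_ext R (free_module R X) (free_gen R) f x = f x"
    unfolding free_ext_def .
qed

section \<open>Quotient modules and tensor products\<close>

lemma lin_neg:
  assumes "module k M" "module k N" and f: "f \<in> lin_maps k M N" and x: "x \<in> carrier M"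
  shows "f (\<ominus>\<^bsub>M\<^esub> x) = \<ominus>\<^bsub>N\<^esub> f x"
proof -
  interpret M: module k M by fact
  interpret N: module k N by fact
  have "f (\<ominus>\<^bsub>M\<^esub> x) \<oplus>\<^bsub>N\<^esub> f x = \<zero>\<^bsub>N\<^esub>"
    using x lin_zero[OF assms(1-3)] by (simp add: lin_add[OF f, symmetric] M.M.l_neg)
  then show ?thesis using x by (intro N.M.minus_equality[symmetric]) (auto intro: lin_closed[OF f])
qed

lemma (in module) submodule_kernel:
  assumes N: "module R N" and f: "f \<in> lin_maps R M N"
  shows "submodule {x \<in> carrier M. f x = \<zero>\<^bsub>N\<^esub>} R M"
proof -
  interpret N: module R N by fact
  show ?thesis
    by (rule submoduleI)
      (auto simp: lin_mapsD[OF f] lin_zero[OF module_axioms N f] lin_neg[OF module_axioms N f])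
qed

lemma (in module) submodule_generated:
  assumes "S \<subseteq> carrier M"
  shows "submodule (generated_submodule R M S) R M"
proof (rule submoduleI)
  \<comment> \<open>The whole module belongs to the intersected family. This member keeps the
    intersection inside the carrier; an empty family would intersect to the full type.\<close>
  have *: "submodule (carrier M) R M \<and> S \<subseteq> carrier M"
    using assms carrier_is_submodule by blast
  then show "generated_submodule R M S \<subseteq> carrier M"
    by (auto simp: generated_submodule_def)
  show "\<zero>\<^bsub>M\<^esub> \<in> generated_submodule R M S"
    by (auto simp: generated_submodule_def dest!: submodule.axioms(1) subgroup.one_closed)
qed (auto simp: generated_submodule_def intro: submoduleE(3-5))

lemma (in module) submodule_is_abelian_subgroup:
  assumes "submodule N R M"
  shows "abelian_subgroup N M"
proof (rule abelian_subgroupI3)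
  show "additive_subgroup N M"
    using assms by (auto intro: additive_subgroup.intro submodule.axioms(1))
qed (rule M.abelian_group_axioms)

locale submodule_quotient = module +
  fixes N assumes sub: "submodule N R M"
begin

sublocale N: abelian_subgroup N M
  by (rule submodule_is_abelian_subgroup[OF sub])

lemma quotient_simps:
  "carrier (quotient_module M N) = a_rcosets\<^bsub>M\<^esub> N"
  "\<zero>\<^bsub>quotient_module M N\<^esub> = N"
  "X \<oplus>\<^bsub>quotient_module M N\<^esub> Y = X <+>\<^bsub>M\<^esub> Y"
  "r \<odot>\<^bsub>quotient_module M N\<^esub> X = (\<Union>x\<in>X. N +>\<^bsub>M\<^esub> (r \<odot>\<^bsub>M\<^esub> x))"
  by (simp_all add: quotient_module_def)

lemma quotient_cases:
  assumes "X \<in> carrier (quotient_module M N)"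
  obtains x where "x \<in> carrier M" "X = N +>\<^bsub>M\<^esub> x"
  using assms by (auto simp: quotient_simps A_RCOSETS_def')

lemma coset_eq:
  assumes "x \<in> carrier M" "y \<in> N +>\<^bsub>M\<^esub> x"
  shows "N +>\<^bsub>M\<^esub> y = N +>\<^bsub>M\<^esub> x"
  using N.a_repr_independence'[OF assms(2,1)] by simp

lemma coset_memD:
  assumes "y \<in> N +>\<^bsub>M\<^esub> x"
  obtains n where "n \<in> N" "y = n \<oplus>\<^bsub>M\<^esub> x"
  using assms by (auto simp: a_r_coset_def')

text \<open>The scalar action is a union over all elements of the coset. Since r n stays in N, each
  element yields the same coset, so the union over this nonempty set collapses to one term.\<close>

lemma coset_smult:
  assumes r: "r \<in> carrier R" and x: "x \<in> carrier M"
  shows "r \<odot>\<^bsub>quotient_module M N\<^esub> (N +>\<^bsub>M\<^esub> x) = N +>\<^bsub>M\<^esub> (r \<odot>\<^bsub>M\<^esub> x)"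
proof -
  have "N +>\<^bsub>M\<^esub> (r \<odot>\<^bsub>M\<^esub> y) = N +>\<^bsub>M\<^esub> (r \<odot>\<^bsub>M\<^esub> x)" if y: "y \<in> N +>\<^bsub>M\<^esub> x" for y
  proof -
    obtain n where n: "n \<in> N" "y = n \<oplus>\<^bsub>M\<^esub> x" using y by (rule coset_memD)
    then have "r \<odot>\<^bsub>M\<^esub> y = r \<odot>\<^bsub>M\<^esub> n \<oplus>\<^bsub>M\<^esub> r \<odot>\<^bsub>M\<^esub> x"
      using r x N.a_Hcarr by (simp add: smult_r_distr)
    moreover have "r \<odot>\<^bsub>M\<^esub> n \<in> N" using submoduleE(4)[OF sub r n(1)] .
    ultimately show ?thesis using r x by (intro coset_eq smult_closed) (unfold a_r_coset_def', blast+)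
  qed
  moreover have "x \<in> N +>\<^bsub>M\<^esub> x" using x by (rule N.a_rcos_self)
  ultimately show ?thesis
    unfolding quotient_simps(4) by (intro SUP_eq_const) blast+
qed

lemma coset_add:
  assumes "x \<in> carrier M" "y \<in> carrier M"
  shows "(N +>\<^bsub>M\<^esub> x) \<oplus>\<^bsub>quotient_module M N\<^esub> (N +>\<^bsub>M\<^esub> y) = N +>\<^bsub>M\<^esub> (x \<oplus>\<^bsub>M\<^esub> y)"
  using assms by (simp add: quotient_simps N.a_rcos_sum)

lemma coset_closed: "x \<in> carrier M \<Longrightarrow> N +>\<^bsub>M\<^esub> x \<in> carrier (quotient_module M N)"
  by (simp add: quotient_simps M.a_rcosetsI N.a_subset)

lemma coset_zero: "\<zero>\<^bsub>quotient_module M N\<^esub> = N +>\<^bsub>M\<^esub> \<zero>\<^bsub>M\<^esub>"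
  by (simp add: quotient_simps N.a_subset)

lemma quotient_module_module: "module R (quotient_module M N)"
proof (rule moduleI)
  show "cring R" by (rule R.is_cring)
  note cs = coset_closed coset_add coset_smult coset_zero M.a_ac
    smult_l_distr smult_r_distr smult_assoc1
  show "abelian_group (quotient_module M N)"
  proof (rule abelian_groupI)
    fix X assume "X \<in> carrier (quotient_module M N)"
    then obtain x where x: "x \<in> carrier M" "X = N +>\<^bsub>M\<^esub> x" by (rule quotient_cases)
    then show "\<zero>\<^bsub>quotient_module M N\<^esub> \<oplus>\<^bsub>quotient_module M N\<^esub> X = X"
      by (simp add: cs del: M.a_coset_add_zero)
    from x show "\<exists>Y\<in>carrier (quotient_module M N). Y \<oplus>\<^bsub>quotient_module M N\<^esub> X = \<zero>\<^bsub>quotient_module M N\<^esub>"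
      by (intro bexI[of _ "N +>\<^bsub>M\<^esub> (\<ominus>\<^bsub>M\<^esub> x)"]) (simp_all add: cs M.r_neg del: M.a_coset_add_zero)
    fix Y assume "Y \<in> carrier (quotient_module M N)"
    then obtain y where y: "y \<in> carrier M" "Y = N +>\<^bsub>M\<^esub> y" by (rule quotient_cases)
    from x y show "X \<oplus>\<^bsub>quotient_module M N\<^esub> Y \<in> carrier (quotient_module M N)"
      by (simp add: cs)
    from x y show "X \<oplus>\<^bsub>quotient_module M N\<^esub> Y = Y \<oplus>\<^bsub>quotient_module M N\<^esub> X"
      by (simp add: cs)
    fix Z assume "Z \<in> carrier (quotient_module M N)"
    then obtain z where z: "z \<in> carrier M" "Z = N +>\<^bsub>M\<^esub> z" by (rule quotient_cases)
    from x y z show "X \<oplus>\<^bsub>quotient_module M N\<^esub> Y \<oplus>\<^bsub>quotient_module M N\<^esub> Z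
      = X \<oplus>\<^bsub>quotient_module M N\<^esub> (Y \<oplus>\<^bsub>quotient_module M N\<^esub> Z)"
      by (simp add: cs)
  qed (simp add: coset_zero coset_closed del: M.a_coset_add_zero)
  fix a b X Y assume a: "a \<in> carrier R" and X: "X \<in> carrier (quotient_module M N)"
  obtain x where x: "x \<in> carrier M" "X = N +>\<^bsub>M\<^esub> x" using X by (rule quotient_cases)
  from a x show "a \<odot>\<^bsub>quotient_module M N\<^esub> X \<in> carrier (quotient_module M N)"
    by (simp add: cs)
  {
    assume b: "b \<in> carrier R"
    from a b x show "(a \<oplus> b) \<odot>\<^bsub>quotient_module M N\<^esub> X
        = a \<odot>\<^bsub>quotient_module M N\<^esub> X \<oplus>\<^bsub>quotient_module M N\<^esub> b \<odot>\<^bsub>quotient_module M N\<^esub> X"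
      by (simp add: cs)
    from a b x show "(a \<otimes> b) \<odot>\<^bsub>quotient_module M N\<^esub> X
        = a \<odot>\<^bsub>quotient_module M N\<^esub> (b \<odot>\<^bsub>quotient_module M N\<^esub> X)"
      by (simp add: cs)
  }
  assume "Y \<in> carrier (quotient_module M N)"
  then obtain y where y: "y \<in> carrier M" "Y = N +>\<^bsub>M\<^esub> y" by (rule quotient_cases)
  from a x y show "a \<odot>\<^bsub>quotient_module M N\<^esub> (X \<oplus>\<^bsub>quotient_module M N\<^esub> Y)
      = a \<odot>\<^bsub>quotient_module M N\<^esub> X \<oplus>\<^bsub>quotient_module M N\<^esub> a \<odot>\<^bsub>quotient_module M N\<^esub> Y"
    by (simp add: cs)
next
  fix X assume "X \<in> carrier (quotient_module M N)"
  then obtain x where "x \<in> carrier M" "X = N +>\<^bsub>M\<^esub> x" by (rule quotient_cases)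
  then show "\<one> \<odot>\<^bsub>quotient_module M N\<^esub> X = X" by (simp add: coset_smult)
qed

lemma coset_lin: "(\<lambda>x. N +>\<^bsub>M\<^esub> x) \<in> lin_maps R M (quotient_module M N)"
  by (rule lin_mapsI) (simp_all add: coset_closed coset_add coset_smult)

end

section \<open>Multilinear maps and the universal property of the tensor product\<close>

definition vecs :: "('k, 'm, 'z) module_scheme \<Rightarrow> nat \<Rightarrow> 'm list set"
  where "vecs M n = {xs. length xs = n \<and> set xs \<subseteq> carrier M}"

lemma mem_vecs [simp]: "xs \<in> vecs M n \<longleftrightarrow> length xs = n \<and> set xs \<subseteq> carrier M"
  by (simp add: vecs_def)

text \<open>A slot is a decomposition \<open>xs @ x # ys\<close>, not an index, so that prefixing
  and appending entries fit the notion directly. For n = 0 only membership of \<open>K []\<close> in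
  L remains.\<close>

definition mlin where
  "mlin k M n L K \<longleftrightarrow> (\<forall>xs\<in>vecs M n. K xs \<in> carrier L) \<and>
    (\<forall>xs ys. xs \<in> vecs M (length xs) \<longrightarrow> ys \<in> vecs M (length ys) \<longrightarrow> length xs + length ys + 1 = n \<longrightarrow>
      (\<lambda>x. K (xs @ x # ys)) \<in> lin_maps k M L)"

definition mlin2 where
  "mlin2 k M p N q L F \<longleftrightarrow> (\<forall>ys\<in>vecs N q. mlin k M p L (\<lambda>xs. F xs ys)) \<and> (\<forall>xs\<in>vecs M p. mlin k N q L (F xs))"

lemma mlinI:
  assumes "\<And>xs. \<lbrakk>length xs = n; set xs \<subseteq> carrier M\<rbrakk> \<Longrightarrow> K xs \<in> carrier L"
    and "\<And>xs ys. \<lbrakk>set xs \<subseteq> carrier M; set ys \<subseteq> carrier M; Suc (length xs + length ys) = n\<rbrakk> \<Longrightarrow>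
      (\<lambda>x. K (xs @ x # ys)) \<in> lin_maps k M L"
  shows "mlin k M n L K"
  using assms by (simp add: mlin_def)

lemma mlinD:
  assumes "mlin k M n L K"
  shows mlin_closed: "\<lbrakk>length xs = n; set xs \<subseteq> carrier M\<rbrakk> \<Longrightarrow> K xs \<in> carrier L"
    and mlin_slot: "\<lbrakk>set xs \<subseteq> carrier M; set ys \<subseteq> carrier M; Suc (length xs + length ys) = n\<rbrakk> \<Longrightarrow>
      (\<lambda>x. K (xs @ x # ys)) \<in> lin_maps k M L"
  using assms by (simp_all add: mlin_def)

lemma mlin2I:
  assumes "\<And>ys. \<lbrakk>length ys = q; set ys \<subseteq> carrier N\<rbrakk> \<Longrightarrow> mlin k M p L (\<lambda>xs. F xs ys)"
    and "\<And>xs. \<lbrakk>length xs = p; set xs \<subseteq> carrier M\<rbrakk> \<Longrightarrow> mlin k N q L (F xs)"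
  shows "mlin2 k M p N q L F"
  using assms by (simp add: mlin2_def)

lemma mlin2D:
  assumes "mlin2 k M p N q L F"
  shows "\<lbrakk>length ys = q; set ys \<subseteq> carrier N\<rbrakk> \<Longrightarrow> mlin k M p L (\<lambda>xs. F xs ys)"
    and "\<lbrakk>length xs = p; set xs \<subseteq> carrier M\<rbrakk> \<Longrightarrow> mlin k N q L (F xs)"
    and "\<lbrakk>length ys = q; set ys \<subseteq> carrier N; length xs = p; set xs \<subseteq> carrier M\<rbrakk> \<Longrightarrow> F xs ys \<in> carrier L"
  using assms by (auto simp: mlin2_def mlin_def)

lemma mem_tensor_gens: "(xs, ys) \<in> tensor_gens M p N q \<longleftrightarrow> xs \<in> vecs M p \<and> ys \<in> vecs N q"
  by (auto simp: tensor_gens_def)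

lemma update_vec:
  assumes "xs \<in> vecs M n" "i < n" "x \<in> carrier M"
  shows "xs[i := x] \<in> vecs M n"
  using assms set_update_subset_insert[of xs i x] by auto

text \<open>Bridge from slots given by splitting a list to the indexed updates in which
  \<open>tensor_rels\<close> is phrased.\<close>

lemma mlin_update:
  assumes K: "mlin k M n L K" and xs: "xs \<in> vecs M n" and i: "i < n"
  shows "(\<lambda>x. K (xs[i := x])) \<in> lin_maps k M L"
proof -
  have "(\<lambda>x. K (take i xs @ x # drop (Suc i) xs)) \<in> lin_maps k M L"
    using xs i set_take_subset[of i xs] set_drop_subset[of "Suc i" xs] by (intro mlin_slot[OF K]) auto
  then show ?thesis using xs i by (simp add: upd_conv_take_nth_drop)
qed

locale module_pair = M: module k M + N: module k N
  for k :: "('k, 'x) ring_scheme" (structure) and M :: "('k, 'm, 'y) module_scheme"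
    and N :: "('k, 'n, 'z) module_scheme"
begin

abbreviation "F p q \<equiv> free_module k (tensor_gens M p N q)"
abbreviation "T p q \<equiv> tensor k M p N q"
abbreviation "null p q \<equiv> tensor_null k M p N q"
abbreviation "pt \<equiv> pure_tensor k M N"

sublocale F: module k "free_module k X" for X
  by (rule M.R.free_module_module)

lemma gen_closed: "xs \<in> vecs M p \<Longrightarrow> ys \<in> vecs N q \<Longrightarrow> free_gen k (xs, ys) \<in> carrier (F p q)"
  by (intro M.R.free_gen_closed) (simp add: mem_tensor_gens)

lemma rels_closed: "tensor_rels k M p N q \<subseteq> carrier (F p q)"
  unfolding tensor_rels_def Let_def mem_tensor_gens
  by (auto intro!: F.M.minus_closed F.M.a_closed F.smult_closed gen_closed
      simp: set_update_subset_insert[THEN subset_trans])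

lemma null_submodule: "submodule (null p q) k (F p q)"
  unfolding tensor_null_def by (rule F.submodule_generated[OF rels_closed])

sublocale Q: submodule_quotient k "F p q" "null p q" for p q
  by (intro submodule_quotient.intro F.module_axioms submodule_quotient_axioms.intro null_submodule)

lemma tensor_module: "module k (T p q)"
  unfolding tensor_def by (rule Q.quotient_module_module)

lemma pure_tensor_coset:
  "xs \<in> vecs M p \<Longrightarrow> ys \<in> vecs N q \<Longrightarrow> pt xs ys = null p q +>\<^bsub>F p q\<^esub> free_gen k (xs, ys)"
  by (auto simp: pure_tensor_def)

lemma coset_lin_tensor: "(\<lambda>x. null p q +>\<^bsub>F p q\<^esub> x) \<in> lin_maps k (F p q) (T p q)"
  unfolding tensor_def by (rule Q.coset_lin)

lemma rep:
  assumes "t \<in> carrier (T p q)"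
  shows "(SOME f. f \<in> t) \<in> carrier (F p q)" "null p q +>\<^bsub>F p q\<^esub> (SOME f. f \<in> t) = t"
proof -
  obtain f where f: "f \<in> carrier (F p q)" "t = null p q +>\<^bsub>F p q\<^esub> f"
    using assms unfolding tensor_def by (rule Q.quotient_cases)
  have "f \<in> t" unfolding f(2) by (rule Q.N.a_rcos_self[OF f(1)])
  then have "(SOME f. f \<in> t) \<in> t" by (rule someI[of "\<lambda>f. f \<in> t"])
  then show "(SOME f. f \<in> t) \<in> carrier (F p q)" "null p q +>\<^bsub>F p q\<^esub> (SOME f. f \<in> t) = t"
    unfolding f(2) using Q.N.a_elemrcos_carrier[OF f(1)] Q.coset_eq[OF f(1)] by blast+
qed

lemma lin_ext_free_ext: "lin_ext k L t G = free_ext k L (\<lambda>(xs, ys). G xs ys) (SOME f. f \<in> t)"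
  by (simp add: lin_ext_def free_ext_def Let_def case_prod_beta)

lemma lin_ext_closed:
  assumes L: "module k L" and t: "t \<in> carrier (T p q)"
    and G: "\<And>xs ys. \<lbrakk>xs \<in> vecs M p; ys \<in> vecs N q\<rbrakk> \<Longrightarrow> G xs ys \<in> carrier L"
  shows "lin_ext k L t G \<in> carrier L"
  unfolding lin_ext_free_ext
  by (rule lin_closed[OF module.free_ext_lin[OF L] rep(1)[OF t]]) (use G in \<open>auto simp: mem_tensor_gens\<close>)

text \<open>Both sides sum over the same chosen representative, whose support consists of tuples
  over the carriers, so only the values of the integrand at such tuples matter.\<close>

lemma lin_ext_cong:
  assumes t: "t \<in> carrier (T p q)"
    and GG': "\<And>xs ys. \<lbrakk>xs \<in> vecs M p; ys \<in> vecs N q\<rbrakk> \<Longrightarrow> G xs ys = G' xs ys"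
  shows "lin_ext k L t G = lin_ext k L t G'"
  unfolding lin_ext_def Let_def
proof (rule finsum_cong_strong)
  fix g assume "g \<in> {g. (SOME f. f \<in> t) g \<noteq> \<zero>}"
  then have "g \<in> tensor_gens M p N q" using free_moduleD(3)[OF rep(1)[OF t]] by blast
  then have "G (fst g) (snd g) = G' (fst g) (snd g)"
    by (cases g) (auto simp: mem_tensor_gens intro!: GG')
  then show "(SOME f. f \<in> t) g \<odot>\<^bsub>L\<^esub> G (fst g) (snd g) = (SOME f. f \<in> t) g \<odot>\<^bsub>L\<^esub> G' (fst g) (snd g)"
    by simp
qed

lemma lin_ext_commute:
  assumes L: "module k L" and L': "module k L'" and t: "t \<in> carrier (T p q)"
    and h: "h \<in> lin_maps k L L'"
    and G: "\<And>xs ys. \<lbrakk>xs \<in> vecs M p; ys \<in> vecs N q\<rbrakk> \<Longrightarrow> G xs ys \<in> carrier L"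
  shows "h (lin_ext k L t G) = lin_ext k L' t (\<lambda>xs ys. h (G xs ys))"
proof -
  interpret L: module k L by fact
  interpret L': module k L' by fact
  let ?f = "SOME f. f \<in> t"
  note f = free_moduleD[OF rep(1)[OF t]]
  have Gs: "G (fst g) (snd g) \<in> carrier L" if "?f g \<noteq> \<zero>" for g
    using f(3)[OF that] by (intro G) (cases g, auto simp: mem_tensor_gens)+
  have "h (lin_ext k L t G) = (\<Oplus>\<^bsub>L'\<^esub>g\<in>{g. ?f g \<noteq> \<zero>}. h (?f g \<odot>\<^bsub>L\<^esub> G (fst g) (snd g)))"
    unfolding lin_ext_def Let_def
    by (rule lin_finsum[OF L L' h]) (use f(1) Gs in auto)
  also have "\<dots> = lin_ext k L' t (\<lambda>xs ys. h (G xs ys))"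
    unfolding lin_ext_def Let_def
    by (rule L'.finsum_cong') (use f(1) Gs in \<open>auto simp: lin_mapsD[OF h]\<close>)
  finally show ?thesis .
qed

text \<open>The tensor, and with it the representative, stays fixed while z varies, so linearity
  holds summand by summand.\<close>

lemma lin_ext_param:
  assumes L: "module k L" and Z: "module k Z" and t: "t \<in> carrier (T p q)"
    and G: "\<And>xs ys. \<lbrakk>xs \<in> vecs M p; ys \<in> vecs N q\<rbrakk> \<Longrightarrow> (\<lambda>z. G z xs ys) \<in> lin_maps k Z L"
  shows "(\<lambda>z. lin_ext k L t (G z)) \<in> lin_maps k Z L"
proof -
  interpret L: module k L by fact
  interpret Z: module k Z by fact
  let ?f = "SOME f. f \<in> t"
  note f = free_moduleD[OF rep(1)[OF t]]
  have Gs: "(\<lambda>z. G z (fst g) (snd g)) \<in> lin_maps k Z L" if "?f g \<noteq> \<zero>" for g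
    using f(3)[OF that] by (intro G) (cases g, auto simp: mem_tensor_gens)+
  have Gc: "G z (fst g) (snd g) \<in> carrier L" if "?f g \<noteq> \<zero>" "z \<in> carrier Z" for g z
    using lin_closed[OF Gs] that by blast
  show ?thesis
  proof (rule lin_mapsI)
    fix z assume z: "z \<in> carrier Z"
    then show "lin_ext k L t (G z) \<in> carrier L"
      using lin_closed[OF G] by (intro lin_ext_closed[OF L t]) auto
    {
      fix w assume w: "w \<in> carrier Z"
      have "lin_ext k L t (G (z \<oplus>\<^bsub>Z\<^esub> w)) =
          (\<Oplus>\<^bsub>L\<^esub>g\<in>{g. ?f g \<noteq> \<zero>}. ?f g \<odot>\<^bsub>L\<^esub> G z (fst g) (snd g) \<oplus>\<^bsub>L\<^esub> ?f g \<odot>\<^bsub>L\<^esub> G w (fst g) (snd g))"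
        unfolding lin_ext_def Let_def using f(1) z w Gc
        by (intro L.finsum_cong') (auto simp: lin_add[OF Gs] L.smult_r_distr)
      also have "\<dots> = lin_ext k L t (G z) \<oplus>\<^bsub>L\<^esub> lin_ext k L t (G w)"
        unfolding lin_ext_def Let_def using f(1) z w Gc
        by (intro L.finsum_addf) auto
      finally show "lin_ext k L t (G (z \<oplus>\<^bsub>Z\<^esub> w)) = lin_ext k L t (G z) \<oplus>\<^bsub>L\<^esub> lin_ext k L t (G w)" .
    }
    fix r assume r: "r \<in> carrier k"
    have "lin_ext k L t (G (r \<odot>\<^bsub>Z\<^esub> z)) =
        (\<Oplus>\<^bsub>L\<^esub>g\<in>{g. ?f g \<noteq> \<zero>}. r \<odot>\<^bsub>L\<^esub> (?f g \<odot>\<^bsub>L\<^esub> G z (fst g) (snd g)))"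
      unfolding lin_ext_def Let_def using f(1) z r Gc
      by (intro L.finsum_cong') (auto simp: lin_smult[OF Gs] L.smult_assoc1[symmetric] M.R.m_comm)
    also have "\<dots> = r \<odot>\<^bsub>L\<^esub> lin_ext k L t (G z)"
      unfolding lin_ext_def Let_def using f(1,2) z r Gc
      by (intro L.finsum_smult_ldistr[symmetric]) auto
    finally show "lin_ext k L t (G (r \<odot>\<^bsub>Z\<^esub> z)) = r \<odot>\<^bsub>L\<^esub> lin_ext k L t (G z)" .
  qed
qed

text \<open>The kernel of the extension to the free module is a submodule. Multilinearity puts all
  four families of relations into it, hence also the submodule they generate.\<close>

lemma null_free_ext:
  assumes L: "module k L" and G: "mlin2 k M p N q L G" and n: "n \<in> null p q"
  shows "free_ext k L (\<lambda>(xs, ys). G xs ys) n = \<zero>\<^bsub>L\<^esub>"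
proof -
  interpret L: module k L by fact
  let ?h = "free_ext k L (\<lambda>(xs, ys). G xs ys)"
  note Gc = mlin2D(3)[OF G]
  have h: "?h \<in> lin_maps k (F p q) L"
    by (rule L.free_ext_lin) (use Gc in \<open>auto simp: mem_tensor_gens\<close>)
  note hs = lin_mapsD[OF h] lin_neg[OF F.module_axioms L h]
  have hgen: "?h (free_gen k (xs, ys)) = G xs ys" if "xs \<in> vecs M p" "ys \<in> vecs N q" for xs ys
    using that Gc by (subst L.free_ext_gen[of _ "tensor_gens M p N q"]) (auto simp: mem_tensor_gens)
  define K where "K = {f \<in> carrier (F p q). ?h f = \<zero>\<^bsub>L\<^esub>}"
  \<comment> \<open>Every relation has the shape generator minus u, so membership in the kernel
    reduces to one value of G agreeing with the extension at u.\<close>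
  have kernel: "free_gen k g \<ominus>\<^bsub>F p q\<^esub> u \<in> K"
    if "g \<in> tensor_gens M p N q" "u \<in> carrier (F p q)" "G (fst g) (snd g) = ?h u" for g u
  proof -
    obtain xs ys where g: "g = (xs, ys)" by (cases g)
    have "?h (free_gen k g \<ominus>\<^bsub>F p q\<^esub> u) = G xs ys \<ominus>\<^bsub>L\<^esub> G xs ys"
      unfolding a_minus_def using that g hgen[of xs ys]
      by (simp add: hs gen_closed mem_tensor_gens)
    then show ?thesis using that g Gc[of ys xs]
      by (simp add: K_def gen_closed mem_tensor_gens L.M.r_neg a_minus_def)
  qed
  have "tensor_rels k M p N q \<subseteq> K"
    unfolding tensor_rels_def Let_def mem_tensor_gens
  proof (intro Un_least subsetI; clarify)
    fix xs ys i x x'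
    assume *: "xs \<in> vecs M p" "ys \<in> vecs N q" "i < p" "x \<in> carrier M" "x' \<in> carrier M"
    have lin: "(\<lambda>x. G (xs[i := x]) ys) \<in> lin_maps k M L"
      using * by (intro mlin_update[OF mlin2D(1)[OF G]]) auto
    note u = update_vec[OF *(1,3), of "x"] update_vec[OF *(1,3), of "x'"] update_vec[OF *(1,3), of "x \<oplus>\<^bsub>M\<^esub> x'"]
    show "free_gen k (xs[i := x \<oplus>\<^bsub>M\<^esub> x'], ys) \<ominus>\<^bsub>F p q\<^esub>
       (free_gen k (xs[i := x], ys) \<oplus>\<^bsub>F p q\<^esub> free_gen k (xs[i := x'], ys)) \<in> K"
      using * u by (intro kernel)
        (simp_all add: mem_tensor_gens gen_closed hs hgen lin_add[OF lin] del: mem_vecs)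
  next
    fix xs ys i r x
    assume *: "xs \<in> vecs M p" "ys \<in> vecs N q" "i < p" "r \<in> carrier k" "x \<in> carrier M"
    have lin: "(\<lambda>x. G (xs[i := x]) ys) \<in> lin_maps k M L"
      using * by (intro mlin_update[OF mlin2D(1)[OF G]]) auto
    note u = update_vec[OF *(1,3), of "x"] update_vec[OF *(1,3), of "r \<odot>\<^bsub>M\<^esub> x"]
    show "free_gen k (xs[i := r \<odot>\<^bsub>M\<^esub> x], ys) \<ominus>\<^bsub>F p q\<^esub>
       (r \<odot>\<^bsub>F p q\<^esub> free_gen k (xs[i := x], ys)) \<in> K"
      using * u by (intro kernel)
        (simp_all add: mem_tensor_gens gen_closed hs hgen lin_smult[OF lin] del: mem_vecs)
  next
    fix xs ys i x x'
    assume *: "xs \<in> vecs M p" "ys \<in> vecs N q" "i < q" "x \<in> carrier N" "x' \<in> carrier N"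
    have lin: "(\<lambda>x. G xs (ys[i := x])) \<in> lin_maps k N L"
      using * by (intro mlin_update[OF mlin2D(2)[OF G]]) auto
    note u = update_vec[OF *(2,3), of "x"] update_vec[OF *(2,3), of "x'"] update_vec[OF *(2,3), of "x \<oplus>\<^bsub>N\<^esub> x'"]
    show "free_gen k (xs, ys[i := x \<oplus>\<^bsub>N\<^esub> x']) \<ominus>\<^bsub>F p q\<^esub>
       (free_gen k (xs, ys[i := x]) \<oplus>\<^bsub>F p q\<^esub> free_gen k (xs, ys[i := x'])) \<in> K"
      using * u by (intro kernel)
        (simp_all add: mem_tensor_gens gen_closed hs hgen lin_add[OF lin] del: mem_vecs)
  next
    fix xs ys i r x
    assume *: "xs \<in> vecs M p" "ys \<in> vecs N q" "i < q" "r \<in> carrier k" "x \<in> carrier N"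
    have lin: "(\<lambda>x. G xs (ys[i := x])) \<in> lin_maps k N L"
      using * by (intro mlin_update[OF mlin2D(2)[OF G]]) auto
    note u = update_vec[OF *(2,3), of "x"] update_vec[OF *(2,3), of "r \<odot>\<^bsub>N\<^esub> x"]
    show "free_gen k (xs, ys[i := r \<odot>\<^bsub>N\<^esub> x]) \<ominus>\<^bsub>F p q\<^esub>
       (r \<odot>\<^bsub>F p q\<^esub> free_gen k (xs, ys[i := x])) \<in> K"
      using * u by (intro kernel)
        (simp_all add: mem_tensor_gens gen_closed hs hgen lin_smult[OF lin] del: mem_vecs)
  qed
  then have "null p q \<subseteq> K"
    unfolding tensor_null_def generated_submodule_def
    using F.submodule_kernel[OF L h] K_def by blast
  then show ?thesis using n K_def by blast
qed

text \<open>Independence of the representative: the chosen one differs from f by an element of the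
  null submodule, on which the extension of a multilinear integrand vanishes.\<close>

lemma lin_ext_coset:
  assumes L: "module k L" and G: "mlin2 k M p N q L G" and f: "f \<in> carrier (F p q)"
  shows "lin_ext k L (null p q +>\<^bsub>F p q\<^esub> f) G = free_ext k L (\<lambda>(xs, ys). G xs ys) f"
proof -
  interpret L: module k L by fact
  let ?t = "null p q +>\<^bsub>F p q\<^esub> f"
  let ?h = "free_ext k L (\<lambda>(xs, ys). G xs ys)"
  have h: "?h \<in> lin_maps k (F p q) L"
    by (rule L.free_ext_lin) (use mlin2D(3)[OF G] in \<open>auto simp: mem_tensor_gens\<close>)
  have t: "?t \<in> carrier (T p q)" unfolding tensor_def by (rule Q.coset_closed[OF f])
  have "(SOME g. g \<in> ?t) \<in> ?t"
    by (rule someI[of "\<lambda>g. g \<in> ?t"]) (rule Q.N.a_rcos_self[OF f])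
  then obtain n where n: "n \<in> null p q" "(SOME g. g \<in> ?t) = n \<oplus>\<^bsub>F p q\<^esub> f" by (rule Q.coset_memD)
  have "?h (n \<oplus>\<^bsub>F p q\<^esub> f) = ?h n \<oplus>\<^bsub>L\<^esub> ?h f"
    by (rule lin_add[OF h]) (use n Q.N.a_Hcarr f in auto)
  also have "\<dots> = ?h f" using null_free_ext[OF L G n(1)] lin_closed[OF h f] by simp
  finally show ?thesis unfolding lin_ext_free_ext n(2) .
qed

lemma lin_ext_lin:
  assumes L: "module k L" and G: "mlin2 k M p N q L G"
  shows "(\<lambda>t. lin_ext k L t G) \<in> lin_maps k (T p q) L"
proof -
  interpret L: module k L by fact
  let ?h = "free_ext k L (\<lambda>(xs, ys). G xs ys)"
  have h: "?h \<in> lin_maps k (F p q) L"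
    by (rule L.free_ext_lin) (use mlin2D(3)[OF G] in \<open>auto simp: mem_tensor_gens\<close>)
  note [simp] = lin_ext_coset[OF L G] lin_mapsD[OF h] Q.coset_add Q.coset_smult
  show ?thesis
    unfolding tensor_def
    by (rule lin_mapsI) (auto elim!: Q.quotient_cases simp del: M.smult_closed)
qed

lemma lin_ext_pure:
  assumes L: "module k L" and G: "mlin2 k M p N q L G" and "xs \<in> vecs M p" "ys \<in> vecs N q"
  shows "lin_ext k L (pt xs ys) G = G xs ys"
  using assms(3,4) mlin2D(3)[OF G]
  by (simp add: pure_tensor_coset[of _ p _ q] lin_ext_coset[OF L G] gen_closed
      module.free_ext_gen[OF L, of _ "tensor_gens M p N q"] mem_tensor_gens)

lemma pure_closed: "xs \<in> vecs M p \<Longrightarrow> ys \<in> vecs N q \<Longrightarrow> pt xs ys \<in> carrier (T p q)"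
  by (simp add: pure_tensor_coset[of _ p _ q] del: mem_vecs) (simp add: tensor_def Q.coset_closed gen_closed)

text \<open>Writing the representative as a combination of generators and projecting to the quotient
  expresses t as the same combination of pure tensors. This is the form in which pure tensors are
  shown to span.\<close>

lemma lin_ext_id:
  assumes t: "t \<in> carrier (T p q)"
  shows "lin_ext k (T p q) t pt = t"
proof -
  let ?f = "SOME f. f \<in> t"
  let ?c = "\<lambda>x. null p q +>\<^bsub>F p q\<^esub> x"
  interpret T: module k "T p q" by (rule tensor_module)
  note f = free_moduleD[OF rep(1)[OF t]]
  have gen: "free_gen k g \<in> carrier (F p q) \<and> pt (fst g) (snd g) = ?c (free_gen k g)" if "?f g \<noteq> \<zero>" for g
    using f(3)[OF that] by (cases g) (simp add: mem_tensor_gens gen_closed pure_tensor_coset[of _ p _ q])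
  have "t = ?c (free_ext k (F p q) (free_gen k) ?f)"
    using M.R.free_ext_free_gen[OF rep(1)[OF t]] rep(2)[OF t] by simp
  also have "\<dots> = (\<Oplus>\<^bsub>T p q\<^esub>g\<in>{g. ?f g \<noteq> \<zero>}. ?c (?f g \<odot>\<^bsub>F p q\<^esub> free_gen k g))"
    unfolding free_ext_def
    by (rule lin_finsum[OF F.module_axioms tensor_module coset_lin_tensor]) (use f gen in auto)
  also have "\<dots> = lin_ext k (T p q) t pt"
    unfolding lin_ext_def Let_def
    by (rule T.finsum_cong')
      (use f gen in \<open>auto simp: lin_smult[OF coset_lin_tensor] intro!: T.smult_closed lin_closed[OF coset_lin_tensor]\<close>)
  finally show ?thesis by simp
qed

text \<open>Expand t by \<open>lin_ext_id\<close> and move both maps inside the sum, where they only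
  meet pure tensors.\<close>

lemma tensor_eqI:
  assumes L: "module k L" and g: "g \<in> lin_maps k (T p q) L" and h: "h \<in> lin_maps k (T p q) L"
    and eq: "\<And>xs ys. \<lbrakk>xs \<in> vecs M p; ys \<in> vecs N q\<rbrakk> \<Longrightarrow> g (pt xs ys) = h (pt xs ys)"
    and t: "t \<in> carrier (T p q)"
  shows "g t = h t"
proof -
  have "g t = lin_ext k L t (\<lambda>xs ys. g (pt xs ys))"
    using lin_ext_commute[OF tensor_module L t g, of pt] pure_closed[of _ p _ q] lin_ext_id[OF t] by simp
  also have "\<dots> = lin_ext k L t (\<lambda>xs ys. h (pt xs ys))"
    by (rule lin_ext_cong[OF t]) (auto simp: eq)
  also have "\<dots> = h t"
    using lin_ext_commute[OF tensor_module L t h, of pt] pure_closed[of _ p _ q] lin_ext_id[OF t] by simp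
  finally show ?thesis .
qed

lemma pure_relI:
  assumes "xs \<in> vecs M p" "ys \<in> vecs N q" "u \<in> carrier (F p q)"
    and "free_gen k (xs, ys) \<ominus>\<^bsub>F p q\<^esub> u \<in> tensor_rels k M p N q"
  shows "pt xs ys = null p q +>\<^bsub>F p q\<^esub> u"
proof -
  have "free_gen k (xs, ys) \<ominus>\<^bsub>F p q\<^esub> u \<in> null p q"
    using assms(4) by (auto simp: tensor_null_def generated_submodule_def)
  then have "free_gen k (xs, ys) \<in> null p q +>\<^bsub>F p q\<^esub> u"
    using assms by (intro Q.N.a_rcos_module_rev) (simp_all add: gen_closed a_minus_def)
  then show ?thesis using assms Q.coset_eq by (simp add: pure_tensor_coset[of _ p _ q])
qed

lemma pure_mlin2: "mlin2 k M p N q (T p q) pt"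
proof (intro mlin2I mlinI)
  note c = lin_mapsD[OF coset_lin_tensor]
  {
    fix ys xs xs' assume *: "length ys = q" "set ys \<subseteq> carrier N" "set xs \<subseteq> carrier M" "set xs' \<subseteq> carrier M"
      "Suc (length xs + length xs') = p"
    let ?g = "\<lambda>x. free_gen k (xs @ x # xs', ys)"
    have v: "xs @ x # xs' \<in> vecs M p" "ys \<in> vecs N q" "?g x \<in> carrier (F p q)" if "x \<in> carrier M" for x
      using * that by (auto intro!: gen_closed)
    show "(\<lambda>x. pt (xs @ x # xs') ys) \<in> lin_maps k M (T p q)"
    proof (rule lin_mapsI)
      fix x x' assume x: "x \<in> carrier M" "x' \<in> carrier M"
      \<comment> \<open>Base tuple of the relation: the tuple with x already in place. Its entry at
        \<open>length xs\<close> is overwritten by the update, so any filler from the carrier would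
        do.\<close>
      have "?g (x \<oplus>\<^bsub>M\<^esub> x') \<ominus>\<^bsub>F p q\<^esub> (?g x \<oplus>\<^bsub>F p q\<^esub> ?g x') \<in> tensor_rels k M p N q"
        unfolding tensor_rels_def Let_def mem_tensor_gens
        using x v[OF x(1)] * by (intro UnI1 CollectI exI[of _ "xs @ x # xs'"] exI[of _ ys]
            exI[of _ "length xs"] exI[of _ x] exI[of _ x']) simp
      then have "pt (xs @ (x \<oplus>\<^bsub>M\<^esub> x') # xs') ys = null p q +>\<^bsub>F p q\<^esub> (?g x \<oplus>\<^bsub>F p q\<^esub> ?g x')"
        using x v by (intro pure_relI) (auto simp del: mem_vecs)
      then show "pt (xs @ (x \<oplus>\<^bsub>M\<^esub> x') # xs') ys = pt (xs @ x # xs') ys \<oplus>\<^bsub>T p q\<^esub> pt (xs @ x' # xs') ys"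
        using x v by (simp add: c pure_tensor_coset[of _ p _ q] del: mem_vecs)
    next
      fix r x assume x: "r \<in> carrier k" "x \<in> carrier M"
      have "?g (r \<odot>\<^bsub>M\<^esub> x) \<ominus>\<^bsub>F p q\<^esub> (r \<odot>\<^bsub>F p q\<^esub> ?g x) \<in> tensor_rels k M p N q"
        unfolding tensor_rels_def Let_def mem_tensor_gens
        using x v[OF x(2)] * by (intro UnI1[OF UnI1[OF UnI2]] CollectI exI[of _ "xs @ x # xs'"] exI[of _ ys]
            exI[of _ "length xs"] exI[of _ r] exI[of _ x]) simp
      then have "pt (xs @ (r \<odot>\<^bsub>M\<^esub> x) # xs') ys = null p q +>\<^bsub>F p q\<^esub> (r \<odot>\<^bsub>F p q\<^esub> ?g x)"
        using x v by (intro pure_relI) (auto simp del: mem_vecs)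
      then show "pt (xs @ (r \<odot>\<^bsub>M\<^esub> x) # xs') ys = r \<odot>\<^bsub>T p q\<^esub> pt (xs @ x # xs') ys"
        using x v by (simp add: c pure_tensor_coset[of _ p _ q] del: mem_vecs)
    qed (intro pure_closed v)
  }
  {
    fix ys xs ys' assume *: "length xs = p" "set xs \<subseteq> carrier M" "set ys \<subseteq> carrier N" "set ys' \<subseteq> carrier N"
      "Suc (length ys + length ys') = q"
    let ?g = "\<lambda>y. free_gen k (xs, ys @ y # ys')"
    have v: "ys @ y # ys' \<in> vecs N q" "xs \<in> vecs M p" "?g y \<in> carrier (F p q)" if "y \<in> carrier N" for y
      using * that by (auto intro!: gen_closed)
    show "(\<lambda>y. pt xs (ys @ y # ys')) \<in> lin_maps k N (T p q)"
    proof (rule lin_mapsI)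
      fix y y' assume y: "y \<in> carrier N" "y' \<in> carrier N"
      have "?g (y \<oplus>\<^bsub>N\<^esub> y') \<ominus>\<^bsub>F p q\<^esub> (?g y \<oplus>\<^bsub>F p q\<^esub> ?g y') \<in> tensor_rels k M p N q"
        unfolding tensor_rels_def Let_def mem_tensor_gens
        using y v[OF y(1)] * by (intro UnI1[OF UnI2] CollectI exI[of _ "xs"] exI[of _ "ys @ y # ys'"]
            exI[of _ "length ys"] exI[of _ y] exI[of _ y']) simp
      then have "pt xs (ys @ (y \<oplus>\<^bsub>N\<^esub> y') # ys') = null p q +>\<^bsub>F p q\<^esub> (?g y \<oplus>\<^bsub>F p q\<^esub> ?g y')"
        using y v by (intro pure_relI) (auto simp del: mem_vecs)
      then show "pt xs (ys @ (y \<oplus>\<^bsub>N\<^esub> y') # ys') = pt xs (ys @ y # ys') \<oplus>\<^bsub>T p q\<^esub> pt xs (ys @ y' # ys')"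
        using y v by (simp add: c pure_tensor_coset[of _ p _ q] del: mem_vecs)
    next
      fix r y assume y: "r \<in> carrier k" "y \<in> carrier N"
      have "?g (r \<odot>\<^bsub>N\<^esub> y) \<ominus>\<^bsub>F p q\<^esub> (r \<odot>\<^bsub>F p q\<^esub> ?g y) \<in> tensor_rels k M p N q"
        unfolding tensor_rels_def Let_def mem_tensor_gens
        using y v[OF y(2)] * by (intro UnI2 CollectI exI[of _ "xs"] exI[of _ "ys @ y # ys'"]
            exI[of _ "length ys"] exI[of _ r] exI[of _ y]) simp
      then have "pt xs (ys @ (r \<odot>\<^bsub>N\<^esub> y) # ys') = null p q +>\<^bsub>F p q\<^esub> (r \<odot>\<^bsub>F p q\<^esub> ?g y)"
        using y v by (intro pure_relI) (auto simp del: mem_vecs)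
      then show "pt xs (ys @ (r \<odot>\<^bsub>N\<^esub> y) # ys') = r \<odot>\<^bsub>T p q\<^esub> pt xs (ys @ y # ys')"
        using y v by (simp add: c pure_tensor_coset[of _ p _ q] del: mem_vecs)
    qed (intro pure_closed v)
  }
qed (auto intro!: pure_closed)

end

text \<open>Both sums run over fixed finite supports, so this is the interchange of finite sums
  together with commutativity of the scalars.\<close>

lemma lin_ext_swap:
  assumes L: "module k L" and MN: "module_pair k M N" and MN': "module_pair k M' N'"
    and t: "t \<in> carrier (tensor k M p N q)" and s: "s \<in> carrier (tensor k M' p' N' q')"
    and G: "\<And>xs ys us vs. \<lbrakk>xs \<in> vecs M p; ys \<in> vecs N q; us \<in> vecs M' p'; vs \<in> vecs N' q'\<rbrakk>
      \<Longrightarrow> G xs ys us vs \<in> carrier L"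
  shows "lin_ext k L t (\<lambda>xs ys. lin_ext k L s (\<lambda>us vs. G xs ys us vs))
    = lin_ext k L s (\<lambda>us vs. lin_ext k L t (\<lambda>xs ys. G xs ys us vs))"
proof -
  interpret L: module k L by fact
  interpret MN: module_pair k M N by fact
  interpret MN': module_pair k M' N' by fact
  let ?f = "SOME f. f \<in> t" and ?g = "SOME f. f \<in> s"
  let ?A = "{x. ?f x \<noteq> \<zero>\<^bsub>k\<^esub>}" and ?B = "{x. ?g x \<noteq> \<zero>\<^bsub>k\<^esub>}"
  note f = free_moduleD[OF MN.rep(1)[OF t]] and g = free_moduleD[OF MN'.rep(1)[OF s]]
  let ?G = "\<lambda>x u. G (fst x) (snd x) (fst u) (snd u)"
  have Gc: "?G x u \<in> carrier L" if "x \<in> ?A" "u \<in> ?B" for x u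
    using f(3)[of x] g(3)[of u] that
    by (intro G) (cases x; cases u; simp add: mem_tensor_gens)+
  have "lin_ext k L t (\<lambda>xs ys. lin_ext k L s (\<lambda>us vs. G xs ys us vs))
      = (\<Oplus>\<^bsub>L\<^esub>x\<in>?A. ?f x \<odot>\<^bsub>L\<^esub> (\<Oplus>\<^bsub>L\<^esub>u\<in>?B. ?g u \<odot>\<^bsub>L\<^esub> ?G x u))"
    by (simp add: lin_ext_def Let_def)
  also have "\<dots> = (\<Oplus>\<^bsub>L\<^esub>x\<in>?A. \<Oplus>\<^bsub>L\<^esub>u\<in>?B. ?f x \<odot>\<^bsub>L\<^esub> (?g u \<odot>\<^bsub>L\<^esub> ?G x u))"
    using f g Gc by (intro L.finsum_cong' L.finsum_smult_ldistr)
      (auto intro!: L.finsum_closed L.smult_closed)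
  also have "\<dots> = (\<Oplus>\<^bsub>L\<^esub>u\<in>?B. \<Oplus>\<^bsub>L\<^esub>x\<in>?A. ?f x \<odot>\<^bsub>L\<^esub> (?g u \<odot>\<^bsub>L\<^esub> ?G x u))"
    using f g Gc by (intro L.finsum_swap) auto
  also have "\<dots> = (\<Oplus>\<^bsub>L\<^esub>u\<in>?B. \<Oplus>\<^bsub>L\<^esub>x\<in>?A. ?g u \<odot>\<^bsub>L\<^esub> (?f x \<odot>\<^bsub>L\<^esub> ?G x u))"
    using f g Gc by (intro L.finsum_cong')
      (auto intro!: L.finsum_closed L.smult_closed simp: L.smult_assoc1[symmetric] L.R.m_comm)
  also have "\<dots> = (\<Oplus>\<^bsub>L\<^esub>u\<in>?B. ?g u \<odot>\<^bsub>L\<^esub> (\<Oplus>\<^bsub>L\<^esub>x\<in>?A. ?f x \<odot>\<^bsub>L\<^esub> ?G x u))"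
    using f g Gc by (intro L.finsum_cong' L.finsum_smult_ldistr[symmetric])
      (auto intro!: L.finsum_closed L.smult_closed)
  also have "\<dots> = lin_ext k L s (\<lambda>us vs. lin_ext k L t (\<lambda>xs ys. G xs ys us vs))"
    by (simp add: lin_ext_def Let_def)
  finally show ?thesis .
qed

section \<open>Sweedler calculus\<close>

lemma regular_module_simps [simp]:
  "carrier (regular_module k) = carrier k" "\<zero>\<^bsub>regular_module k\<^esub> = \<zero>\<^bsub>k\<^esub>"
  "x \<oplus>\<^bsub>regular_module k\<^esub> y = x \<oplus>\<^bsub>k\<^esub> y" "r \<odot>\<^bsub>regular_module k\<^esub> x = r \<otimes>\<^bsub>k\<^esub> x"
  by (simp_all add: regular_module_def)

context module_pair
begin

lemma hd_vecs [simp]: "xs \<in> vecs M (Suc 0) \<Longrightarrow> hd xs \<in> carrier M"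
  by (cases xs) auto

lemma sweedler_closed:
  assumes "module k L" "t \<in> carrier (T 1 1)"
    and "\<And>x y. \<lbrakk>x \<in> carrier M; y \<in> carrier N\<rbrakk> \<Longrightarrow> G x y \<in> carrier L"
  shows "sweedler k L t G \<in> carrier L"
  unfolding sweedler_def
  by (rule lin_ext_closed[OF assms(1,2)]) (auto simp: length_Suc_conv intro!: assms(3))

lemma sweedler_cong:
  assumes "t \<in> carrier (T 1 1)"
    and "\<And>x y. \<lbrakk>x \<in> carrier M; y \<in> carrier N\<rbrakk> \<Longrightarrow> G x y = G' x y"
  shows "sweedler k L t G = sweedler k L t G'"
  unfolding sweedler_def
  by (rule lin_ext_cong[OF assms(1)]) (auto simp: length_Suc_conv intro!: assms(2))

lemma sweedler_commute:
  assumes "h \<in> lin_maps k L L'" "module k L" "module k L'" "t \<in> carrier (T 1 1)"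
    and "\<And>x y. \<lbrakk>x \<in> carrier M; y \<in> carrier N\<rbrakk> \<Longrightarrow> G x y \<in> carrier L"
  shows "h (sweedler k L t G) = sweedler k L' t (\<lambda>x y. h (G x y))"
  unfolding sweedler_def
  by (rule lin_ext_commute[OF assms(2,3,4,1)]) (auto simp: length_Suc_conv intro!: assms(5))

lemma lin_sweedler_param:
  assumes "module k L" "module k Z" "t \<in> carrier (T 1 1)"
    and "\<And>x y. \<lbrakk>x \<in> carrier M; y \<in> carrier N\<rbrakk> \<Longrightarrow> (\<lambda>z. G z x y) \<in> lin_maps k Z L"
  shows "(\<lambda>z. sweedler k L t (G z)) \<in> lin_maps k Z L"
  unfolding sweedler_def
  by (rule lin_ext_param[OF assms(1-3)]) (auto simp: length_Suc_conv intro!: assms(4))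

lemma bilin_mlin2:
  assumes "\<And>y. y \<in> carrier N \<Longrightarrow> (\<lambda>x. G x y) \<in> lin_maps k M L"
    and "\<And>x. x \<in> carrier M \<Longrightarrow> (\<lambda>y. G x y) \<in> lin_maps k N L"
  shows "mlin2 k M 1 N 1 L (\<lambda>xs ys. G (hd xs) (hd ys))"
  by (intro mlin2I mlinI) (auto simp: length_Suc_conv assms intro: lin_closed[OF assms(1)])

text \<open>Here z enters through the tensor, which is why G is bilinear; in
  \<open>lin_sweedler_param\<close> it enters through the integrand and linearity is
  termwise.\<close>

lemma lin_sweedler:
  assumes "module k L" "f \<in> lin_maps k Z (T 1 1)"
    and "\<And>y. y \<in> carrier N \<Longrightarrow> (\<lambda>x. G x y) \<in> lin_maps k M L"
    and "\<And>x. x \<in> carrier M \<Longrightarrow> (\<lambda>y. G x y) \<in> lin_maps k N L"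
  shows "(\<lambda>z. sweedler k L (f z) G) \<in> lin_maps k Z L"
  unfolding sweedler_def
  by (rule lin_comp[OF lin_ext_lin[OF assms(1)] assms(2)]) (intro bilin_mlin2 assms(3,4))

lemma sweedler_pure:
  assumes "module k L" "x \<in> carrier M" "y \<in> carrier N"
    and "\<And>y. y \<in> carrier N \<Longrightarrow> (\<lambda>x. G x y) \<in> lin_maps k M L"
    and "\<And>x. x \<in> carrier M \<Longrightarrow> (\<lambda>y. G x y) \<in> lin_maps k N L"
  shows "sweedler k L (pt [x] [y]) G = G x y"
  unfolding sweedler_def
  using lin_ext_pure[OF assms(1) bilin_mlin2[of G L], of "[x]" "[y]"] assms by simp

end

lemma sweedler_swap:
  assumes "module k L" "module_pair k M N" "module_pair k M' N'"
    and "t \<in> carrier (tensor k M 1 N 1)" "s \<in> carrier (tensor k M' 1 N' 1)"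
    and "\<And>x y u v. \<lbrakk>x \<in> carrier M; y \<in> carrier N; u \<in> carrier M'; v \<in> carrier N'\<rbrakk>
      \<Longrightarrow> G x y u v \<in> carrier L"
  shows "sweedler k L t (\<lambda>x y. sweedler k L s (\<lambda>u v. G x y u v))
    = sweedler k L s (\<lambda>u v. sweedler k L t (\<lambda>x y. G x y u v))"
  unfolding sweedler_def
  by (rule lin_ext_swap[OF assms(1-5)]) (auto simp: length_Suc_conv intro!: assms(6))

text \<open>A list in which a single entry depends on z, and does so linearly. The closure rules for
  \<open>slot\<close> turn linearity of a multilinear expression in z into a check directed by the
  shape of the list.\<close>

definition slot where
  "slot k Z M e \<longleftrightarrow> (\<exists>f xs ys. f \<in> lin_maps k Z M \<and> set xs \<subseteq> carrier M \<and> set ys \<subseteq> carrier M \<and>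
    (\<forall>z. e z = xs @ f z # ys))"

lemma slot_here: "f \<in> lin_maps k Z M \<Longrightarrow> set ys \<subseteq> carrier M \<Longrightarrow> slot k Z M (\<lambda>z. f z # ys)"
  unfolding slot_def by (intro exI[of _ f] exI[of _ "[]"] exI[of _ ys]) simp

lemma slot_Cons:
  assumes "slot k Z M e" "x \<in> carrier M"
  shows "slot k Z M (\<lambda>z. x # e z)"
proof -
  obtain f xs ys where "f \<in> lin_maps k Z M" "set xs \<subseteq> carrier M" "set ys \<subseteq> carrier M"
    "\<forall>z. e z = xs @ f z # ys" using assms(1) unfolding slot_def by blast
  then show ?thesis unfolding slot_def using assms(2)
    by (intro exI[of _ f] exI[of _ "x # xs"] exI[of _ ys]) simp
qed

lemma slot_append1:
  assumes "slot k Z M e" "set us \<subseteq> carrier M"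
  shows "slot k Z M (\<lambda>z. e z @ us)"
proof -
  obtain f xs ys where "f \<in> lin_maps k Z M" "set xs \<subseteq> carrier M" "set ys \<subseteq> carrier M"
    "\<forall>z. e z = xs @ f z # ys" using assms(1) unfolding slot_def by blast
  then show ?thesis unfolding slot_def using assms(2)
    by (intro exI[of _ f] exI[of _ "xs"] exI[of _ "ys @ us"]) simp
qed

lemma slot_append2:
  assumes "slot k Z M e" "set us \<subseteq> carrier M"
  shows "slot k Z M (\<lambda>z. us @ e z)"
proof -
  obtain f xs ys where "f \<in> lin_maps k Z M" "set xs \<subseteq> carrier M" "set ys \<subseteq> carrier M"
    "\<forall>z. e z = xs @ f z # ys" using assms(1) unfolding slot_def by blast
  then show ?thesis unfolding slot_def using assms(2)
    by (intro exI[of _ f] exI[of _ "us @ xs"] exI[of _ "ys"]) simp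
qed

lemmas slot_intros = slot_here slot_Cons slot_append1 slot_append2

lemma lin_mlin:
  assumes K: "mlin k M n L K" and e: "slot k Z M e" and n: "\<And>z. length (e z) = n"
  shows "(\<lambda>z. K (e z)) \<in> lin_maps k Z L"
proof -
  obtain f xs ys where *: "f \<in> lin_maps k Z M" "set xs \<subseteq> carrier M" "set ys \<subseteq> carrier M"
    "\<forall>z. e z = xs @ f z # ys" using e unfolding slot_def by blast
  then have "(\<lambda>z. K (xs @ f z # ys)) \<in> lin_maps k Z L"
    \<comment> \<open>All \<open>e z\<close> have the same length, so one arbitrary argument fixes
      the lengths of the two ends.\<close>
    using n[of undefined] by (intro lin_comp[OF mlin_slot[OF K]]) auto
  then show ?thesis using * by simp
qed

lemma mlin_Cons:
  assumes K: "mlin k M (Suc n) L K" and x: "x \<in> carrier M"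
  shows "mlin k M n L (\<lambda>xs. K (x # xs))"
proof (rule mlinI)
  fix xs ys assume "set xs \<subseteq> carrier M" "set ys \<subseteq> carrier M" "Suc (length xs + length ys) = n"
  then show "(\<lambda>y. K (x # xs @ y # ys)) \<in> lin_maps k M L"
    using mlin_slot[OF K, of "x # xs" ys] x by simp
qed (use x in \<open>simp add: mlin_closed[OF K]\<close>)

lemma mlin_append2:
  assumes K: "mlin k M (n + m) L K" and xs: "length xs = n" "set xs \<subseteq> carrier M"
  shows "mlin k M m L (\<lambda>ys. K (xs @ ys))"
proof (rule mlinI)
  fix us vs assume "set us \<subseteq> carrier M" "set vs \<subseteq> carrier M" "Suc (length us + length vs) = m"
  then show "(\<lambda>y. K (xs @ us @ y # vs)) \<in> lin_maps k M L"
    using mlin_slot[OF K, of "xs @ us" vs] xs by simp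
qed (use xs in \<open>simp add: mlin_closed[OF K]\<close>)

lemma lin_ident: "(\<lambda>x. x) \<in> lin_maps k M M"
  by (rule lin_mapsI) simp_all

lemma lin_smult_right:
  assumes "module k L" "f \<in> lin_maps k Z L" "r \<in> carrier k"
  shows "(\<lambda>z. r \<odot>\<^bsub>L\<^esub> f z) \<in> lin_maps k Z L"
proof -
  interpret L: module k L by fact
  show ?thesis using assms(3)
    by (intro lin_mapsI)
      (simp_all add: lin_mapsD[OF assms(2)] L.smult_r_distr L.smult_assoc1[symmetric] L.R.m_comm)
qed

lemma lin_smult_left:
  assumes "module k L" "f \<in> lin_maps k Z (regular_module k)" "c \<in> carrier L"
  shows "(\<lambda>z. f z \<odot>\<^bsub>L\<^esub> c) \<in> lin_maps k Z L"
proof -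
  interpret L: module k L by fact
  have "f x \<in> carrier k" if "x \<in> carrier Z" for x using lin_closed[OF assms(2) that] by simp
  then show ?thesis using assms(3)
    by (intro lin_mapsI)
      (simp_all add: lin_mapsD(2,3)[OF assms(2)] L.smult_l_distr L.smult_assoc1[symmetric])
qed

context coalgebra
begin

sublocale pair: module_pair k C C ..

abbreviation D where "D L a G \<equiv> sweedler k L (\<Delta>\<^bsub>C\<^esub> a) G"

lemma comult_closed: "a \<in> carrier C \<Longrightarrow> \<Delta>\<^bsub>C\<^esub> a \<in> carrier (tensor k C 1 C 1)"
  by (rule lin_closed[OF comult_linear])

lemma counit_closed [simp]: "a \<in> carrier C \<Longrightarrow> \<epsilon>\<^bsub>C\<^esub> a \<in> carrier k"
  using lin_closed[OF counit_linear] by simp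

lemma lin_counit: "f \<in> lin_maps k Z C \<Longrightarrow> (\<lambda>z. \<epsilon>\<^bsub>C\<^esub> (f z)) \<in> lin_maps k Z (regular_module k)"
  by (rule lin_comp[OF counit_linear])

lemma D_closed:
  "\<lbrakk>module k L; a \<in> carrier C; \<And>x y. \<lbrakk>x \<in> carrier C; y \<in> carrier C\<rbrakk> \<Longrightarrow> G x y \<in> carrier L\<rbrakk>
    \<Longrightarrow> D L a G \<in> carrier L"
  by (rule pair.sweedler_closed[OF _ comult_closed])

lemma D_cong:
  "\<lbrakk>a \<in> carrier C; \<And>x y. \<lbrakk>x \<in> carrier C; y \<in> carrier C\<rbrakk> \<Longrightarrow> G x y = G' x y\<rbrakk> \<Longrightarrow> D L a G = D L a G'"
  by (rule pair.sweedler_cong[OF comult_closed])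

text \<open>Congruence-rule form: it hands the simplifier the carrier memberships of the two bound
  legs while it rewrites under the sum.\<close>

lemma D_simp_cong:
  "\<lbrakk>a = b; b \<in> carrier C; \<And>x y. \<lbrakk>x \<in> carrier C; y \<in> carrier C\<rbrakk> \<Longrightarrow> G x y = G' x y\<rbrakk> \<Longrightarrow> D L a G = D L b G'"
  by (hypsubst) (rule D_cong)

lemmas D_commute = pair.sweedler_commute[OF _ _ _ comult_closed]
lemmas lin_D_param = pair.lin_sweedler_param[OF _ _ comult_closed]
lemmas lin_D = pair.lin_sweedler[OF _ lin_comp[OF comult_linear]]
lemmas D_swap = sweedler_swap[OF _ pair.module_pair_axioms pair.module_pair_axioms comult_closed comult_closed]

text \<open>Transport device for \<open>coassoc\<close>: a trilinear integrand becomes a linear map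
  out of the tensor cube in which the axiom is stated.\<close>

lemma lin_ext3:
  assumes L: "module k L"
    and G: "\<And>y z. \<lbrakk>y \<in> carrier C; z \<in> carrier C\<rbrakk> \<Longrightarrow> (\<lambda>x. G x y z) \<in> lin_maps k C L"
      "\<And>x z. \<lbrakk>x \<in> carrier C; z \<in> carrier C\<rbrakk> \<Longrightarrow> (\<lambda>y. G x y z) \<in> lin_maps k C L"
      "\<And>x y. \<lbrakk>x \<in> carrier C; y \<in> carrier C\<rbrakk> \<Longrightarrow> (\<lambda>z. G x y z) \<in> lin_maps k C L"
  shows "\<exists>E\<in>lin_maps k (tensor k C 3 C 0) L.
    \<forall>x\<in>carrier C. \<forall>y\<in>carrier C. \<forall>z\<in>carrier C. E (pure_tensor k C C [x, y, z] []) = G x y z"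
proof (intro bexI ballI)
  have G3: "mlin2 k C 3 C 0 L (\<lambda>xs _. G (xs ! 0) (xs ! 1) (xs ! 2))"
  proof (intro mlin2I mlinI)
    fix xs ys :: "'c list"
    assume xs: "set xs \<subseteq> carrier C" "set ys \<subseteq> carrier C" "Suc (length xs + length ys) = 3"
    consider "length xs = 0" "length ys = 2" | "length xs = 1" "length ys = 1" | "length xs = 2" "length ys = 0"
      using xs(3) by linarith
    then show "(\<lambda>x. G ((xs @ x # ys) ! 0) ((xs @ x # ys) ! 1) ((xs @ x # ys) ! 2)) \<in> lin_maps k C L"
      using xs by cases (auto simp: numeral_2_eq_2 length_Suc_conv G)
  qed (auto simp: numeral_3_eq_3 numeral_2_eq_2 length_Suc_conv lin_closed[OF G(1)])
  show "(\<lambda>t. lin_ext k L t (\<lambda>xs _. G (xs ! 0) (xs ! 1) (xs ! 2))) \<in> lin_maps k (tensor k C 3 C 0) L"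
    by (rule pair.lin_ext_lin[OF L G3])
  fix x y z assume "x \<in> carrier C" "y \<in> carrier C" "z \<in> carrier C"
  then show "lin_ext k L (pure_tensor k C C [x, y, z] []) (\<lambda>xs _. G (xs ! 0) (xs ! 1) (xs ! 2)) = G x y z"
    by (subst pair.lin_ext_pure[OF L G3]) auto
qed

text \<open>Apply the linear map induced by G to the axiom in the tensor cube, then move it inside
  both nested sums.\<close>

lemma D_coassoc:
  assumes L: "module k L" and a: "a \<in> carrier C"
    and G: "\<And>y z. \<lbrakk>y \<in> carrier C; z \<in> carrier C\<rbrakk> \<Longrightarrow> (\<lambda>x. G x y z) \<in> lin_maps k C L"
      "\<And>x z. \<lbrakk>x \<in> carrier C; z \<in> carrier C\<rbrakk> \<Longrightarrow> (\<lambda>y. G x y z) \<in> lin_maps k C L"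
      "\<And>x y. \<lbrakk>x \<in> carrier C; y \<in> carrier C\<rbrakk> \<Longrightarrow> (\<lambda>z. G x y z) \<in> lin_maps k C L"
  shows "D L a (\<lambda>x y. D L x (\<lambda>u v. G u v y)) = D L a (\<lambda>x y. D L y (\<lambda>u v. G x u v))"
proof -
  let ?T = "tensor k C 3 C 0"
  obtain E where E: "E \<in> lin_maps k ?T L"
    "\<And>x y z. \<lbrakk>x \<in> carrier C; y \<in> carrier C; z \<in> carrier C\<rbrakk> \<Longrightarrow> E (pair.pt [x, y, z] []) = G x y z"
    using lin_ext3[OF L, of G, OF G] by blast
  have T: "module k ?T" by (rule pair.tensor_module)
  have pc: "pair.pt [x, y, z] [] \<in> carrier ?T" if "x \<in> carrier C" "y \<in> carrier C" "z \<in> carrier C" for x y z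
    using that by (intro pair.pure_closed) auto
  note cl = D_commute[OF E(1) T L] D_closed[OF T] pc E(2)
  have "D L a (\<lambda>x y. D L x (\<lambda>u v. G u v y)) = E (D ?T a (\<lambda>x y. D ?T x (\<lambda>u v. pair.pt [u, v, y] [])))"
    using a by (simp add: cl cong: D_simp_cong)
  also have "\<dots> = E (D ?T a (\<lambda>x y. D ?T y (\<lambda>u v. pair.pt [x, u, v] [])))"
    by (simp add: coassoc[OF a])
  also have "\<dots> = D L a (\<lambda>x y. D L y (\<lambda>u v. G x u v))"
    using a by (simp add: cl cong: D_simp_cong)
  finally show ?thesis .
qed

text \<open>The axiom is an equation in C itself; applying f and moving it under the sum gives the
  form for an arbitrary linear integrand.\<close>

lemma D_counit_left:
  assumes L: "module k L" and a: "a \<in> carrier C" and f: "f \<in> lin_maps k C L"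
  shows "D L a (\<lambda>x y. \<epsilon>\<^bsub>C\<^esub> x \<odot>\<^bsub>L\<^esub> f y) = f a"
proof -
  have "f a = f (D C a (\<lambda>x y. \<epsilon>\<^bsub>C\<^esub> x \<odot>\<^bsub>C\<^esub> y))" using counit_left[OF a] by simp
  also have "\<dots> = D L a (\<lambda>x y. f (\<epsilon>\<^bsub>C\<^esub> x \<odot>\<^bsub>C\<^esub> y))"
    using a by (intro D_commute[OF f module_axioms L]) auto
  also have "\<dots> = D L a (\<lambda>x y. \<epsilon>\<^bsub>C\<^esub> x \<odot>\<^bsub>L\<^esub> f y)"
    using a by (intro D_cong) (auto simp: lin_smult[OF f])
  finally show ?thesis by simp
qed

lemma D_counit_right:
  assumes L: "module k L" and a: "a \<in> carrier C" and f: "f \<in> lin_maps k C L"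
  shows "D L a (\<lambda>x y. \<epsilon>\<^bsub>C\<^esub> y \<odot>\<^bsub>L\<^esub> f x) = f a"
proof -
  have "f a = f (D C a (\<lambda>x y. \<epsilon>\<^bsub>C\<^esub> y \<odot>\<^bsub>C\<^esub> x))" using counit_right[OF a] by simp
  also have "\<dots> = D L a (\<lambda>x y. f (\<epsilon>\<^bsub>C\<^esub> y \<odot>\<^bsub>C\<^esub> x))"
    using a by (intro D_commute[OF f module_axioms L]) auto
  also have "\<dots> = D L a (\<lambda>x y. \<epsilon>\<^bsub>C\<^esub> y \<odot>\<^bsub>L\<^esub> f x)"
    using a by (intro D_cong) (auto simp: lin_smult[OF f])
  finally show ?thesis by simp
qed

end

section \<open>Diagonal actions of Hopf algebras\<close>

context hopf_algebra
begin

lemma ring_H: "ring H" ..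

lemmas H_m_assoc = ring.ring_simprules(11)[OF ring_H]
lemmas H_l_distr = ring.ring_simprules(13)[OF ring_H]
lemmas H_r_distr = ring.ring_simprules(23)[OF ring_H]

lemma lin_mult_left:
  assumes f: "f \<in> lin_maps k Z H" and "c \<in> carrier H"
  shows "(\<lambda>z. f z \<otimes>\<^bsub>H\<^esub> c) \<in> lin_maps k Z H"
  using assms(2) by (intro lin_mapsI) (simp_all add: lin_mapsD[OF f] H_l_distr smult_mult_left)

lemma lin_mult_right:
  assumes f: "f \<in> lin_maps k Z H" and "c \<in> carrier H"
  shows "(\<lambda>z. c \<otimes>\<^bsub>H\<^esub> f z) \<in> lin_maps k Z H"
  using assms(2) by (intro lin_mapsI) (simp_all add: lin_mapsD[OF f] H_r_distr smult_mult_right)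

lemma D_one:
  assumes "module k L"
    and "\<And>y. y \<in> carrier H \<Longrightarrow> (\<lambda>x. G x y) \<in> lin_maps k H L"
    and "\<And>x. x \<in> carrier H \<Longrightarrow> (\<lambda>y. G x y) \<in> lin_maps k H L"
  shows "D L \<one>\<^bsub>H\<^esub> G = G \<one>\<^bsub>H\<^esub> \<one>\<^bsub>H\<^esub>"
  unfolding comult_one by (rule pair.sweedler_pure) (use assms in auto)

text \<open>The axiom equates elements of H \<otimes> H. The linear map induced by the bilinear G,
  applied to both sides, carries it into L.\<close>

lemma D_mult:
  assumes L: "module k L" and x: "x \<in> carrier H" and y: "y \<in> carrier H"
    and G: "\<And>y. y \<in> carrier H \<Longrightarrow> (\<lambda>x. G x y) \<in> lin_maps k H L"
      "\<And>x. x \<in> carrier H \<Longrightarrow> (\<lambda>y. G x y) \<in> lin_maps k H L"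
  shows "D L (x \<otimes>\<^bsub>H\<^esub> y) G = D L x (\<lambda>x0 x1. D L y (\<lambda>y0 y1. G (x0 \<otimes>\<^bsub>H\<^esub> y0) (x1 \<otimes>\<^bsub>H\<^esub> y1)))"
proof -
  let ?T = "tensor k H 1 H 1"
  define E where "E = (\<lambda>t. sweedler k L t G)"
  have T: "module k ?T" by (rule pair.tensor_module)
  have E: "E \<in> lin_maps k ?T L"
    unfolding E_def by (rule pair.lin_sweedler[OF L lin_ident G])
  have Ep: "E (pair.pt [u] [v]) = G u v" if "u \<in> carrier H" "v \<in> carrier H" for u v
    unfolding E_def by (rule pair.sweedler_pure[OF L that G])
  have pc: "pair.pt [u] [v] \<in> carrier ?T" if "u \<in> carrier H" "v \<in> carrier H" for u v
    using that by (intro pair.pure_closed) auto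
  have "D L (x \<otimes>\<^bsub>H\<^esub> y) G = E (\<Delta>\<^bsub>H\<^esub> (x \<otimes>\<^bsub>H\<^esub> y))" by (simp add: E_def)
  also have "\<dots> = D L x (\<lambda>x0 x1. D L y (\<lambda>y0 y1. G (x0 \<otimes>\<^bsub>H\<^esub> y0) (x1 \<otimes>\<^bsub>H\<^esub> y1)))"
    unfolding comult_mult[OF x y]
    using x y by (simp add: D_commute[OF E T L] D_closed[OF T] pc Ep del: One_nat_def cong: D_simp_cong)
  finally show ?thesis .
qed

text \<open>
  The action in continuation-passing form: the sum of all $K(h^{(0)} g_0, \dots, h^{(n)} g_n)$.
  Letting the empty list contribute the counit makes the recursion uniform; the iterated coproduct
  of the definitions has at least one factor and agrees with it only on nonempty lists.
\<close>

primrec act where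
  "act L [] h K = \<epsilon>\<^bsub>H\<^esub> h \<odot>\<^bsub>L\<^esub> K []"
| "act L (g # gs) h K = D L h (\<lambda>x y. act L gs y (\<lambda>r. K (x \<otimes>\<^bsub>H\<^esub> g # r)))"

lemma act_closed:
  assumes L: "module k L"
  shows "\<lbrakk>h \<in> carrier H; set gs \<subseteq> carrier H;
    \<And>r. \<lbrakk>length r = length gs; set r \<subseteq> carrier H\<rbrakk> \<Longrightarrow> K r \<in> carrier L\<rbrakk> \<Longrightarrow> act L gs h K \<in> carrier L"
proof (induction gs arbitrary: h K)
  case Nil
  then show ?case by (simp add: module.smult_closed[OF L])
next
  case (Cons g gs)
  show ?case unfolding act.simps
    by (intro D_closed[OF L] Cons) (use Cons.prems in auto)
qed

lemma act_cong:
  "\<lbrakk>h \<in> carrier H; set gs \<subseteq> carrier H;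
    \<And>r. \<lbrakk>length r = length gs; set r \<subseteq> carrier H\<rbrakk> \<Longrightarrow> K r = K' r\<rbrakk> \<Longrightarrow> act L gs h K = act L gs h K'"
proof (induction gs arbitrary: h K K')
  case (Cons g gs)
  show ?case unfolding act.simps
    by (rule D_cong[OF Cons.prems(1)], rule Cons.IH) (use Cons.prems in auto)
qed simp

lemma act_commute:
  assumes f: "f \<in> lin_maps k L L'" and L: "module k L" "module k L'"
  shows "\<lbrakk>h \<in> carrier H; set gs \<subseteq> carrier H;
    \<And>r. \<lbrakk>length r = length gs; set r \<subseteq> carrier H\<rbrakk> \<Longrightarrow> K r \<in> carrier L\<rbrakk>
    \<Longrightarrow> f (act L gs h K) = act L' gs h (\<lambda>r. f (K r))"
proof (induction gs arbitrary: h K)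
  case Nil
  then show ?case by (simp add: lin_smult[OF f])
next
  case (Cons g gs)
  then have "f (act L (g # gs) h K) = D L' h (\<lambda>x y. f (act L gs y (\<lambda>r. K (x \<otimes>\<^bsub>H\<^esub> g # r))))"
    by (simp add: D_commute[OF f L] act_closed[OF L(1)])
  also have "\<dots> = act L' (g # gs) h (\<lambda>r. f (K r))"
    using Cons.prems by (auto intro!: D_cong Cons.IH)
  finally show ?case .
qed

lemma lin_act_param:
  assumes L: "module k L" and Z: "module k Z"
  shows "\<lbrakk>h \<in> carrier H; set gs \<subseteq> carrier H;
    \<And>r. \<lbrakk>length r = length gs; set r \<subseteq> carrier H\<rbrakk> \<Longrightarrow> (\<lambda>z. K z r) \<in> lin_maps k Z L\<rbrakk>
    \<Longrightarrow> (\<lambda>z. act L gs h (K z)) \<in> lin_maps k Z L"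
proof (induction gs arbitrary: h K)
  case Nil
  then show ?case by (simp add: lin_smult_right[OF L])
next
  case (Cons g gs)
  then show ?case by (auto intro!: lin_D_param[OF L Z])
qed

text \<open>The acting element enters through its coproduct, so K has to be multilinear; contrast
  \<open>lin_act_param\<close>, where h is fixed and the continuation varies.\<close>

lemma lin_act_id:
  assumes L: "module k L"
  shows "\<lbrakk>set gs \<subseteq> carrier H; mlin k H (length gs) L K\<rbrakk> \<Longrightarrow> (\<lambda>h. act L gs h K) \<in> lin_maps k H L"
proof (induction gs arbitrary: K)
  case Nil
  then show ?case by (auto intro!: lin_smult_left[OF L] lin_counit lin_ident simp: mlin_closed)
next
  case (Cons g gs)
  have "(\<lambda>y. act L gs y (\<lambda>r. K (x \<otimes>\<^bsub>H\<^esub> g # r))) \<in> lin_maps k H L" if "x \<in> carrier H" for x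
    using Cons.prems that by (intro Cons.IH mlin_Cons) auto
  moreover have "(\<lambda>x. act L gs y (\<lambda>r. K (x \<otimes>\<^bsub>H\<^esub> g # r))) \<in> lin_maps k H L" if "y \<in> carrier H" for y
    using Cons.prems that
    by (intro lin_act_param[OF L module_axioms] lin_mlin[OF Cons.prems(2)] slot_intros lin_mult_left lin_ident) auto
  ultimately show ?case
    unfolding act.simps by (intro lin_D[OF L lin_ident])
qed

lemmas lin_act = lin_comp[OF lin_act_id]

text \<open>The action is a nest of finite sums, each of which may be exchanged with the sum over t.
  The empty list contributes multiplication by a scalar, a linear map that moves inside.\<close>

lemma act_swap:
  assumes L: "module k L" and MN: "module_pair k M N" and t: "t \<in> carrier (tensor k M p N q)"
  shows "\<lbrakk>h \<in> carrier H; set gs \<subseteq> carrier H;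
    \<And>r us vs. \<lbrakk>length r = length gs; set r \<subseteq> carrier H; us \<in> vecs M p; vs \<in> vecs N q\<rbrakk> \<Longrightarrow> K r us vs \<in> carrier L\<rbrakk>
    \<Longrightarrow> act L gs h (\<lambda>r. lin_ext k L t (K r)) = lin_ext k L t (\<lambda>us vs. act L gs h (\<lambda>r. K r us vs))"
proof (induction gs arbitrary: h K)
  case Nil
  then have "(\<lambda>u. \<epsilon>\<^bsub>H\<^esub> h \<odot>\<^bsub>L\<^esub> u) \<in> lin_maps k L L"
    by (intro lin_smult_right[OF L lin_ident]) simp
  from module_pair.lin_ext_commute[OF MN L L t this, of "K []"] show ?case using Nil by simp
next
  case (Cons g gs)
  have "act L (g # gs) h (\<lambda>r. lin_ext k L t (K r))
      = D L h (\<lambda>x y. lin_ext k L t (\<lambda>us vs. act L gs y (\<lambda>r. K (x \<otimes>\<^bsub>H\<^esub> g # r) us vs)))"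
    unfolding act.simps using Cons.prems by (intro D_cong Cons.IH) auto
  also have "\<dots> = lin_ext k L t (\<lambda>us vs. act L (g # gs) h (\<lambda>r. K r us vs))"
    unfolding act.simps sweedler_def using Cons.prems
    by (intro lin_ext_swap[OF L pair.module_pair_axioms MN comult_closed t] act_closed[OF L])
      (auto simp: length_Suc_conv)
  finally show ?case .
qed

lemma act_sweedler_swap:
  assumes L: "module k L" and MN: "module_pair k M N" and t: "t \<in> carrier (tensor k M 1 N 1)"
    and "h \<in> carrier H" "set gs \<subseteq> carrier H"
    and "\<And>r u v. \<lbrakk>length r = length gs; set r \<subseteq> carrier H; u \<in> carrier M; v \<in> carrier N\<rbrakk> \<Longrightarrow> K r u v \<in> carrier L"
  shows "act L gs h (\<lambda>r. sweedler k L t (K r)) = sweedler k L t (\<lambda>u v. act L gs h (\<lambda>r. K r u v))"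
  unfolding sweedler_def
  by (rule act_swap[OF L MN t assms(4,5)]) (auto simp: length_Suc_conv intro!: assms(6))

lemmas act_D_swap = act_sweedler_swap[OF _ pair.module_pair_axioms comult_closed]

lemma mlin_act:
  assumes L: "module k L" and h: "h \<in> carrier H" and K: "mlin k H n L K"
  shows "mlin k H n L (\<lambda>gs. act L gs h K)"
proof (rule mlinI)
  fix xs ys assume "set xs \<subseteq> carrier H" "set ys \<subseteq> carrier H" "Suc (length xs + length ys) = n"
  then show "(\<lambda>x. act L (xs @ x # ys) h K) \<in> lin_maps k H L"
    using h K
  proof (induction xs arbitrary: n h K)
    case Nil
    then have "(\<lambda>z. act L ys v (\<lambda>r. K (u \<otimes>\<^bsub>H\<^esub> z # r))) \<in> lin_maps k H L"
      if "u \<in> carrier H" "v \<in> carrier H" for u v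
      using that
      by (intro lin_act_param[OF L module_axioms] lin_mlin[OF Nil.prems(5)] slot_intros lin_mult_right lin_ident) auto
    then show ?case using Nil by (auto intro!: lin_D_param[OF L module_axioms])
  next
    case (Cons a xs)
    then have "(\<lambda>x. act L (xs @ x # ys) v (\<lambda>r. K (u \<otimes>\<^bsub>H\<^esub> a # r))) \<in> lin_maps k H L"
      if "u \<in> carrier H" "v \<in> carrier H" for u v
      using that by (intro Cons.IH[of "n - 1"] mlin_Cons) auto
    then show ?case using Cons.prems by (auto intro!: lin_D_param[OF L module_axioms])
  qed
qed (auto intro!: act_closed[OF L h] mlin_closed[OF K])

text \<open>In continuation form the outer action comes first: h acts on gs and h' on the result,
  whence the product h' h. The step is multiplicativity of the coproduct once the two Sweedler sums
  are exchanged; the empty list uses multiplicativity of the counit.\<close>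

lemma act_mult:
  assumes L: "module k L"
  shows "\<lbrakk>h \<in> carrier H; h' \<in> carrier H; set gs \<subseteq> carrier H; mlin k H (length gs) L K\<rbrakk>
    \<Longrightarrow> act L gs h (\<lambda>r. act L r h' K) = act L gs (h' \<otimes>\<^bsub>H\<^esub> h) K"
proof (induction gs arbitrary: h h' K)
  case Nil
  then show ?case
    by (simp add: counit_mult module.smult_assoc1[OF L, symmetric] R.m_comm mlin_closed)
next
  case (Cons g gs)
  note K = Cons.prems(4)
  have Kc: "K r \<in> carrier L" if "length r = Suc (length gs)" "set r \<subseteq> carrier H" for r
    using that by (intro mlin_closed[OF K]) auto
  have K': "mlin k H (length gs) L (\<lambda>r. K (u # r))" if "u \<in> carrier H" for u
    using K that by (intro mlin_Cons) auto
  have "act L (g # gs) h (\<lambda>r. act L r h' K)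
    = D L h (\<lambda>x y. D L h' (\<lambda>u v. act L gs y (\<lambda>r. act L r v (\<lambda>s. K (u \<otimes>\<^bsub>H\<^esub> (x \<otimes>\<^bsub>H\<^esub> g) # s)))))"
    using Cons.prems by (simp add: act_D_swap[OF L] act_closed[OF L] Kc cong: D_simp_cong)
  also have "\<dots> = D L h (\<lambda>x y. D L h' (\<lambda>u v. act L gs (v \<otimes>\<^bsub>H\<^esub> y) (\<lambda>s. K ((u \<otimes>\<^bsub>H\<^esub> x) \<otimes>\<^bsub>H\<^esub> g # s))))"
    using Cons.prems by (simp add: Cons.IH K' H_m_assoc cong: D_simp_cong)
  also have "\<dots> = D L h' (\<lambda>u v. D L h (\<lambda>x y. act L gs (v \<otimes>\<^bsub>H\<^esub> y) (\<lambda>s. K ((u \<otimes>\<^bsub>H\<^esub> x) \<otimes>\<^bsub>H\<^esub> g # s))))"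
    using Cons.prems by (intro D_swap[OF L]) (simp_all add: act_closed[OF L] Kc)
  also have "\<dots> = act L (g # gs) (h' \<otimes>\<^bsub>H\<^esub> h) K"
    unfolding act.simps using Cons.prems
    by (intro D_mult[OF L, symmetric] lin_act[OF L] lin_act_param[OF L module_axioms] lin_mlin[OF K]
        slot_intros lin_mult_left lin_ident K') auto
  finally show ?case .
qed

text \<open>The unit is grouplike, so every leg of its coproduct is again the unit and each entry is
  multiplied by it.\<close>

lemma act_one:
  assumes L: "module k L"
  shows "\<lbrakk>set gs \<subseteq> carrier H; mlin k H (length gs) L K\<rbrakk> \<Longrightarrow> act L gs \<one>\<^bsub>H\<^esub> K = K gs"
proof (induction gs arbitrary: K)
  case Nil
  then show ?case by (simp add: counit_one module.smult_one[OF L] mlin_closed)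
next
  case (Cons g gs)
  note K = Cons.prems(2)
  have K': "mlin k H (length gs) L (\<lambda>r. K (u # r))" if "u \<in> carrier H" for u
    using K that by (intro mlin_Cons) auto
  have "act L (g # gs) \<one>\<^bsub>H\<^esub> K = act L gs \<one>\<^bsub>H\<^esub> (\<lambda>r. K (\<one>\<^bsub>H\<^esub> \<otimes>\<^bsub>H\<^esub> g # r))"
    unfolding act.simps using Cons.prems
    by (intro D_one[OF L] lin_act[OF L] lin_act_param[OF L module_axioms] lin_mlin[OF K]
        slot_intros lin_mult_left lin_ident K') auto
  also have "\<dots> = K (g # gs)" using Cons.prems by (simp add: Cons.IH K')
  finally show ?case .
qed

text \<open>One coproduct splits the acting element between the two blocks. Coassociativity carries
  the splitting past the first entry, and for an empty first block the counit absorbs the extra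
  leg.\<close>

lemma act_append:
  assumes L: "module k L" and gs': "set gs' \<subseteq> carrier H"
  shows "\<lbrakk>h \<in> carrier H; set gs \<subseteq> carrier H; mlin k H (length gs + length gs') L K\<rbrakk>
    \<Longrightarrow> act L (gs @ gs') h K = D L h (\<lambda>x y. act L gs x (\<lambda>r. act L gs' y (\<lambda>s. K (r @ s))))"
proof (induction gs arbitrary: h K)
  case Nil
  then show ?case using gs' by (simp add: D_counit_left[OF L] lin_act[OF L _ _ lin_ident])
next
  case (Cons g gs)
  note K = Cons.prems(3)
  have K': "mlin k H (length gs + length gs') L (\<lambda>r. K (u # r))" if "u \<in> carrier H" for u
    using K that by (intro mlin_Cons) auto
  have Kr: "mlin k H (length gs') L (\<lambda>s. K (r @ s))" if "length r = Suc (length gs)" "set r \<subseteq> carrier H" for r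
    using K that by (intro mlin_append2[of _ _ "Suc (length gs)"]) auto
  have "act L ((g # gs) @ gs') h K
    = D L h (\<lambda>x y. D L y (\<lambda>u v. act L gs u (\<lambda>r. act L gs' v (\<lambda>s. K (x \<otimes>\<^bsub>H\<^esub> g # r @ s)))))"
    using Cons.prems by (simp add: Cons.IH K' cong: D_simp_cong)
  also have "\<dots> = D L h (\<lambda>x y. D L x (\<lambda>u v. act L gs v (\<lambda>r. act L gs' y (\<lambda>s. K (u \<otimes>\<^bsub>H\<^esub> g # r @ s)))))"
  proof (rule D_coassoc[OF L, symmetric])
    fix x z assume xz: "x \<in> carrier H" "z \<in> carrier H"
    show "(\<lambda>y. act L gs y (\<lambda>r. act L gs' z (\<lambda>s. K (x \<otimes>\<^bsub>H\<^esub> g # r @ s)))) \<in> lin_maps k H L"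
    proof (intro lin_act[OF L _ _ lin_ident])
      show "mlin k H (length gs) L (\<lambda>r. act L gs' z (\<lambda>s. K (x \<otimes>\<^bsub>H\<^esub> g # r @ s)))"
        using gs' xz Cons.prems
        by (intro mlinI act_closed[OF L] lin_act_param[OF L module_axioms] lin_mlin[OF K] slot_intros lin_ident
            mlin_closed[OF K]) auto
    qed (use Cons.prems in auto)
  next
    fix x y assume "x \<in> carrier H" "y \<in> carrier H"
    then show "(\<lambda>z. act L gs y (\<lambda>r. act L gs' z (\<lambda>s. K (x \<otimes>\<^bsub>H\<^esub> g # r @ s)))) \<in> lin_maps k H L"
      using Cons.prems gs' Kr[of "x \<otimes>\<^bsub>H\<^esub> g # _"]
      by (intro lin_act[OF L] lin_act_param[OF L module_axioms] lin_ident) auto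
  next
    fix y z assume "y \<in> carrier H" "z \<in> carrier H"
    then show "(\<lambda>x. act L gs y (\<lambda>r. act L gs' z (\<lambda>s. K (x \<otimes>\<^bsub>H\<^esub> g # r @ s)))) \<in> lin_maps k H L"
      using Cons.prems gs'
      by (intro lin_act_param[OF L module_axioms] lin_mlin[OF K] slot_intros lin_mult_left lin_ident) auto
  qed (use Cons.prems in auto)
  finally show ?case by simp
qed

text \<open>Comultiplying an entry is equivariant for the diagonal action: the coproduct of leg
  times entry is the product of the coproducts, and coassociativity provides the additional leg that
  the longer list consumes.\<close>

lemma act_dup:
  assumes L: "module k L" and r: "set r \<subseteq> carrier H" and g: "g \<in> carrier H"
  shows "\<lbrakk>h \<in> carrier H; set l \<subseteq> carrier H; mlin k H (length l + length r + 2) L K\<rbrakk>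
    \<Longrightarrow> act L (l @ g # r) h (\<lambda>s. D L (s ! length l) (\<lambda>x y. K (take (length l) s @ x # y # drop (Suc (length l)) s)))
      = D L g (\<lambda>x y. act L (l @ x # y # r) h K)"
proof (induction l arbitrary: h K)
  case Nil
  note K = Nil.prems(3)
  have Kc: "K s \<in> carrier L" if "length s = Suc (Suc (length r))" "set s \<subseteq> carrier H" for s
    using that by (intro mlin_closed[OF K]) auto
  have K1: "mlin k H (length r) L (\<lambda>s. K (x # y # s))" if "x \<in> carrier H" "y \<in> carrier H" for x y
    using K that by (intro mlin_Cons) auto
  have lin1: "(\<lambda>z. act L r v (\<lambda>s. K (f z # y # s))) \<in> lin_maps k H L"
    "(\<lambda>z. act L r v (\<lambda>s. K (y # f z # s))) \<in> lin_maps k H L"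
    if "f \<in> lin_maps k H H" "v \<in> carrier H" "y \<in> carrier H" for f v y
    using that r by (intro lin_act_param[OF L module_axioms] lin_mlin[OF K] slot_intros; auto)+
  have "act L (g # r) h (\<lambda>s. D L (s ! 0) (\<lambda>x y. K (take 0 s @ x # y # drop (Suc 0) s)))
    = D L h (\<lambda>u v. D L (u \<otimes>\<^bsub>H\<^esub> g) (\<lambda>x y. act L r v (\<lambda>s. K (x # y # s))))"
    using Nil.prems g r by (simp add: act_D_swap[OF L] Kc cong: D_simp_cong)
  also have "\<dots> = D L h (\<lambda>u v. D L u (\<lambda>u1 u2. D L g (\<lambda>x y. act L r v (\<lambda>s. K (u1 \<otimes>\<^bsub>H\<^esub> x # u2 \<otimes>\<^bsub>H\<^esub> y # s)))))"
    using Nil.prems g r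
    by (intro D_cong) (simp_all add: D_mult[OF L] lin1 lin_ident)
  also have "\<dots> = D L h (\<lambda>u v. D L v (\<lambda>v1 v2. D L g (\<lambda>x y. act L r v2 (\<lambda>s. K (u \<otimes>\<^bsub>H\<^esub> x # v1 \<otimes>\<^bsub>H\<^esub> y # s)))))"
    using Nil.prems g r
    by (intro D_coassoc[OF L]) (auto intro!: lin_D_param[OF L module_axioms] lin1 lin_mult_left lin_ident lin_act[OF L] K1)
  also have "\<dots> = D L h (\<lambda>u v. D L g (\<lambda>x y. D L v (\<lambda>v1 v2. act L r v2 (\<lambda>s. K (u \<otimes>\<^bsub>H\<^esub> x # v1 \<otimes>\<^bsub>H\<^esub> y # s)))))"
    using Nil.prems g r by (intro D_cong D_swap[OF L]) (auto intro!: act_closed[OF L] Kc)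
  also have "\<dots> = D L g (\<lambda>x y. act L (x # y # r) h K)"
    unfolding act.simps using Nil.prems g r
    by (intro D_swap[OF L]) (auto intro!: act_closed[OF L] D_closed[OF L] Kc)
  finally show ?case by simp
next
  case (Cons a l)
  note K = Cons.prems(3)
  have K': "mlin k H (length l + length r + 2) L (\<lambda>r. K (u # r))" if "u \<in> carrier H" for u
    using K that by (intro mlin_Cons) auto
  have Kc: "K s \<in> carrier L" if "length s = Suc (length l + length r + 2)" "set s \<subseteq> carrier H" for s
    using that by (intro mlin_closed[OF K]) auto
  have "act L ((a # l) @ g # r) h (\<lambda>s. D L (s ! length (a # l)) (\<lambda>x y. K (take (length (a # l)) s @ x # y # drop (Suc (length (a # l))) s)))
    = D L h (\<lambda>u v. D L g (\<lambda>x y. act L (l @ x # y # r) v (\<lambda>s. K (u \<otimes>\<^bsub>H\<^esub> a # s))))"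
    unfolding act.simps append_Cons using Cons.prems by (intro D_cong) (simp_all add: Cons.IH[OF _ _ K'])
  also have "\<dots> = D L g (\<lambda>x y. act L ((a # l) @ x # y # r) h K)"
    unfolding act.simps append_Cons using Cons.prems g r
    by (intro D_swap[OF L]) (auto intro!: act_closed[OF L] Kc)
  finally show ?case .
qed

text \<open>Deleting an entry by the counit is equivariant for the diagonal action: the counit of
  leg times entry splits, and its factor on the leg removes that leg by the counit law.\<close>

lemma act_del:
  assumes L: "module k L" and r: "set r \<subseteq> carrier H" and g: "g \<in> carrier H"
  shows "\<lbrakk>h \<in> carrier H; set l \<subseteq> carrier H; mlin k H (length l + length r) L K\<rbrakk>
    \<Longrightarrow> act L (l @ g # r) h (\<lambda>s. \<epsilon>\<^bsub>H\<^esub> (s ! length l) \<odot>\<^bsub>L\<^esub> K (take (length l) s @ drop (Suc (length l)) s))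
      = \<epsilon>\<^bsub>H\<^esub> g \<odot>\<^bsub>L\<^esub> act L (l @ r) h K"
proof (induction l arbitrary: h K)
  case Nil
  interpret L: module k L by (rule L)
  have Kc: "K s \<in> carrier L" if "length s = length r" "set s \<subseteq> carrier H" for s
    using that Nil by (intro mlin_closed[of k H "length r" L K]) auto
  have sm: "c \<odot>\<^bsub>L\<^esub> act L r v K = act L r v (\<lambda>s. c \<odot>\<^bsub>L\<^esub> K s)" if "c \<in> carrier k" "v \<in> carrier H" for c v
    using that r Kc by (intro act_commute[OF lin_smult_right[OF L lin_ident] L L]) auto
  have "act L (g # r) h (\<lambda>s. \<epsilon>\<^bsub>H\<^esub> (s ! 0) \<odot>\<^bsub>L\<^esub> K (take 0 s @ drop (Suc 0) s))
    = D L h (\<lambda>u v. \<epsilon>\<^bsub>H\<^esub> u \<odot>\<^bsub>L\<^esub> (\<epsilon>\<^bsub>H\<^esub> g \<odot>\<^bsub>L\<^esub> act L r v K))"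
    unfolding act.simps using Nil.prems g r
    by (intro D_cong) (simp_all add: sm[symmetric] counit_mult L.smult_assoc1 act_closed[OF L] Kc)
  also have "\<dots> = \<epsilon>\<^bsub>H\<^esub> g \<odot>\<^bsub>L\<^esub> act L r h K"
    using Nil.prems g r by (intro D_counit_left[OF L] lin_smult_right[OF L] lin_act[OF L] lin_ident) auto
  finally show ?case by simp
next
  case (Cons a l)
  have K': "mlin k H (length l + length r) L (\<lambda>r. K (u # r))" if "u \<in> carrier H" for u
    using Cons.prems(3) that by (intro mlin_Cons) auto
  have Kc: "K s \<in> carrier L" if "length s = Suc (length l + length r)" "set s \<subseteq> carrier H" for s
    using that by (intro mlin_closed[OF Cons.prems(3)]) auto
  have "act L ((a # l) @ g # r) h (\<lambda>s. \<epsilon>\<^bsub>H\<^esub> (s ! length (a # l)) \<odot>\<^bsub>L\<^esub> K (take (length (a # l)) s @ drop (Suc (length (a # l))) s))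
    = D L h (\<lambda>u v. \<epsilon>\<^bsub>H\<^esub> g \<odot>\<^bsub>L\<^esub> act L (l @ r) v (\<lambda>s. K (u \<otimes>\<^bsub>H\<^esub> a # s)))"
    unfolding act.simps append_Cons using Cons.prems by (intro D_cong) (simp_all add: Cons.IH[OF _ _ K'])
  also have "\<dots> = \<epsilon>\<^bsub>H\<^esub> g \<odot>\<^bsub>L\<^esub> act L ((a # l) @ r) h K"
    unfolding act.simps append_Cons using Cons.prems g r
    by (intro D_commute[OF lin_smult_right[OF L lin_ident] L L, symmetric]) (auto intro!: act_closed[OF L] Kc)
  finally show ?case .
qed

section \<open>Comparison with the iterated coproduct\<close>

lemma iter_comult_closed: "h \<in> carrier H \<Longrightarrow> iter_comult k H n h \<in> carrier (tensor k H (n + 1) H 0)"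
proof (induction n arbitrary: h)
  case 0
  then show ?case by (auto intro!: pair.pure_closed)
next
  case (Suc n)
  let ?T = "tensor k H (n + 2) H 0"
  have T: "module k ?T" by (rule pair.tensor_module)
  have "D ?T h (\<lambda>x y. lin_ext k ?T (iter_comult k H n y) (\<lambda>hs _. pair.pt (x # hs) [])) \<in> carrier ?T"
    by (intro D_closed[OF T] pair.lin_ext_closed[OF T Suc.IH] pair.pure_closed Suc.prems) auto
  then show ?case by simp
qed

lemma mlin_map2_mult:
  assumes K: "mlin k H n L K" and gs: "length gs = n" "set gs \<subseteq> carrier H"
  shows "mlin k H n L (\<lambda>hs. K (map2 (mult H) hs gs))"
proof -
  have map2: "set (map2 (mult H) us vs) \<subseteq> carrier H" if "set us \<subseteq> carrier H" "set vs \<subseteq> carrier H" for us vs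
    using that by (auto dest: set_zip_leftD set_zip_rightD)
  show ?thesis
  proof (rule mlinI)
    fix xs ys assume *: "set xs \<subseteq> carrier H" "set ys \<subseteq> carrier H" "Suc (length xs + length ys) = n"
    obtain as b bs where gs': "gs = as @ b # bs" "length as = length xs" "length bs = length ys"
    proof
      show "gs = take (length xs) gs @ gs ! length xs # drop (Suc (length xs)) gs"
        using * gs by (intro id_take_nth_drop) simp
    qed (use * gs in auto)
    have "(\<lambda>x. K (map2 (mult H) xs as @ (x \<otimes>\<^bsub>H\<^esub> b) # map2 (mult H) ys bs)) \<in> lin_maps k H L"
      using * gs gs' map2
      by (intro lin_mlin[OF K] slot_intros lin_mult_left lin_ident) auto
    then show "(\<lambda>x. K (map2 (mult H) (xs @ x # ys) gs)) \<in> lin_maps k H L"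
      using gs' by simp
  next
    fix hs assume "length hs = n" "set hs \<subseteq> carrier H"
    then show "K (map2 (mult H) hs gs) \<in> carrier L"
      using gs map2 by (intro mlin_closed[OF K]) auto
  qed
qed

text \<open>The two recursions differ at the end: on a one-entry list \<open>act\<close> still takes
  a coproduct and applies the counit to its second leg, while \<open>iter_comult\<close> stops at h
  itself. The counit law closes this gap.\<close>

lemma iter_comult_act:
  assumes L: "module k L"
  shows "\<lbrakk>h \<in> carrier H; gs \<noteq> []; set gs \<subseteq> carrier H; mlin k H (length gs) L K\<rbrakk>
    \<Longrightarrow> lin_ext k L (iter_comult k H (length gs - 1) h) (\<lambda>hs _. K (map2 (mult H) hs gs)) = act L gs h K"
proof (induction gs arbitrary: h K)
  case (Cons g gs)
  have G: "mlin2 k H (length (g # gs)) H 0 L (\<lambda>hs _. K (map2 (mult H) hs (g # gs)))"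
    using mlin_map2_mult[OF Cons.prems(4)] Cons.prems by (auto simp: mlin2_def mlin_def)
  show ?case
  proof (cases gs)
    case Nil
    have "(\<lambda>u. K [u \<otimes>\<^bsub>H\<^esub> g]) \<in> lin_maps k H L"
      using Cons.prems Nil by (intro lin_mlin[OF Cons.prems(4)] slot_intros lin_mult_left lin_ident) auto
    then have "act L (g # gs) h K = K [h \<otimes>\<^bsub>H\<^esub> g]"
      using Cons.prems Nil by (simp add: D_counit_right[OF L])
    then show ?thesis
      using pair.lin_ext_pure[OF L G, of "[h]" "[]"] Nil Cons.prems by simp
  next
    case (Cons g' gs')
    let ?T = "tensor k H (Suc (length gs)) H 0"
    define E where "E = (\<lambda>t. lin_ext k L t (\<lambda>hs (_ :: 'h list). K (map2 (mult H) hs (g # gs))))"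
    have T: "module k ?T" by (rule pair.tensor_module)
    have E: "E \<in> lin_maps k ?T L" unfolding E_def using pair.lin_ext_lin[OF L G] by simp
    have pc: "pair.pt (x # hs) [] \<in> carrier ?T" if "x \<in> carrier H" "length hs = length gs" "set hs \<subseteq> carrier H" for x hs
      using that by (intro pair.pure_closed) auto
    have Ep: "E (pair.pt (x # hs) []) = K (x \<otimes>\<^bsub>H\<^esub> g # map2 (mult H) hs gs)"
      if "x \<in> carrier H" "length hs = length gs" "set hs \<subseteq> carrier H" for x hs
      unfolding E_def using that pair.lin_ext_pure[OF L G, of "x # hs" "[]"] by simp
    have it: "iter_comult k H (length gs') y \<in> carrier (tensor k H (length gs) H 0)" if "y \<in> carrier H" for y
      using iter_comult_closed[OF that, of "length gs'"] Cons by simp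
    have IH: "lin_ext k L (iter_comult k H (length gs') y) (\<lambda>hs _. K (x \<otimes>\<^bsub>H\<^esub> g # map2 (mult H) hs gs))
        = act L gs y (\<lambda>r. K (x \<otimes>\<^bsub>H\<^esub> g # r))" if "x \<in> carrier H" "y \<in> carrier H" for x y
      using Cons.IH[of y "\<lambda>r. K (x \<otimes>\<^bsub>H\<^esub> g # r)"] Cons Cons.prems that by (auto intro!: mlin_Cons)
    have step: "E (lin_ext k ?T (iter_comult k H (length gs') y) (\<lambda>hs _. pair.pt (x # hs) []))
        = act L gs y (\<lambda>r. K (x \<otimes>\<^bsub>H\<^esub> g # r))" if "x \<in> carrier H" "y \<in> carrier H" for x y
      unfolding IH[OF that, symmetric]
      using that pc by (subst pair.lin_ext_commute[OF T L it E]) (auto intro!: pair.lin_ext_cong[OF it] Ep)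
    have cl: "lin_ext k ?T (iter_comult k H (length gs') y) (\<lambda>hs _. pair.pt (x # hs) []) \<in> carrier ?T"
      if "x \<in> carrier H" "y \<in> carrier H" for x y
      using that pc by (intro pair.lin_ext_closed[OF T it]) auto
    have "lin_ext k L (iter_comult k H (length (g # gs) - 1) h) (\<lambda>hs _. K (map2 (mult H) hs (g # gs)))
      = E (D ?T h (\<lambda>x y. lin_ext k ?T (iter_comult k H (length gs') y) (\<lambda>hs _. pair.pt (x # hs) [])))"
      by (simp add: E_def Cons)
    also have "\<dots> = D L h (\<lambda>x y. act L gs y (\<lambda>r. K (x \<otimes>\<^bsub>H\<^esub> g # r)))"
      using Cons.prems by (simp add: D_commute[OF E T L] cl step cong: D_simp_cong)
    finally show ?thesis by simp
  qed
qed simp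

end

section \<open>The inverse antipode\<close>

context hopf_algebra
begin

abbreviation S where "S \<equiv> antipode H"
abbreviation Si where "Si \<equiv> antipode_inv H"

lemma S_closed [simp]: "x \<in> carrier H \<Longrightarrow> S x \<in> carrier H"
  by (rule lin_closed[OF antipode_linear])

lemma lin_S: "f \<in> lin_maps k Z H \<Longrightarrow> (\<lambda>z. S (f z)) \<in> lin_maps k Z H"
  by (rule lin_comp[OF antipode_linear])

lemma S_one: "S \<one>\<^bsub>H\<^esub> = \<one>\<^bsub>H\<^esub>"
proof -
  have "D H \<one>\<^bsub>H\<^esub> (\<lambda>x y. S x \<otimes>\<^bsub>H\<^esub> y) = S \<one>\<^bsub>H\<^esub> \<otimes>\<^bsub>H\<^esub> \<one>\<^bsub>H\<^esub>"
    by (intro D_one[OF module_axioms] lin_mult_left lin_mult_right lin_S lin_ident) auto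
  then show ?thesis by (simp add: antipode_left counit_one)
qed

text \<open>Both sides are evaluations of the sum of all $S(a_1 b_1) a_2 b_2 S(b_3) S(a_3)$.\<close>

lemma S_mult:
  assumes a: "a \<in> carrier H" and b: "b \<in> carrier H"
  shows "S (a \<otimes>\<^bsub>H\<^esub> b) = S b \<otimes>\<^bsub>H\<^esub> S a"
proof -
  note L = module_axioms
  note lins = lin_mult_left lin_mult_right lin_S lin_ident lin_smult_right[OF L] lin_D_param[OF L L]
  let ?G = "\<lambda>a1 b1 a3 b3 a4 b4. S (a1 \<otimes>\<^bsub>H\<^esub> b1) \<otimes>\<^bsub>H\<^esub> ((a3 \<otimes>\<^bsub>H\<^esub> b3) \<otimes>\<^bsub>H\<^esub> (S b4 \<otimes>\<^bsub>H\<^esub> S a4))"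
  let ?X = "D H a (\<lambda>a1 a2. D H b (\<lambda>b1 b2. D H a2 (\<lambda>a3 a4. D H b2 (\<lambda>b3 b4. ?G a1 b1 a3 b3 a4 b4))))"
  have inner1: "D H b2 (\<lambda>b3 b4. c \<otimes>\<^bsub>H\<^esub> ((a3 \<otimes>\<^bsub>H\<^esub> b3) \<otimes>\<^bsub>H\<^esub> (S b4 \<otimes>\<^bsub>H\<^esub> S a4)))
      = \<epsilon>\<^bsub>H\<^esub> b2 \<odot>\<^bsub>H\<^esub> (c \<otimes>\<^bsub>H\<^esub> (a3 \<otimes>\<^bsub>H\<^esub> S a4))"
    if "c \<in> carrier H" "b2 \<in> carrier H" "a3 \<in> carrier H" "a4 \<in> carrier H" for c b2 a3 a4
  proof -
    have "D H b2 (\<lambda>b3 b4. c \<otimes>\<^bsub>H\<^esub> ((a3 \<otimes>\<^bsub>H\<^esub> b3) \<otimes>\<^bsub>H\<^esub> (S b4 \<otimes>\<^bsub>H\<^esub> S a4)))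
      = D H b2 (\<lambda>b3 b4. c \<otimes>\<^bsub>H\<^esub> (a3 \<otimes>\<^bsub>H\<^esub> ((b3 \<otimes>\<^bsub>H\<^esub> S b4) \<otimes>\<^bsub>H\<^esub> S a4)))"
      using that by (intro D_cong) (simp_all add: H_m_assoc)
    also have "\<dots> = c \<otimes>\<^bsub>H\<^esub> (a3 \<otimes>\<^bsub>H\<^esub> (D H b2 (\<lambda>b3 b4. b3 \<otimes>\<^bsub>H\<^esub> S b4) \<otimes>\<^bsub>H\<^esub> S a4))"
      using that by (intro D_commute[where h = "\<lambda>u. c \<otimes>\<^bsub>H\<^esub> (a3 \<otimes>\<^bsub>H\<^esub> (u \<otimes>\<^bsub>H\<^esub> S a4))", OF _ L L, symmetric] lins) auto
    also have "\<dots> = \<epsilon>\<^bsub>H\<^esub> b2 \<odot>\<^bsub>H\<^esub> (c \<otimes>\<^bsub>H\<^esub> (a3 \<otimes>\<^bsub>H\<^esub> S a4))"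
      using that by (simp add: antipode_right smult_mult_left smult_mult_right)
    finally show ?thesis .
  qed
  have inner2: "D H a2 (\<lambda>a3 a4. \<epsilon>\<^bsub>H\<^esub> b2 \<odot>\<^bsub>H\<^esub> (c \<otimes>\<^bsub>H\<^esub> (a3 \<otimes>\<^bsub>H\<^esub> S a4))) = \<epsilon>\<^bsub>H\<^esub> b2 \<odot>\<^bsub>H\<^esub> (\<epsilon>\<^bsub>H\<^esub> a2 \<odot>\<^bsub>H\<^esub> c)"
    if "c \<in> carrier H" "b2 \<in> carrier H" "a2 \<in> carrier H" for c b2 a2
  proof -
    have "D H a2 (\<lambda>a3 a4. \<epsilon>\<^bsub>H\<^esub> b2 \<odot>\<^bsub>H\<^esub> (c \<otimes>\<^bsub>H\<^esub> (a3 \<otimes>\<^bsub>H\<^esub> S a4)))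
      = \<epsilon>\<^bsub>H\<^esub> b2 \<odot>\<^bsub>H\<^esub> (c \<otimes>\<^bsub>H\<^esub> D H a2 (\<lambda>a3 a4. a3 \<otimes>\<^bsub>H\<^esub> S a4))"
      using that by (intro D_commute[where h = "\<lambda>u. \<epsilon>\<^bsub>H\<^esub> b2 \<odot>\<^bsub>H\<^esub> (c \<otimes>\<^bsub>H\<^esub> u)", OF _ L L, symmetric] lins) auto
    also have "\<dots> = \<epsilon>\<^bsub>H\<^esub> b2 \<odot>\<^bsub>H\<^esub> (\<epsilon>\<^bsub>H\<^esub> a2 \<odot>\<^bsub>H\<^esub> c)"
      using that by (simp add: antipode_right smult_mult_right)
    finally show ?thesis .
  qed
  have "?X = D H a (\<lambda>a1 a2. D H b (\<lambda>b1 b2. \<epsilon>\<^bsub>H\<^esub> b2 \<odot>\<^bsub>H\<^esub> (\<epsilon>\<^bsub>H\<^esub> a2 \<odot>\<^bsub>H\<^esub> S (a1 \<otimes>\<^bsub>H\<^esub> b1))))"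
    using a b by (simp add: inner1 inner2 cong: D_simp_cong)
  also have "\<dots> = D H a (\<lambda>a1 a2. \<epsilon>\<^bsub>H\<^esub> a2 \<odot>\<^bsub>H\<^esub> S (a1 \<otimes>\<^bsub>H\<^esub> b))"
    using a b by (intro D_cong D_counit_right[OF L] lins) auto
  also have "\<dots> = S (a \<otimes>\<^bsub>H\<^esub> b)"
    using a b by (intro D_counit_right[OF L] lins) auto
  finally have 1: "?X = S (a \<otimes>\<^bsub>H\<^esub> b)" .

  \<comment> \<open>Second evaluation: coassociativity in both a and b groups the first two legs of
    each, so that they form the coproduct of a product x y, to which the left antipode axiom
    applies.\<close>
  have "?X = D H a (\<lambda>a1 a2. D H a2 (\<lambda>a3 a4. D H b (\<lambda>b1 b2. D H b2 (\<lambda>b3 b4. ?G a1 b1 a3 b3 a4 b4))))"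
    using a b by (intro D_cong D_swap[OF L] D_closed[OF L]) auto
  also have "\<dots> = D H a (\<lambda>a1 a2. D H a2 (\<lambda>a3 a4. D H b (\<lambda>y b4. D H y (\<lambda>b1 b3. ?G a1 b1 a3 b3 a4 b4))))"
    using a b by (intro D_cong D_coassoc[OF L, symmetric] lins) auto
  also have "\<dots> = D H a (\<lambda>x a4. D H x (\<lambda>a1 a3. D H b (\<lambda>y b4. D H y (\<lambda>b1 b3. ?G a1 b1 a3 b3 a4 b4))))"
    using a b by (intro D_coassoc[OF L, symmetric] lins) auto
  also have "\<dots> = D H a (\<lambda>x a4. D H b (\<lambda>y b4. D H x (\<lambda>a1 a3. D H y (\<lambda>b1 b3. ?G a1 b1 a3 b3 a4 b4))))"
    using a b by (intro D_cong D_swap[OF L] D_closed[OF L]) auto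
  also have "\<dots> = D H a (\<lambda>x a4. D H b (\<lambda>y b4. D H (x \<otimes>\<^bsub>H\<^esub> y) (\<lambda>u v. S u \<otimes>\<^bsub>H\<^esub> (v \<otimes>\<^bsub>H\<^esub> (S b4 \<otimes>\<^bsub>H\<^esub> S a4)))))"
    using a b by (intro D_cong D_mult[OF L, symmetric] lins) auto
  also have "\<dots> = D H a (\<lambda>x a4. D H b (\<lambda>y b4. \<epsilon>\<^bsub>H\<^esub> y \<odot>\<^bsub>H\<^esub> (\<epsilon>\<^bsub>H\<^esub> x \<odot>\<^bsub>H\<^esub> (S b4 \<otimes>\<^bsub>H\<^esub> S a4))))"
  proof (intro D_cong a b)
    fix x a4 y b4 assume *: "x \<in> carrier H" "a4 \<in> carrier H" "y \<in> carrier H" "b4 \<in> carrier H"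
    let ?c = "S b4 \<otimes>\<^bsub>H\<^esub> S a4"
    have "D H (x \<otimes>\<^bsub>H\<^esub> y) (\<lambda>u v. S u \<otimes>\<^bsub>H\<^esub> (v \<otimes>\<^bsub>H\<^esub> ?c)) = D H (x \<otimes>\<^bsub>H\<^esub> y) (\<lambda>u v. (S u \<otimes>\<^bsub>H\<^esub> v) \<otimes>\<^bsub>H\<^esub> ?c)"
      using * by (intro D_cong) (simp_all add: H_m_assoc)
    also have "\<dots> = D H (x \<otimes>\<^bsub>H\<^esub> y) (\<lambda>u v. S u \<otimes>\<^bsub>H\<^esub> v) \<otimes>\<^bsub>H\<^esub> ?c"
      using * by (intro D_commute[where h = "\<lambda>u. u \<otimes>\<^bsub>H\<^esub> ?c", OF _ L L, symmetric] lins) auto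
    also have "\<dots> = \<epsilon>\<^bsub>H\<^esub> y \<odot>\<^bsub>H\<^esub> (\<epsilon>\<^bsub>H\<^esub> x \<odot>\<^bsub>H\<^esub> ?c)"
      using * by (simp add: antipode_left counit_mult smult_mult_left smult_assoc1[symmetric] R.m_comm)
    finally show "D H (x \<otimes>\<^bsub>H\<^esub> y) (\<lambda>u v. S u \<otimes>\<^bsub>H\<^esub> (v \<otimes>\<^bsub>H\<^esub> ?c)) = \<epsilon>\<^bsub>H\<^esub> y \<odot>\<^bsub>H\<^esub> (\<epsilon>\<^bsub>H\<^esub> x \<odot>\<^bsub>H\<^esub> ?c)" .
  qed
  also have "\<dots> = D H a (\<lambda>x a4. \<epsilon>\<^bsub>H\<^esub> x \<odot>\<^bsub>H\<^esub> (S b \<otimes>\<^bsub>H\<^esub> S a4))"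
    using a b by (intro D_cong D_counit_left[OF L] lins) auto
  also have "\<dots> = S b \<otimes>\<^bsub>H\<^esub> S a"
    using a b by (intro D_counit_left[OF L] lins) auto
  finally show ?thesis using 1 by simp
qed

context
  assumes S_bij: "bij_betw S (carrier H) (carrier H)"
begin

lemma Si_closed: "x \<in> carrier H \<Longrightarrow> Si x \<in> carrier H"
  using S_bij unfolding antipode_inv_def by (metis bij_betw_imp_surj_on inv_into_into)

lemma S_Si: "x \<in> carrier H \<Longrightarrow> S (Si x) = x"
  using S_bij unfolding antipode_inv_def by (metis bij_betw_inv_into_right)

lemma S_inj: "\<lbrakk>x \<in> carrier H; y \<in> carrier H; S x = S y\<rbrakk> \<Longrightarrow> x = y"
  using S_bij by (meson bij_betw_imp_inj_on inj_onD)

lemma Si_linear: "Si \<in> lin_maps k H H"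
proof (rule lin_mapsI)
  note [simp] = Si_closed S_Si lin_mapsD(2,3)[OF antipode_linear]
  show "Si (x \<oplus>\<^bsub>H\<^esub> y) = Si x \<oplus>\<^bsub>H\<^esub> Si y" if "x \<in> carrier H" "y \<in> carrier H" for x y
    using that by - (rule S_inj, simp_all)
  show "Si (r \<odot>\<^bsub>H\<^esub> x) = r \<odot>\<^bsub>H\<^esub> Si x" if "r \<in> carrier k" "x \<in> carrier H" for r x
    using that by - (rule S_inj, simp_all)
qed (rule Si_closed)

text \<open>S reverses products, so applying it to the left side gives the sum of all S(x) y and the
  antipode axiom evaluates it; injectivity of S removes it again. This is why the legs occur in the
  opposite order to the axiom for S.\<close>

lemma Si_left: "h \<in> carrier H \<Longrightarrow> D H h (\<lambda>x y. Si y \<otimes>\<^bsub>H\<^esub> x) = \<epsilon>\<^bsub>H\<^esub> h \<odot>\<^bsub>H\<^esub> \<one>\<^bsub>H\<^esub>"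
proof (rule S_inj)
  assume h: "h \<in> carrier H"
  have "S (D H h (\<lambda>x y. Si y \<otimes>\<^bsub>H\<^esub> x)) = D H h (\<lambda>x y. S (Si y \<otimes>\<^bsub>H\<^esub> x))"
    using h by (intro D_commute[OF antipode_linear module_axioms module_axioms]) (auto simp: Si_closed)
  also have "\<dots> = D H h (\<lambda>x y. S x \<otimes>\<^bsub>H\<^esub> y)"
    using h by (intro D_cong) (simp_all add: S_mult S_Si Si_closed)
  also have "\<dots> = S (\<epsilon>\<^bsub>H\<^esub> h \<odot>\<^bsub>H\<^esub> \<one>\<^bsub>H\<^esub>)"
    using h by (simp add: antipode_left lin_smult[OF antipode_linear] S_one)
  finally show "S (D H h (\<lambda>x y. Si y \<otimes>\<^bsub>H\<^esub> x)) = S (\<epsilon>\<^bsub>H\<^esub> h \<odot>\<^bsub>H\<^esub> \<one>\<^bsub>H\<^esub>)" .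
qed (auto intro!: D_closed module_axioms simp: Si_closed)

lemma Si_right: "h \<in> carrier H \<Longrightarrow> D H h (\<lambda>x y. y \<otimes>\<^bsub>H\<^esub> Si x) = \<epsilon>\<^bsub>H\<^esub> h \<odot>\<^bsub>H\<^esub> \<one>\<^bsub>H\<^esub>"
proof (rule S_inj)
  assume h: "h \<in> carrier H"
  have "S (D H h (\<lambda>x y. y \<otimes>\<^bsub>H\<^esub> Si x)) = D H h (\<lambda>x y. S (y \<otimes>\<^bsub>H\<^esub> Si x))"
    using h by (intro D_commute[OF antipode_linear module_axioms module_axioms]) (auto simp: Si_closed)
  also have "\<dots> = D H h (\<lambda>x y. x \<otimes>\<^bsub>H\<^esub> S y)"
    using h by (intro D_cong) (simp_all add: S_mult S_Si Si_closed)
  also have "\<dots> = S (\<epsilon>\<^bsub>H\<^esub> h \<odot>\<^bsub>H\<^esub> \<one>\<^bsub>H\<^esub>)"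
    using h by (simp add: antipode_right lin_smult[OF antipode_linear] S_one)
  finally show "S (D H h (\<lambda>x y. y \<otimes>\<^bsub>H\<^esub> Si x)) = S (\<epsilon>\<^bsub>H\<^esub> h \<odot>\<^bsub>H\<^esub> \<one>\<^bsub>H\<^esub>)" .
qed (auto intro!: D_closed module_axioms simp: Si_closed)

end

end

section \<open>Diagonal coactions\<close>

text \<open>The simplifier admits one congruence rule per constant, so this one has to serve all coalgebras at once.\<close>

lemma comult_simp_cong:
  assumes "a = b" "coalgebra k X" "b \<in> carrier X"
    and "\<And>x y. \<lbrakk>x \<in> carrier X; y \<in> carrier X\<rbrakk> \<Longrightarrow> G x y = G' x y"
  shows "sweedler k L (\<Delta>\<^bsub>X\<^esub> a) G = sweedler k L (\<Delta>\<^bsub>X\<^esub> b) G'"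
proof -
  interpret coalgebra k X by fact
  show ?thesis unfolding assms(1) by (rule D_cong[OF assms(3,4)])
qed

context comodule_coalgebra
begin

declare H.coalgebra_axioms [simp] C.coalgebra_axioms [simp]

sublocale HC: module_pair k H C ..

text \<open>A constant of its own, unlike the abbreviation \<open>D\<close>, so that the simplifier
  can use \<open>R_simp_cong\<close> side by side with \<open>comult_simp_cong\<close>.\<close>

definition R where "R L a G = sweedler k L (\<rho>\<^bsub>C\<^esub> a) G"

lemma coaction_closed: "a \<in> carrier C \<Longrightarrow> \<rho>\<^bsub>C\<^esub> a \<in> carrier (tensor k H 1 C 1)"
  by (rule lin_closed[OF coaction_linear])

lemma R_closed:
  "\<lbrakk>module k L; a \<in> carrier C; \<And>x y. \<lbrakk>x \<in> carrier H; y \<in> carrier C\<rbrakk> \<Longrightarrow> G x y \<in> carrier L\<rbrakk>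
    \<Longrightarrow> R L a G \<in> carrier L"
  unfolding R_def by (rule HC.sweedler_closed[OF _ coaction_closed])

lemma R_cong:
  "\<lbrakk>a \<in> carrier C; \<And>x y. \<lbrakk>x \<in> carrier H; y \<in> carrier C\<rbrakk> \<Longrightarrow> G x y = G' x y\<rbrakk> \<Longrightarrow> R L a G = R L a G'"
  unfolding R_def by (rule HC.sweedler_cong[OF coaction_closed])

lemma R_simp_cong:
  "\<lbrakk>a = b; b \<in> carrier C; \<And>x y. \<lbrakk>x \<in> carrier H; y \<in> carrier C\<rbrakk> \<Longrightarrow> G x y = G' x y\<rbrakk> \<Longrightarrow> R L a G = R L b G'"
  by (hypsubst) (rule R_cong)

lemmas R_commute = HC.sweedler_commute[OF _ _ _ coaction_closed, folded R_def]
lemmas lin_R_param = HC.lin_sweedler_param[OF _ _ coaction_closed, folded R_def]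
lemmas lin_R = HC.lin_sweedler[OF _ lin_comp[OF coaction_linear], folded R_def]
lemmas R_swap = sweedler_swap[OF _ HC.module_pair_axioms HC.module_pair_axioms coaction_closed coaction_closed, folded R_def]
lemmas R_DH_swap = sweedler_swap[OF _ HC.module_pair_axioms H.pair.module_pair_axioms coaction_closed H.comult_closed, folded R_def]
lemmas R_DC_swap = sweedler_swap[OF _ HC.module_pair_axioms C.pair.module_pair_axioms coaction_closed C.comult_closed, folded R_def]
lemmas DC_DH_swap = sweedler_swap[OF _ C.pair.module_pair_axioms H.pair.module_pair_axioms C.comult_closed H.comult_closed]
lemmas act_R_swap = H.act_sweedler_swap[OF _ HC.module_pair_axioms coaction_closed, folded R_def]
lemmas act_DC_swap = H.act_sweedler_swap[OF _ C.pair.module_pair_axioms C.comult_closed]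

text \<open>The axiom is an equation in H \<otimes> H \<otimes> C; the linear map E induced by the
  trilinear G carries it to L.\<close>

lemma R_coassoc:
  assumes L: "module k L" and a: "a \<in> carrier C"
    and G: "\<And>y z. \<lbrakk>y \<in> carrier H; z \<in> carrier C\<rbrakk> \<Longrightarrow> (\<lambda>x. G x y z) \<in> lin_maps k H L"
      "\<And>x z. \<lbrakk>x \<in> carrier H; z \<in> carrier C\<rbrakk> \<Longrightarrow> (\<lambda>y. G x y z) \<in> lin_maps k H L"
      "\<And>x y. \<lbrakk>x \<in> carrier H; y \<in> carrier H\<rbrakk> \<Longrightarrow> (\<lambda>z. G x y z) \<in> lin_maps k C L"
  shows "R L a (\<lambda>h b. H.D L h (\<lambda>u v. G u v b)) = R L a (\<lambda>h b. R L b (\<lambda>u c. G h u c))"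
proof -
  let ?T = "tensor k H 2 C 1"
  define E where "E = (\<lambda>t. lin_ext k L t (\<lambda>xs ys. G (xs ! 0) (xs ! 1) (hd ys)))"
  have G3: "mlin2 k H 2 C 1 L (\<lambda>xs ys. G (xs ! 0) (xs ! 1) (hd ys))"
  proof (intro mlin2I mlinI)
    fix ys xs xs'
    assume *: "length ys = 1" "set ys \<subseteq> carrier C" "set xs \<subseteq> carrier H" "set xs' \<subseteq> carrier H"
      "Suc (length xs + length xs') = 2"
    consider "length xs = 0" "length xs' = 1" | "length xs = 1" "length xs' = 0"
      using *(5) by linarith
    then show "(\<lambda>x. G ((xs @ x # xs') ! 0) ((xs @ x # xs') ! 1) (hd ys)) \<in> lin_maps k H L"
      using * by cases (auto simp: length_Suc_conv G)
  qed (auto simp: numeral_2_eq_2 length_Suc_conv G lin_closed[OF G(1)])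
  have E: "E \<in> lin_maps k ?T L"
    unfolding E_def by (rule HC.lin_ext_lin[OF L G3])
  have Ep: "E (HC.pt [x, y] [z]) = G x y z" if "x \<in> carrier H" "y \<in> carrier H" "z \<in> carrier C" for x y z
    unfolding E_def using that by (subst HC.lin_ext_pure[OF L G3]) auto
  have T: "module k ?T" by (rule HC.tensor_module)
  have pc: "HC.pt [x, y] [z] \<in> carrier ?T" if "x \<in> carrier H" "y \<in> carrier H" "z \<in> carrier C" for x y z
    using that by (intro HC.pure_closed) auto
  note cl = H.D_commute[OF E T L] R_commute[OF E T L] H.D_closed[OF T] R_closed[OF T] pc Ep
  have "R L a (\<lambda>h b. H.D L h (\<lambda>u v. G u v b)) = E (R ?T a (\<lambda>h b. H.D ?T h (\<lambda>u v. HC.pt [u, v] [b])))"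
    using a by (simp add: cl del: One_nat_def cong: R_simp_cong comult_simp_cong)
  also have "\<dots> = E (R ?T a (\<lambda>h b. R ?T b (\<lambda>u c. HC.pt [h, u] [c])))"
    by (simp only: coaction_coassoc[OF a, folded R_def])
  also have "\<dots> = R L a (\<lambda>h b. R L b (\<lambda>u c. G h u c))"
    using a by (simp add: cl del: One_nat_def cong: R_simp_cong comult_simp_cong)
  finally show ?thesis .
qed

lemma R_counit:
  assumes L: "module k L" and a: "a \<in> carrier C" and f: "f \<in> lin_maps k C L"
  shows "R L a (\<lambda>h b. \<epsilon>\<^bsub>H\<^esub> h \<odot>\<^bsub>L\<^esub> f b) = f a"
proof -
  have "f a = f (R C a (\<lambda>h b. \<epsilon>\<^bsub>H\<^esub> h \<odot>\<^bsub>C\<^esub> b))" using coaction_counit[OF a] by (simp add: R_def)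
  also have "\<dots> = R L a (\<lambda>h b. f (\<epsilon>\<^bsub>H\<^esub> h \<odot>\<^bsub>C\<^esub> b))"
    using a by (intro R_commute[OF f C.module_axioms L]) auto
  also have "\<dots> = R L a (\<lambda>h b. \<epsilon>\<^bsub>H\<^esub> h \<odot>\<^bsub>L\<^esub> f b)"
    using a by (intro R_cong) (auto simp: lin_smult[OF f])
  finally show ?thesis by simp
qed

text \<open>Applies f to \<open>coaction_counit_C\<close>: once the counit consumes the comodule
  leg, the Hopf leg becomes the unit.\<close>

lemma R_counit_C:
  assumes L: "module k L" and a: "a \<in> carrier C" and f: "f \<in> lin_maps k H L"
  shows "R L a (\<lambda>h b. \<epsilon>\<^bsub>C\<^esub> b \<odot>\<^bsub>L\<^esub> f h) = \<epsilon>\<^bsub>C\<^esub> a \<odot>\<^bsub>L\<^esub> f \<one>\<^bsub>H\<^esub>"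
proof -
  have "\<epsilon>\<^bsub>C\<^esub> a \<odot>\<^bsub>L\<^esub> f \<one>\<^bsub>H\<^esub> = f (R H a (\<lambda>h b. \<epsilon>\<^bsub>C\<^esub> b \<odot>\<^bsub>H\<^esub> h))"
    using a by (simp add: R_def coaction_counit_C lin_smult[OF f])
  also have "\<dots> = R L a (\<lambda>h b. f (\<epsilon>\<^bsub>C\<^esub> b \<odot>\<^bsub>H\<^esub> h))"
    using a by (intro R_commute[OF f H.module_axioms L]) auto
  also have "\<dots> = R L a (\<lambda>h b. \<epsilon>\<^bsub>C\<^esub> b \<odot>\<^bsub>L\<^esub> f h)"
    using a by (intro R_cong) (auto simp: lin_smult[OF f])
  finally show ?thesis by simp
qed

text \<open>Transport of the compatibility axiom from H \<otimes> C \<otimes> C. It trades two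
  coactions on the halves of a coproduct, with their legs multiplied, for one coaction before the
  coproduct.\<close>

lemma R_comult:
  assumes L: "module k L" and a: "a \<in> carrier C"
    and G: "\<And>y z. \<lbrakk>y \<in> carrier C; z \<in> carrier C\<rbrakk> \<Longrightarrow> (\<lambda>x. G x y z) \<in> lin_maps k H L"
      "\<And>x z. \<lbrakk>x \<in> carrier H; z \<in> carrier C\<rbrakk> \<Longrightarrow> (\<lambda>y. G x y z) \<in> lin_maps k C L"
      "\<And>x y. \<lbrakk>x \<in> carrier H; y \<in> carrier C\<rbrakk> \<Longrightarrow> (\<lambda>z. G x y z) \<in> lin_maps k C L"
  shows "C.D L a (\<lambda>x y. R L x (\<lambda>g b. R L y (\<lambda>h c. G (g \<otimes>\<^bsub>H\<^esub> h) b c)))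
    = R L a (\<lambda>h b. C.D L b (\<lambda>x y. G h x y))"
proof -
  let ?T = "tensor k H 1 C 2"
  define E where "E = (\<lambda>t. lin_ext k L t (\<lambda>xs ys. G (hd xs) (ys ! 0) (ys ! 1)))"
  have G3: "mlin2 k H 1 C 2 L (\<lambda>xs ys. G (hd xs) (ys ! 0) (ys ! 1))"
  proof (intro mlin2I mlinI)
    fix ys xs xs'
    assume *: "length ys = 1" "set ys \<subseteq> carrier H" "set xs \<subseteq> carrier C" "set xs' \<subseteq> carrier C"
      "Suc (length xs + length xs') = 2"
    consider "length xs = 0" "length xs' = 1" | "length xs = 1" "length xs' = 0"
      using *(5) by linarith
    then show "(\<lambda>x. G (hd ys) ((xs @ x # xs') ! 0) ((xs @ x # xs') ! 1)) \<in> lin_maps k C L"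
      using * by cases (auto simp: length_Suc_conv G)
  qed (auto simp: numeral_2_eq_2 length_Suc_conv G lin_closed[OF G(1)])
  have E: "E \<in> lin_maps k ?T L"
    unfolding E_def by (rule HC.lin_ext_lin[OF L G3])
  have Ep: "E (HC.pt [x] [y, z]) = G x y z" if "x \<in> carrier H" "y \<in> carrier C" "z \<in> carrier C" for x y z
    unfolding E_def using that by (subst HC.lin_ext_pure[OF L G3]) auto
  have T: "module k ?T" by (rule HC.tensor_module)
  have pc: "HC.pt [x] [y, z] \<in> carrier ?T" if "x \<in> carrier H" "y \<in> carrier C" "z \<in> carrier C" for x y z
    using that by (intro HC.pure_closed) auto
  note cl = C.D_commute[OF E T L] R_commute[OF E T L] C.D_closed[OF T] R_closed[OF T] pc Ep
  have "C.D L a (\<lambda>x y. R L x (\<lambda>g b. R L y (\<lambda>h c. G (g \<otimes>\<^bsub>H\<^esub> h) b c)))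
    = E (C.D ?T a (\<lambda>x y. R ?T x (\<lambda>g b. R ?T y (\<lambda>h c. HC.pt [g \<otimes>\<^bsub>H\<^esub> h] [b, c]))))"
    using a by (simp add: cl del: One_nat_def cong: R_simp_cong comult_simp_cong)
  also have "\<dots> = E (R ?T a (\<lambda>h b. C.D ?T b (\<lambda>x y. HC.pt [h] [x, y])))"
    by (simp only: coaction_comult[OF a, folded R_def])
  also have "\<dots> = R L a (\<lambda>h b. C.D L b (\<lambda>x y. G h x y))"
    using a by (simp add: cl del: One_nat_def cong: R_simp_cong comult_simp_cong)
  finally show ?thesis .
qed

text \<open>
  The sum of all $K(a_0^{(\bar 1)} \cdots a_q^{(\bar 1)}, (a_0^{(\bar 0)}, \dots, a_q^{(\bar 0)}))$.
\<close>

primrec co where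
  "co L [] K = K \<one>\<^bsub>H\<^esub> []"
| "co L (a # as) K = R L a (\<lambda>h b. co L as (\<lambda>u bs. K (h \<otimes>\<^bsub>H\<^esub> u) (b # bs)))"

lemma co_closed:
  assumes L: "module k L"
  shows "\<lbrakk>set as \<subseteq> carrier C;
    \<And>u bs. \<lbrakk>u \<in> carrier H; length bs = length as; set bs \<subseteq> carrier C\<rbrakk> \<Longrightarrow> K u bs \<in> carrier L\<rbrakk>
    \<Longrightarrow> co L as K \<in> carrier L"
proof (induction as arbitrary: K)
  case (Cons a as)
  show ?case unfolding co.simps
    by (intro R_closed[OF L] Cons.IH) (use Cons.prems in auto)
qed simp

lemma co_cong:
  "\<lbrakk>set as \<subseteq> carrier C;
    \<And>u bs. \<lbrakk>u \<in> carrier H; length bs = length as; set bs \<subseteq> carrier C\<rbrakk> \<Longrightarrow> K u bs = K' u bs\<rbrakk>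
    \<Longrightarrow> co L as K = co L as K'"
proof (induction as arbitrary: K K')
  case (Cons a as)
  show ?case unfolding co.simps
    by (rule R_cong, use Cons.prems in simp, rule Cons.IH) (use Cons.prems in auto)
qed simp

lemma co_commute:
  assumes f: "f \<in> lin_maps k L L'" and L: "module k L" "module k L'"
  shows "\<lbrakk>set as \<subseteq> carrier C;
    \<And>u bs. \<lbrakk>u \<in> carrier H; length bs = length as; set bs \<subseteq> carrier C\<rbrakk> \<Longrightarrow> K u bs \<in> carrier L\<rbrakk>
    \<Longrightarrow> f (co L as K) = co L' as (\<lambda>u bs. f (K u bs))"
proof (induction as arbitrary: K)
  case (Cons a as)
  then have "f (co L (a # as) K) = R L' a (\<lambda>h b. f (co L as (\<lambda>u bs. K (h \<otimes>\<^bsub>H\<^esub> u) (b # bs))))"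
    by (simp add: R_commute[OF f L] co_closed[OF L(1)])
  also have "\<dots> = co L' (a # as) (\<lambda>u bs. f (K u bs))"
    unfolding co.simps by (rule R_cong, use Cons.prems in simp, rule Cons.IH) (use Cons.prems in auto)
  finally show ?case .
qed simp

lemma lin_co_param:
  assumes L: "module k L" and Z: "module k Z"
  shows "\<lbrakk>set as \<subseteq> carrier C;
    \<And>u bs. \<lbrakk>u \<in> carrier H; length bs = length as; set bs \<subseteq> carrier C\<rbrakk> \<Longrightarrow> (\<lambda>z. K z u bs) \<in> lin_maps k Z L\<rbrakk>
    \<Longrightarrow> (\<lambda>z. co L as (K z)) \<in> lin_maps k Z L"
proof (induction as arbitrary: K)
  case (Cons a as)
  show ?case unfolding co.simps
    by (intro lin_R_param[OF L Z] Cons.IH) (use Cons.prems in auto)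
qed simp

lemma co_swap:
  assumes L: "module k L" and MN: "module_pair k M N" and t: "t \<in> carrier (tensor k M 1 N 1)"
  shows "\<lbrakk>set as \<subseteq> carrier C;
    \<And>u bs x y. \<lbrakk>u \<in> carrier H; length bs = length as; set bs \<subseteq> carrier C; x \<in> carrier M; y \<in> carrier N\<rbrakk>
      \<Longrightarrow> K u bs x y \<in> carrier L\<rbrakk>
    \<Longrightarrow> co L as (\<lambda>u bs. sweedler k L t (K u bs)) = sweedler k L t (\<lambda>x y. co L as (\<lambda>u bs. K u bs x y))"
proof (induction as arbitrary: K)
  case (Cons a as)
  have "co L (a # as) (\<lambda>u bs. sweedler k L t (K u bs))
      = R L a (\<lambda>h b. sweedler k L t (\<lambda>x y. co L as (\<lambda>u bs. K (h \<otimes>\<^bsub>H\<^esub> u) (b # bs) x y)))"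
    unfolding co.simps by (rule R_cong, use Cons.prems in simp, rule Cons.IH) (use Cons.prems in auto)
  also have "\<dots> = sweedler k L t (\<lambda>x y. co L (a # as) (\<lambda>u bs. K u bs x y))"
    unfolding co.simps R_def using Cons.prems
    by (intro sweedler_swap[OF L HC.module_pair_axioms MN coaction_closed t] co_closed[OF L]) auto
  finally show ?case .
qed simp

lemmas co_R_swap = co_swap[OF _ HC.module_pair_axioms coaction_closed, folded R_def]
lemmas co_DC_swap = co_swap[OF _ C.pair.module_pair_axioms C.comult_closed]
lemmas co_DH_swap = co_swap[OF _ H.pair.module_pair_axioms H.comult_closed]

lemma act_co_swap:
  assumes L: "module k L"
  shows "\<lbrakk>h \<in> carrier H; set gs \<subseteq> carrier H; set as \<subseteq> carrier C;
    \<And>r u bs. \<lbrakk>length r = length gs; set r \<subseteq> carrier H; u \<in> carrier H; length bs = length as; set bs \<subseteq> carrier C\<rbrakk>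
      \<Longrightarrow> K r u bs \<in> carrier L\<rbrakk>
    \<Longrightarrow> H.act L gs h (\<lambda>r. co L as (K r)) = co L as (\<lambda>u bs. H.act L gs h (\<lambda>r. K r u bs))"
proof (induction as arbitrary: K)
  case (Cons a as)
  have "H.act L gs h (\<lambda>r. co L (a # as) (K r))
      = R L a (\<lambda>x b. H.act L gs h (\<lambda>r. co L as (\<lambda>u bs. K r (x \<otimes>\<^bsub>H\<^esub> u) (b # bs))))"
    unfolding co.simps using Cons.prems
    by (intro act_R_swap[OF L] co_closed[OF L]) auto
  also have "\<dots> = co L (a # as) (\<lambda>u bs. H.act L gs h (\<lambda>r. K r u bs))"
    unfolding co.simps by (rule R_cong, use Cons.prems in simp, rule Cons.IH) (use Cons.prems in auto)
  finally show ?case .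
qed simp

lemma mlin_co:
  assumes L: "module k L"
    and Ku: "\<And>u. u \<in> carrier H \<Longrightarrow> mlin k C n L (K u)"
    and Kb: "\<And>bs. \<lbrakk>length bs = n; set bs \<subseteq> carrier C\<rbrakk> \<Longrightarrow> (\<lambda>u. K u bs) \<in> lin_maps k H L"
  shows "mlin k C n L (\<lambda>as. co L as K)"
proof (rule mlinI)
  fix xs ys assume "set xs \<subseteq> carrier C" "set ys \<subseteq> carrier C" "Suc (length xs + length ys) = n"
  then show "(\<lambda>x. co L (xs @ x # ys) K) \<in> lin_maps k C L"
    using Ku Kb
  proof (induction xs arbitrary: n K)
    case Nil
    have K': "K u bs \<in> carrier L" if "u \<in> carrier H" "length bs = n" "set bs \<subseteq> carrier C" for u bs
      using that by (intro mlin_closed[OF Nil.prems(4)])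
    have 1: "(\<lambda>b. co L ys (\<lambda>u bs. K (h \<otimes>\<^bsub>H\<^esub> u) (b # bs))) \<in> lin_maps k C L" if "h \<in> carrier H" for h
      using that Nil.prems(1-3)
      by (intro lin_co_param[OF L C.module_axioms] lin_mlin[OF Nil.prems(4)] slot_intros lin_ident) auto
    have 2: "(\<lambda>h. co L ys (\<lambda>u bs. K (h \<otimes>\<^bsub>H\<^esub> u) (b # bs))) \<in> lin_maps k H L" if "b \<in> carrier C" for b
      using that Nil.prems(1-3)
      by (intro lin_co_param[OF L H.module_axioms] lin_comp[OF Nil.prems(5)] H.lin_mult_left lin_ident) auto
    show ?case using lin_R[OF L lin_ident 2 1] by simp
  next
    case (Cons a xs)
    have "(\<lambda>x. co L (xs @ x # ys) (\<lambda>u bs. K (h \<otimes>\<^bsub>H\<^esub> u) (b # bs))) \<in> lin_maps k C L"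
      if "h \<in> carrier H" "b \<in> carrier C" for h b
    proof (rule Cons.IH[of "n - 1"])
      fix u assume "u \<in> carrier H"
      then show "mlin k C (n - 1) L (\<lambda>bs. K (h \<otimes>\<^bsub>H\<^esub> u) (b # bs))"
        using that Cons.prems(3) Cons.prems(4)[of "h \<otimes>\<^bsub>H\<^esub> u"] by (intro mlin_Cons) auto
    next
      fix bs assume "length bs = n - 1" "set bs \<subseteq> carrier C"
      then show "(\<lambda>u. K (h \<otimes>\<^bsub>H\<^esub> u) (b # bs)) \<in> lin_maps k H L"
        using that Cons.prems(3) by (intro lin_comp[OF Cons.prems(5)] H.lin_mult_right lin_ident) auto
    qed (use Cons.prems in auto)
    then show ?case using Cons.prems by (auto intro!: lin_R_param[OF L C.module_axioms])
  qed
qed (auto intro!: co_closed[OF L] mlin_closed[OF Ku])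

lemma co_append:
  "\<lbrakk>set as \<subseteq> carrier C; set as' \<subseteq> carrier C\<rbrakk>
    \<Longrightarrow> co L (as @ as') K = co L as (\<lambda>u bs. co L as' (\<lambda>u' bs'. K (u \<otimes>\<^bsub>H\<^esub> u') (bs @ bs')))"
proof (induction as arbitrary: K)
  case Nil
  then show ?case by (auto intro!: co_cong)
next
  case (Cons a as)
  have "co L ((a # as) @ as') K
      = R L a (\<lambda>h b. co L as (\<lambda>u bs. co L as' (\<lambda>u' bs'. K (h \<otimes>\<^bsub>H\<^esub> (u \<otimes>\<^bsub>H\<^esub> u')) (b # bs @ bs'))))"
    unfolding co.simps append_Cons by (rule R_cong, use Cons.prems in simp, rule Cons.IH) (use Cons.prems in auto)
  also have "\<dots> = co L (a # as) (\<lambda>u bs. co L as' (\<lambda>u' bs'. K (u \<otimes>\<^bsub>H\<^esub> u') (bs @ bs')))"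
    unfolding co.simps append_Cons using Cons.prems
    by (intro R_cong co_cong) (auto simp: H.H_m_assoc)
  finally show ?case .
qed

text \<open>Tensor powers of C are comodules under the diagonal coaction. In the induction the head
  uses coassociativity of the coaction and the tail the induction hypothesis; multiplicativity of
  the coproduct then joins the two coproducts into that of the product leg.\<close>

lemma co_coassoc:
  assumes L: "module k L"
  shows "\<lbrakk>set as \<subseteq> carrier C;
    \<And>u v. \<lbrakk>u \<in> carrier H; v \<in> carrier H\<rbrakk> \<Longrightarrow> mlin k C (length as) L (K u v);
    \<And>v bs. \<lbrakk>v \<in> carrier H; length bs = length as; set bs \<subseteq> carrier C\<rbrakk> \<Longrightarrow> (\<lambda>u. K u v bs) \<in> lin_maps k H L;
    \<And>u bs. \<lbrakk>u \<in> carrier H; length bs = length as; set bs \<subseteq> carrier C\<rbrakk> \<Longrightarrow> (\<lambda>v. K u v bs) \<in> lin_maps k H L\<rbrakk>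
    \<Longrightarrow> co L as (\<lambda>u bs. co L bs (\<lambda>v cs. K u v cs)) = co L as (\<lambda>u bs. H.D L u (\<lambda>x y. K x y bs))"
proof (induction as arbitrary: K)
  case Nil
  then show ?case by (simp add: H.D_one[OF L])
next
  case (Cons a as)
  note K1 = Cons.prems(2) and K2 = Cons.prems(3) and K3 = Cons.prems(4)
  have Kc: "K u v bs \<in> carrier L"
    if "u \<in> carrier H" "v \<in> carrier H" "length bs = Suc (length as)" "set bs \<subseteq> carrier C" for u v bs
    using that by (intro mlin_closed[OF K1]) auto
  have "co L (a # as) (\<lambda>u bs. co L bs (\<lambda>v cs. K u v cs))
    = R L a (\<lambda>h b. co L as (\<lambda>u bs. R L b (\<lambda>h' b'. co L bs (\<lambda>v cs. K (h \<otimes>\<^bsub>H\<^esub> u) (h' \<otimes>\<^bsub>H\<^esub> v) (b' # cs)))))"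
    by simp
  also have "\<dots> = R L a (\<lambda>h b. R L b (\<lambda>h' b'. co L as (\<lambda>u bs. co L bs (\<lambda>v cs. K (h \<otimes>\<^bsub>H\<^esub> u) (h' \<otimes>\<^bsub>H\<^esub> v) (b' # cs)))))"
    using Cons.prems(1) by (intro R_cong co_R_swap[OF L] co_closed[OF L] Kc) auto
  also have "\<dots> = R L a (\<lambda>h b. R L b (\<lambda>h' b'. co L as (\<lambda>u bs. H.D L u (\<lambda>x y. K (h \<otimes>\<^bsub>H\<^esub> x) (h' \<otimes>\<^bsub>H\<^esub> y) (b' # bs)))))"
  proof (intro R_cong Cons.IH)
    fix h b h' b' u v assume *: "h \<in> carrier H" "h' \<in> carrier H" "b' \<in> carrier C" "u \<in> carrier H" "v \<in> carrier H"
    show "mlin k C (length as) L (\<lambda>cs. K (h \<otimes>\<^bsub>H\<^esub> u) (h' \<otimes>\<^bsub>H\<^esub> v) (b' # cs))"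
      using * K1[of "h \<otimes>\<^bsub>H\<^esub> u" "h' \<otimes>\<^bsub>H\<^esub> v"] by (intro mlin_Cons) auto
  qed (use Cons.prems(1) in \<open>auto intro!: lin_comp[OF K2] lin_comp[OF K3] H.lin_mult_right lin_ident\<close>)
  also have "\<dots> = R L a (\<lambda>h b. H.D L h (\<lambda>h h'. co L as (\<lambda>u bs. H.D L u (\<lambda>x y. K (h \<otimes>\<^bsub>H\<^esub> x) (h' \<otimes>\<^bsub>H\<^esub> y) (b # bs)))))"
    using Cons.prems(1)
    by (intro R_coassoc[OF L, symmetric] lin_co_param[OF L] H.module_axioms C.module_axioms H.lin_D_param[OF L]
        lin_comp[OF K2] lin_comp[OF K3] lin_mlin[OF K1] slot_intros H.lin_mult_left lin_ident) auto
  also have "\<dots> = R L a (\<lambda>h b. co L as (\<lambda>u bs. H.D L h (\<lambda>h h'. H.D L u (\<lambda>x y. K (h \<otimes>\<^bsub>H\<^esub> x) (h' \<otimes>\<^bsub>H\<^esub> y) (b # bs)))))"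
    using Cons.prems(1) by (intro R_cong co_DH_swap[OF L, symmetric] H.D_closed[OF L] Kc) auto
  also have "\<dots> = R L a (\<lambda>h b. co L as (\<lambda>u bs. H.D L (h \<otimes>\<^bsub>H\<^esub> u) (\<lambda>x y. K x y (b # bs))))"
    using Cons.prems(1) by (intro R_cong co_cong H.D_mult[OF L, symmetric] K2 K3) auto
  finally show ?case by simp
qed

text \<open>The counit is multiplicative, so on the product leg it splits into scalars, which the
  counit law of the coaction removes one entry at a time.\<close>

lemma co_counit:
  assumes L: "module k L"
  shows "\<lbrakk>set as \<subseteq> carrier C; mlin k C (length as) L K\<rbrakk> \<Longrightarrow> co L as (\<lambda>u bs. \<epsilon>\<^bsub>H\<^esub> u \<odot>\<^bsub>L\<^esub> K bs) = K as"
proof (induction as arbitrary: K)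
  case Nil
  then show ?case by (simp add: H.counit_one module.smult_one[OF L] mlin_closed)
next
  case (Cons a as)
  interpret L: module k L by (rule L)
  note K = Cons.prems(2)
  have Kc: "K bs \<in> carrier L" if "length bs = Suc (length as)" "set bs \<subseteq> carrier C" for bs
    using that by (intro mlin_closed[OF K]) auto
  have "co L (a # as) (\<lambda>u bs. \<epsilon>\<^bsub>H\<^esub> u \<odot>\<^bsub>L\<^esub> K bs)
      = R L a (\<lambda>h b. co L as (\<lambda>u bs. \<epsilon>\<^bsub>H\<^esub> u \<odot>\<^bsub>L\<^esub> (\<epsilon>\<^bsub>H\<^esub> h \<odot>\<^bsub>L\<^esub> K (b # bs))))"
    unfolding co.simps using Cons.prems(1)
    by (intro R_cong co_cong) (simp_all add: H.counit_mult L.smult_assoc1[symmetric] H.R.m_comm Kc)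
  also have "\<dots> = R L a (\<lambda>h b. \<epsilon>\<^bsub>H\<^esub> h \<odot>\<^bsub>L\<^esub> K (b # as))"
  proof (intro R_cong Cons.IH)
    fix h b assume "h \<in> carrier H" "b \<in> carrier C"
    then have "mlin k C (length as) L (\<lambda>bs. K (b # bs))" using K by (intro mlin_Cons) auto
    then show "mlin k C (length as) L (\<lambda>bs. \<epsilon>\<^bsub>H\<^esub> h \<odot>\<^bsub>L\<^esub> K (b # bs))"
      using \<open>h \<in> carrier H\<close> by (auto intro!: mlinI lin_smult_right[OF L] dest: mlinD)
  qed (use Cons.prems in auto)
  also have "\<dots> = K (a # as)"
    using Cons.prems(1) by (intro R_counit[OF L] lin_mlin[OF K] slot_intros lin_ident) auto
  finally show ?case .
qed

text \<open>Comultiplication in one entry is a comodule map for the diagonal coaction. At the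
  affected entry this is \<open>R_comult\<close>, with associativity absorbing the two legs into the
  ordered product; the entries before it are carried along by the induction.\<close>

lemma co_dup:
  assumes L: "module k L" and r: "set r \<subseteq> carrier C" and a: "a \<in> carrier C"
  shows "\<lbrakk>set l \<subseteq> carrier C;
    \<And>u. u \<in> carrier H \<Longrightarrow> mlin k C (length l + length r + 2) L (K u);
    \<And>bs. \<lbrakk>length bs = length l + length r + 2; set bs \<subseteq> carrier C\<rbrakk> \<Longrightarrow> (\<lambda>u. K u bs) \<in> lin_maps k H L\<rbrakk>
    \<Longrightarrow> co L (l @ a # r) (\<lambda>u s. C.D L (s ! length l) (\<lambda>x y. K u (take (length l) s @ x # y # drop (Suc (length l)) s)))
      = C.D L a (\<lambda>x y. co L (l @ x # y # r) K)"
proof (induction l arbitrary: K)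
  case Nil
  note K1 = Nil.prems(2) and K2 = Nil.prems(3)
  have Kc: "K u s \<in> carrier L" if "u \<in> carrier H" "length s = Suc (Suc (length r))" "set s \<subseteq> carrier C" for u s
    using that by (intro mlin_closed[OF K1]) auto
  have "co L ([] @ a # r) (\<lambda>u s. C.D L (s ! length []) (\<lambda>x y. K u (take (length []) s @ x # y # drop (Suc (length [])) s)))
    = R L a (\<lambda>h b. C.D L b (\<lambda>x y. co L r (\<lambda>u bs. K (h \<otimes>\<^bsub>H\<^esub> u) (x # y # bs))))"
    unfolding co.simps append_Nil using r a
    by (simp, intro R_cong co_DC_swap[OF L] Kc) auto
  also have "\<dots> = C.D L a (\<lambda>x y. R L x (\<lambda>g b. R L y (\<lambda>h c. co L r (\<lambda>u bs. K ((g \<otimes>\<^bsub>H\<^esub> h) \<otimes>\<^bsub>H\<^esub> u) (b # c # bs)))))"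
    using r a
    by (intro R_comult[OF L, symmetric] lin_co_param[OF L] H.module_axioms C.module_axioms
        lin_comp[OF K2] lin_mlin[OF K1] slot_intros H.lin_mult_left lin_ident) auto
  also have "\<dots> = C.D L a (\<lambda>x y. R L x (\<lambda>g b. R L y (\<lambda>h c. co L r (\<lambda>u bs. K (g \<otimes>\<^bsub>H\<^esub> (h \<otimes>\<^bsub>H\<^esub> u)) (b # c # bs)))))"
    using r a by (intro C.D_cong R_cong co_cong) (auto simp: H.H_m_assoc)
  finally show ?case by simp
next
  case (Cons c l)
  note K1 = Cons.prems(2) and K2 = Cons.prems(3)
  have Kc: "K u s \<in> carrier L" if "u \<in> carrier H" "length s = Suc (length l + length r + 2)" "set s \<subseteq> carrier C" for u s
    using that by (intro mlin_closed[OF K1]) auto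
  have "co L ((c # l) @ a # r) (\<lambda>u s. C.D L (s ! length (c # l)) (\<lambda>x y. K u (take (length (c # l)) s @ x # y # drop (Suc (length (c # l))) s)))
    = R L c (\<lambda>h b. co L (l @ a # r) (\<lambda>u s. C.D L (s ! length l) (\<lambda>x y. K (h \<otimes>\<^bsub>H\<^esub> u) (b # take (length l) s @ x # y # drop (Suc (length l)) s))))"
    by simp
  also have "\<dots> = R L c (\<lambda>h b. C.D L a (\<lambda>x y. co L (l @ x # y # r) (\<lambda>u bs. K (h \<otimes>\<^bsub>H\<^esub> u) (b # bs))))"
  proof (rule R_cong)
    fix h b assume hb: "h \<in> carrier H" "b \<in> carrier C"
    show "co L (l @ a # r) (\<lambda>u s. C.D L (s ! length l) (\<lambda>x y. K (h \<otimes>\<^bsub>H\<^esub> u) (b # take (length l) s @ x # y # drop (Suc (length l)) s)))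
      = C.D L a (\<lambda>x y. co L (l @ x # y # r) (\<lambda>u bs. K (h \<otimes>\<^bsub>H\<^esub> u) (b # bs)))"
    proof (rule Cons.IH)
      fix u assume "u \<in> carrier H"
      then show "mlin k C (length l + length r + 2) L (\<lambda>bs. K (h \<otimes>\<^bsub>H\<^esub> u) (b # bs))"
        using hb K1[of "h \<otimes>\<^bsub>H\<^esub> u"] by (intro mlin_Cons) auto
    next
      fix bs assume "length bs = length l + length r + 2" "set bs \<subseteq> carrier C"
      then show "(\<lambda>u. K (h \<otimes>\<^bsub>H\<^esub> u) (b # bs)) \<in> lin_maps k H L"
        using hb by (intro lin_comp[OF K2] H.lin_mult_right lin_ident) auto
    qed (use Cons.prems in auto)
  qed (use Cons.prems in auto)
  also have "\<dots> = C.D L a (\<lambda>x y. co L ((c # l) @ x # y # r) K)"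
    unfolding co.simps append_Cons using Cons.prems(1) a r
    by (intro R_DC_swap[OF L] co_closed[OF L] Kc) auto
  finally show ?case .
qed

text \<open>Applying the counit to an entry replaces its coaction leg by the unit, which disappears
  from the ordered product.\<close>

lemma co_del:
  assumes L: "module k L" and r: "set r \<subseteq> carrier C" and a: "a \<in> carrier C"
  shows "\<lbrakk>set l \<subseteq> carrier C;
    \<And>u. u \<in> carrier H \<Longrightarrow> mlin k C (length l + length r) L (K u);
    \<And>bs. \<lbrakk>length bs = length l + length r; set bs \<subseteq> carrier C\<rbrakk> \<Longrightarrow> (\<lambda>u. K u bs) \<in> lin_maps k H L\<rbrakk>
    \<Longrightarrow> co L (l @ a # r) (\<lambda>u s. \<epsilon>\<^bsub>C\<^esub> (s ! length l) \<odot>\<^bsub>L\<^esub> K u (take (length l) s @ drop (Suc (length l)) s))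
      = \<epsilon>\<^bsub>C\<^esub> a \<odot>\<^bsub>L\<^esub> co L (l @ r) K"
proof (induction l arbitrary: K)
  case Nil
  note K1 = Nil.prems(2) and K2 = Nil.prems(3)
  have Kc: "K u s \<in> carrier L" if "u \<in> carrier H" "length s = length r" "set s \<subseteq> carrier C" for u s
    using that by (intro mlin_closed[OF K1]) auto
  have "co L ([] @ a # r) (\<lambda>u s. \<epsilon>\<^bsub>C\<^esub> (s ! length []) \<odot>\<^bsub>L\<^esub> K u (take (length []) s @ drop (Suc (length [])) s))
    = R L a (\<lambda>h b. \<epsilon>\<^bsub>C\<^esub> b \<odot>\<^bsub>L\<^esub> co L r (\<lambda>u bs. K (h \<otimes>\<^bsub>H\<^esub> u) bs))"
    unfolding co.simps append_Nil using r a
    by (simp, intro R_cong co_commute[OF lin_smult_right[OF L lin_ident] L L, symmetric] Kc) auto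
  also have "\<dots> = \<epsilon>\<^bsub>C\<^esub> a \<odot>\<^bsub>L\<^esub> co L r (\<lambda>u bs. K (\<one>\<^bsub>H\<^esub> \<otimes>\<^bsub>H\<^esub> u) bs)"
    using r a
    by (intro R_counit_C[OF L] lin_co_param[OF L] H.module_axioms lin_comp[OF K2] H.lin_mult_left lin_ident) auto
  also have "co L r (\<lambda>u bs. K (\<one>\<^bsub>H\<^esub> \<otimes>\<^bsub>H\<^esub> u) bs) = co L r K"
    using r by (intro co_cong) auto
  finally show ?case by simp
next
  case (Cons c l)
  note K1 = Cons.prems(2) and K2 = Cons.prems(3)
  have Kc: "K u s \<in> carrier L" if "u \<in> carrier H" "length s = Suc (length l + length r)" "set s \<subseteq> carrier C" for u s
    using that by (intro mlin_closed[OF K1]) auto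
  have "co L ((c # l) @ a # r) (\<lambda>u s. \<epsilon>\<^bsub>C\<^esub> (s ! length (c # l)) \<odot>\<^bsub>L\<^esub> K u (take (length (c # l)) s @ drop (Suc (length (c # l))) s))
    = R L c (\<lambda>h b. co L (l @ a # r) (\<lambda>u s. \<epsilon>\<^bsub>C\<^esub> (s ! length l) \<odot>\<^bsub>L\<^esub> K (h \<otimes>\<^bsub>H\<^esub> u) (b # take (length l) s @ drop (Suc (length l)) s)))"
    by simp
  also have "\<dots> = R L c (\<lambda>h b. \<epsilon>\<^bsub>C\<^esub> a \<odot>\<^bsub>L\<^esub> co L (l @ r) (\<lambda>u bs. K (h \<otimes>\<^bsub>H\<^esub> u) (b # bs)))"
  proof (rule R_cong)
    fix h b assume hb: "h \<in> carrier H" "b \<in> carrier C"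
    show "co L (l @ a # r) (\<lambda>u s. \<epsilon>\<^bsub>C\<^esub> (s ! length l) \<odot>\<^bsub>L\<^esub> K (h \<otimes>\<^bsub>H\<^esub> u) (b # take (length l) s @ drop (Suc (length l)) s))
      = \<epsilon>\<^bsub>C\<^esub> a \<odot>\<^bsub>L\<^esub> co L (l @ r) (\<lambda>u bs. K (h \<otimes>\<^bsub>H\<^esub> u) (b # bs))"
    proof (rule Cons.IH)
      fix u assume "u \<in> carrier H"
      then show "mlin k C (length l + length r) L (\<lambda>bs. K (h \<otimes>\<^bsub>H\<^esub> u) (b # bs))"
        using hb K1[of "h \<otimes>\<^bsub>H\<^esub> u"] by (intro mlin_Cons) auto
    next
      fix bs assume "length bs = length l + length r" "set bs \<subseteq> carrier C"
      then show "(\<lambda>u. K (h \<otimes>\<^bsub>H\<^esub> u) (b # bs)) \<in> lin_maps k H L"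
        using hb by (intro lin_comp[OF K2] H.lin_mult_right lin_ident) auto
    qed (use Cons.prems in auto)
  qed (use Cons.prems in auto)
  also have "\<dots> = \<epsilon>\<^bsub>C\<^esub> a \<odot>\<^bsub>L\<^esub> co L ((c # l) @ r) K"
    unfolding co.simps append_Cons using Cons.prems(1) a r
    by (intro R_commute[OF lin_smult_right[OF L lin_ident] L L, symmetric] co_closed[OF L] Kc) auto
  finally show ?case .
qed

section \<open>Comparison with the diagonal coaction as a tensor\<close>

lemma diag_coaction_closed:
  "set as \<subseteq> carrier C \<Longrightarrow> diag_coaction k H C as \<in> carrier (tensor k H 1 C (length as))"
proof (induction as)
  case Nil
  then show ?case by (auto intro!: HC.pure_closed)
next
  case (Cons a as)
  let ?T = "tensor k H 1 C (length as + 1)"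
  have T: "module k ?T" by (rule HC.tensor_module)
  have "R ?T a (\<lambda>h b. lin_ext k ?T (diag_coaction k H C as) (\<lambda>us bs. HC.pt [h \<otimes>\<^bsub>H\<^esub> hd us] (b # bs))) \<in> carrier ?T"
    using Cons by (intro R_closed[OF T] HC.lin_ext_closed[OF T] HC.pure_closed) auto
  then show ?case by (simp add: R_def)
qed

text \<open>Multilinearity of K gives a linear map E on the target tensor product, and E is moved
  through the recursion that builds \<open>diag_coaction\<close> until it meets pure
  tensors.\<close>

lemma diag_coaction_co:
  assumes L: "module k L"
  shows "\<lbrakk>set as \<subseteq> carrier C;
    \<And>u. u \<in> carrier H \<Longrightarrow> mlin k C (length as) L (K u);
    \<And>bs. \<lbrakk>length bs = length as; set bs \<subseteq> carrier C\<rbrakk> \<Longrightarrow> (\<lambda>u. K u bs) \<in> lin_maps k H L\<rbrakk>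
    \<Longrightarrow> lin_ext k L (diag_coaction k H C as) (\<lambda>us bs. K (hd us) bs) = co L as K"
proof (induction as arbitrary: K)
  case Nil
  have "K u [] \<in> carrier L" if "u \<in> carrier H" for u
    using mlin_closed[OF Nil(2)[OF that], of "[]"] by simp
  then have "mlin2 k H 1 C 0 L (\<lambda>us bs. K (hd us) bs)"
    using Nil by (auto intro!: mlin2I mlinI simp: length_Suc_conv)
  from HC.lin_ext_pure[OF L this, of "[\<one>\<^bsub>H\<^esub>]" "[]"] show ?case by simp
next
  case (Cons a as)
  note K1 = Cons.prems(2) and K2 = Cons.prems(3)
  let ?T = "tensor k H 1 C (Suc (length as))"
  have G: "mlin2 k H 1 C (Suc (length as)) L (\<lambda>us bs. K (hd us) bs)"
  proof (rule mlin2I)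
    fix bs assume "length bs = Suc (length as)" "set bs \<subseteq> carrier C"
    then show "mlin k H 1 L (\<lambda>us. K (hd us) bs)"
      using K2[of bs] by (intro mlinI) (auto simp: length_Suc_conv intro: lin_closed)
  qed (use K1 in \<open>auto simp: length_Suc_conv\<close>)
  define E where "E = (\<lambda>t. lin_ext k L t (\<lambda>us bs. K (hd us) bs))"
  have T: "module k ?T" by (rule HC.tensor_module)
  have E: "E \<in> lin_maps k ?T L" unfolding E_def using HC.lin_ext_lin[OF L G] by simp
  have pc: "HC.pt [h] (b # bs) \<in> carrier ?T"
    if "h \<in> carrier H" "b \<in> carrier C" "length bs = length as" "set bs \<subseteq> carrier C" for h b bs
    using that by (intro HC.pure_closed) auto
  have Ep: "E (HC.pt [h] (b # bs)) = K h (b # bs)"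
    if "h \<in> carrier H" "b \<in> carrier C" "length bs = length as" "set bs \<subseteq> carrier C" for h b bs
    unfolding E_def using that HC.lin_ext_pure[OF L G, of "[h]" "b # bs"] by simp
  have dc: "diag_coaction k H C as \<in> carrier (tensor k H 1 C (length as))"
    using Cons.prems by (intro diag_coaction_closed) auto
  have IH: "lin_ext k L (diag_coaction k H C as) (\<lambda>us bs. K (h \<otimes>\<^bsub>H\<^esub> hd us) (b # bs))
      = co L as (\<lambda>u bs. K (h \<otimes>\<^bsub>H\<^esub> u) (b # bs))" if hb: "h \<in> carrier H" "b \<in> carrier C" for h b
  proof (rule Cons.IH)
    fix u assume "u \<in> carrier H"
    then show "mlin k C (length as) L (\<lambda>bs. K (h \<otimes>\<^bsub>H\<^esub> u) (b # bs))"
      using hb K1[of "h \<otimes>\<^bsub>H\<^esub> u"] by (intro mlin_Cons) auto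
  next
    fix bs assume "length bs = length as" "set bs \<subseteq> carrier C"
    then show "(\<lambda>u. K (h \<otimes>\<^bsub>H\<^esub> u) (b # bs)) \<in> lin_maps k H L"
      using hb by (intro lin_comp[OF K2] H.lin_mult_right lin_ident) auto
  qed (use Cons.prems in auto)
  have step: "E (lin_ext k ?T (diag_coaction k H C as) (\<lambda>us bs. HC.pt [h \<otimes>\<^bsub>H\<^esub> hd us] (b # bs)))
      = co L as (\<lambda>u bs. K (h \<otimes>\<^bsub>H\<^esub> u) (b # bs))" if "h \<in> carrier H" "b \<in> carrier C" for h b
    unfolding IH[OF that, symmetric]
    using that by (subst HC.lin_ext_commute[OF T L dc E]) (auto intro!: HC.lin_ext_cong[OF dc] Ep pc pc[unfolded One_nat_def])
  have cl: "lin_ext k ?T (diag_coaction k H C as) (\<lambda>us bs. HC.pt [h \<otimes>\<^bsub>H\<^esub> hd us] (b # bs)) \<in> carrier ?T"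
    if "h \<in> carrier H" "b \<in> carrier C" for h b
    using that by (intro HC.lin_ext_closed[OF T dc] pc) auto
  have "lin_ext k L (diag_coaction k H C (a # as)) (\<lambda>us bs. K (hd us) bs)
    = E (R ?T a (\<lambda>h b. lin_ext k ?T (diag_coaction k H C as) (\<lambda>us bs. HC.pt [h \<otimes>\<^bsub>H\<^esub> hd us] (b # bs))))"
    by (simp add: E_def R_def)
  also have "\<dots> = co L (a # as) K"
    using Cons.prems(1) by (subst R_commute[OF E T L _ cl]) (auto intro!: R_cong step simp del: One_nat_def)
  finally show ?case .
qed

end

section \<open>Reduction of the paracocyclic identities\<close>

text \<open>Only cofaces with index at most n are primitive here; the last one is the cyclic
  operator after the zeroth. Its identities follow by moving the cyclic operator across. One case
  has to be supplied as \<open>s_d_0\<close>: in degree 0 the shift used for the codegeneracy after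
  the last coface would refer to the last coface again.\<close>

lemma paracocyclic_module_reduced:
  fixes k :: "('k, 'z) ring_scheme" and A :: "nat \<Rightarrow> ('k, 'a, 'y) module_scheme"
  assumes mod: "\<And>n. module k (A n)"
    and d_lin: "\<And>n i. i \<le> n \<Longrightarrow> d n i \<in> lin_maps k (A n) (A (Suc n))"
    and s_lin: "\<And>n i. i < n \<Longrightarrow> s n i \<in> lin_maps k (A n) (A (n - 1))"
    and t_lin: "\<And>n. t n \<in> lin_maps k (A n) (A n)"
    and t_bij: "\<And>n. bij_betw (t n) (carrier (A n)) (carrier (A n))"
    and d_last: "\<And>n x. x \<in> carrier (A n) \<Longrightarrow> d n (Suc n) x = t (Suc n) (d n 0 x)"
    and d_d: "\<And>n i j x. \<lbrakk>i < j; j \<le> Suc n; x \<in> carrier (A n)\<rbrakk> \<Longrightarrow>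
      d (Suc n) j (d n i x) = d (Suc n) i (d n (j - 1) x)"
    and s_s: "\<And>n i j x. \<lbrakk>i \<le> j; Suc j < n; x \<in> carrier (A n)\<rbrakk> \<Longrightarrow>
      s (n - 1) j (s n i x) = s (n - 1) i (s n (Suc j) x)"
    and s_d_less: "\<And>n i j x. \<lbrakk>i < j; j \<le> n; x \<in> carrier (A n)\<rbrakk> \<Longrightarrow>
      s (Suc n) j (d n i x) = d (n - 1) i (s n (j - 1) x)"
    and s_d_id: "\<And>n i j x. \<lbrakk>i = j \<or> i = Suc j; i \<le> n; x \<in> carrier (A n)\<rbrakk> \<Longrightarrow> s (Suc n) j (d n i x) = x"
    and s_d_greater: "\<And>n i j x. \<lbrakk>Suc j < i; i \<le> n; x \<in> carrier (A n)\<rbrakk> \<Longrightarrow>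
      s (Suc n) j (d n i x) = d (n - 1) (i - 1) (s n j x)"
    and s_d_0: "\<And>x. x \<in> carrier (A 0) \<Longrightarrow> s (Suc 0) 0 (t (Suc 0) (d 0 0 x)) = x"
    and t_d: "\<And>n i x. \<lbrakk>1 \<le> i; i \<le> n; x \<in> carrier (A n)\<rbrakk> \<Longrightarrow> t (Suc n) (d n i x) = d n (i - 1) (t n x)"
    and t_d_last: "\<And>n x. x \<in> carrier (A n) \<Longrightarrow> t (Suc n) (t (Suc n) (d n 0 x)) = d n n (t n x)"
    and t_s: "\<And>n i x. \<lbrakk>1 \<le> i; i < n; x \<in> carrier (A n)\<rbrakk> \<Longrightarrow> t (n - 1) (s n i x) = s n (i - 1) (t n x)"
    and t_s_0: "\<And>n x. \<lbrakk>1 \<le> n; x \<in> carrier (A n)\<rbrakk> \<Longrightarrow> t (n - 1) (s n 0 x) = s n (n - 1) (t n (t n x))"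
  shows "paracocyclic_module k A d s t"
proof (rule paracocyclic_module.intro)
  note dc = lin_closed[OF d_lin] and sc = lin_closed[OF s_lin] and tc = lin_closed[OF t_lin]
  have d_lin': "d n i \<in> lin_maps k (A n) (A (Suc n))" if "i \<le> Suc n" for n i
  proof (cases "i = Suc n")
    case True
    have "(\<lambda>x. t (Suc n) (d n 0 x)) \<in> lin_maps k (A n) (A (Suc n))"
      by (rule lin_comp[OF t_lin d_lin]) simp
    then show ?thesis
      unfolding True by (subst lin_maps_cong[OF mod, of n _ "\<lambda>x. t (Suc n) (d n 0 x)"]) (rule d_last)
  qed (use that d_lin in auto)
  have t_d': "t (Suc n) (d n i x) = d n (i - 1) (t n x)" if "1 \<le> i" "i \<le> Suc n" "x \<in> carrier (A n)" for n i x
    using that t_d[of i n x] t_d_last[of x n] d_last[of x n] by (cases "i = Suc n") auto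
  show "module k (A n)" for n by (rule mod)
  show "d n i \<in> lin_maps k (A n) (A (n + 1))" if "i \<le> n + 1" for n i
    using d_lin'[of i n] that by simp
  show "s n i \<in> lin_maps k (A n) (A (n - 1))" if "i < n" for n i by (rule s_lin[OF that])
  show "t n \<in> lin_maps k (A n) (A n)" for n by (rule t_lin)
  show "bij_betw (t n) (carrier (A n)) (carrier (A n))" for n by (rule t_bij)
  \<comment> \<open>Exchanging coface i with the zeroth coface raises its index by one, and the
    cyclic operator lowers it again.\<close>
  have d_d_last: "d (Suc n) (Suc (Suc n)) (d n i x) = d (Suc n) i (d n (Suc n) x)"
    if "i \<le> n" "x \<in> carrier (A n)" for n i x
  proof -
    have "d (Suc n) (Suc (Suc n)) (d n i x) = t (Suc (Suc n)) (d (Suc n) 0 (d n i x))"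
      using that by (intro d_last dc) auto
    also have "d (Suc n) 0 (d n i x) = d (Suc n) (Suc i) (d n 0 x)"
      using that d_d[of 0 "Suc i" n x] by simp
    also have "t (Suc (Suc n)) \<dots> = d (Suc n) i (t (Suc n) (d n 0 x))"
      using that t_d[of "Suc i" "Suc n" "d n 0 x"] by (simp add: dc)
    finally show ?thesis using that by (simp add: d_last)
  qed
  show "d (n + 1) j (d n i x) = d (n + 1) i (d n (j - 1) x)"
    if ij: "i < j" "j \<le> n + 2" "x \<in> carrier (A n)" for n i j x
  proof -
    consider "j \<le> Suc n" | "j = Suc (Suc n)" "i \<le> n" | "j = Suc (Suc n)" "i = Suc n"
      using ij by linarith
    then show ?thesis
    proof cases
      case 3
      \<comment> \<open>Two last cofaces in a row: both are unfolded through the zeroth coface, and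
        the resulting square of the cyclic operator is absorbed by \<open>t_d_last\<close>.\<close>
      have "d (Suc n) (Suc (Suc n)) (d n (Suc n) x) = t (Suc (Suc n)) (d (Suc n) 0 (d n (Suc n) x))"
        using ij by (intro d_last lin_closed[OF d_lin']) auto
      also have "d (Suc n) 0 (d n (Suc n) x) = t (Suc (Suc n)) (d (Suc n) 0 (d n 0 x))"
        using ij d_d_last[of 0 n x] by (simp add: d_last dc)
      also have "t (Suc (Suc n)) (t (Suc (Suc n)) (d (Suc n) 0 (d n 0 x))) = d (Suc n) (Suc n) (t (Suc n) (d n 0 x))"
        using ij by (intro t_d_last dc) auto
      finally show ?thesis using ij 3 by (simp add: d_last)
    qed (use ij d_d[of i j n x] d_d_last[of i n x] in simp_all)
  qed
  show "s (n - 1) j (s n i x) = s (n - 1) i (s n (j + 1) x)"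
    if "i \<le> j" "j + 1 < n" "x \<in> carrier (A n)" for n i j x
    using s_s[of i j n x] that by simp
  show "s (n + 1) j (d n i x) = d (n - 1) i (s n (j - 1) x)"
    if "i < j" "j \<le> n" "x \<in> carrier (A n)" for n i j x
    using s_d_less[of i j n x] that by simp
  show "s (n + 1) j (d n i x) = x" if ij: "i = j \<or> i = j + 1" "j \<le> n" "x \<in> carrier (A n)" for n i j x
  proof (cases "i \<le> n")
    case False
    then have i: "i = Suc n" "j = n" using ij by auto
    show ?thesis
    proof (cases n)
      case 0
      then show ?thesis using s_d_0[of x] d_last[of x n] ij i by simp
    next
      case (Suc m)
      \<comment> \<open>Surjectivity of the cyclic operator lets x be shifted back. The last coface
        of x becomes the square of the cyclic operator on coface 1 of y, which is an ordinary coface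
        because n is positive.\<close>
      obtain y where y: "y \<in> carrier (A n)" "x = t n y"
        using t_bij[of n] ij(3) by (auto simp: bij_betw_def)
      have "s (Suc n) n (t (Suc n) (d n 0 x)) = s (Suc n) n (t (Suc n) (t (Suc n) (d n (Suc 0) y)))"
        using y Suc t_d[of "Suc 0" n y] by simp
      also have "\<dots> = t n (s (Suc n) 0 (d n (Suc 0) y))"
        using y Suc t_s_0[of "Suc n" "d n (Suc 0) y"] by (simp add: dc)
      also have "\<dots> = x" using y Suc s_d_id[of "Suc 0" 0 n y] by simp
      finally show ?thesis using d_last[of x n] ij i by simp
    qed
  qed (use s_d_id[of i j n x] ij in simp)
  show "s (n + 1) j (d n i x) = d (n - 1) (i - 1) (s n j x)"
    if ij: "j + 1 < i" "i \<le> n + 1" "x \<in> carrier (A n)" for n i j x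
  proof (cases "i \<le> n")
    case False
    then have i: "i = Suc n" "j < n" using ij by auto
    then obtain m where m: "n = Suc m" by (cases n) auto
    \<comment> \<open>Pulling the cyclic operator out raises the codegeneracy index, and what
      remains inside involves only the zeroth coface.\<close>
    have "s (Suc n) j (t (Suc n) (d n 0 x)) = t n (s (Suc n) (Suc j) (d n 0 x))"
      using t_s[of "Suc j" "Suc n" "d n 0 x"] i ij by (simp add: dc)
    also have "s (Suc n) (Suc j) (d n 0 x) = d m 0 (s n j x)"
      using s_d_less[of 0 "Suc j" n x] i ij m by simp
    also have "t n (d m 0 (s n j x)) = d m n (s n j x)"
      using d_last[of "s n j x" m] sc[of j n x] i ij m by simp
    finally show ?thesis using d_last[of x n] i ij m by simp
  qed (use s_d_greater[of j i n x] ij in simp)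
  show "t (n + 1) (d n i x) = d n (i - 1) (t n x)" if "1 \<le> i" "i \<le> n + 1" "x \<in> carrier (A n)" for n i x
    using t_d'[of i n x] that by simp
  show "t (n + 1) (d n 0 x) = d n (n + 1) x" if "x \<in> carrier (A n)" for n x
    using d_last[OF that] by simp
  show "t (n - 1) (s n i x) = s n (i - 1) (t n x)" if "1 \<le> i" "i < n" "x \<in> carrier (A n)" for n i x
    by (rule t_s[OF that])
  show "t (n - 1) (s n 0 x) = s n (n - 1) (t n (t n x))" if "1 \<le> n" "x \<in> carrier (A n)" for n x
    by (rule t_s_0[OF that])
qed

section \<open>Comultiplication and counit in one entry of a list\<close>

lemma split_list_at:
  assumes "i < length xs"
  obtains l a r where "xs = l @ a # r" "length l = i"
  by (rule that[OF id_take_nth_drop[OF assms]]) (use assms in simp)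

lemma split_list_at2:
  assumes "i < j" "j < length xs"
  obtains l a m b r where "xs = l @ a # m @ b # r" "length l = i" "length m = j - Suc i"
proof -
  have "i < length xs" using assms by simp
  then obtain l a r where 1: "xs = l @ a # r" "length l = i" by (rule split_list_at)
  then have "j - Suc i < length r" using assms by auto
  then obtain m b r' where "r = m @ b # r'" "length m = j - Suc i" by (rule split_list_at)
  with 1 show thesis using that by simp
qed

text \<open>If the varying slot is the entry being comultiplied, linearity comes from the coproduct;
  otherwise the comultiplied entry is fixed and linearity comes from K. The three cases place the
  slot after, at or before position i.\<close>

lemma (in coalgebra) mlin_dup:
  assumes L: "module k L" and K: "mlin k C (Suc n) L K" and i: "i < n"
  shows "mlin k C n L (\<lambda>xs. D L (xs ! i) (\<lambda>x y. K (take i xs @ x # y # drop (Suc i) xs)))"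
proof (rule mlinI)
  fix xs ys assume *: "set xs \<subseteq> carrier C" "set ys \<subseteq> carrier C" "Suc (length xs + length ys) = n"
  consider "i < length xs" | "i = length xs" | "length xs < i" by linarith
  then show "(\<lambda>z. D L ((xs @ z # ys) ! i) (\<lambda>x y. K (take i (xs @ z # ys) @ x # y # drop (Suc i) (xs @ z # ys))))
    \<in> lin_maps k C L"
  proof cases
    case 1
    then obtain l a r where "xs = l @ a # r" "length l = i" by (rule split_list_at)
    then show ?thesis using *
      by (simp add: nth_append) (intro lin_D_param[OF L module_axioms] lin_mlin[OF K] slot_intros lin_ident; auto)
  next
    case 2
    then show ?thesis using *
      by simp (intro lin_D[OF L] lin_mlin[OF K] slot_intros lin_ident; auto)
  next
    case 3
    then have "i - Suc (length xs) < length ys" using * i by auto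
    then obtain l a r where ys: "ys = l @ a # r" "length l = i - Suc (length xs)"
      by (rule split_list_at)
    then have i: "i = Suc (length xs + length l)" using 3 by simp
    show ?thesis unfolding i ys(1) using *(1,2) *(3) ys(1)
      by (simp add: nth_append) (intro lin_D_param[OF L module_axioms] lin_mlin[OF K] slot_intros lin_ident; auto)
  qed
next
  fix xs assume *: "length xs = n" "set xs \<subseteq> carrier C"
  then have "i < length xs" using i by simp
  then obtain l a r where "xs = l @ a # r" "length l = i" by (rule split_list_at)
  then show "D L (xs ! i) (\<lambda>x y. K (take i xs @ x # y # drop (Suc i) xs)) \<in> carrier L"
    using * by (auto intro!: D_closed[OF L] mlin_closed[OF K])
qed

lemma (in coalgebra) mlin_del:
  assumes L: "module k L" and K: "mlin k C n L K" and i: "i \<le> n"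
  shows "mlin k C (Suc n) L (\<lambda>xs. \<epsilon>\<^bsub>C\<^esub> (xs ! i) \<odot>\<^bsub>L\<^esub> K (take i xs @ drop (Suc i) xs))"
proof (rule mlinI)
  fix xs ys assume *: "set xs \<subseteq> carrier C" "set ys \<subseteq> carrier C" "Suc (length xs + length ys) = Suc n"
  consider "i < length xs" | "i = length xs" | "length xs < i" by linarith
  then show "(\<lambda>z. \<epsilon>\<^bsub>C\<^esub> ((xs @ z # ys) ! i) \<odot>\<^bsub>L\<^esub> K (take i (xs @ z # ys) @ drop (Suc i) (xs @ z # ys)))
    \<in> lin_maps k C L"
  proof cases
    case 1
    then obtain l a r where "xs = l @ a # r" "length l = i" by (rule split_list_at)
    then show ?thesis using *
      by (simp add: nth_append) (intro lin_smult_right[OF L] lin_mlin[OF K] slot_intros lin_ident; auto)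
  next
    case 2
    then show ?thesis using *
      by simp (intro lin_smult_left[OF L] lin_counit lin_ident mlin_closed[OF K]; auto)
  next
    case 3
    then have "i - Suc (length xs) < length ys" using * i by auto
    then obtain l a r where ys: "ys = l @ a # r" "length l = i - Suc (length xs)"
      by (rule split_list_at)
    then have i: "i = Suc (length xs + length l)" using 3 by simp
    show ?thesis unfolding i ys(1) using *(1,2) *(3) ys(1)
      by (simp add: nth_append) (intro lin_smult_right[OF L] lin_mlin[OF K] slot_intros lin_ident; auto)
  qed
next
  fix xs assume *: "length xs = Suc n" "set xs \<subseteq> carrier C"
  then have "i < length xs" using i by simp
  then obtain l a r where "xs = l @ a # r" "length l = i" by (rule split_list_at)
  then show "\<epsilon>\<^bsub>C\<^esub> (xs ! i) \<odot>\<^bsub>L\<^esub> K (take i xs @ drop (Suc i) xs) \<in> carrier L"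
    using * by (auto intro!: module.smult_closed[OF L] mlin_closed[OF K])
qed

text \<open>Common pattern of the two directions: \<open>xs\<close> lists the factors from the
  coalgebra M, and g in I is the other list, which stays a spectator. \<open>A_eqI\<close> expresses
  that the elements \<open>P g xs\<close> span. Cofaces are constrained for i up to n only, the last
  one being treated through the cyclic operator.\<close>

locale slot_cosimplicial = coalgebra k M
  for k :: "('k, 'x) ring_scheme" (structure) and M :: "('k, 'm, 'z) coalgebra_scheme" +
  fixes A :: "nat \<Rightarrow> ('k, 'a, 'y) module_scheme" and d s :: "nat \<Rightarrow> nat \<Rightarrow> 'a \<Rightarrow> 'a"
    and P :: "'g \<Rightarrow> 'm list \<Rightarrow> 'a" and I :: "'g set"
  assumes A_module: "module k (A n)"
    and P_mlin: "g \<in> I \<Longrightarrow> mlin k M (Suc n) (A n) (P g)"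
    and A_eqI: "\<And>\<phi> \<psi>. \<lbrakk>\<phi> \<in> lin_maps k (A n) (A m); \<psi> \<in> lin_maps k (A n) (A m);
      \<And>g xs. \<lbrakk>g \<in> I; length xs = Suc n; set xs \<subseteq> carrier M\<rbrakk> \<Longrightarrow> \<phi> (P g xs) = \<psi> (P g xs);
      x \<in> carrier (A n)\<rbrakk> \<Longrightarrow> \<phi> x = \<psi> x"
    and d_lin: "i \<le> n \<Longrightarrow> d n i \<in> lin_maps k (A n) (A (Suc n))"
    and s_lin: "i < n \<Longrightarrow> s n i \<in> lin_maps k (A n) (A (n - 1))"
    and d_P_nth: "\<lbrakk>i \<le> n; g \<in> I; length xs = Suc n; set xs \<subseteq> carrier M\<rbrakk> \<Longrightarrow>
      d n i (P g xs) = D (A (Suc n)) (xs ! i) (\<lambda>x y. P g (take i xs @ x # y # drop (Suc i) xs))"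
    and s_P_nth: "\<lbrakk>i < n; g \<in> I; length xs = Suc n; set xs \<subseteq> carrier M\<rbrakk> \<Longrightarrow>
      s n i (P g xs) = \<epsilon>\<^bsub>M\<^esub> (xs ! Suc i) \<odot>\<^bsub>A (n - 1)\<^esub> P g (take (Suc i) xs @ drop (Suc (Suc i)) xs)"
begin

lemma P_closed: "\<lbrakk>g \<in> I; length xs = Suc n; set xs \<subseteq> carrier M\<rbrakk> \<Longrightarrow> P g xs \<in> carrier (A n)"
  by (rule mlin_closed[OF P_mlin])

lemma d_P:
  "\<lbrakk>i = length l; n = length l + length r; g \<in> I; set l \<subseteq> carrier M; a \<in> carrier M; set r \<subseteq> carrier M\<rbrakk> \<Longrightarrow>
    d n i (P g (l @ a # r)) = D (A (Suc n)) a (\<lambda>x y. P g (l @ x # y # r))"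
  using d_P_nth[of i n g "l @ a # r"] by simp

text \<open>Codegeneracy i deletes entry i + 1, hence the prefix of length i + 1.\<close>

lemma s_P:
  "\<lbrakk>length l = Suc i; n = length l + length r; g \<in> I; set l \<subseteq> carrier M; a \<in> carrier M; set r \<subseteq> carrier M\<rbrakk> \<Longrightarrow>
    s n i (P g (l @ a # r)) = \<epsilon>\<^bsub>M\<^esub> a \<odot>\<^bsub>A (n - 1)\<^esub> P g (l @ r)"
  using s_P_nth[of i n g "l @ a # r"] by (simp add: nth_append)

lemmas d_D = D_commute[OF d_lin A_module A_module]
lemmas s_D = D_commute[OF s_lin A_module A_module]

lemma lin_P: "\<lbrakk>g \<in> I; slot k Z M e; \<And>z. length (e z) = Suc n\<rbrakk> \<Longrightarrow> (\<lambda>z. P g (e z)) \<in> lin_maps k Z (A n)"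
  by (rule lin_mlin[OF P_mlin])

lemma d_d:
  assumes ij: "i < j" "j \<le> Suc n" and x: "x \<in> carrier (A n)"
  shows "d (Suc n) j (d n i x) = d (Suc n) i (d n (j - 1) x)"
proof (rule A_eqI[where x = x and \<phi> = "\<lambda>x. d (Suc n) j (d n i x)" and \<psi> = "\<lambda>x. d (Suc n) i (d n (j - 1) x)"])
  fix g xs assume g: "g \<in> I" and xs: "length xs = Suc n" "set xs \<subseteq> carrier M"
  show "d (Suc n) j (d n i (P g xs)) = d (Suc n) i (d n (j - 1) (P g xs))"
  \<comment> \<open>If j = i + 1, the second coproduct acts on a leg of the first and
    coassociativity decides; otherwise two different entries are involved and the sums are
    exchanged.\<close>
  proof (cases "j = Suc i")
    case True
    then have "i < length xs" using ij xs by simp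
    then obtain l a r where l: "xs = l @ a # r" "length l = i" by (rule split_list_at)
    then have n: "n = length l + length r" using xs by simp
    have dP: "d (Suc n) j (P g (l @ x # y # r)) = D (A (Suc (Suc n))) y (\<lambda>u v. P g (l @ x # u # v # r))" if "x \<in> carrier M" "y \<in> carrier M" for x y
      using that l xs g n True d_P[of j "l @ [x]" "Suc n" r g y] by simp
    have "d (Suc n) j (d n i (P g xs)) = D (A (Suc (Suc n))) a (\<lambda>x y. d (Suc n) j (P g (l @ x # y # r)))"
      using l xs g ij n by (simp add: d_P) (intro d_D, auto intro!: P_closed)
    also have "\<dots> = D (A (Suc (Suc n))) a (\<lambda>x y. D (A (Suc (Suc n))) y (\<lambda>u v. P g (l @ x # u # v # r)))"
      using l xs by (intro D_cong) (auto simp: dP)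
    also have "\<dots> = D (A (Suc (Suc n))) a (\<lambda>x y. D (A (Suc (Suc n))) x (\<lambda>u v. P g (l @ u # v # y # r)))"
      using l xs g ij n True
      by (intro D_coassoc[OF A_module, symmetric] lin_P slot_intros lin_ident) auto
    also have "\<dots> = D (A (Suc (Suc n))) a (\<lambda>x y. d (Suc n) i (P g (l @ x # y # r)))"
      using l xs g n by (intro D_cong) (auto simp: d_P)
    also have "\<dots> = d (Suc n) i (d n (j - 1) (P g xs))"
      using l xs g ij n True by (simp add: d_P) (intro d_D[symmetric], auto intro!: P_closed)
    finally show ?thesis .
  next
    case False
    then have "i < j - 1" "j - 1 < length xs" using ij xs by auto
    then obtain l a m b r where l: "xs = l @ a # m @ b # r" "length l = i" "length m = j - 1 - Suc i"
      by (rule split_list_at2)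
    then have n: "n = Suc (length l + length m + length r)" and j: "j = Suc (Suc (length l + length m))"
      using xs False ij by auto
    have dP: "d (Suc n) j (P g (l @ x # y # m @ b # r)) = D (A (Suc (Suc n))) b (\<lambda>u v. P g (l @ x # y # m @ u # v # r))" if "x \<in> carrier M" "y \<in> carrier M" for x y
      using that l xs g n j d_P[of j "l @ x # y # m" "Suc n" r g b] by simp
    have "d (Suc n) j (d n i (P g xs)) = D (A (Suc (Suc n))) a (\<lambda>x y. d (Suc n) j (P g (l @ x # y # m @ b # r)))"
      using l xs g ij n by (simp add: d_P) (intro d_D, auto intro!: P_closed)
    also have "\<dots> = D (A (Suc (Suc n))) a (\<lambda>x y. D (A (Suc (Suc n))) b (\<lambda>u v. P g (l @ x # y # m @ u # v # r)))"
      using l xs by (intro D_cong) (auto simp: dP)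
    also have "\<dots> = D (A (Suc (Suc n))) b (\<lambda>u v. D (A (Suc (Suc n))) a (\<lambda>x y. P g (l @ x # y # m @ u # v # r)))"
      using l xs g n j by (intro D_swap[OF A_module] P_closed) auto
    also have "\<dots> = D (A (Suc (Suc n))) b (\<lambda>u v. d (Suc n) i (P g (l @ a # m @ u # v # r)))"
      using l xs g n j by (intro D_cong) (auto simp: d_P)
    also have "\<dots> = d (Suc n) i (D (A (Suc n)) b (\<lambda>u v. P g (l @ a # m @ u # v # r)))"
      using l xs g ij n by (intro d_D[symmetric]) (auto intro!: P_closed)
    also have "D (A (Suc n)) b (\<lambda>u v. P g (l @ a # m @ u # v # r)) = d n (j - 1) (P g xs)"
      using l xs g n j d_P[of "j - 1" "l @ a # m" n r g b] by simp
    finally show ?thesis .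
  qed
qed (use ij x in \<open>auto intro!: lin_comp[OF d_lin d_lin]\<close>)

lemma s_s:
  assumes ij: "i \<le> j" "Suc j < n" and x: "x \<in> carrier (A n)"
  shows "s (n - 1) j (s n i x) = s (n - 1) i (s n (Suc j) x)"
proof (rule A_eqI[where x = x and \<phi> = "\<lambda>x. s (n - 1) j (s n i x)" and \<psi> = "\<lambda>x. s (n - 1) i (s n (Suc j) x)"])
  fix g xs assume g: "g \<in> I" and xs: "length xs = Suc n" "set xs \<subseteq> carrier M"
  \<comment> \<open>Measured in the original list, the two codegeneracies delete entries i + 1 and j
    + 2.\<close>
  have "Suc i < Suc (Suc j)" "Suc (Suc j) < length xs" using ij xs by auto
  then obtain l a m b r where l: "xs = l @ a # m @ b # r" "length l = Suc i" "length m = Suc (Suc j) - Suc (Suc i)"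
    by (rule split_list_at2)
  then have n: "n = Suc (length l + length m + length r)" and j: "Suc j = length l + length m"
    using xs ij by auto
  have n': "n = length l + length (m @ b # r)" using n by simp
  have 1: "s n i (P g xs) = \<epsilon>\<^bsub>M\<^esub> a \<odot>\<^bsub>A (n - 1)\<^esub> P g (l @ m @ b # r)"
    using s_P[OF l(2) n' g] l xs by simp
  have 2: "s n (Suc j) (P g xs) = \<epsilon>\<^bsub>M\<^esub> b \<odot>\<^bsub>A (n - 1)\<^esub> P g (l @ a # m @ r)"
    using l xs g n j s_P[of "l @ a # m" "Suc j" n r g b] by simp
  have "s (n - 1) j (s n i (P g xs)) = \<epsilon>\<^bsub>M\<^esub> a \<odot>\<^bsub>A (n - 1 - 1)\<^esub> (\<epsilon>\<^bsub>M\<^esub> b \<odot>\<^bsub>A (n - 1 - 1)\<^esub> P g (l @ m @ r))"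
    unfolding 1 using l xs g n j ij s_P[of "l @ m" j "n - 1" r g b]
    by (subst lin_smult[OF s_lin]) (auto intro!: P_closed)
  also have "\<dots> = \<epsilon>\<^bsub>M\<^esub> b \<odot>\<^bsub>A (n - 1 - 1)\<^esub> (\<epsilon>\<^bsub>M\<^esub> a \<odot>\<^bsub>A (n - 1 - 1)\<^esub> P g (l @ m @ r))"
    using l xs g n j by (simp add: module.smult_assoc1[OF A_module, symmetric] R.m_comm P_closed)
  also have "\<dots> = s (n - 1) i (s n (Suc j) (P g xs))"
    unfolding 2 using l xs g n j ij
    by (subst lin_smult[OF s_lin]) (auto intro!: P_closed simp: s_P[of l i _ "m @ r"])
  finally show "s (n - 1) j (s n i (P g xs)) = s (n - 1) i (s n (Suc j) (P g xs))" .
next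
  show "(\<lambda>x. s (n - 1) j (s n i x)) \<in> lin_maps k (A n) (A (n - 1 - 1))"
    "(\<lambda>x. s (n - 1) i (s n (Suc j) x)) \<in> lin_maps k (A n) (A (n - 1 - 1))"
    using ij s_lin[of j "n - 1"] s_lin[of i "n - 1"] by (auto intro!: lin_comp[OF _ s_lin])
qed (rule x)

lemma s_d_less:
  assumes ij: "i < j" "j \<le> n" and x: "x \<in> carrier (A n)"
  shows "s (Suc n) j (d n i x) = d (n - 1) i (s n (j - 1) x)"
proof (rule A_eqI[where x = x and \<phi> = "\<lambda>x. s (Suc n) j (d n i x)" and \<psi> = "\<lambda>x. d (n - 1) i (s n (j - 1) x)"])
  fix g xs assume g: "g \<in> I" and xs: "length xs = Suc n" "set xs \<subseteq> carrier M"
  have "i < j" "j < length xs" using ij xs by auto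
  then obtain l a m b r where l: "xs = l @ a # m @ b # r" "length l = i" "length m = j - Suc i"
    by (rule split_list_at2)
  then have n: "n = Suc (length l + length m + length r)" and j: "j = Suc (length l + length m)"
    using xs ij by auto
  have sP: "s (Suc n) j (P g (l @ x # y # m @ b # r)) = \<epsilon>\<^bsub>M\<^esub> b \<odot>\<^bsub>A n\<^esub> P g (l @ x # y # m @ r)" if "x \<in> carrier M" "y \<in> carrier M" for x y
      using that l xs g n j s_P[of "l @ x # y # m" j "Suc n" r g b] by simp
  have "s (Suc n) j (d n i (P g xs)) = D (A n) a (\<lambda>x y. s (Suc n) j (P g (l @ x # y # m @ b # r)))"
    using l xs g ij n s_D[of j "Suc n" a "\<lambda>x y. P g (l @ x # y # m @ b # r)"] by (simp add: d_P P_closed)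
  also have "\<dots> = D (A n) a (\<lambda>x y. \<epsilon>\<^bsub>M\<^esub> b \<odot>\<^bsub>A n\<^esub> P g (l @ x # y # m @ r))"
    using l xs by (intro D_cong) (auto simp: sP)
  also have "\<dots> = \<epsilon>\<^bsub>M\<^esub> b \<odot>\<^bsub>A n\<^esub> D (A n) a (\<lambda>x y. P g (l @ x # y # m @ r))"
    using l xs g n j
    by (intro D_commute[OF lin_smult_right[OF A_module lin_ident] A_module A_module, symmetric]) (auto intro!: P_closed)
  also have "D (A n) a (\<lambda>x y. P g (l @ x # y # m @ r)) = d (n - 1) i (P g (l @ a # m @ r))"
    using l xs g n j by (simp add: d_P)
  also have "\<epsilon>\<^bsub>M\<^esub> b \<odot>\<^bsub>A n\<^esub> \<dots> = d (n - 1) i (\<epsilon>\<^bsub>M\<^esub> b \<odot>\<^bsub>A (n - 1)\<^esub> P g (l @ a # m @ r))"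
    using l xs g n j lin_smult[OF d_lin[of i "n - 1"], of "\<epsilon>\<^bsub>M\<^esub> b" "P g (l @ a # m @ r)"] by (simp add: P_closed)
  also have "\<epsilon>\<^bsub>M\<^esub> b \<odot>\<^bsub>A (n - 1)\<^esub> P g (l @ a # m @ r) = s n (j - 1) (P g xs)"
    using l xs g n j s_P[of "l @ a # m" "j - 1" n r g b] by simp
  finally show "s (Suc n) j (d n i (P g xs)) = d (n - 1) i (s n (j - 1) (P g xs))" .
next
  show "(\<lambda>x. s (Suc n) j (d n i x)) \<in> lin_maps k (A n) (A n)"
    using ij s_lin[of j "Suc n"] by (auto intro!: lin_comp[OF _ d_lin])
  show "(\<lambda>x. d (n - 1) i (s n (j - 1) x)) \<in> lin_maps k (A n) (A n)"
    using ij d_lin[of i "n - 1"] by (auto intro!: lin_comp[OF _ s_lin])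
qed (rule x)

text \<open>Coface i creates two legs at positions i and i + 1. For i = j the codegeneracy deletes
  the second leg, for i = j + 1 the first, so the right and the left counit law apply
  respectively.\<close>

lemma s_d_id:
  assumes ij: "i = j \<or> i = Suc j" "i \<le> n" and x: "x \<in> carrier (A n)"
  shows "s (Suc n) j (d n i x) = x"
proof (rule A_eqI[where x = x and \<phi> = "\<lambda>x. s (Suc n) j (d n i x)" and \<psi> = "\<lambda>x. x"])
  fix g xs assume g: "g \<in> I" and xs: "length xs = Suc n" "set xs \<subseteq> carrier M"
  have "i < length xs" using ij xs by simp
  then obtain l a r where l: "xs = l @ a # r" "length l = i" by (rule split_list_at)
  then have n: "n = length l + length r" using xs by simp
  have sd: "s (Suc n) j (d n i (P g xs)) = D (A n) a (\<lambda>x y. s (Suc n) j (P g (l @ x # y # r)))"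
    using l xs g ij n s_D[of j "Suc n" a "\<lambda>x y. P g (l @ x # y # r)"] by (auto simp add: d_P P_closed)
  show "s (Suc n) j (d n i (P g xs)) = P g xs"
    using ij(1)
  proof
    assume [simp]: "i = j"
    have sP: "s (Suc n) j (P g (l @ x # y # r)) = \<epsilon>\<^bsub>M\<^esub> y \<odot>\<^bsub>A n\<^esub> P g (l @ x # r)" if "x \<in> carrier M" "y \<in> carrier M" for x y
      using that l xs g n s_P[of "l @ [x]" j "Suc n" r g y] by simp
    have "D (A n) a (\<lambda>x y. s (Suc n) j (P g (l @ x # y # r))) = D (A n) a (\<lambda>x y. \<epsilon>\<^bsub>M\<^esub> y \<odot>\<^bsub>A n\<^esub> P g (l @ x # r))"
      using l xs by (intro D_cong) (auto simp: sP)
    also have "\<dots> = P g (l @ a # r)"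
      using l xs g n by (intro D_counit_right[OF A_module] lin_P slot_intros lin_ident) auto
    finally show ?thesis using sd l by simp
  next
    assume [simp]: "i = Suc j"
    have sP: "s (Suc n) j (P g (l @ x # y # r)) = \<epsilon>\<^bsub>M\<^esub> x \<odot>\<^bsub>A n\<^esub> P g (l @ y # r)" if "x \<in> carrier M" "y \<in> carrier M" for x y
      using that l xs g n s_P[of l j "Suc n" "y # r" g x] by simp
    have "D (A n) a (\<lambda>x y. s (Suc n) j (P g (l @ x # y # r))) = D (A n) a (\<lambda>x y. \<epsilon>\<^bsub>M\<^esub> x \<odot>\<^bsub>A n\<^esub> P g (l @ y # r))"
      using l xs by (intro D_cong) (auto simp: sP)
    also have "\<dots> = P g (l @ a # r)"
      using l xs g n by (intro D_counit_left[OF A_module] lin_P slot_intros lin_ident) auto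
    finally show ?thesis using sd l by simp
  qed
next
  show "(\<lambda>x. s (Suc n) j (d n i x)) \<in> lin_maps k (A n) (A n)"
    using ij s_lin[of j "Suc n"] by (auto intro!: lin_comp[OF _ d_lin])
qed (rule lin_ident x)+

lemma s_d_greater:
  assumes ij: "Suc j < i" "i \<le> n" and x: "x \<in> carrier (A n)"
  shows "s (Suc n) j (d n i x) = d (n - 1) (i - 1) (s n j x)"
proof (rule A_eqI[where x = x and \<phi> = "\<lambda>x. s (Suc n) j (d n i x)" and \<psi> = "\<lambda>x. d (n - 1) (i - 1) (s n j x)"])
  fix g xs assume g: "g \<in> I" and xs: "length xs = Suc n" "set xs \<subseteq> carrier M"
  have "Suc j < i" "i < length xs" using ij xs by auto
  then obtain l b m a r where l: "xs = l @ b # m @ a # r" "length l = Suc j" "length m = i - Suc (Suc j)"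
    by (rule split_list_at2)
  then have n: "n = Suc (length l + length m + length r)" and i: "i = Suc (length l + length m)"
    using xs ij by auto
  have "d n i (P g xs) = D (A (Suc n)) a (\<lambda>x y. P g (l @ b # m @ x # y # r))"
    using l xs g n i d_P[of i "l @ b # m" n r g a] by simp
  then have sd: "s (Suc n) j (d n i (P g xs)) = D (A n) a (\<lambda>x y. s (Suc n) j (P g (l @ b # m @ x # y # r)))"
    using l xs g ij n s_D[of j "Suc n" a "\<lambda>x y. P g (l @ b # m @ x # y # r)"] by (simp add: P_closed)
  have sP: "s (Suc n) j (P g (l @ b # m @ x # y # r)) = \<epsilon>\<^bsub>M\<^esub> b \<odot>\<^bsub>A n\<^esub> P g (l @ m @ x # y # r)" if "x \<in> carrier M" "y \<in> carrier M" for x y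
      using that l xs g n s_P[of l j "Suc n" "m @ x # y # r" g b] by simp
  note sd
  also have "D (A n) a (\<lambda>x y. s (Suc n) j (P g (l @ b # m @ x # y # r))) = D (A n) a (\<lambda>x y. \<epsilon>\<^bsub>M\<^esub> b \<odot>\<^bsub>A n\<^esub> P g (l @ m @ x # y # r))"
    using l xs by (intro D_cong) (auto simp: sP)
  also have "\<dots> = \<epsilon>\<^bsub>M\<^esub> b \<odot>\<^bsub>A n\<^esub> D (A n) a (\<lambda>x y. P g (l @ m @ x # y # r))"
    using l xs g n
    by (intro D_commute[OF lin_smult_right[OF A_module lin_ident] A_module A_module, symmetric]) (auto intro!: P_closed)
  also have "D (A n) a (\<lambda>x y. P g (l @ m @ x # y # r)) = d (n - 1) (i - 1) (P g (l @ m @ a # r))"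
    using l xs g n i d_P[of "i - 1" "l @ m" "n - 1" r g a] by simp
  also have "\<epsilon>\<^bsub>M\<^esub> b \<odot>\<^bsub>A n\<^esub> \<dots> = d (n - 1) (i - 1) (\<epsilon>\<^bsub>M\<^esub> b \<odot>\<^bsub>A (n - 1)\<^esub> P g (l @ m @ a # r))"
    using l xs g n i lin_smult[OF d_lin[of "i - 1" "n - 1"], of "\<epsilon>\<^bsub>M\<^esub> b" "P g (l @ m @ a # r)"] by (simp add: P_closed)
  also have "\<epsilon>\<^bsub>M\<^esub> b \<odot>\<^bsub>A (n - 1)\<^esub> P g (l @ m @ a # r) = s n j (P g xs)"
    using l xs g n by (simp add: s_P)
  finally show "s (Suc n) j (d n i (P g xs)) = d (n - 1) (i - 1) (s n j (P g xs))" .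
next
  show "(\<lambda>x. s (Suc n) j (d n i x)) \<in> lin_maps k (A n) (A n)"
    using ij s_lin[of j "Suc n"] by (auto intro!: lin_comp[OF _ d_lin])
  show "(\<lambda>x. d (n - 1) (i - 1) (s n j x)) \<in> lin_maps k (A n) (A n)"
    using ij d_lin[of "i - 1" "n - 1"] by (auto intro!: lin_comp[OF _ s_lin])
qed (rule x)

end

section \<open>The operators on the crossed product\<close>

locale crossed_product = comodule_coalgebra k H C
  for k :: "('k, 'x) ring_scheme" (structure) and H :: "('k, 'h, 'y) hopf_algebra_scheme"
    and C :: "('k, 'h, 'c, 'z) comodule_coalgebra_scheme" +
  assumes S_bij: "bij_betw (antipode H) (carrier H) (carrier H)"
begin

abbreviation A where "A p q \<equiv> tensor k H (Suc p) C (Suc q)"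
abbreviation pt where "pt \<equiv> pure_tensor k H C"
abbreviation Si where "Si \<equiv> antipode_inv H"
abbreviation "dd \<equiv> CH_partial k H C"
abbreviation "ss \<equiv> CH_sigma k H C"
abbreviation "tt \<equiv> CH_tau k H C"
abbreviation "db \<equiv> CH_partial_bar k H C"
abbreviation "sb \<equiv> CH_sigma_bar k H C"
abbreviation "tb \<equiv> CH_tau_bar k H C"

lemmas Si_closed [simp] = H.Si_closed[OF S_bij]
lemmas Si_linear = H.Si_linear[OF S_bij]
lemmas lin_Si = lin_comp[OF Si_linear]

lemma Si_one: "Si \<one>\<^bsub>H\<^esub> = \<one>\<^bsub>H\<^esub>"
  by (rule H.S_inj[OF S_bij]) (simp_all add: H.S_Si[OF S_bij] H.S_one)

lemma CH_A: "CH k H C p q = A p q"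
  by (simp add: CH_def)

lemma A_module: "module k (A p q)"
  by (rule HC.tensor_module)

lemma pt_closed:
  "\<lbrakk>length gs = Suc p; set gs \<subseteq> carrier H; length as = Suc q; set as \<subseteq> carrier C\<rbrakk> \<Longrightarrow> pt gs as \<in> carrier (A p q)"
  by (intro HC.pure_closed) auto

lemma mlin_pt1: "\<lbrakk>length as = Suc q; set as \<subseteq> carrier C\<rbrakk> \<Longrightarrow> mlin k H (Suc p) (A p q) (\<lambda>gs. pt gs as)"
  by (rule mlin2D(1)[OF HC.pure_mlin2])

lemma mlin_pt2: "\<lbrakk>length gs = Suc p; set gs \<subseteq> carrier H\<rbrakk> \<Longrightarrow> mlin k C (Suc q) (A p q) (pt gs)"
  by (rule mlin2D(2)[OF HC.pure_mlin2])

lemma lin_pt1: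
  "\<lbrakk>slot k Z H e; \<And>z. length (e z) = Suc p; length as = Suc q; set as \<subseteq> carrier C\<rbrakk> \<Longrightarrow>
    (\<lambda>z. pt (e z) as) \<in> lin_maps k Z (A p q)"
  by (rule lin_mlin[OF mlin_pt1])

lemma lin_pt2:
  "\<lbrakk>slot k Z C e; \<And>z. length (e z) = Suc q; length gs = Suc p; set gs \<subseteq> carrier H\<rbrakk> \<Longrightarrow>
    (\<lambda>z. pt gs (e z)) \<in> lin_maps k Z (A p q)"
  by (rule lin_mlin[OF mlin_pt2])

lemma A_eqI:
  assumes "f \<in> lin_maps k (A p q) L" "g \<in> lin_maps k (A p q) L" "module k L"
    and "\<And>gs as. \<lbrakk>length gs = Suc p; set gs \<subseteq> carrier H; length as = Suc q; set as \<subseteq> carrier C\<rbrakk> \<Longrightarrow>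
      f (pt gs as) = g (pt gs as)"
    and "x \<in> carrier (A p q)"
  shows "f x = g x"
  by (rule HC.tensor_eqI[OF assms(3,1,2) _ assms(5)]) (use assms(4) in simp)

lemma mlin_DC_param:
  assumes L: "module k L" and Z: "module k Z" and a: "a \<in> carrier C"
    and K: "\<And>x y. \<lbrakk>x \<in> carrier C; y \<in> carrier C\<rbrakk> \<Longrightarrow> mlin k Z n L (\<lambda>gs. K gs x y)"
  shows "mlin k Z n L (\<lambda>gs. C.D L a (K gs))"
  by (rule mlinI)
    (auto intro!: C.D_closed[OF L a] C.lin_D_param[OF L Z a] intro: mlin_closed[OF K] mlin_slot[OF K])

lemma mlin_DH_param:
  assumes L: "module k L" and Z: "module k Z" and a: "a \<in> carrier H"
    and K: "\<And>x y. \<lbrakk>x \<in> carrier H; y \<in> carrier H\<rbrakk> \<Longrightarrow> mlin k Z n L (\<lambda>gs. K gs x y)"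
  shows "mlin k Z n L (\<lambda>gs. H.D L a (K gs))"
  by (rule mlinI)
    (auto intro!: H.D_closed[OF L a] H.lin_D_param[OF L Z a] intro: mlin_closed[OF K] mlin_slot[OF K])

lemma mlin_R_param:
  assumes L: "module k L" and Z: "module k Z" and a: "a \<in> carrier C"
    and K: "\<And>x y. \<lbrakk>x \<in> carrier H; y \<in> carrier C\<rbrakk> \<Longrightarrow> mlin k Z n L (\<lambda>gs. K gs x y)"
  shows "mlin k Z n L (\<lambda>gs. R L a (K gs))"
  by (rule mlinI)
    (auto intro!: R_closed[OF L a] lin_R_param[OF L Z a] intro: mlin_closed[OF K] mlin_slot[OF K])

lemma mlin_smult:
  assumes L: "module k L" and K: "mlin k Z n L K" and c: "c \<in> carrier k"
  shows "mlin k Z n L (\<lambda>gs. c \<odot>\<^bsub>L\<^esub> K gs)"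
  by (rule mlinI)
    (use c in \<open>auto intro!: lin_smult_right[OF L] module.smult_closed[OF L] intro: mlin_closed[OF K] mlin_slot[OF K]\<close>)

section \<open>Multilinearity of the formulas for the operators\<close>

lemma dd_mlin2:
  assumes i: "i \<le> q"
  shows "mlin2 k H (Suc p) C (Suc q) (A p (Suc q))
    (\<lambda>gs as. C.D (A p (Suc q)) (as ! i) (\<lambda>x y. pt gs (take i as @ x # y # drop (Suc i) as)))"
proof (rule mlin2I)
  fix as assume as: "length as = Suc q" "set as \<subseteq> carrier C"
  then have "i < length as" using i by simp
  then obtain l a r where l: "as = l @ a # r" "length l = i" by (rule split_list_at)
  show "mlin k H (Suc p) (A p (Suc q)) (\<lambda>gs. C.D (A p (Suc q)) (as ! i) (\<lambda>x y. pt gs (take i as @ x # y # drop (Suc i) as)))"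
    using as l by (intro mlin_DC_param A_module H.module_axioms mlin_pt1) auto
next
  fix gs assume "length gs = Suc p" "set gs \<subseteq> carrier H"
  then show "mlin k C (Suc q) (A p (Suc q)) (\<lambda>as. C.D (A p (Suc q)) (as ! i) (\<lambda>x y. pt gs (take i as @ x # y # drop (Suc i) as)))"
    using i by (intro C.mlin_dup A_module mlin_pt2) auto
qed

lemma ss_mlin2:
  assumes i: "i \<le> Suc q"
  shows "mlin2 k H (Suc p) C (Suc (Suc q)) (A p q)
    (\<lambda>gs as. \<epsilon>\<^bsub>C\<^esub> (as ! i) \<odot>\<^bsub>A p q\<^esub> pt gs (take i as @ drop (Suc i) as))"
proof (rule mlin2I)
  fix as assume as: "length as = Suc (Suc q)" "set as \<subseteq> carrier C"
  then have "i < length as" using i by simp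
  then obtain l a r where l: "as = l @ a # r" "length l = i" by (rule split_list_at)
  show "mlin k H (Suc p) (A p q) (\<lambda>gs. \<epsilon>\<^bsub>C\<^esub> (as ! i) \<odot>\<^bsub>A p q\<^esub> pt gs (take i as @ drop (Suc i) as))"
    using as l by (intro mlin_smult A_module mlin_pt1) auto
next
  fix gs assume "length gs = Suc p" "set gs \<subseteq> carrier H"
  then show "mlin k C (Suc (Suc q)) (A p q) (\<lambda>as. \<epsilon>\<^bsub>C\<^esub> (as ! i) \<odot>\<^bsub>A p q\<^esub> pt gs (take i as @ drop (Suc i) as))"
    using i by (intro C.mlin_del A_module mlin_pt2) auto
qed

lemma db_mlin2:
  assumes i: "i \<le> p"
  shows "mlin2 k H (Suc p) C (Suc q) (A (Suc p) q)
    (\<lambda>gs as. H.D (A (Suc p) q) (gs ! i) (\<lambda>x y. pt (take i gs @ x # y # drop (Suc i) gs) as))"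
proof (rule mlin2I)
  fix gs assume gs: "length gs = Suc p" "set gs \<subseteq> carrier H"
  then have "i < length gs" using i by simp
  then obtain l a r where l: "gs = l @ a # r" "length l = i" by (rule split_list_at)
  show "mlin k C (Suc q) (A (Suc p) q) (\<lambda>as. H.D (A (Suc p) q) (gs ! i) (\<lambda>x y. pt (take i gs @ x # y # drop (Suc i) gs) as))"
    using gs l by (intro mlin_DH_param A_module C.module_axioms mlin_pt2) auto
next
  fix as assume "length as = Suc q" "set as \<subseteq> carrier C"
  then show "mlin k H (Suc p) (A (Suc p) q) (\<lambda>gs. H.D (A (Suc p) q) (gs ! i) (\<lambda>x y. pt (take i gs @ x # y # drop (Suc i) gs) as))"
    using i by (intro H.mlin_dup[where K = "\<lambda>gs. pt gs as"] A_module mlin_pt1) auto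
qed

lemma sb_mlin2:
  assumes i: "i \<le> Suc p"
  shows "mlin2 k H (Suc (Suc p)) C (Suc q) (A p q)
    (\<lambda>gs as. \<epsilon>\<^bsub>H\<^esub> (gs ! i) \<odot>\<^bsub>A p q\<^esub> pt (take i gs @ drop (Suc i) gs) as)"
proof (rule mlin2I)
  fix gs assume gs: "length gs = Suc (Suc p)" "set gs \<subseteq> carrier H"
  then have "i < length gs" using i by simp
  then obtain l a r where l: "gs = l @ a # r" "length l = i" by (rule split_list_at)
  show "mlin k C (Suc q) (A p q) (\<lambda>as. \<epsilon>\<^bsub>H\<^esub> (gs ! i) \<odot>\<^bsub>A p q\<^esub> pt (take i gs @ drop (Suc i) gs) as)"
    using gs l by (intro mlin_smult A_module mlin_pt2) auto
next
  fix as assume "length as = Suc q" "set as \<subseteq> carrier C"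
  then show "mlin k H (Suc (Suc p)) (A p q) (\<lambda>gs. \<epsilon>\<^bsub>H\<^esub> (gs ! i) \<odot>\<^bsub>A p q\<^esub> pt (take i gs @ drop (Suc i) gs) as)"
    using i by (intro H.mlin_del[where K = "\<lambda>gs. pt gs as"] A_module mlin_pt1) auto
qed

lemma act_pt_closed:
  "\<lbrakk>h \<in> carrier H; length gs = Suc p; set gs \<subseteq> carrier H; length as = Suc q; set as \<subseteq> carrier C\<rbrakk> \<Longrightarrow>
    H.act (A p q) gs h (\<lambda>r. pt r as) \<in> carrier (A p q)"
  by (intro H.act_closed[OF A_module] pt_closed) auto

text \<open>The first coalgebra entry enters through the coaction and the others only as parameters,
  hence the case distinction on the position of the varying slot.\<close>

lemma tt_mlin2:
  "mlin2 k H (Suc p) C (Suc q) (A p q)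
    (\<lambda>gs as. R (A p q) (hd as) (\<lambda>h b. H.act (A p q) gs (Si h) (\<lambda>r. pt r (tl as @ [b]))))"
proof (rule mlin2I)
  fix as assume "length as = Suc q" "set as \<subseteq> carrier C"
  then show "mlin k H (Suc p) (A p q) (\<lambda>gs. R (A p q) (hd as) (\<lambda>h b. H.act (A p q) gs (Si h) (\<lambda>r. pt r (tl as @ [b]))))"
    by (auto simp: length_Suc_conv intro!: mlin_R_param A_module H.module_axioms H.mlin_act mlin_pt1)
next
  fix gs assume gs: "length gs = Suc p" "set gs \<subseteq> carrier H"
  show "mlin k C (Suc q) (A p q) (\<lambda>as. R (A p q) (hd as) (\<lambda>h b. H.act (A p q) gs (Si h) (\<lambda>r. pt r (tl as @ [b]))))"
  proof (rule mlinI)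
    fix xs ys assume xs: "set xs \<subseteq> carrier C" "set ys \<subseteq> carrier C" "Suc (length xs + length ys) = Suc q"
    show "(\<lambda>a. R (A p q) (hd (xs @ a # ys)) (\<lambda>h b. H.act (A p q) gs (Si h) (\<lambda>r. pt r (tl (xs @ a # ys) @ [b])))) \<in> lin_maps k C (A p q)"
    proof (cases xs)
      case Nil
      then show ?thesis using gs xs
        by simp (intro lin_R H.lin_act H.lin_act_param lin_Si lin_ident lin_pt2 A_module C.module_axioms slot_intros; auto intro!: mlin_pt1)
    next
      case (Cons x xs')
      then show ?thesis using gs xs
        by simp (intro lin_R_param H.lin_act_param lin_ident lin_pt2 A_module C.module_axioms slot_intros; auto)
    qed
  qed (use gs in \<open>auto simp: length_Suc_conv intro!: R_closed A_module act_pt_closed\<close>)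
qed

lemma tb_mlin2:
  "mlin2 k H (Suc p) C (Suc q) (A p q)
    (\<lambda>gs as. co (A p q) as (\<lambda>u bs. pt (tl gs @ [u \<otimes>\<^bsub>H\<^esub> hd gs]) bs))"
proof (rule mlin2I)
  fix as assume as: "length as = Suc q" "set as \<subseteq> carrier C"
  show "mlin k H (Suc p) (A p q) (\<lambda>gs. co (A p q) as (\<lambda>u bs. pt (tl gs @ [u \<otimes>\<^bsub>H\<^esub> hd gs]) bs))"
  proof (rule mlinI)
    fix xs ys assume xs: "set xs \<subseteq> carrier H" "set ys \<subseteq> carrier H" "Suc (length xs + length ys) = Suc p"
    show "(\<lambda>a. co (A p q) as (\<lambda>u bs. pt (tl (xs @ a # ys) @ [u \<otimes>\<^bsub>H\<^esub> hd (xs @ a # ys)]) bs)) \<in> lin_maps k H (A p q)"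
    proof (cases xs)
      case Nil
      then show ?thesis using as xs
        by simp (intro lin_co_param lin_pt1 A_module H.module_axioms slot_intros H.lin_mult_right lin_ident; auto)
    next
      case (Cons x xs')
      then show ?thesis using as xs
        by simp (intro lin_co_param lin_pt1 A_module H.module_axioms slot_intros lin_ident; auto)
    qed
  qed (use as in \<open>auto simp: length_Suc_conv intro!: co_closed A_module pt_closed\<close>)
next
  fix gs assume "length gs = Suc p" "set gs \<subseteq> carrier H"
  then show "mlin k C (Suc q) (A p q) (\<lambda>as. co (A p q) as (\<lambda>u bs. pt (tl gs @ [u \<otimes>\<^bsub>H\<^esub> hd gs]) bs))"
    by (auto simp: length_Suc_conv
        intro!: mlin_co A_module mlin_pt2 lin_pt1 slot_append2 slot_here H.lin_mult_left lin_ident slot_Cons)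
qed

text \<open>The inverse of the paracocyclic operator, which does not involve the antipode.\<close>

definition om where
  "om p q t = lin_ext k (A p q) t (\<lambda>gs as.
    R (A p q) (last as) (\<lambda>h b. H.act (A p q) gs h (\<lambda>r. pt r (b # butlast as))))"

lemma om_mlin2:
  "mlin2 k H (Suc p) C (Suc q) (A p q)
    (\<lambda>gs as. R (A p q) (last as) (\<lambda>h b. H.act (A p q) gs h (\<lambda>r. pt r (b # butlast as))))"
proof (rule mlin2I)
  fix as assume as: "length as = Suc q" "set as \<subseteq> carrier C"
  then obtain l a where "as = l @ [a]" by (cases as rule: rev_cases) auto
  then show "mlin k H (Suc p) (A p q) (\<lambda>gs. R (A p q) (last as) (\<lambda>h b. H.act (A p q) gs h (\<lambda>r. pt r (b # butlast as))))"
    using as by (auto intro!: mlin_R_param A_module H.module_axioms H.mlin_act mlin_pt1)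
next
  fix gs assume gs: "length gs = Suc p" "set gs \<subseteq> carrier H"
  show "mlin k C (Suc q) (A p q) (\<lambda>as. R (A p q) (last as) (\<lambda>h b. H.act (A p q) gs h (\<lambda>r. pt r (b # butlast as))))"
  proof (rule mlinI)
    fix xs ys assume xs: "set xs \<subseteq> carrier C" "set ys \<subseteq> carrier C" "Suc (length xs + length ys) = Suc q"
    show "(\<lambda>a. R (A p q) (last (xs @ a # ys)) (\<lambda>h b. H.act (A p q) gs h (\<lambda>r. pt r (b # butlast (xs @ a # ys))))) \<in> lin_maps k C (A p q)"
    proof (cases ys rule: rev_cases)
      case Nil
      then show ?thesis using gs xs
        by simp (intro lin_R H.lin_act H.lin_act_param lin_ident lin_pt2 A_module C.module_axioms slot_intros; auto intro!: mlin_pt1)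
    next
      case (snoc ys' y)
      then show ?thesis using gs xs
        by (simp add: butlast_append)
          (intro lin_R_param H.lin_act_param lin_ident lin_pt2 A_module C.module_axioms slot_intros; auto)
    qed
  next
    fix as assume as: "length as = Suc q" "set as \<subseteq> carrier C"
    then obtain l a where "as = l @ [a]" by (cases as rule: rev_cases) auto
    then show "R (A p q) (last as) (\<lambda>h b. H.act (A p q) gs h (\<lambda>r. pt r (b # butlast as))) \<in> carrier (A p q)"
      using as gs by (auto intro!: R_closed A_module act_pt_closed)
  qed
qed

text \<open>Turns a multilinear formula for an operator into its linearity and its value on pure
  tensors. The formula is asked for on the carrier, since passing from \<open>diag_act\<close> and
  \<open>diag_coaction\<close> to the continuation form presupposes entries in the carriers.\<close>

lemma operatorI:
  assumes F: "mlin2 k H (Suc p) C (Suc q) L F" and L: "module k L"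
    and f: "\<And>t. t \<in> carrier (A p q) \<Longrightarrow> f t = lin_ext k L t F"
  shows "f \<in> lin_maps k (A p q) L"
    and "\<lbrakk>length gs = Suc p; set gs \<subseteq> carrier H; length as = Suc q; set as \<subseteq> carrier C\<rbrakk> \<Longrightarrow> f (pt gs as) = F gs as"
proof -
  show "f \<in> lin_maps k (A p q) L"
    by (subst lin_maps_cong[OF A_module f], assumption) (rule HC.lin_ext_lin[OF L F])
  assume *: "length gs = Suc p" "set gs \<subseteq> carrier H" "length as = Suc q" "set as \<subseteq> carrier C"
  then show "f (pt gs as) = F gs as"
    by (subst f) (auto intro!: pt_closed HC.lin_ext_pure[OF L F])
qed

lemma dd_eq:
  assumes "i \<le> q" "t \<in> carrier (A p q)"
  shows "dd p q i t = lin_ext k (A p (Suc q)) t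
    (\<lambda>gs as. C.D (A p (Suc q)) (as ! i) (\<lambda>x y. pt gs (take i as @ x # y # drop (Suc i) as)))"
  using assms(1) by (simp add: CH_partial_def CH_A)

lemma dd_lin: "i \<le> q \<Longrightarrow> dd p q i \<in> lin_maps k (A p q) (A p (Suc q))"
  by (rule operatorI(1)[OF dd_mlin2 A_module dd_eq]) auto

lemma dd_nth:
  "\<lbrakk>i \<le> q; length gs = Suc p; set gs \<subseteq> carrier H; length as = Suc q; set as \<subseteq> carrier C\<rbrakk> \<Longrightarrow>
    dd p q i (pt gs as) = C.D (A p (Suc q)) (as ! i) (\<lambda>x y. pt gs (take i as @ x # y # drop (Suc i) as))"
  by (rule operatorI(2)[OF dd_mlin2 A_module dd_eq]) auto

lemma ss_eq:
  assumes "t \<in> carrier (A p (Suc q))"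
  shows "ss p (Suc q) i t = lin_ext k (A p q) t
    (\<lambda>gs as. \<epsilon>\<^bsub>C\<^esub> (as ! Suc i) \<odot>\<^bsub>A p q\<^esub> pt gs (take (Suc i) as @ drop (Suc (Suc i)) as))"
  by (simp add: CH_sigma_def CH_A)

lemma ss_lin: "i \<le> q \<Longrightarrow> ss p (Suc q) i \<in> lin_maps k (A p (Suc q)) (A p q)"
  by (rule operatorI(1)[OF ss_mlin2 A_module ss_eq]) auto

lemma ss_nth:
  "\<lbrakk>i \<le> q; length gs = Suc p; set gs \<subseteq> carrier H; length as = Suc (Suc q); set as \<subseteq> carrier C\<rbrakk> \<Longrightarrow>
    ss p (Suc q) i (pt gs as) =
      \<epsilon>\<^bsub>C\<^esub> (as ! Suc i) \<odot>\<^bsub>A p q\<^esub> pt gs (take (Suc i) as @ drop (Suc (Suc i)) as)"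
  by (rule operatorI(2)[OF ss_mlin2 A_module ss_eq]) auto

lemma db_eq:
  assumes "i \<le> p" "t \<in> carrier (A p q)"
  shows "db p q i t = lin_ext k (A (Suc p) q) t
    (\<lambda>gs as. H.D (A (Suc p) q) (gs ! i) (\<lambda>x y. pt (take i gs @ x # y # drop (Suc i) gs) as))"
  using assms(1) by (simp add: CH_partial_bar_def CH_A)

lemma db_lin: "i \<le> p \<Longrightarrow> db p q i \<in> lin_maps k (A p q) (A (Suc p) q)"
  by (rule operatorI(1)[OF db_mlin2 A_module db_eq]) auto

lemma db_nth:
  "\<lbrakk>i \<le> p; length gs = Suc p; set gs \<subseteq> carrier H; length as = Suc q; set as \<subseteq> carrier C\<rbrakk> \<Longrightarrow>
    db p q i (pt gs as) = H.D (A (Suc p) q) (gs ! i) (\<lambda>x y. pt (take i gs @ x # y # drop (Suc i) gs) as)"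
  by (rule operatorI(2)[OF db_mlin2 A_module db_eq]) auto

lemma sb_eq:
  assumes "t \<in> carrier (A (Suc p) q)"
  shows "sb (Suc p) q i t = lin_ext k (A p q) t
    (\<lambda>gs as. \<epsilon>\<^bsub>H\<^esub> (gs ! Suc i) \<odot>\<^bsub>A p q\<^esub> pt (take (Suc i) gs @ drop (Suc (Suc i)) gs) as)"
  by (simp add: CH_sigma_bar_def CH_A)

lemma sb_lin: "i \<le> p \<Longrightarrow> sb (Suc p) q i \<in> lin_maps k (A (Suc p) q) (A p q)"
  by (rule operatorI(1)[OF sb_mlin2 A_module sb_eq]) auto

lemma sb_nth:
  "\<lbrakk>i \<le> p; length gs = Suc (Suc p); set gs \<subseteq> carrier H; length as = Suc q; set as \<subseteq> carrier C\<rbrakk> \<Longrightarrow>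
    sb (Suc p) q i (pt gs as) =
      \<epsilon>\<^bsub>H\<^esub> (gs ! Suc i) \<odot>\<^bsub>A p q\<^esub> pt (take (Suc i) gs @ drop (Suc (Suc i)) gs) as"
  by (rule operatorI(2)[OF sb_mlin2 A_module sb_eq]) auto

lemma diag_act_eq:
  assumes "h \<in> carrier H" "length gs = Suc p" "set gs \<subseteq> carrier H" "length as = Suc q" "set as \<subseteq> carrier C"
  shows "diag_act k H C h gs as = H.act (A p q) gs h (\<lambda>r. pt r as)"
  unfolding diag_act_def using assms H.iter_comult_act[OF A_module, of h gs p q "\<lambda>r. pt r as"]
  by (fastforce intro: mlin_pt1)

lemma tt_eq:
  assumes t: "t \<in> carrier (A p q)"
  shows "tt p q t = lin_ext k (A p q) t
    (\<lambda>gs as. R (A p q) (hd as) (\<lambda>h b. H.act (A p q) gs (Si h) (\<lambda>r. pt r (tl as @ [b]))))"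
  unfolding CH_tau_def CH_A R_def[symmetric]
proof (rule HC.lin_ext_cong[OF t], rule R_cong)
  fix gs as h b
  assume *: "gs \<in> vecs H (Suc p)" "as \<in> vecs C (Suc q)" "h \<in> carrier H" "b \<in> carrier C"
  then obtain a l where "as = a # l" by (cases as) auto
  with * show "diag_act k H C (Si h) gs (tl as @ [b]) = H.act (A p q) gs (Si h) (\<lambda>r. pt r (tl as @ [b]))"
    by (intro diag_act_eq) auto
qed (auto simp: length_Suc_conv)

lemma tt_lin: "tt p q \<in> lin_maps k (A p q) (A p q)"
  by (rule operatorI(1)[OF tt_mlin2 A_module tt_eq])

lemma tt_hd:
  "\<lbrakk>length gs = Suc p; set gs \<subseteq> carrier H; length as = Suc q; set as \<subseteq> carrier C\<rbrakk> \<Longrightarrow>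
    tt p q (pt gs as) = R (A p q) (hd as) (\<lambda>h b. H.act (A p q) gs (Si h) (\<lambda>r. pt r (tl as @ [b])))"
  by (rule operatorI(2)[OF tt_mlin2 A_module tt_eq])

lemma tb_eq:
  assumes t: "t \<in> carrier (A p q)"
  shows "tb p q t = lin_ext k (A p q) t (\<lambda>gs as. co (A p q) as (\<lambda>u bs. pt (tl gs @ [u \<otimes>\<^bsub>H\<^esub> hd gs]) bs))"
  unfolding CH_tau_bar_def CH_A
proof (rule HC.lin_ext_cong[OF t])
  fix gs as assume "gs \<in> vecs H (Suc p)" "as \<in> vecs C (Suc q)"
  moreover from this obtain g r where "gs = g # r" by (cases gs) auto
  ultimately show "lin_ext k (A p q) (diag_coaction k H C as) (\<lambda>us bs. pt (tl gs @ [hd us \<otimes>\<^bsub>H\<^esub> hd gs]) bs)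
      = co (A p q) as (\<lambda>u bs. pt (tl gs @ [u \<otimes>\<^bsub>H\<^esub> hd gs]) bs)"
    by (intro diag_coaction_co[where K = "\<lambda>u bs. pt (tl gs @ [u \<otimes>\<^bsub>H\<^esub> hd gs]) bs"] A_module)
      (auto intro!: mlin_pt2 lin_pt1 slot_append2 slot_here H.lin_mult_left lin_ident)
qed

lemma tb_lin: "tb p q \<in> lin_maps k (A p q) (A p q)"
  by (rule operatorI(1)[OF tb_mlin2 A_module tb_eq])

lemma tb_hd:
  "\<lbrakk>length gs = Suc p; set gs \<subseteq> carrier H; length as = Suc q; set as \<subseteq> carrier C\<rbrakk> \<Longrightarrow>
    tb p q (pt gs as) = co (A p q) as (\<lambda>u bs. pt (tl gs @ [u \<otimes>\<^bsub>H\<^esub> hd gs]) bs)"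
  by (rule operatorI(2)[OF tb_mlin2 A_module tb_eq])

lemma om_lin: "om p q \<in> lin_maps k (A p q) (A p q)"
  by (rule operatorI(1)[OF om_mlin2 A_module om_def])

lemma om_last:
  "\<lbrakk>length gs = Suc p; set gs \<subseteq> carrier H; length as = Suc q; set as \<subseteq> carrier C\<rbrakk> \<Longrightarrow>
    om p q (pt gs as) = R (A p q) (last as) (\<lambda>h b. H.act (A p q) gs h (\<lambda>r. pt r (b # butlast as)))"
  by (rule operatorI(2)[OF om_mlin2 A_module om_def])

text \<open>Holds at every t and not just at pure tensors: \<tau> is moved inside the sum over the
  chosen representative, and the integrands agree term by term. Linearity of the last coface is
  later inherited from this equation.\<close>

lemma dd_last:
  assumes t: "t \<in> carrier (A p q)"
  shows "dd p q (Suc q) t = tt p (Suc q) (dd p q 0 t)"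
proof -
  let ?A = "A p (Suc q)"
  have "tt p (Suc q) (dd p q 0 t) = tt p (Suc q) (lin_ext k ?A t
      (\<lambda>gs as. C.D ?A (as ! 0) (\<lambda>x y. pt gs (take 0 as @ x # y # drop (Suc 0) as))))"
    using dd_eq[OF _ t, of 0] by simp
  also have "\<dots> = lin_ext k ?A t (\<lambda>gs as. tt p (Suc q) (C.D ?A (as ! 0) (\<lambda>x y. pt gs (take 0 as @ x # y # drop (Suc 0) as))))"
    by (rule HC.lin_ext_commute[OF A_module A_module t tt_lin])
      (auto simp: length_Suc_conv intro!: C.D_closed A_module pt_closed)
  also have "\<dots> = dd p q (Suc q) t"
  proof (simp add: CH_partial_def CH_A R_def[symmetric], rule HC.lin_ext_cong[OF t])
    fix gs as assume *: "gs \<in> vecs H (Suc p)" "as \<in> vecs C (Suc q)"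
    then obtain a l where as: "as = a # l" by (cases as) auto
    have "tt p (Suc q) (C.D ?A a (\<lambda>x y. pt gs (x # y # l))) = C.D ?A a (\<lambda>x y. tt p (Suc q) (pt gs (x # y # l)))"
      using * as by (intro C.D_commute[OF tt_lin A_module A_module] pt_closed) auto
    also have "\<dots> = C.D ?A a (\<lambda>x y. R ?A x (\<lambda>h b. diag_act k H C (Si h) gs (y # l @ [b])))"
    proof (rule C.D_cong)
      fix x y assume xy: "x \<in> carrier C" "y \<in> carrier C"
      have "tt p (Suc q) (pt gs (x # y # l)) = R ?A x (\<lambda>h b. H.act ?A gs (Si h) (\<lambda>r. pt r (y # l @ [b])))"
        using * as xy by (simp add: tt_hd)
      also have "\<dots> = R ?A x (\<lambda>h b. diag_act k H C (Si h) gs (y # l @ [b]))"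
        using * as xy by (intro R_cong diag_act_eq[symmetric]) auto
      finally show "tt p (Suc q) (pt gs (x # y # l)) = \<dots>" .
    qed (use * as in auto)
    finally show "tt p (Suc q) (C.D ?A (as ! 0) (\<lambda>x y. pt gs (x # y # drop (Suc 0) as)))
      = C.D ?A (hd as) (\<lambda>x y. R ?A x (\<lambda>h b. diag_act k H C (Si h) gs (y # tl as @ [b])))"
      using as by simp
  qed
  finally show ?thesis by simp
qed

text \<open>As for \<open>dd_last\<close>, the sum over the representative is rewritten term by
  term; \<open>diag_coaction_co\<close> supplies the passage between the tensor and the continuation
  form.\<close>

lemma db_last:
  assumes t: "t \<in> carrier (A p q)"
  shows "db p q (Suc p) t = tb (Suc p) q (db p q 0 t)"
proof -
  let ?A = "A (Suc p) q"
  have "tb (Suc p) q (db p q 0 t) = tb (Suc p) q (lin_ext k ?A t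
      (\<lambda>gs as. H.D ?A (gs ! 0) (\<lambda>x y. pt (take 0 gs @ x # y # drop (Suc 0) gs) as)))"
    using db_eq[OF _ t, of 0] by simp
  also have "\<dots> = lin_ext k ?A t (\<lambda>gs as. tb (Suc p) q (H.D ?A (gs ! 0) (\<lambda>x y. pt (take 0 gs @ x # y # drop (Suc 0) gs) as)))"
    by (rule HC.lin_ext_commute[OF A_module A_module t tb_lin])
      (auto simp: length_Suc_conv intro!: H.D_closed A_module pt_closed)
  also have "\<dots> = db p q (Suc p) t"
  proof (simp add: CH_partial_bar_def CH_A, rule HC.lin_ext_cong[OF t])
    fix gs as assume *: "gs \<in> vecs H (Suc p)" "as \<in> vecs C (Suc q)"
    then obtain a l where gs: "gs = a # l" by (cases gs) auto
    have "tb (Suc p) q (H.D ?A a (\<lambda>x y. pt (x # y # l) as)) = H.D ?A a (\<lambda>x y. tb (Suc p) q (pt (x # y # l) as))"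
      using * gs by (intro H.D_commute[OF tb_lin A_module A_module] pt_closed) auto
    also have "\<dots> = H.D ?A a (\<lambda>x y. lin_ext k ?A (diag_coaction k H C as) (\<lambda>us bs. pt (y # l @ [hd us \<otimes>\<^bsub>H\<^esub> x]) bs))"
    proof (rule H.D_cong)
      fix x y assume xy: "x \<in> carrier H" "y \<in> carrier H"
      have "lin_ext k ?A (diag_coaction k H C as) (\<lambda>us bs. pt (y # l @ [hd us \<otimes>\<^bsub>H\<^esub> x]) bs)
        = co ?A as (\<lambda>u bs. pt (y # l @ [u \<otimes>\<^bsub>H\<^esub> x]) bs)"
        using * gs xy by (intro diag_coaction_co[where K = "\<lambda>u bs. pt (y # l @ [u \<otimes>\<^bsub>H\<^esub> x]) bs"] A_module)
          (auto intro!: mlin_pt2 lin_pt1 slot_append2 slot_here slot_Cons H.lin_mult_left lin_ident)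
      then show "tb (Suc p) q (pt (x # y # l) as) = lin_ext k ?A (diag_coaction k H C as) (\<lambda>us bs. pt (y # l @ [hd us \<otimes>\<^bsub>H\<^esub> x]) bs)"
        using * gs xy by (simp add: tb_hd)
    qed (use * gs in auto)
    finally show "tb (Suc p) q (H.D ?A (gs ! 0) (\<lambda>x y. pt (x # y # drop (Suc 0) gs) as))
      = H.D ?A (hd gs) (\<lambda>x y. lin_ext k ?A (diag_coaction k H C as) (\<lambda>us bs. pt (y # tl gs @ [hd us \<otimes>\<^bsub>H\<^esub> x]) bs))"
      using gs by simp
  qed
  finally show ?thesis by simp
qed

end

lemma (in hopf_algebra) act_single:
  assumes L: "module k L" and h: "h \<in> carrier H" and g: "g \<in> carrier H" and K: "mlin k H 1 L K"
  shows "act L [g] h K = K [h \<otimes>\<^bsub>H\<^esub> g]"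
  using assms
  by (simp, intro D_counit_right[OF L h] lin_mlin[OF K] slot_intros lin_mult_left lin_ident) auto

context crossed_product
begin

section \<open>Values of the operators on tuples split at the affected entry\<close>

lemma dd_pt:
  "\<lbrakk>i = length l; q = length l + length r; length gs = Suc p; set gs \<subseteq> carrier H;
    set l \<subseteq> carrier C; a \<in> carrier C; set r \<subseteq> carrier C\<rbrakk> \<Longrightarrow>
    dd p q i (pt gs (l @ a # r)) = C.D (A p (Suc q)) a (\<lambda>x y. pt gs (l @ x # y # r))"
  by (subst dd_nth) auto

lemma ss_pt:
  "\<lbrakk>length l = Suc i; Suc q = length l + length r; length gs = Suc p; set gs \<subseteq> carrier H;
    set l \<subseteq> carrier C; a \<in> carrier C; set r \<subseteq> carrier C\<rbrakk> \<Longrightarrow>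
    ss p (Suc q) i (pt gs (l @ a # r)) = \<epsilon>\<^bsub>C\<^esub> a \<odot>\<^bsub>A p q\<^esub> pt gs (l @ r)"
  by (subst ss_nth) (auto simp: nth_append)

lemma db_pt:
  "\<lbrakk>i = length l; p = length l + length r; length as = Suc q; set as \<subseteq> carrier C;
    set l \<subseteq> carrier H; g \<in> carrier H; set r \<subseteq> carrier H\<rbrakk> \<Longrightarrow>
    db p q i (pt (l @ g # r) as) = H.D (A (Suc p) q) g (\<lambda>x y. pt (l @ x # y # r) as)"
  by (subst db_nth) auto

lemma sb_pt:
  "\<lbrakk>length l = Suc i; Suc p = length l + length r; length as = Suc q; set as \<subseteq> carrier C;
    set l \<subseteq> carrier H; g \<in> carrier H; set r \<subseteq> carrier H\<rbrakk> \<Longrightarrow>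
    sb (Suc p) q i (pt (l @ g # r) as) = \<epsilon>\<^bsub>H\<^esub> g \<odot>\<^bsub>A p q\<^esub> pt (l @ r) as"
  by (subst sb_nth) (auto simp: nth_append)

lemma tt_pt:
  "\<lbrakk>q = length l; length gs = Suc p; set gs \<subseteq> carrier H; a \<in> carrier C; set l \<subseteq> carrier C\<rbrakk> \<Longrightarrow>
    tt p q (pt gs (a # l)) = R (A p q) a (\<lambda>h b. H.act (A p q) gs (Si h) (\<lambda>r. pt r (l @ [b])))"
  by (subst tt_hd) auto

lemma om_pt:
  "\<lbrakk>q = length l; length gs = Suc p; set gs \<subseteq> carrier H; a \<in> carrier C; set l \<subseteq> carrier C\<rbrakk> \<Longrightarrow>
    om p q (pt gs (l @ [a])) = R (A p q) a (\<lambda>h b. H.act (A p q) gs h (\<lambda>r. pt r (b # l)))"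
  by (subst om_last) auto

lemma tb_pt:
  "\<lbrakk>p = length r; length as = Suc q; set as \<subseteq> carrier C; g \<in> carrier H; set r \<subseteq> carrier H\<rbrakk> \<Longrightarrow>
    tb p q (pt (g # r) as) = co (A p q) as (\<lambda>u bs. pt (r @ [u \<otimes>\<^bsub>H\<^esub> g]) bs)"
  by (subst tb_hd) auto

lemmas A_act_closed = H.act_closed[OF A_module]
lemmas A_R_closed = R_closed[OF A_module]
lemmas A_co_closed = co_closed[OF A_module]
lemmas A_DH_closed = H.D_closed[OF A_module]
lemmas A_DC_closed = C.D_closed[OF A_module]
lemmas A_closed = A_act_closed A_R_closed A_co_closed A_DH_closed A_DC_closed pt_closed

text \<open>Tool for iterating \<omega>: on a tuple already acted upon by h, the new coaction leg
  multiplies h from the left, so that a power of \<omega> collects a single product.\<close>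

lemma om_act:
  assumes "q = length l" "length gs = Suc p" "set gs \<subseteq> carrier H" "h \<in> carrier H" "a \<in> carrier C" "set l \<subseteq> carrier C"
  shows "om p q (H.act (A p q) gs h (\<lambda>r. pt r (l @ [a])))
    = R (A p q) a (\<lambda>g c. H.act (A p q) gs (g \<otimes>\<^bsub>H\<^esub> h) (\<lambda>s. pt s (c # l)))"
proof -
  have "om p q (H.act (A p q) gs h (\<lambda>r. pt r (l @ [a]))) = H.act (A p q) gs h (\<lambda>r. om p q (pt r (l @ [a])))"
    using assms by (intro H.act_commute[OF om_lin A_module A_module] pt_closed) auto
  also have "\<dots> = H.act (A p q) gs h (\<lambda>r. R (A p q) a (\<lambda>g c. H.act (A p q) r g (\<lambda>s. pt s (c # l))))"
    using assms by (intro H.act_cong om_pt) auto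
  also have "\<dots> = R (A p q) a (\<lambda>g c. H.act (A p q) gs h (\<lambda>r. H.act (A p q) r g (\<lambda>s. pt s (c # l))))"
    using assms by (intro act_R_swap[OF A_module] A_closed) auto
  also have "\<dots> = R (A p q) a (\<lambda>g c. H.act (A p q) gs (g \<otimes>\<^bsub>H\<^esub> h) (\<lambda>s. pt s (c # l)))"
    using assms by (intro R_cong H.act_mult[OF A_module]) (auto intro!: mlin_pt1)
  finally show ?thesis .
qed

lemma tt_act:
  assumes "q = length l" "length gs = Suc p" "set gs \<subseteq> carrier H" "h \<in> carrier H" "a \<in> carrier C" "set l \<subseteq> carrier C"
  shows "tt p q (H.act (A p q) gs h (\<lambda>r. pt r (a # l)))
    = R (A p q) a (\<lambda>g c. H.act (A p q) gs (Si g \<otimes>\<^bsub>H\<^esub> h) (\<lambda>s. pt s (l @ [c])))"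
proof -
  have "tt p q (H.act (A p q) gs h (\<lambda>r. pt r (a # l))) = H.act (A p q) gs h (\<lambda>r. tt p q (pt r (a # l)))"
    using assms by (intro H.act_commute[OF tt_lin A_module A_module] pt_closed) auto
  also have "\<dots> = H.act (A p q) gs h (\<lambda>r. R (A p q) a (\<lambda>g c. H.act (A p q) r (Si g) (\<lambda>s. pt s (l @ [c]))))"
    using assms by (intro H.act_cong tt_pt) auto
  also have "\<dots> = R (A p q) a (\<lambda>g c. H.act (A p q) gs h (\<lambda>r. H.act (A p q) r (Si g) (\<lambda>s. pt s (l @ [c]))))"
    using assms by (intro act_R_swap[OF A_module] A_closed) auto
  also have "\<dots> = R (A p q) a (\<lambda>g c. H.act (A p q) gs (Si g \<otimes>\<^bsub>H\<^esub> h) (\<lambda>s. pt s (l @ [c])))"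
    using assms by (intro R_cong H.act_mult[OF A_module]) (auto intro!: mlin_pt1)
  finally show ?thesis .
qed

text \<open>Core of the invertibility of \<tau>, for both orders of composition at once.
  Coassociativity turns the second coaction into a coproduct of the first leg, f contracts this
  coproduct to the counit, and the counit law of the coaction finishes.\<close>

lemma R_act_cancel:
  assumes L: "module k L" and a: "a \<in> carrier C" and gs: "set gs \<subseteq> carrier H"
    and f: "\<And>y. y \<in> carrier H \<Longrightarrow> (\<lambda>x. f x y) \<in> lin_maps k H H"
      "\<And>x. x \<in> carrier H \<Longrightarrow> (\<lambda>y. f x y) \<in> lin_maps k H H"
      "\<And>h. h \<in> carrier H \<Longrightarrow> H.D H h f = \<epsilon>\<^bsub>H\<^esub> h \<odot>\<^bsub>H\<^esub> \<one>\<^bsub>H\<^esub>"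
    and K: "\<And>b. b \<in> carrier C \<Longrightarrow> mlin k H (length gs) L (K b)"
      "\<And>s. \<lbrakk>length s = length gs; set s \<subseteq> carrier H\<rbrakk> \<Longrightarrow> (\<lambda>b. K b s) \<in> lin_maps k C L"
  shows "R L a (\<lambda>h b. R L b (\<lambda>h' b'. H.act L gs (f h h') (K b'))) = K a gs"
proof -
  have fc: "f x y \<in> carrier H" if "x \<in> carrier H" "y \<in> carrier H" for x y
    using lin_closed[OF f(1)] that by blast
  have "R L a (\<lambda>h b. R L b (\<lambda>h' b'. H.act L gs (f h h') (K b')))
      = R L a (\<lambda>h b. H.D L h (\<lambda>x y. H.act L gs (f x y) (K b)))"
    using a gs by (intro R_coassoc[OF L, symmetric] H.lin_act[OF L gs] H.lin_act_param[OF L C.module_axioms] f K fc)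
  also have "\<dots> = R L a (\<lambda>h b. H.act L gs (H.D H h f) (K b))"
    using a gs by (intro R_cong H.D_commute[OF H.lin_act_id[OF L gs K(1)] H.module_axioms L, symmetric] fc)
  also have "\<dots> = R L a (\<lambda>h b. \<epsilon>\<^bsub>H\<^esub> h \<odot>\<^bsub>L\<^esub> K b gs)"
  proof (intro R_cong a)
    fix h b assume hb: "h \<in> carrier H" "b \<in> carrier C"
    then show "H.act L gs (H.D H h f) (K b) = \<epsilon>\<^bsub>H\<^esub> h \<odot>\<^bsub>L\<^esub> K b gs"
      using lin_smult[OF H.lin_act_id[OF L gs K(1)], of b "\<epsilon>\<^bsub>H\<^esub> h" "\<one>\<^bsub>H\<^esub>"] gs
      by (simp add: f(3) H.act_one[OF L gs K(1)])
  qed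
  also have "\<dots> = K a gs" using a gs by (intro R_counit[OF L] K(2)) auto
  finally show ?thesis .
qed

lemma om_tt:
  assumes "x \<in> carrier (A p q)"
  shows "om p q (tt p q x) = x"
proof (rule A_eqI[where f = "\<lambda>x. om p q (tt p q x)" and g = "\<lambda>x. x"])
  fix gs as assume gs: "length gs = Suc p" "set gs \<subseteq> carrier H" and as: "length as = Suc q" "set as \<subseteq> carrier C"
  then obtain a l where l: "as = a # l" by (cases as) auto
  let ?L = "A p q"
  have "om p q (tt p q (pt gs (a # l))) = R ?L a (\<lambda>h b. om p q (H.act ?L gs (Si h) (\<lambda>r. pt r (l @ [b]))))"
    using gs as l by (simp add: tt_pt, intro R_commute[OF om_lin A_module A_module] A_closed) auto
  also have "\<dots> = R ?L a (\<lambda>h b. R ?L b (\<lambda>h' b'. H.act ?L gs (h' \<otimes>\<^bsub>H\<^esub> Si h) (\<lambda>s. pt s (b' # l))))"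
    using gs as l by (intro R_cong om_act) auto
  \<comment> \<open>The contraction is f h h' = h' S^{-1}(h), evaluated by
    \<open>Si_right\<close>.\<close>
  also have "\<dots> = pt gs (a # l)"
    using gs as l
    by (intro R_act_cancel[OF A_module, where K = "\<lambda>b s. pt s (b # l)"])
      (auto intro!: H.lin_mult_left H.lin_mult_right lin_ident lin_Si H.Si_right[OF S_bij] mlin_pt1 lin_pt2 slot_intros)
  finally show "om p q (tt p q (pt gs as)) = pt gs as" using l by simp
qed (use assms in \<open>auto intro!: lin_comp[OF om_lin] lin_comp[OF tt_lin] om_lin tt_lin lin_ident A_module\<close>)

lemma tt_om:
  assumes "x \<in> carrier (A p q)"
  shows "tt p q (om p q x) = x"
proof (rule A_eqI[where f = "\<lambda>x. tt p q (om p q x)" and g = "\<lambda>x. x"])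
  fix gs as assume gs: "length gs = Suc p" "set gs \<subseteq> carrier H" and as: "length as = Suc q" "set as \<subseteq> carrier C"
  then obtain l a where l: "as = l @ [a]" by (cases as rule: rev_cases) auto
  let ?L = "A p q"
  have "tt p q (om p q (pt gs (l @ [a]))) = R ?L a (\<lambda>h b. tt p q (H.act ?L gs h (\<lambda>r. pt r (b # l))))"
    using gs as l by (simp add: om_pt, intro R_commute[OF tt_lin A_module A_module] A_closed) auto
  also have "\<dots> = R ?L a (\<lambda>h b. R ?L b (\<lambda>h' b'. H.act ?L gs (Si h' \<otimes>\<^bsub>H\<^esub> h) (\<lambda>s. pt s (l @ [b']))))"
    using gs as l by (intro R_cong tt_act) auto
  \<comment> \<open>The contraction is f h h' = S^{-1}(h') h, evaluated by
    \<open>Si_left\<close>.\<close>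
  also have "\<dots> = pt gs (l @ [a])"
    using gs as l
    by (intro R_act_cancel[OF A_module, where K = "\<lambda>b s. pt s (l @ [b])"])
      (auto intro!: H.lin_mult_left H.lin_mult_right lin_ident lin_Si H.Si_left[OF S_bij] mlin_pt1 lin_pt2
        slot_append2 slot_here)
  finally show "tt p q (om p q (pt gs as)) = pt gs as" using l by simp
qed (use assms in \<open>auto intro!: lin_comp[OF om_lin] lin_comp[OF tt_lin] om_lin tt_lin lin_ident A_module\<close>)

section \<open>The paracocyclic identities in the coalgebra direction\<close>

text \<open>This is \<tau> \<partial>^i = \<partial>^{i-1} \<tau> conjugated by \<omega>. The
  comultiplied entry and the entry carried to the front are different, so all sums simply
  exchange.\<close>

lemma om_dd:
  assumes i: "1 \<le> i" "i \<le> q" and x: "x \<in> carrier (A p q)"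
  shows "om p (Suc q) (dd p q (i - 1) x) = dd p q i (om p q x)"
proof (rule A_eqI[where f = "\<lambda>x. om p (Suc q) (dd p q (i - 1) x)" and g = "\<lambda>x. dd p q i (om p q x)"])
  fix gs as assume gs: "length gs = Suc p" "set gs \<subseteq> carrier H" and as: "length as = Suc q" "set as \<subseteq> carrier C"
  then obtain m b where m: "as = m @ [b]" by (cases as rule: rev_cases) auto
  then have "i - 1 < length m" using i as by simp
  then obtain l a r where l: "m = l @ a # r" "length l = i - 1" by (rule split_list_at)
  have q: "q = Suc (length l + length r)" "i = Suc (length l)" using as m l i by auto
  note ms = gs as(2)[unfolded m l, simplified]
  let ?L = "A p (Suc q)" and ?M = "A p q"
  have om: "om p (Suc q) (pt gs (l @ x # y # r @ [b])) = R ?L b (\<lambda>h c. H.act ?L gs h (\<lambda>s. pt s (c # l @ x # y # r)))"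
    if "x \<in> carrier C" "y \<in> carrier C" for x y
    using om_pt[of "Suc q" "l @ x # y # r" gs p b] ms q that by simp
  have dd: "dd p q i (pt s (c # l @ a # r)) = C.D ?L a (\<lambda>x y. pt s (c # l @ x # y # r))"
    if "c \<in> carrier C" "length s = Suc p" "set s \<subseteq> carrier H" for c s
    using dd_pt[of i "c # l" q r s p a] ms q that by simp
  have "om p (Suc q) (dd p q (i - 1) (pt gs as)) = om p (Suc q) (C.D ?L a (\<lambda>x y. pt gs (l @ x # y # r @ [b])))"
    using dd_pt[of "i - 1" l q "r @ [b]" gs p a] ms q m l(1) by simp
  also have "\<dots> = C.D ?L a (\<lambda>x y. om p (Suc q) (pt gs (l @ x # y # r @ [b])))"
    using ms q by (intro C.D_commute[OF om_lin A_module A_module] A_closed) auto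
  also have "\<dots> = C.D ?L a (\<lambda>x y. R ?L b (\<lambda>h c. H.act ?L gs h (\<lambda>s. pt s (c # l @ x # y # r))))"
    using ms by (intro C.D_cong om) auto
  also have "\<dots> = R ?L b (\<lambda>h c. C.D ?L a (\<lambda>x y. H.act ?L gs h (\<lambda>s. pt s (c # l @ x # y # r))))"
    using ms q by (intro R_DC_swap[OF A_module, symmetric] A_closed) auto
  also have "\<dots> = R ?L b (\<lambda>h c. H.act ?L gs h (\<lambda>s. C.D ?L a (\<lambda>x y. pt s (c # l @ x # y # r))))"
    using ms q by (intro R_cong act_DC_swap[OF A_module, symmetric] A_closed) auto
  also have "\<dots> = R ?L b (\<lambda>h c. H.act ?L gs h (\<lambda>s. dd p q i (pt s (c # l @ a # r))))"
    using ms by (intro R_cong H.act_cong dd[symmetric]) auto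
  also have "\<dots> = R ?L b (\<lambda>h c. dd p q i (H.act ?M gs h (\<lambda>s. pt s (c # l @ a # r))))"
    using ms q i by (intro R_cong H.act_commute[OF dd_lin A_module A_module, symmetric] A_closed) auto
  also have "\<dots> = dd p q i (R ?M b (\<lambda>h c. H.act ?M gs h (\<lambda>s. pt s (c # l @ a # r))))"
    using ms q i by (intro R_commute[OF dd_lin A_module A_module, symmetric] A_closed) auto
  also have "\<dots> = dd p q i (om p q (pt gs as))"
    using om_pt[of q m gs p b] ms q m l(1) by simp
  finally show "om p (Suc q) (dd p q (i - 1) (pt gs as)) = dd p q i (om p q (pt gs as))" .
qed (use i x in \<open>auto intro!: lin_comp[OF om_lin] lin_comp[OF dd_lin] dd_lin om_lin A_module\<close>)

lemma om_om_pt: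
  assumes "q = Suc (length l)" "length gs = Suc p" "set gs \<subseteq> carrier H"
    "a \<in> carrier C" "b \<in> carrier C" "set l \<subseteq> carrier C"
  shows "om p q (om p q (pt gs (l @ [a, b])))
    = R (A p q) b (\<lambda>h d. R (A p q) a (\<lambda>g c. H.act (A p q) gs (g \<otimes>\<^bsub>H\<^esub> h) (\<lambda>s. pt s (c # d # l))))"
proof -
  have "om p q (om p q (pt gs (l @ [a, b]))) = om p q (R (A p q) b (\<lambda>h d. H.act (A p q) gs h (\<lambda>r. pt r (d # l @ [a]))))"
    using om_pt[of q "l @ [a]" gs p b] assms by simp
  also have "\<dots> = R (A p q) b (\<lambda>h d. om p q (H.act (A p q) gs h (\<lambda>r. pt r (d # l @ [a]))))"
    using assms by (intro R_commute[OF om_lin A_module A_module] A_closed) auto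
  also have "\<dots> = R (A p q) b (\<lambda>h d. R (A p q) a (\<lambda>g c. H.act (A p q) gs (g \<otimes>\<^bsub>H\<^esub> h) (\<lambda>s. pt s (c # d # l))))"
    using assms om_act[of q "d # l" gs p _ a for d] by (intro R_cong) auto
  finally show ?thesis .
qed

text \<open>Here the comodule coalgebra axiom enters. Both halves of the comultiplied last entry are
  carried to the front, their coaction legs multiply in the order of the halves, and
  \<open>R_comult\<close> merges them into a single coaction.\<close>

lemma om_om_dd:
  assumes x: "x \<in> carrier (A p q)"
  shows "om p (Suc q) (om p (Suc q) (dd p q q x)) = dd p q 0 (om p q x)"
proof (rule A_eqI[where f = "\<lambda>x. om p (Suc q) (om p (Suc q) (dd p q q x))" and g = "\<lambda>x. dd p q 0 (om p q x)"])
  fix gs as assume gs: "length gs = Suc p" "set gs \<subseteq> carrier H" and as: "length as = Suc q" "set as \<subseteq> carrier C"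
  then obtain l a where l: "as = l @ [a]" by (cases as rule: rev_cases) auto
  have q: "q = length l" using as l by auto
  note ms = gs as(2)[unfolded l, simplified]
  let ?L = "A p (Suc q)" and ?M = "A p q"
  have "om p (Suc q) (om p (Suc q) (dd p q q (pt gs as)))
    = om p (Suc q) (om p (Suc q) (C.D ?L a (\<lambda>x y. pt gs (l @ [x, y]))))"
    using dd_pt[of q l q "[]" gs p a] ms q l by simp
  also have "\<dots> = C.D ?L a (\<lambda>x y. om p (Suc q) (om p (Suc q) (pt gs (l @ [x, y]))))"
    using ms q by (intro C.D_commute[OF lin_comp[OF om_lin om_lin] A_module A_module] A_closed) auto
  also have "\<dots> = C.D ?L a (\<lambda>x y. R ?L y (\<lambda>h d. R ?L x (\<lambda>g c. H.act ?L gs (g \<otimes>\<^bsub>H\<^esub> h) (\<lambda>s. pt s (c # d # l)))))"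
    using ms q by (intro C.D_cong om_om_pt) auto
  also have "\<dots> = C.D ?L a (\<lambda>x y. R ?L x (\<lambda>g c. R ?L y (\<lambda>h d. H.act ?L gs (g \<otimes>\<^bsub>H\<^esub> h) (\<lambda>s. pt s (c # d # l)))))"
    using ms q by (intro C.D_cong R_swap[OF A_module] A_closed) auto
  also have "\<dots> = R ?L a (\<lambda>h b. C.D ?L b (\<lambda>x y. H.act ?L gs h (\<lambda>s. pt s (x # y # l))))"
    using ms q
    by (intro R_comult[OF A_module] H.lin_act[OF A_module] H.lin_act_param[OF A_module] C.module_axioms
        lin_pt2 slot_intros lin_ident) (auto intro!: mlin_pt1)
  also have "\<dots> = R ?L a (\<lambda>h b. H.act ?L gs h (\<lambda>s. C.D ?L b (\<lambda>x y. pt s (x # y # l))))"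
    using ms q by (intro R_cong act_DC_swap[OF A_module, symmetric] A_closed) auto
  also have "\<dots> = R ?L a (\<lambda>h b. H.act ?L gs h (\<lambda>s. dd p q 0 (pt s (b # l))))"
    using ms q dd_pt[of 0 "[]" q l _ p] by (intro R_cong H.act_cong) auto
  also have "\<dots> = R ?L a (\<lambda>h b. dd p q 0 (H.act ?M gs h (\<lambda>s. pt s (b # l))))"
    using ms q by (intro R_cong H.act_commute[OF dd_lin A_module A_module, symmetric] A_closed) auto
  also have "\<dots> = dd p q 0 (R ?M a (\<lambda>h b. H.act ?M gs h (\<lambda>s. pt s (b # l))))"
    using ms q by (intro R_commute[OF dd_lin A_module A_module, symmetric] A_closed) auto
  also have "\<dots> = dd p q 0 (om p q (pt gs as))"
    using om_pt[of q l gs p a] ms q l by simp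
  finally show "om p (Suc q) (om p (Suc q) (dd p q q (pt gs as))) = dd p q 0 (om p q (pt gs as))" .
qed (use x in \<open>auto intro!: lin_comp[OF om_lin] lin_comp[OF dd_lin] dd_lin om_lin A_module\<close>)

lemma act_smult:
  "\<lbrakk>c \<in> carrier k; h \<in> carrier H; length gs = Suc p; set gs \<subseteq> carrier H; length as = Suc q; set as \<subseteq> carrier C\<rbrakk> \<Longrightarrow>
    H.act (A p q) gs h (\<lambda>s. c \<odot>\<^bsub>A p q\<^esub> pt s as) = c \<odot>\<^bsub>A p q\<^esub> H.act (A p q) gs h (\<lambda>s. pt s as)"
  by (intro H.act_commute[OF lin_smult_right[OF A_module lin_ident] A_module A_module, symmetric] pt_closed) auto

lemma R_smult:
  "\<lbrakk>c \<in> carrier k; a \<in> carrier C; \<And>h b. \<lbrakk>h \<in> carrier H; b \<in> carrier C\<rbrakk> \<Longrightarrow> G h b \<in> carrier (A p q)\<rbrakk> \<Longrightarrow>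
    R (A p q) a (\<lambda>h b. c \<odot>\<^bsub>A p q\<^esub> G h b) = c \<odot>\<^bsub>A p q\<^esub> R (A p q) a G"
  by (intro R_commute[OF lin_smult_right[OF A_module lin_ident] A_module A_module, symmetric]) auto

lemma om_ss:
  assumes i: "1 \<le> i" "i \<le> q" and x: "x \<in> carrier (A p (Suc q))"
  shows "om p q (ss p (Suc q) (i - 1) x) = ss p (Suc q) i (om p (Suc q) x)"
proof (rule A_eqI[where f = "\<lambda>x. om p q (ss p (Suc q) (i - 1) x)" and g = "\<lambda>x. ss p (Suc q) i (om p (Suc q) x)"])
  fix gs as assume gs: "length gs = Suc p" "set gs \<subseteq> carrier H" and as: "length as = Suc (Suc q)" "set as \<subseteq> carrier C"
  then obtain m b where m: "as = m @ [b]" by (cases as rule: rev_cases) auto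
  then have "i < length m" using i as by simp
  then obtain l a r where l: "m = l @ a # r" "length l = i" by (rule split_list_at)
  have q: "q = length l + length r" using as m l i by auto
  note ms = gs as(2)[unfolded m l, simplified]
  let ?L = "A p q" and ?M = "A p (Suc q)"
  have ss: "ss p (Suc q) i (pt s (c # l @ a # r)) = \<epsilon>\<^bsub>C\<^esub> a \<odot>\<^bsub>?L\<^esub> pt s (c # l @ r)"
    if "c \<in> carrier C" "length s = Suc p" "set s \<subseteq> carrier H" for c s
    using ss_pt[of "c # l" i q r s p a] ms q l that by simp
  have "om p q (ss p (Suc q) (i - 1) (pt gs as)) = om p q (\<epsilon>\<^bsub>C\<^esub> a \<odot>\<^bsub>?L\<^esub> pt gs ((l @ r) @ [b]))"
    using ss_pt[of l "i - 1" q "r @ [b]" gs p a] ms q m l i by simp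
  also have "\<dots> = \<epsilon>\<^bsub>C\<^esub> a \<odot>\<^bsub>?L\<^esub> R ?L b (\<lambda>h c. H.act ?L gs h (\<lambda>s. pt s (c # l @ r)))"
    using ms q l om_pt[of q "l @ r" gs p b] by (simp add: lin_smult[OF om_lin] pt_closed)
  also have "\<dots> = R ?L b (\<lambda>h c. \<epsilon>\<^bsub>C\<^esub> a \<odot>\<^bsub>?L\<^esub> H.act ?L gs h (\<lambda>s. pt s (c # l @ r)))"
    using ms q by (intro R_smult[symmetric] A_closed) auto
  also have "\<dots> = R ?L b (\<lambda>h c. H.act ?L gs h (\<lambda>s. \<epsilon>\<^bsub>C\<^esub> a \<odot>\<^bsub>?L\<^esub> pt s (c # l @ r)))"
    using ms q by (intro R_cong act_smult[symmetric]) auto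
  also have "\<dots> = R ?L b (\<lambda>h c. H.act ?L gs h (\<lambda>s. ss p (Suc q) i (pt s (c # l @ a # r))))"
    using ms by (intro R_cong H.act_cong ss[symmetric]) auto
  also have "\<dots> = R ?L b (\<lambda>h c. ss p (Suc q) i (H.act ?M gs h (\<lambda>s. pt s (c # l @ a # r))))"
    using ms q i by (intro R_cong H.act_commute[OF ss_lin A_module A_module, symmetric] A_closed) auto
  also have "\<dots> = ss p (Suc q) i (R ?M b (\<lambda>h c. H.act ?M gs h (\<lambda>s. pt s (c # l @ a # r))))"
    using ms q i by (intro R_commute[OF ss_lin A_module A_module, symmetric] A_closed) auto
  also have "\<dots> = ss p (Suc q) i (om p (Suc q) (pt gs as))"
    using om_pt[of "Suc q" m gs p b] ms q m l by simp
  finally show "om p q (ss p (Suc q) (i - 1) (pt gs as)) = ss p (Suc q) i (om p (Suc q) (pt gs as))" .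
qed (use i x in \<open>auto intro!: lin_comp[OF om_lin] lin_comp[OF ss_lin] ss_lin om_lin A_module\<close>)

text \<open>Two rotations bring b and then a to the front, and the codegeneracy applies the counit
  to what is left of b. Compatibility of coaction and counit turns the leg of b into the unit, so
  only the rotation of a survives.\<close>

lemma om_ss_last:
  assumes x: "x \<in> carrier (A p (Suc q))"
  shows "om p q (ss p (Suc q) q x) = ss p (Suc q) 0 (om p (Suc q) (om p (Suc q) x))"
proof (rule A_eqI[where f = "\<lambda>x. om p q (ss p (Suc q) q x)" and g = "\<lambda>x. ss p (Suc q) 0 (om p (Suc q) (om p (Suc q) x))"])
  fix gs as assume gs: "length gs = Suc p" "set gs \<subseteq> carrier H" and as: "length as = Suc (Suc q)" "set as \<subseteq> carrier C"
  then obtain m b where m: "as = m @ [b]" by (cases as rule: rev_cases) auto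
  then obtain l a where l: "m = l @ [a]" using as by (cases m rule: rev_cases) auto
  have q: "q = length l" using as m l by auto
  note ms = gs as(2)[unfolded m l, simplified]
  let ?L = "A p q" and ?M = "A p (Suc q)"
  have "ss p (Suc q) 0 (om p (Suc q) (om p (Suc q) (pt gs as)))
    = ss p (Suc q) 0 (R ?M b (\<lambda>h d. R ?M a (\<lambda>g c. H.act ?M gs (g \<otimes>\<^bsub>H\<^esub> h) (\<lambda>s. pt s (c # d # l)))))"
    using om_om_pt[of "Suc q" l gs p a b] ms q m l by simp
  also have "\<dots> = R ?L b (\<lambda>h d. ss p (Suc q) 0 (R ?M a (\<lambda>g c. H.act ?M gs (g \<otimes>\<^bsub>H\<^esub> h) (\<lambda>s. pt s (c # d # l)))))"
    using ms q by (intro R_commute[OF ss_lin A_module A_module] A_closed) auto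
  also have "\<dots> = R ?L b (\<lambda>h d. R ?L a (\<lambda>g c. ss p (Suc q) 0 (H.act ?M gs (g \<otimes>\<^bsub>H\<^esub> h) (\<lambda>s. pt s (c # d # l)))))"
    using ms q by (intro R_cong R_commute[OF ss_lin A_module A_module] A_closed) auto
  also have "\<dots> = R ?L b (\<lambda>h d. R ?L a (\<lambda>g c. H.act ?L gs (g \<otimes>\<^bsub>H\<^esub> h) (\<lambda>s. ss p (Suc q) 0 (pt s (c # d # l)))))"
    using ms q by (intro R_cong H.act_commute[OF ss_lin A_module A_module] A_closed) auto
  also have "\<dots> = R ?L b (\<lambda>h d. R ?L a (\<lambda>g c. H.act ?L gs (g \<otimes>\<^bsub>H\<^esub> h) (\<lambda>s. \<epsilon>\<^bsub>C\<^esub> d \<odot>\<^bsub>?L\<^esub> pt s (c # l))))"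
    using ms q ss_pt[of "[_]" 0 q l _ p _] by (intro R_cong H.act_cong) auto
  also have "\<dots> = R ?L b (\<lambda>h d. R ?L a (\<lambda>g c. \<epsilon>\<^bsub>C\<^esub> d \<odot>\<^bsub>?L\<^esub> H.act ?L gs (g \<otimes>\<^bsub>H\<^esub> h) (\<lambda>s. pt s (c # l))))"
    using ms q by (intro R_cong act_smult) auto
  \<comment> \<open>The coaction of b is made innermost, because \<open>R_counit_C\<close> contracts
    a single coaction sum whose comodule leg sits under the counit.\<close>
  also have "\<dots> = R ?L a (\<lambda>g c. R ?L b (\<lambda>h d. \<epsilon>\<^bsub>C\<^esub> d \<odot>\<^bsub>?L\<^esub> H.act ?L gs (g \<otimes>\<^bsub>H\<^esub> h) (\<lambda>s. pt s (c # l))))"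
    using ms q by (intro R_swap[OF A_module] module.smult_closed[OF A_module] A_closed) auto
  also have "\<dots> = R ?L a (\<lambda>g c. \<epsilon>\<^bsub>C\<^esub> b \<odot>\<^bsub>?L\<^esub> H.act ?L gs (g \<otimes>\<^bsub>H\<^esub> \<one>\<^bsub>H\<^esub>) (\<lambda>s. pt s (c # l)))"
    using ms q by (intro R_cong R_counit_C[OF A_module] H.lin_act[OF A_module] H.lin_mult_right lin_ident)
      (auto intro!: mlin_pt1)
  also have "\<dots> = R ?L a (\<lambda>g c. \<epsilon>\<^bsub>C\<^esub> b \<odot>\<^bsub>?L\<^esub> H.act ?L gs g (\<lambda>s. pt s (c # l)))"
    using ms q by (intro R_cong) auto
  also have "\<dots> = \<epsilon>\<^bsub>C\<^esub> b \<odot>\<^bsub>?L\<^esub> om p q (pt gs (l @ [a]))"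
    using ms q by (simp add: om_pt, intro R_smult A_closed) auto
  also have "\<dots> = om p q (ss p (Suc q) q (pt gs as))"
    using ss_pt[of "l @ [a]" q q "[]" gs p b] ms q m l by (simp add: lin_smult[OF om_lin] pt_closed)
  finally show "om p q (ss p (Suc q) q (pt gs as)) = ss p (Suc q) 0 (om p (Suc q) (om p (Suc q) (pt gs as)))" by simp
qed (use x in \<open>auto intro!: lin_comp[OF om_lin] lin_comp[OF ss_lin] ss_lin om_lin A_module\<close>)

text \<open>The degree 0 identity that the reduction takes as input. Here \<tau> itself occurs: the
  counit turns the coaction leg into the unit, and S^{-1}(1) = 1 acts trivially.\<close>

lemma ss_tt_dd_0:
  assumes x: "x \<in> carrier (A p 0)"
  shows "ss p (Suc 0) 0 (tt p (Suc 0) (dd p 0 0 x)) = x"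
proof (rule A_eqI[where f = "\<lambda>x. ss p (Suc 0) 0 (tt p (Suc 0) (dd p 0 0 x))" and g = "\<lambda>x. x"])
  fix gs as assume gs: "length gs = Suc p" "set gs \<subseteq> carrier H" and as: "length as = Suc 0" "set as \<subseteq> carrier C"
  from as obtain a where a: "as = [a]" "a \<in> carrier C" by (cases as) auto
  let ?L = "A p 0" and ?M = "A p (Suc 0)"
  have tt: "tt p (Suc 0) (pt gs [x, y]) = R ?M x (\<lambda>h b. H.act ?M gs (Si h) (\<lambda>r. pt r [y, b]))"
    if "x \<in> carrier C" "y \<in> carrier C" for x y
    using gs that by (intro tt_pt[where l = "[y]" for y, unfolded append.simps]) auto
  have ss: "ss p (Suc 0) 0 (pt r [y, b]) = \<epsilon>\<^bsub>C\<^esub> b \<odot>\<^bsub>?L\<^esub> pt r [y]"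
    if "y \<in> carrier C" "b \<in> carrier C" "length r = Suc p" "set r \<subseteq> carrier H" for y b r
    using that by (intro ss_pt[where l = "[y]" and r = "[]" for y, unfolded append.simps]) auto
  have "ss p (Suc 0) 0 (tt p (Suc 0) (dd p 0 0 (pt gs as))) = ss p (Suc 0) 0 (tt p (Suc 0) (C.D ?M a (\<lambda>x y. pt gs [x, y])))"
    using dd_pt[of 0 "[]" 0 "[]" gs p a] gs a by simp
  also have "tt p (Suc 0) (C.D ?M a (\<lambda>x y. pt gs [x, y])) = C.D ?M a (\<lambda>x y. tt p (Suc 0) (pt gs [x, y]))"
    using gs a by (intro C.D_commute[OF tt_lin A_module A_module] A_closed) auto
  also have "ss p (Suc 0) 0 \<dots> = C.D ?L a (\<lambda>x y. ss p (Suc 0) 0 (tt p (Suc 0) (pt gs [x, y])))"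
    using gs a by (intro C.D_commute[OF ss_lin A_module A_module] A_closed lin_closed[OF tt_lin]) auto
  also have "\<dots> = C.D ?L a (\<lambda>x y. ss p (Suc 0) 0 (R ?M x (\<lambda>h b. H.act ?M gs (Si h) (\<lambda>r. pt r [y, b]))))"
    using gs a tt by (intro C.D_cong) simp_all
  also have "\<dots> = C.D ?L a (\<lambda>x y. R ?L x (\<lambda>h b. ss p (Suc 0) 0 (H.act ?M gs (Si h) (\<lambda>r. pt r [y, b]))))"
    using gs a by (intro C.D_cong R_commute[OF ss_lin A_module A_module] A_closed) auto
  also have "\<dots> = C.D ?L a (\<lambda>x y. R ?L x (\<lambda>h b. H.act ?L gs (Si h) (\<lambda>r. ss p (Suc 0) 0 (pt r [y, b]))))"
    using gs a by (intro C.D_cong R_cong H.act_commute[OF ss_lin A_module A_module] A_closed) auto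
  also have "\<dots> = C.D ?L a (\<lambda>x y. R ?L x (\<lambda>h b. H.act ?L gs (Si h) (\<lambda>r. \<epsilon>\<^bsub>C\<^esub> b \<odot>\<^bsub>?L\<^esub> pt r [y])))"
    using gs a by (intro C.D_cong R_cong H.act_cong ss) simp_all
  also have "\<dots> = C.D ?L a (\<lambda>x y. R ?L x (\<lambda>h b. \<epsilon>\<^bsub>C\<^esub> b \<odot>\<^bsub>?L\<^esub> H.act ?L gs (Si h) (\<lambda>r. pt r [y])))"
    using gs a by (intro C.D_cong R_cong act_smult) auto
  also have "\<dots> = C.D ?L a (\<lambda>x y. \<epsilon>\<^bsub>C\<^esub> x \<odot>\<^bsub>?L\<^esub> H.act ?L gs (Si \<one>\<^bsub>H\<^esub>) (\<lambda>r. pt r [y]))"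
    using gs a by (intro C.D_cong R_counit_C[OF A_module] H.lin_act[OF A_module] lin_Si lin_ident) (auto intro!: mlin_pt1)
  also have "\<dots> = C.D ?L a (\<lambda>x y. \<epsilon>\<^bsub>C\<^esub> x \<odot>\<^bsub>?L\<^esub> pt gs [y])"
    using gs a by (intro C.D_cong) (simp_all add: Si_one H.act_one[OF A_module] mlin_pt1)
  also have "\<dots> = pt gs [a]"
    using gs a by (intro C.D_counit_left[OF A_module] lin_pt2 slot_intros lin_ident) auto
  finally show "ss p (Suc 0) 0 (tt p (Suc 0) (dd p 0 0 (pt gs as))) = pt gs as" using a by simp
next
  show "(\<lambda>x. ss p (Suc 0) 0 (tt p (Suc 0) (dd p 0 0 x))) \<in> lin_maps k (A p 0) (A p 0)"
    by (rule lin_comp[OF ss_lin lin_comp[OF tt_lin dd_lin]]) simp_all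
qed (use x in \<open>simp_all add: lin_ident A_module\<close>)

lemma co_smult:
  "\<lbrakk>c \<in> carrier k; set as \<subseteq> carrier C;
    \<And>u bs. \<lbrakk>u \<in> carrier H; length bs = length as; set bs \<subseteq> carrier C\<rbrakk> \<Longrightarrow> G u bs \<in> carrier (A p q)\<rbrakk> \<Longrightarrow>
    co (A p q) as (\<lambda>u bs. c \<odot>\<^bsub>A p q\<^esub> G u bs) = c \<odot>\<^bsub>A p q\<^esub> co (A p q) as G"
  by (intro co_commute[OF lin_smult_right[OF A_module lin_ident] A_module A_module, symmetric]) auto

section \<open>The paracocyclic identities in the Hopf algebra direction\<close>

lemma tb_db:
  assumes i: "1 \<le> i" "i \<le> p" and x: "x \<in> carrier (A p q)"
  shows "tb (Suc p) q (db p q i x) = db p q (i - 1) (tb p q x)"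
proof (rule A_eqI[where f = "\<lambda>x. tb (Suc p) q (db p q i x)" and g = "\<lambda>x. db p q (i - 1) (tb p q x)"])
  fix gs as assume gs: "length gs = Suc p" "set gs \<subseteq> carrier H" and as: "length as = Suc q" "set as \<subseteq> carrier C"
  then obtain g m where m: "gs = g # m" by (cases gs) auto
  then have "i - 1 < length m" using i gs by simp
  then obtain l c r where l: "m = l @ c # r" "length l = i - 1" by (rule split_list_at)
  have p: "p = Suc (length l + length r)" "i = Suc (length l)" using gs m l i by auto
  note ms = as gs(2)[unfolded m l, simplified]
  let ?L = "A (Suc p) q" and ?M = "A p q"
  have tb: "tb (Suc p) q (pt (g # l @ x # y # r) as) = co ?L as (\<lambda>u bs. pt (l @ x # y # r @ [u \<otimes>\<^bsub>H\<^esub> g]) bs)"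
    if "x \<in> carrier H" "y \<in> carrier H" for x y
    using tb_pt[of "Suc p" "l @ x # y # r" as q g] ms p that by simp
  have db: "db p q (i - 1) (pt (l @ c # r @ [u \<otimes>\<^bsub>H\<^esub> g]) bs) = H.D ?L c (\<lambda>x y. pt (l @ x # y # r @ [u \<otimes>\<^bsub>H\<^esub> g]) bs)"
    if "u \<in> carrier H" "length bs = length as" "set bs \<subseteq> carrier C" for u bs
    using db_pt[of "i - 1" l p "r @ [u \<otimes>\<^bsub>H\<^esub> g]" bs q c] ms p that by simp
  have "tb (Suc p) q (db p q i (pt gs as)) = tb (Suc p) q (H.D ?L c (\<lambda>x y. pt (g # l @ x # y # r) as))"
    using db_pt[of i "g # l" p r as q c] ms p m l(1) by simp
  also have "\<dots> = H.D ?L c (\<lambda>x y. tb (Suc p) q (pt (g # l @ x # y # r) as))"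
    using ms p by (intro H.D_commute[OF tb_lin A_module A_module] A_closed) auto
  also have "\<dots> = H.D ?L c (\<lambda>x y. co ?L as (\<lambda>u bs. pt (l @ x # y # r @ [u \<otimes>\<^bsub>H\<^esub> g]) bs))"
    using ms by (intro H.D_cong tb) auto
  also have "\<dots> = co ?L as (\<lambda>u bs. H.D ?L c (\<lambda>x y. pt (l @ x # y # r @ [u \<otimes>\<^bsub>H\<^esub> g]) bs))"
    using ms p by (intro co_DH_swap[OF A_module, symmetric] A_closed) auto
  also have "\<dots> = co ?L as (\<lambda>u bs. db p q (i - 1) (pt (l @ c # r @ [u \<otimes>\<^bsub>H\<^esub> g]) bs))"
    using ms by (intro co_cong db[symmetric]) auto
  also have "\<dots> = db p q (i - 1) (co ?M as (\<lambda>u bs. pt (l @ c # r @ [u \<otimes>\<^bsub>H\<^esub> g]) bs))"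
    using ms p by (intro co_commute[OF db_lin A_module A_module, symmetric] A_closed) auto
  also have "\<dots> = db p q (i - 1) (tb p q (pt gs as))"
    using tb_pt[of p m as q g] ms p m l(1) by simp
  finally show "tb (Suc p) q (db p q i (pt gs as)) = db p q (i - 1) (tb p q (pt gs as))" .
next
  show "(\<lambda>x. tb (Suc p) q (db p q i x)) \<in> lin_maps k (A p q) (A (Suc p) q)"
    using i by (intro lin_comp[OF tb_lin db_lin])
  show "(\<lambda>x. db p q (i - 1) (tb p q x)) \<in> lin_maps k (A p q) (A (Suc p) q)"
    using i by (intro lin_comp[OF db_lin tb_lin]) auto
qed (rule A_module x)+

text \<open>Two applications coact twice on the same entries. \<open>co_coassoc\<close> replaces
  this by one coaction whose leg is comultiplied, the first half multiplying x and the second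
  y.\<close>

lemma tb_tb_pt:
  assumes "p = Suc (length r)" "length as = Suc q" "set as \<subseteq> carrier C"
    "x \<in> carrier H" "y \<in> carrier H" "set r \<subseteq> carrier H"
  shows "tb p q (tb p q (pt (x # y # r) as))
    = co (A p q) as (\<lambda>u bs. H.D (A p q) u (\<lambda>u1 u2. pt (r @ [u1 \<otimes>\<^bsub>H\<^esub> x, u2 \<otimes>\<^bsub>H\<^esub> y]) bs))"
proof -
  have tb: "tb p q (pt (y # r @ [u \<otimes>\<^bsub>H\<^esub> x]) bs) = co (A p q) bs (\<lambda>v cs. pt (r @ [u \<otimes>\<^bsub>H\<^esub> x, v \<otimes>\<^bsub>H\<^esub> y]) cs)"
    if "u \<in> carrier H" "length bs = length as" "set bs \<subseteq> carrier C" for u bs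
    using tb_pt[of p "r @ [u \<otimes>\<^bsub>H\<^esub> x]" bs q y] assms that by simp
  have "tb p q (tb p q (pt (x # y # r) as)) = tb p q (co (A p q) as (\<lambda>u bs. pt (y # r @ [u \<otimes>\<^bsub>H\<^esub> x]) bs))"
    using tb_pt[of p "y # r" as q x] assms by simp
  also have "\<dots> = co (A p q) as (\<lambda>u bs. tb p q (pt (y # r @ [u \<otimes>\<^bsub>H\<^esub> x]) bs))"
    using assms by (intro co_commute[OF tb_lin A_module A_module] A_closed) auto
  also have "\<dots> = co (A p q) as (\<lambda>u bs. co (A p q) bs (\<lambda>v cs. pt (r @ [u \<otimes>\<^bsub>H\<^esub> x, v \<otimes>\<^bsub>H\<^esub> y]) cs))"
    using assms by (intro co_cong tb) auto
  also have "\<dots> = co (A p q) as (\<lambda>u bs. H.D (A p q) u (\<lambda>u1 u2. pt (r @ [u1 \<otimes>\<^bsub>H\<^esub> x, u2 \<otimes>\<^bsub>H\<^esub> y]) bs))"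
    using assms
    by (intro co_coassoc[OF A_module, where K = "\<lambda>u v. pt (r @ [u \<otimes>\<^bsub>H\<^esub> x, v \<otimes>\<^bsub>H\<^esub> y])"])
      (auto intro!: mlin_pt2 lin_pt1 slot_append2 slot_Cons slot_here H.lin_mult_left lin_ident)
  finally show ?thesis .
qed

text \<open>Comultiplying g and rotating both halves produces \<Delta>(u) \<Delta>(g);
  multiplicativity of the coproduct identifies this with comultiplying the rotated entry u
  g.\<close>

lemma tb_tb_db:
  assumes x: "x \<in> carrier (A p q)"
  shows "tb (Suc p) q (tb (Suc p) q (db p q 0 x)) = db p q p (tb p q x)"
proof (rule A_eqI[where f = "\<lambda>x. tb (Suc p) q (tb (Suc p) q (db p q 0 x))" and g = "\<lambda>x. db p q p (tb p q x)"])
  fix gs as assume gs: "length gs = Suc p" "set gs \<subseteq> carrier H" and as: "length as = Suc q" "set as \<subseteq> carrier C"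
  then obtain g r where r: "gs = g # r" by (cases gs) auto
  have p: "p = length r" using gs r by auto
  note ms = as gs(2)[unfolded r, simplified]
  let ?L = "A (Suc p) q" and ?M = "A p q"
  have db: "db p q p (pt (r @ [u \<otimes>\<^bsub>H\<^esub> g]) bs) = H.D ?L (u \<otimes>\<^bsub>H\<^esub> g) (\<lambda>x y. pt (r @ [x, y]) bs)"
    if "u \<in> carrier H" "length bs = length as" "set bs \<subseteq> carrier C" for u bs
    using db_pt[of p r p "[]" bs q "u \<otimes>\<^bsub>H\<^esub> g"] ms p that by simp
  have "tb (Suc p) q (tb (Suc p) q (db p q 0 (pt gs as)))
    = tb (Suc p) q (tb (Suc p) q (H.D ?L g (\<lambda>x y. pt (x # y # r) as)))"
    using db_pt[of 0 "[]" p r as q g] ms p r by simp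
  also have "\<dots> = H.D ?L g (\<lambda>x y. tb (Suc p) q (tb (Suc p) q (pt (x # y # r) as)))"
    using ms p by (intro H.D_commute[OF lin_comp[OF tb_lin tb_lin] A_module A_module] A_closed) auto
  also have "\<dots> = H.D ?L g (\<lambda>x y. co ?L as (\<lambda>u bs. H.D ?L u (\<lambda>u1 u2. pt (r @ [u1 \<otimes>\<^bsub>H\<^esub> x, u2 \<otimes>\<^bsub>H\<^esub> y]) bs)))"
    using ms p by (intro H.D_cong tb_tb_pt) auto
  also have "\<dots> = co ?L as (\<lambda>u bs. H.D ?L g (\<lambda>x y. H.D ?L u (\<lambda>u1 u2. pt (r @ [u1 \<otimes>\<^bsub>H\<^esub> x, u2 \<otimes>\<^bsub>H\<^esub> y]) bs)))"
    using ms p by (intro co_DH_swap[OF A_module, symmetric] A_closed) auto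
  also have "\<dots> = co ?L as (\<lambda>u bs. H.D ?L u (\<lambda>u1 u2. H.D ?L g (\<lambda>x y. pt (r @ [u1 \<otimes>\<^bsub>H\<^esub> x, u2 \<otimes>\<^bsub>H\<^esub> y]) bs)))"
    using ms p by (intro co_cong H.D_swap[OF A_module] A_closed) auto
  also have "\<dots> = co ?L as (\<lambda>u bs. H.D ?L (u \<otimes>\<^bsub>H\<^esub> g) (\<lambda>x y. pt (r @ [x, y]) bs))"
    using ms p by (intro co_cong H.D_mult[OF A_module, symmetric] lin_pt1 slot_append2 slot_Cons slot_here lin_ident) auto
  also have "\<dots> = co ?L as (\<lambda>u bs. db p q p (pt (r @ [u \<otimes>\<^bsub>H\<^esub> g]) bs))"
    using ms by (intro co_cong db[symmetric]) auto
  also have "\<dots> = db p q p (co ?M as (\<lambda>u bs. pt (r @ [u \<otimes>\<^bsub>H\<^esub> g]) bs))"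
    using ms p by (intro co_commute[OF db_lin A_module A_module, symmetric] A_closed) auto
  also have "\<dots> = db p q p (tb p q (pt gs as))"
    using tb_pt[of p r as q g] ms p r by simp
  finally show "tb (Suc p) q (tb (Suc p) q (db p q 0 (pt gs as))) = db p q p (tb p q (pt gs as))" .
next
  show "(\<lambda>x. tb (Suc p) q (tb (Suc p) q (db p q 0 x))) \<in> lin_maps k (A p q) (A (Suc p) q)"
    by (intro lin_comp[OF tb_lin] db_lin) auto
  show "(\<lambda>x. db p q p (tb p q x)) \<in> lin_maps k (A p q) (A (Suc p) q)"
    by (intro lin_comp[OF db_lin tb_lin]) auto
qed (rule A_module x)+

lemma tb_sb:
  assumes i: "1 \<le> i" "i \<le> p" and x: "x \<in> carrier (A (Suc p) q)"
  shows "tb p q (sb (Suc p) q i x) = sb (Suc p) q (i - 1) (tb (Suc p) q x)"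
proof (rule A_eqI[where f = "\<lambda>x. tb p q (sb (Suc p) q i x)" and g = "\<lambda>x. sb (Suc p) q (i - 1) (tb (Suc p) q x)"])
  fix gs as assume gs: "length gs = Suc (Suc p)" "set gs \<subseteq> carrier H" and as: "length as = Suc q" "set as \<subseteq> carrier C"
  then obtain g m where m: "gs = g # m" by (cases gs) auto
  then have "i < length m" using i gs by simp
  then obtain l c r where l: "m = l @ c # r" "length l = i" by (rule split_list_at)
  have p: "p = length l + length r" using gs m l i by auto
  note ms = as gs(2)[unfolded m l, simplified]
  let ?L = "A p q" and ?M = "A (Suc p) q"
  have sb: "sb (Suc p) q (i - 1) (pt (l @ c # r @ [u \<otimes>\<^bsub>H\<^esub> g]) bs) = \<epsilon>\<^bsub>H\<^esub> c \<odot>\<^bsub>?L\<^esub> pt (l @ r @ [u \<otimes>\<^bsub>H\<^esub> g]) bs"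
    if "u \<in> carrier H" "length bs = length as" "set bs \<subseteq> carrier C" for u bs
    using sb_pt[of l "i - 1" p "r @ [u \<otimes>\<^bsub>H\<^esub> g]" bs q c] ms p l(2) i that by simp
  have "tb p q (sb (Suc p) q i (pt gs as)) = tb p q (\<epsilon>\<^bsub>H\<^esub> c \<odot>\<^bsub>?L\<^esub> pt (g # l @ r) as)"
    using sb_pt[of "g # l" i p r as q c] ms p m l by simp
  also have "\<dots> = \<epsilon>\<^bsub>H\<^esub> c \<odot>\<^bsub>?L\<^esub> co ?L as (\<lambda>u bs. pt (l @ r @ [u \<otimes>\<^bsub>H\<^esub> g]) bs)"
    using ms p tb_pt[of p "l @ r" as q g] by (simp add: lin_smult[OF tb_lin] pt_closed)
  also have "\<dots> = co ?L as (\<lambda>u bs. \<epsilon>\<^bsub>H\<^esub> c \<odot>\<^bsub>?L\<^esub> pt (l @ r @ [u \<otimes>\<^bsub>H\<^esub> g]) bs)"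
    using ms p by (intro co_smult[symmetric] A_closed) auto
  also have "\<dots> = co ?L as (\<lambda>u bs. sb (Suc p) q (i - 1) (pt (l @ c # r @ [u \<otimes>\<^bsub>H\<^esub> g]) bs))"
    using ms by (intro co_cong sb[symmetric]) auto
  also have "\<dots> = sb (Suc p) q (i - 1) (co ?M as (\<lambda>u bs. pt (l @ c # r @ [u \<otimes>\<^bsub>H\<^esub> g]) bs))"
    using ms p i by (intro co_commute[OF sb_lin A_module A_module, symmetric] A_closed) auto
  also have "\<dots> = sb (Suc p) q (i - 1) (tb (Suc p) q (pt gs as))"
    using tb_pt[of "Suc p" m as q g] ms p m l(1) by simp
  finally show "tb p q (sb (Suc p) q i (pt gs as)) = sb (Suc p) q (i - 1) (tb (Suc p) q (pt gs as))" .
next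
  show "(\<lambda>x. tb p q (sb (Suc p) q i x)) \<in> lin_maps k (A (Suc p) q) (A p q)"
    using i by (intro lin_comp[OF tb_lin sb_lin]) auto
  show "(\<lambda>x. sb (Suc p) q (i - 1) (tb (Suc p) q x)) \<in> lin_maps k (A (Suc p) q) (A p q)"
    using i by (intro lin_comp[OF sb_lin tb_lin]) auto
qed (rule A_module x)+

text \<open>After two rotations the deleted entry is \<open>u2\<close> times y. Its counit splits,
  and the factor on \<open>u2\<close> reduces the coproduct of u to u itself.\<close>

lemma tb_sb_0:
  assumes x: "x \<in> carrier (A (Suc p) q)"
  shows "tb p q (sb (Suc p) q 0 x) = sb (Suc p) q p (tb (Suc p) q (tb (Suc p) q x))"
proof (rule A_eqI[where f = "\<lambda>x. tb p q (sb (Suc p) q 0 x)" and g = "\<lambda>x. sb (Suc p) q p (tb (Suc p) q (tb (Suc p) q x))"])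
  fix gs as assume gs: "length gs = Suc (Suc p)" "set gs \<subseteq> carrier H" and as: "length as = Suc q" "set as \<subseteq> carrier C"
  then obtain x m where m: "gs = x # m" by (cases gs) auto
  then obtain y r where r: "m = y # r" using gs by (cases m) auto
  have p: "p = length r" using gs m r by auto
  note ms = as gs(2)[unfolded m r, simplified]
  let ?L = "A p q" and ?M = "A (Suc p) q"
  have sb: "sb (Suc p) q p (pt (r @ [v, w \<otimes>\<^bsub>H\<^esub> y]) bs) = \<epsilon>\<^bsub>H\<^esub> w \<odot>\<^bsub>?L\<^esub> (\<epsilon>\<^bsub>H\<^esub> y \<odot>\<^bsub>?L\<^esub> pt (r @ [v]) bs)"
    if "v \<in> carrier H" "w \<in> carrier H" "length bs = length as" "set bs \<subseteq> carrier C" for v w bs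
    using sb_pt[of "r @ [v]" p p "[]" bs q "w \<otimes>\<^bsub>H\<^esub> y"] ms p that
    by (simp add: H.counit_mult module.smult_assoc1[OF A_module] pt_closed)
  have "sb (Suc p) q p (tb (Suc p) q (tb (Suc p) q (pt gs as)))
    = sb (Suc p) q p (co ?M as (\<lambda>u bs. H.D ?M u (\<lambda>u1 u2. pt (r @ [u1 \<otimes>\<^bsub>H\<^esub> x, u2 \<otimes>\<^bsub>H\<^esub> y]) bs)))"
    using tb_tb_pt[of "Suc p" r as q x y] ms p m r by simp
  also have "\<dots> = co ?L as (\<lambda>u bs. sb (Suc p) q p (H.D ?M u (\<lambda>u1 u2. pt (r @ [u1 \<otimes>\<^bsub>H\<^esub> x, u2 \<otimes>\<^bsub>H\<^esub> y]) bs)))"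
    using ms p by (intro co_commute[OF sb_lin A_module A_module] A_closed) auto
  also have "\<dots> = co ?L as (\<lambda>u bs. H.D ?L u (\<lambda>u1 u2. sb (Suc p) q p (pt (r @ [u1 \<otimes>\<^bsub>H\<^esub> x, u2 \<otimes>\<^bsub>H\<^esub> y]) bs)))"
    using ms p by (intro co_cong H.D_commute[OF sb_lin A_module A_module] A_closed) auto
  also have "\<dots> = co ?L as (\<lambda>u bs. H.D ?L u (\<lambda>u1 u2. \<epsilon>\<^bsub>H\<^esub> u2 \<odot>\<^bsub>?L\<^esub> (\<epsilon>\<^bsub>H\<^esub> y \<odot>\<^bsub>?L\<^esub> pt (r @ [u1 \<otimes>\<^bsub>H\<^esub> x]) bs)))"
    using ms by (intro co_cong H.D_cong sb) auto
  also have "\<dots> = co ?L as (\<lambda>u bs. \<epsilon>\<^bsub>H\<^esub> y \<odot>\<^bsub>?L\<^esub> pt (r @ [u \<otimes>\<^bsub>H\<^esub> x]) bs)"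
    using ms p by (intro co_cong H.D_counit_right[OF A_module] lin_smult_right[OF A_module] lin_pt1 slot_append2
        slot_here H.lin_mult_left lin_ident) auto
  also have "\<dots> = \<epsilon>\<^bsub>H\<^esub> y \<odot>\<^bsub>?L\<^esub> tb p q (pt (x # r) as)"
    using ms p by (simp add: tb_pt, intro co_smult A_closed) auto
  also have "\<dots> = tb p q (sb (Suc p) q 0 (pt gs as))"
    using sb_pt[of "[x]" 0 p r as q y] ms p m r by (simp add: lin_smult[OF tb_lin] pt_closed)
  finally show "tb p q (sb (Suc p) q 0 (pt gs as)) = sb (Suc p) q p (tb (Suc p) q (tb (Suc p) q (pt gs as)))" by simp
next
  show "(\<lambda>x. tb p q (sb (Suc p) q 0 x)) \<in> lin_maps k (A (Suc p) q) (A p q)"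
    by (intro lin_comp[OF tb_lin sb_lin]) auto
  show "(\<lambda>x. sb (Suc p) q p (tb (Suc p) q (tb (Suc p) q x))) \<in> lin_maps k (A (Suc p) q) (A p q)"
    by (intro lin_comp[OF sb_lin] lin_comp[OF tb_lin tb_lin]) auto
qed (rule A_module x)+

text \<open>Degree 0 input for the Hopf direction. The counit of u x splits; one factor removes the
  whole diagonal coaction by \<open>co_counit\<close>, the other removes the leg x of the
  coproduct.\<close>

lemma sb_tb_db_0:
  assumes x: "x \<in> carrier (A 0 q)"
  shows "sb (Suc 0) q 0 (tb (Suc 0) q (db 0 q 0 x)) = x"
proof (rule A_eqI[where f = "\<lambda>x. sb (Suc 0) q 0 (tb (Suc 0) q (db 0 q 0 x))" and g = "\<lambda>x. x"])
  fix gs as assume gs: "length gs = Suc 0" "set gs \<subseteq> carrier H" and as: "length as = Suc q" "set as \<subseteq> carrier C"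
  from gs obtain g where g: "gs = [g]" "g \<in> carrier H" by (cases gs) auto
  let ?L = "A 0 q" and ?M = "A (Suc 0) q"
  have tb: "tb (Suc 0) q (pt [x, y] as) = co ?M as (\<lambda>u bs. pt [y, u \<otimes>\<^bsub>H\<^esub> x] bs)"
    if "x \<in> carrier H" "y \<in> carrier H" for x y
    using as that by (intro tb_pt[where r = "[y]" for y, unfolded append.simps]) auto
  have sb: "sb (Suc 0) q 0 (pt [y, u \<otimes>\<^bsub>H\<^esub> x] bs) = \<epsilon>\<^bsub>H\<^esub> x \<odot>\<^bsub>?L\<^esub> (\<epsilon>\<^bsub>H\<^esub> u \<odot>\<^bsub>?L\<^esub> pt [y] bs)"
    if "x \<in> carrier H" "y \<in> carrier H" "u \<in> carrier H" "length bs = Suc q" "set bs \<subseteq> carrier C" for x y u bs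
  proof -
    have "sb (Suc 0) q 0 (pt [y, u \<otimes>\<^bsub>H\<^esub> x] bs) = \<epsilon>\<^bsub>H\<^esub> (u \<otimes>\<^bsub>H\<^esub> x) \<odot>\<^bsub>?L\<^esub> pt [y] bs"
      using that by (intro sb_pt[where l = "[y]" and r = "[]" for y, unfolded append.simps]) auto
    then show ?thesis
      using that by (simp add: H.counit_mult module.smult_assoc1[OF A_module, symmetric] H.R.m_comm pt_closed)
  qed
  have "sb (Suc 0) q 0 (tb (Suc 0) q (db 0 q 0 (pt gs as))) = sb (Suc 0) q 0 (tb (Suc 0) q (H.D ?M g (\<lambda>x y. pt [x, y] as)))"
    using db_pt[of 0 "[]" 0 "[]" as q g] as g by simp
  also have "tb (Suc 0) q (H.D ?M g (\<lambda>x y. pt [x, y] as)) = H.D ?M g (\<lambda>x y. tb (Suc 0) q (pt [x, y] as))"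
    using as g by (intro H.D_commute[OF tb_lin A_module A_module] A_closed) auto
  also have "\<dots> = H.D ?M g (\<lambda>x y. co ?M as (\<lambda>u bs. pt [y, u \<otimes>\<^bsub>H\<^esub> x] bs))"
    using as g by (intro H.D_cong tb) auto
  also have "sb (Suc 0) q 0 \<dots> = H.D ?L g (\<lambda>x y. sb (Suc 0) q 0 (co ?M as (\<lambda>u bs. pt [y, u \<otimes>\<^bsub>H\<^esub> x] bs)))"
    using as g by (intro H.D_commute[OF sb_lin A_module A_module] A_closed) auto
  also have "\<dots> = H.D ?L g (\<lambda>x y. co ?L as (\<lambda>u bs. sb (Suc 0) q 0 (pt [y, u \<otimes>\<^bsub>H\<^esub> x] bs)))"
    using as g by (intro H.D_cong co_commute[OF sb_lin A_module A_module] A_closed) auto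
  also have "\<dots> = H.D ?L g (\<lambda>x y. co ?L as (\<lambda>u bs. \<epsilon>\<^bsub>H\<^esub> x \<odot>\<^bsub>?L\<^esub> (\<epsilon>\<^bsub>H\<^esub> u \<odot>\<^bsub>?L\<^esub> pt [y] bs)))"
    using as g by (intro H.D_cong co_cong sb) auto
  also have "\<dots> = H.D ?L g (\<lambda>x y. \<epsilon>\<^bsub>H\<^esub> x \<odot>\<^bsub>?L\<^esub> co ?L as (\<lambda>u bs. \<epsilon>\<^bsub>H\<^esub> u \<odot>\<^bsub>?L\<^esub> pt [y] bs))"
    using as g by (intro H.D_cong co_smult module.smult_closed[OF A_module] A_closed) auto
  also have "\<dots> = H.D ?L g (\<lambda>x y. \<epsilon>\<^bsub>H\<^esub> x \<odot>\<^bsub>?L\<^esub> pt [y] as)"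
    using as g by (intro H.D_cong) (simp_all add: co_counit[OF A_module] mlin_pt2)
  also have "\<dots> = pt [g] as"
    using as g by (intro H.D_counit_left[OF A_module] lin_pt1 slot_intros lin_ident) auto
  finally show "sb (Suc 0) q 0 (tb (Suc 0) q (db 0 q 0 (pt gs as))) = pt gs as" using g by simp
next
  show "(\<lambda>x. sb (Suc 0) q 0 (tb (Suc 0) q (db 0 q 0 x))) \<in> lin_maps k (A 0 q) (A 0 q)"
    by (rule lin_comp[OF sb_lin lin_comp[OF tb_lin db_lin]]) simp_all
qed (use x in \<open>simp_all add: lin_ident A_module\<close>)

section \<open>Compatibility of the two directions\<close>

text \<open>The barred cyclic operator coacts on all coalgebra entries, so the point is that
  comultiplying one of them commutes with the diagonal coaction, which is
  \<open>co_dup\<close>.\<close>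

lemma dd_tb:
  assumes i: "i \<le> q" and x: "x \<in> carrier (A p q)"
  shows "dd p q i (tb p q x) = tb p (Suc q) (dd p q i x)"
proof (rule A_eqI[where f = "\<lambda>x. dd p q i (tb p q x)" and g = "\<lambda>x. tb p (Suc q) (dd p q i x)"])
  fix gs as assume gs: "length gs = Suc p" "set gs \<subseteq> carrier H" and as: "length as = Suc q" "set as \<subseteq> carrier C"
  then obtain g m where m: "gs = g # m" by (cases gs) auto
  have "i < length as" using i as by simp
  then obtain l a r where l: "as = l @ a # r" "length l = i" by (rule split_list_at)
  have p: "p = length m" "q = length l + length r" using gs as m l by auto
  note ms = gs(2)[unfolded m, simplified] as(2)[unfolded l, simplified]
  let ?L = "A p (Suc q)" and ?M = "A p q" and ?K = "\<lambda>u. pt (m @ [u \<otimes>\<^bsub>H\<^esub> g])"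
  have tb: "tb p (Suc q) (pt gs (l @ x # y # r)) = co ?L (l @ x # y # r) ?K" if "x \<in> carrier C" "y \<in> carrier C" for x y
    using tb_pt[of p m "l @ x # y # r" "Suc q" g] ms m p that by simp
  have "dd p q i (tb p q (pt gs as)) = dd p q i (co ?M (l @ a # r) ?K)"
    using tb_pt[of p m as q g] as ms p m l(1) by simp
  also have "\<dots> = co ?L (l @ a # r) (\<lambda>u bs. dd p q i (?K u bs))"
    using ms p i by (intro co_commute[OF dd_lin A_module A_module] A_closed) auto
  also have "\<dots> = co ?L (l @ a # r) (\<lambda>u bs. C.D ?L (bs ! length l) (\<lambda>x y. ?K u (take (length l) bs @ x # y # drop (Suc (length l)) bs)))"
    unfolding l(2) using ms p i by (intro co_cong dd_nth) auto
  also have "\<dots> = C.D ?L a (\<lambda>x y. co ?L (l @ x # y # r) ?K)"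
    using ms p
    by (intro co_dup[OF A_module]) (auto intro!: mlin_pt2 lin_pt1 slot_append2 slot_here H.lin_mult_left lin_ident)
  also have "\<dots> = C.D ?L a (\<lambda>x y. tb p (Suc q) (pt gs (l @ x # y # r)))"
    using ms by (intro C.D_cong tb[symmetric]) auto
  also have "\<dots> = tb p (Suc q) (C.D ?L a (\<lambda>x y. pt gs (l @ x # y # r)))"
    using ms p m by (intro C.D_commute[OF tb_lin A_module A_module, symmetric] A_closed) auto
  also have "\<dots> = tb p (Suc q) (dd p q i (pt gs as))"
    using dd_pt[of i l q r gs p a] gs ms p l by simp
  finally show "dd p q i (tb p q (pt gs as)) = tb p (Suc q) (dd p q i (pt gs as))" .
next
  show "(\<lambda>x. dd p q i (tb p q x)) \<in> lin_maps k (A p q) (A p (Suc q))"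
    using i by (intro lin_comp[OF dd_lin tb_lin]) auto
  show "(\<lambda>x. tb p (Suc q) (dd p q i x)) \<in> lin_maps k (A p q) (A p (Suc q))"
    using i by (intro lin_comp[OF tb_lin dd_lin]) auto
qed (rule A_module x)+

lemma ss_tb:
  assumes i: "i \<le> q" and x: "x \<in> carrier (A p (Suc q))"
  shows "ss p (Suc q) i (tb p (Suc q) x) = tb p q (ss p (Suc q) i x)"
proof (rule A_eqI[where f = "\<lambda>x. ss p (Suc q) i (tb p (Suc q) x)" and g = "\<lambda>x. tb p q (ss p (Suc q) i x)"])
  fix gs as assume gs: "length gs = Suc p" "set gs \<subseteq> carrier H" and as: "length as = Suc (Suc q)" "set as \<subseteq> carrier C"
  then obtain g m where m: "gs = g # m" by (cases gs) auto
  have "Suc i < length as" using i as by simp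
  then obtain l a r where l: "as = l @ a # r" "length l = Suc i" by (rule split_list_at)
  have p: "p = length m" "Suc q = length l + length r" using gs as m l by auto
  note ms = gs(2)[unfolded m, simplified] as(2)[unfolded l, simplified]
  let ?L = "A p q" and ?M = "A p (Suc q)" and ?K = "\<lambda>u. pt (m @ [u \<otimes>\<^bsub>H\<^esub> g])"
  have len: "length (l @ a # r) = Suc (Suc q)" using p by simp
  have "ss p (Suc q) i (tb p (Suc q) (pt gs as)) = ss p (Suc q) i (co ?M (l @ a # r) ?K)"
    using tb_pt[of p m as "Suc q" g] as ms p(1) m l(1) by simp
  also have "\<dots> = co ?L (l @ a # r) (\<lambda>u bs. ss p (Suc q) i (?K u bs))"
    using ms p(1) i len by (intro co_commute[OF ss_lin A_module A_module] A_closed) auto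
  also have "\<dots> = co ?L (l @ a # r) (\<lambda>u bs. \<epsilon>\<^bsub>C\<^esub> (bs ! length l) \<odot>\<^bsub>?L\<^esub> ?K u (take (length l) bs @ drop (Suc (length l)) bs))"
    unfolding l(2) using ms p(1) i len by (intro co_cong ss_nth) auto
  also have "\<dots> = \<epsilon>\<^bsub>C\<^esub> a \<odot>\<^bsub>?L\<^esub> co ?L (l @ r) ?K"
    using ms p(1) p(2)[symmetric]
    by (intro co_del[OF A_module]) (auto intro!: mlin_pt2 lin_pt1 slot_append2 slot_here H.lin_mult_left lin_ident)
  also have "co ?L (l @ r) ?K = tb p q (pt gs (l @ r))"
    using tb_pt[of p m "l @ r" q g] ms m p by simp
  also have "\<epsilon>\<^bsub>C\<^esub> a \<odot>\<^bsub>?L\<^esub> tb p q (pt gs (l @ r)) = tb p q (\<epsilon>\<^bsub>C\<^esub> a \<odot>\<^bsub>?L\<^esub> pt gs (l @ r))"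
    using ms m p by (intro lin_smult[OF tb_lin, symmetric] pt_closed) auto
  also have "\<dots> = tb p q (ss p (Suc q) i (pt gs as))"
    using ss_pt[of l i q r gs p a] gs ms p l by simp
  finally show "ss p (Suc q) i (tb p (Suc q) (pt gs as)) = tb p q (ss p (Suc q) i (pt gs as))" .
next
  show "(\<lambda>x. ss p (Suc q) i (tb p (Suc q) x)) \<in> lin_maps k (A p (Suc q)) (A p q)"
    using i by (intro lin_comp[OF ss_lin tb_lin]) auto
  show "(\<lambda>x. tb p q (ss p (Suc q) i x)) \<in> lin_maps k (A p (Suc q)) (A p q)"
    using i by (intro lin_comp[OF tb_lin ss_lin]) auto
qed (rule A_module x)+

text \<open>\<omega> acts diagonally on the Hopf entries, so the point is equivariance of
  comultiplying one of them, which is \<open>act_dup\<close>.\<close>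

lemma om_db:
  assumes i: "i \<le> p" and x: "x \<in> carrier (A p q)"
  shows "om (Suc p) q (db p q i x) = db p q i (om p q x)"
proof (rule A_eqI[where f = "\<lambda>x. om (Suc p) q (db p q i x)" and g = "\<lambda>x. db p q i (om p q x)"])
  fix gs as assume gs: "length gs = Suc p" "set gs \<subseteq> carrier H" and as: "length as = Suc q" "set as \<subseteq> carrier C"
  then obtain m a where m: "as = m @ [a]" by (cases as rule: rev_cases) auto
  have "i < length gs" using i gs by simp
  then obtain l g r where l: "gs = l @ g # r" "length l = i" by (rule split_list_at)
  have q: "q = length m" "p = length l + length r" using gs as m l by auto
  note ms = as(2)[unfolded m, simplified] gs(2)[unfolded l, simplified]
  let ?L = "A (Suc p) q" and ?M = "A p q"
  have om: "om (Suc p) q (pt (l @ x # y # r) as) = R ?L a (\<lambda>h b. H.act ?L (l @ x # y # r) h (\<lambda>s. pt s (b # m)))"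
    if "x \<in> carrier H" "y \<in> carrier H" for x y
    using om_pt[of q m "l @ x # y # r" "Suc p" a] ms m q that by simp
  have "db p q i (om p q (pt gs as)) = db p q i (R ?M a (\<lambda>h b. H.act ?M (l @ g # r) h (\<lambda>s. pt s (b # m))))"
    using om_pt[of q m gs p a] gs ms q m l(1) by simp
  also have "\<dots> = R ?L a (\<lambda>h b. db p q i (H.act ?M (l @ g # r) h (\<lambda>s. pt s (b # m))))"
    using ms q i by (intro R_commute[OF db_lin A_module A_module] A_closed) auto
  also have "\<dots> = R ?L a (\<lambda>h b. H.act ?L (l @ g # r) h (\<lambda>s. db p q i (pt s (b # m))))"
    using ms q i by (intro R_cong H.act_commute[OF db_lin A_module A_module] A_closed) auto
  also have "\<dots> = R ?L a (\<lambda>h b. H.act ?L (l @ g # r) h (\<lambda>s. H.D ?L (s ! length l) (\<lambda>x y. pt (take (length l) s @ x # y # drop (Suc (length l)) s) (b # m))))"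
    unfolding l(2) using ms q i by (intro R_cong H.act_cong db_nth) auto
  also have "\<dots> = R ?L a (\<lambda>h b. H.D ?L g (\<lambda>x y. H.act ?L (l @ x # y # r) h (\<lambda>s. pt s (b # m))))"
    using ms q by (intro R_cong H.act_dup[OF A_module, where K = "\<lambda>s. pt s (b # m)" for b]) (auto intro!: mlin_pt1)
  also have "\<dots> = H.D ?L g (\<lambda>x y. R ?L a (\<lambda>h b. H.act ?L (l @ x # y # r) h (\<lambda>s. pt s (b # m))))"
    using ms q by (intro R_DH_swap[OF A_module] A_closed) auto
  also have "\<dots> = H.D ?L g (\<lambda>x y. om (Suc p) q (pt (l @ x # y # r) as))"
    using ms by (intro H.D_cong om[symmetric]) auto
  also have "\<dots> = om (Suc p) q (H.D ?L g (\<lambda>x y. pt (l @ x # y # r) as))"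
    using as ms q by (intro H.D_commute[OF om_lin A_module A_module, symmetric] A_closed) auto
  also have "\<dots> = om (Suc p) q (db p q i (pt gs as))"
    using db_pt[of i l p r as q g] as ms q l by simp
  finally show "om (Suc p) q (db p q i (pt gs as)) = db p q i (om p q (pt gs as))" by simp
next
  show "(\<lambda>x. om (Suc p) q (db p q i x)) \<in> lin_maps k (A p q) (A (Suc p) q)"
    using i by (intro lin_comp[OF om_lin db_lin]) auto
  show "(\<lambda>x. db p q i (om p q x)) \<in> lin_maps k (A p q) (A (Suc p) q)"
    using i by (intro lin_comp[OF db_lin om_lin]) auto
qed (rule A_module x)+

lemma om_sb:
  assumes i: "i \<le> p" and x: "x \<in> carrier (A (Suc p) q)"
  shows "om p q (sb (Suc p) q i x) = sb (Suc p) q i (om (Suc p) q x)"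
proof (rule A_eqI[where f = "\<lambda>x. om p q (sb (Suc p) q i x)" and g = "\<lambda>x. sb (Suc p) q i (om (Suc p) q x)"])
  fix gs as assume gs: "length gs = Suc (Suc p)" "set gs \<subseteq> carrier H" and as: "length as = Suc q" "set as \<subseteq> carrier C"
  then obtain m a where m: "as = m @ [a]" by (cases as rule: rev_cases) auto
  have "Suc i < length gs" using i gs by simp
  then obtain l g r where l: "gs = l @ g # r" "length l = Suc i" by (rule split_list_at)
  have q: "q = length m" "Suc p = length l + length r" using gs as m l by auto
  note ms = as(2)[unfolded m, simplified] gs(2)[unfolded l, simplified]
  let ?L = "A p q" and ?M = "A (Suc p) q"
  have len: "length (l @ g # r) = Suc (Suc p)" using q by simp
  have "sb (Suc p) q i (om (Suc p) q (pt gs as)) = sb (Suc p) q i (R ?M a (\<lambda>h b. H.act ?M (l @ g # r) h (\<lambda>s. pt s (b # m))))"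
    using om_pt[of q m gs "Suc p" a] gs ms q(1) m l(1) by simp
  also have "\<dots> = R ?L a (\<lambda>h b. sb (Suc p) q i (H.act ?M (l @ g # r) h (\<lambda>s. pt s (b # m))))"
    using ms q(1) i len by (intro R_commute[OF sb_lin A_module A_module] A_closed) auto
  also have "\<dots> = R ?L a (\<lambda>h b. H.act ?L (l @ g # r) h (\<lambda>s. sb (Suc p) q i (pt s (b # m))))"
    using ms q(1) i len by (intro R_cong H.act_commute[OF sb_lin A_module A_module] A_closed) auto
  also have "\<dots> = R ?L a (\<lambda>h b. H.act ?L (l @ g # r) h (\<lambda>s. \<epsilon>\<^bsub>H\<^esub> (s ! length l) \<odot>\<^bsub>?L\<^esub> pt (take (length l) s @ drop (Suc (length l)) s) (b # m)))"
    unfolding l(2) using ms q(1) i len by (intro R_cong H.act_cong sb_nth) auto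
  also have "\<dots> = R ?L a (\<lambda>h b. \<epsilon>\<^bsub>H\<^esub> g \<odot>\<^bsub>?L\<^esub> H.act ?L (l @ r) h (\<lambda>s. pt s (b # m)))"
    using ms q(1) q(2)[symmetric] by (intro R_cong H.act_del[OF A_module, where K = "\<lambda>s. pt s (b # m)" for b]) (auto intro!: mlin_pt1)
  also have "\<dots> = \<epsilon>\<^bsub>H\<^esub> g \<odot>\<^bsub>?L\<^esub> R ?L a (\<lambda>h b. H.act ?L (l @ r) h (\<lambda>s. pt s (b # m)))"
    using ms q by (intro R_smult A_closed) auto
  also have "R ?L a (\<lambda>h b. H.act ?L (l @ r) h (\<lambda>s. pt s (b # m))) = om p q (pt (l @ r) as)"
    using om_pt[of q m "l @ r" p a] ms m q by simp
  also have "\<epsilon>\<^bsub>H\<^esub> g \<odot>\<^bsub>?L\<^esub> om p q (pt (l @ r) as) = om p q (\<epsilon>\<^bsub>H\<^esub> g \<odot>\<^bsub>?L\<^esub> pt (l @ r) as)"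
    using as ms q by (intro lin_smult[OF om_lin, symmetric] pt_closed) auto
  also have "\<dots> = om p q (sb (Suc p) q i (pt gs as))"
    using sb_pt[of l i p r as q g] as ms q l by simp
  finally show "om p q (sb (Suc p) q i (pt gs as)) = sb (Suc p) q i (om (Suc p) q (pt gs as))" by simp
next
  show "(\<lambda>x. om p q (sb (Suc p) q i x)) \<in> lin_maps k (A (Suc p) q) (A p q)"
    using i by (intro lin_comp[OF om_lin sb_lin]) auto
  show "(\<lambda>x. sb (Suc p) q i (om (Suc p) q x)) \<in> lin_maps k (A (Suc p) q) (A p q)"
    using i by (intro lin_comp[OF sb_lin om_lin]) auto
qed (rule A_module x)+

text \<open>Let a be the last coalgebra entry, l the others and \<open>g # r\<close> the Hopf
  entries. Both composites use three consecutive coaction legs x, y, z of a: the middle leg y acts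
  on r, and the last Hopf entry becomes z u x g, where u is the leg of l. They differ only in
  whether y, z or x, y arise from a coproduct, so coassociativity identifies them.\<close>

lemma om_tb:
  assumes x: "x \<in> carrier (A p q)"
  shows "om p q (tb p q x) = tb p q (om p q x)"
proof (rule A_eqI[where f = "\<lambda>x. om p q (tb p q x)" and g = "\<lambda>x. tb p q (om p q x)"])
  fix gs as assume gs: "length gs = Suc p" "set gs \<subseteq> carrier H" and as: "length as = Suc q" "set as \<subseteq> carrier C"
  then obtain l a where l: "as = l @ [a]" by (cases as rule: rev_cases) auto
  from gs obtain g r where r: "gs = g # r" by (cases gs) auto
  have p: "q = length l" "p = length r" using gs as r l by auto
  note ms = as(2)[unfolded l, simplified] gs(2)[unfolded r, simplified]
  let ?L = "A p q"
  have tb: "tb p q (pt gs (l @ [a])) = co ?L l (\<lambda>u bs. R ?L a (\<lambda>h b. pt (r @ [(u \<otimes>\<^bsub>H\<^esub> h) \<otimes>\<^bsub>H\<^esub> g]) (bs @ [b])))"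
  proof -
    have "tb p q (pt gs (l @ [a])) = co ?L l (\<lambda>u bs. co ?L [a] (\<lambda>v cs. pt (r @ [(u \<otimes>\<^bsub>H\<^esub> v) \<otimes>\<^bsub>H\<^esub> g]) (bs @ cs)))"
      using ms p r tb_pt[of p r "l @ [a]" q g] co_append[of l "[a]" ?L] by simp
    also have "\<dots> = co ?L l (\<lambda>u bs. R ?L a (\<lambda>h b. pt (r @ [(u \<otimes>\<^bsub>H\<^esub> h) \<otimes>\<^bsub>H\<^esub> g]) (bs @ [b])))"
      unfolding co.simps using ms p by (intro co_cong R_cong) simp_all
    finally show ?thesis .
  qed
  have om: "om p q (pt (r @ [v]) (bs @ [b])) = R ?L b (\<lambda>h c. H.D ?L h (\<lambda>x y. H.act ?L r x (\<lambda>s. pt (s @ [y \<otimes>\<^bsub>H\<^esub> v]) (c # bs))))"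
    if "v \<in> carrier H" "b \<in> carrier C" "length bs = q" "set bs \<subseteq> carrier C" for v bs b
  proof -
    have "om p q (pt (r @ [v]) (bs @ [b])) = R ?L b (\<lambda>h c. H.act ?L (r @ [v]) h (\<lambda>s. pt s (c # bs)))"
      using that ms p by (intro om_pt) auto
    also have "\<dots> = R ?L b (\<lambda>h c. H.D ?L h (\<lambda>x y. H.act ?L r x (\<lambda>s. H.act ?L [v] y (\<lambda>s'. pt (s @ s') (c # bs)))))"
      using that ms p by (intro R_cong H.act_append[OF A_module, where K = "\<lambda>s. pt s (c # bs)" for c]) (auto intro!: mlin_pt1)
    also have "\<dots> = R ?L b (\<lambda>h c. H.D ?L h (\<lambda>x y. H.act ?L r x (\<lambda>s. pt (s @ [y \<otimes>\<^bsub>H\<^esub> v]) (c # bs))))"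
      using that ms p
      by (intro R_cong H.D_cong H.act_cong H.act_single[OF A_module, where K = "\<lambda>s'. pt (s @ s') (c # bs)" for c s])
        (auto intro!: mlinI pt_closed lin_pt1 slot_append2 slot_here lin_ident)
    finally show ?thesis .
  qed
  let ?F = "\<lambda>x y z b u bs. H.act ?L r y (\<lambda>s. pt (s @ [(z \<otimes>\<^bsub>H\<^esub> (u \<otimes>\<^bsub>H\<^esub> x)) \<otimes>\<^bsub>H\<^esub> g]) (b # bs))"
  let ?G = "\<lambda>x y z b. co ?L l (?F x y z b)"
  have Gc: "?F x y z b u bs \<in> carrier ?L"
    if "x \<in> carrier H" "y \<in> carrier H" "z \<in> carrier H" "b \<in> carrier C" "u \<in> carrier H" "length bs = q" "set bs \<subseteq> carrier C"
    for x y z b u bs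
    using that ms p by (intro A_closed) auto
  have "om p q (tb p q (pt gs as)) = om p q (co ?L l (\<lambda>u bs. R ?L a (\<lambda>h b. pt (r @ [(u \<otimes>\<^bsub>H\<^esub> h) \<otimes>\<^bsub>H\<^esub> g]) (bs @ [b]))))"
    using tb l by simp
  also have "\<dots> = co ?L l (\<lambda>u bs. om p q (R ?L a (\<lambda>h b. pt (r @ [(u \<otimes>\<^bsub>H\<^esub> h) \<otimes>\<^bsub>H\<^esub> g]) (bs @ [b]))))"
    using ms p by (intro co_commute[OF om_lin A_module A_module] A_closed) auto
  also have "\<dots> = co ?L l (\<lambda>u bs. R ?L a (\<lambda>h b. om p q (pt (r @ [(u \<otimes>\<^bsub>H\<^esub> h) \<otimes>\<^bsub>H\<^esub> g]) (bs @ [b]))))"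
    using ms p by (intro co_cong R_commute[OF om_lin A_module A_module] A_closed) auto
  also have "\<dots> = co ?L l (\<lambda>u bs. R ?L a (\<lambda>h b. R ?L b (\<lambda>h' c. H.D ?L h' (\<lambda>y z. ?F h y z c u bs))))"
    using ms p by (intro co_cong R_cong om[THEN trans] R_cong H.D_cong H.act_cong) (auto simp: H.H_m_assoc)
  also have "\<dots> = R ?L a (\<lambda>h b. co ?L l (\<lambda>u bs. R ?L b (\<lambda>h' c. H.D ?L h' (\<lambda>y z. ?F h y z c u bs))))"
    using ms p Gc by (intro co_R_swap[OF A_module] A_R_closed A_DH_closed) auto
  also have "\<dots> = R ?L a (\<lambda>h b. R ?L b (\<lambda>h' c. co ?L l (\<lambda>u bs. H.D ?L h' (\<lambda>y z. ?F h y z c u bs))))"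
    using ms p Gc by (intro R_cong co_R_swap[OF A_module] A_DH_closed) auto
  also have "\<dots> = R ?L a (\<lambda>h b. R ?L b (\<lambda>h' c. H.D ?L h' (\<lambda>y z. ?G h y z c)))"
    using ms p Gc by (intro R_cong co_DH_swap[OF A_module]) auto
  \<comment> \<open>From here the legs are regrouped from x, (y, z) to (x, y), z: the coaction is
    turned into a coproduct, coassociativity of the coproduct is applied, and the outer coproduct is
    turned back into a coaction.\<close>
  also have "\<dots> = R ?L a (\<lambda>h b. H.D ?L h (\<lambda>x h'. H.D ?L h' (\<lambda>y z. ?G x y z b)))"
    using ms p Gc
    by (intro R_coassoc[OF A_module, symmetric] H.lin_D_param[OF A_module] H.lin_D[OF A_module]
        lin_co_param[OF A_module] H.lin_act_param[OF A_module] H.lin_act[OF A_module]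
        H.module_axioms C.module_axioms lin_pt1 lin_pt2 slot_append2 slot_here lin_ident H.lin_mult_left H.lin_mult_right)
      (auto intro!: mlinI pt_closed lin_pt1 slot_append1 slot_append2 slot_here lin_ident)
  also have "\<dots> = R ?L a (\<lambda>h b. H.D ?L h (\<lambda>h' z. H.D ?L h' (\<lambda>x y. ?G x y z b)))"
    using ms p Gc
    by (intro R_cong H.D_coassoc[OF A_module, symmetric]
        lin_co_param[OF A_module] H.lin_act_param[OF A_module] H.lin_act[OF A_module]
        H.module_axioms C.module_axioms lin_pt1 slot_append2 slot_here lin_ident H.lin_mult_left H.lin_mult_right)
      (auto intro!: mlinI pt_closed lin_pt1 slot_append1 slot_append2 slot_here lin_ident)
  also have "\<dots> = R ?L a (\<lambda>h b. R ?L b (\<lambda>z c. H.D ?L h (\<lambda>x y. ?G x y z c)))"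
    using ms p Gc
    by (intro R_coassoc[OF A_module] H.lin_D_param[OF A_module] H.lin_D[OF A_module]
        lin_co_param[OF A_module] H.lin_act_param[OF A_module] H.lin_act[OF A_module]
        H.module_axioms C.module_axioms lin_pt1 lin_pt2 slot_append2 slot_here lin_ident H.lin_mult_left H.lin_mult_right)
      (auto intro!: mlinI pt_closed lin_pt1 slot_append1 slot_append2 slot_here lin_ident)
  also have "\<dots> = R ?L a (\<lambda>h b. tb p q (H.act ?L gs h (\<lambda>s. pt s (b # l))))"
  proof (rule R_cong)
    fix h b assume hb: "h \<in> carrier H" "b \<in> carrier C"
    have tb: "tb p q (pt (x \<otimes>\<^bsub>H\<^esub> g # s) (b # l)) = R ?L b (\<lambda>z c. co ?L l (\<lambda>u bs. pt (s @ [(z \<otimes>\<^bsub>H\<^esub> (u \<otimes>\<^bsub>H\<^esub> x)) \<otimes>\<^bsub>H\<^esub> g]) (c # bs)))"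
      if "x \<in> carrier H" "length s = p" "set s \<subseteq> carrier H" for x s
    proof -
      have "tb p q (pt (x \<otimes>\<^bsub>H\<^esub> g # s) (b # l)) = R ?L b (\<lambda>z c. co ?L l (\<lambda>u bs. pt (s @ [(z \<otimes>\<^bsub>H\<^esub> u) \<otimes>\<^bsub>H\<^esub> (x \<otimes>\<^bsub>H\<^esub> g)]) (c # bs)))"
        using tb_pt[of p s "b # l" q "x \<otimes>\<^bsub>H\<^esub> g"] that ms p hb by simp
      also have "\<dots> = R ?L b (\<lambda>z c. co ?L l (\<lambda>u bs. pt (s @ [(z \<otimes>\<^bsub>H\<^esub> (u \<otimes>\<^bsub>H\<^esub> x)) \<otimes>\<^bsub>H\<^esub> g]) (c # bs)))"
        using that ms p hb by (intro R_cong co_cong) (simp_all add: H.H_m_assoc)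
      finally show ?thesis .
    qed
    have "tb p q (H.act ?L gs h (\<lambda>s. pt s (b # l))) = H.D ?L h (\<lambda>x y. tb p q (H.act ?L r y (\<lambda>s. pt (x \<otimes>\<^bsub>H\<^esub> g # s) (b # l))))"
      unfolding r H.act.simps using hb ms p by (intro H.D_commute[OF tb_lin A_module A_module] A_closed) auto
    also have "\<dots> = H.D ?L h (\<lambda>x y. H.act ?L r y (\<lambda>s. tb p q (pt (x \<otimes>\<^bsub>H\<^esub> g # s) (b # l))))"
      using hb ms p by (intro H.D_cong H.act_commute[OF tb_lin A_module A_module] A_closed) auto
    also have "\<dots> = H.D ?L h (\<lambda>x y. H.act ?L r y (\<lambda>s. R ?L b (\<lambda>z c. co ?L l (\<lambda>u bs. pt (s @ [(z \<otimes>\<^bsub>H\<^esub> (u \<otimes>\<^bsub>H\<^esub> x)) \<otimes>\<^bsub>H\<^esub> g]) (c # bs)))))"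
      using hb ms p by (intro H.D_cong H.act_cong tb) auto
    also have "\<dots> = H.D ?L h (\<lambda>x y. R ?L b (\<lambda>z c. H.act ?L r y (\<lambda>s. co ?L l (\<lambda>u bs. pt (s @ [(z \<otimes>\<^bsub>H\<^esub> (u \<otimes>\<^bsub>H\<^esub> x)) \<otimes>\<^bsub>H\<^esub> g]) (c # bs)))))"
      using hb ms p by (intro H.D_cong act_R_swap[OF A_module] A_closed) auto
    also have "\<dots> = H.D ?L h (\<lambda>x y. R ?L b (\<lambda>z c. ?G x y z c))"
      using hb ms p by (intro H.D_cong R_cong act_co_swap[OF A_module] A_closed) auto
    also have "\<dots> = R ?L b (\<lambda>z c. H.D ?L h (\<lambda>x y. ?G x y z c))"
      using hb ms p Gc by (intro R_DH_swap[OF A_module, symmetric] A_co_closed) auto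
    finally show "R ?L b (\<lambda>z c. H.D ?L h (\<lambda>x y. ?G x y z c)) = tb p q (H.act ?L gs h (\<lambda>s. pt s (b # l)))" by simp
  qed (use ms in auto)
  also have "\<dots> = tb p q (R ?L a (\<lambda>h b. H.act ?L gs h (\<lambda>s. pt s (b # l))))"
    using gs ms p by (intro R_commute[OF tb_lin A_module A_module, symmetric] A_closed) auto
  also have "\<dots> = tb p q (om p q (pt gs as))"
    using om_pt[of q l gs p a] gs ms p l by simp
  finally show "om p q (tb p q (pt gs as)) = tb p q (om p q (pt gs as))" .
next
  show "(\<lambda>x. om p q (tb p q x)) \<in> lin_maps k (A p q) (A p q)"
    by (intro lin_comp[OF om_lin tb_lin])
  show "(\<lambda>x. tb p q (om p q x)) \<in> lin_maps k (A p q) (A p q)"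
    by (intro lin_comp[OF tb_lin om_lin])
qed (rule A_module x)+

text \<open>The two coproducts affect entries of different lists, so the claim is an interchange of
  sums. The last cofaces are added in \<open>dd_db\<close>.\<close>

lemma dd_db_0:
  assumes i: "i \<le> q" "j \<le> p" and x: "x \<in> carrier (A p q)"
  shows "dd (Suc p) q i (db p q j x) = db p (Suc q) j (dd p q i x)"
proof (rule A_eqI[where f = "\<lambda>x. dd (Suc p) q i (db p q j x)" and g = "\<lambda>x. db p (Suc q) j (dd p q i x)"])
  fix gs as assume gs: "length gs = Suc p" "set gs \<subseteq> carrier H" and as: "length as = Suc q" "set as \<subseteq> carrier C"
  have "i < length as" "j < length gs" using i gs as by auto
  then obtain l a r l' g r' where l: "as = l @ a # r" "length l = i" and l': "gs = l' @ g # r'" "length l' = j"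
    by (metis split_list_at)
  have p: "q = length l + length r" "p = length l' + length r'" using gs as l l' by auto
  note ms = as(2)[unfolded l, simplified] gs(2)[unfolded l', simplified]
  let ?L = "A (Suc p) (Suc q)"
  have dd: "dd (Suc p) q i (pt (l' @ x # y # r') as) = C.D ?L a (\<lambda>u v. pt (l' @ x # y # r') (l @ u # v # r))"
    if "x \<in> carrier H" "y \<in> carrier H" for x y
    using dd_pt[of i l q r "l' @ x # y # r'" "Suc p" a] l ms p that by simp
  have db: "db p (Suc q) j (pt gs (l @ u # v # r)) = H.D ?L g (\<lambda>x y. pt (l' @ x # y # r') (l @ u # v # r))"
    if "u \<in> carrier C" "v \<in> carrier C" for u v
    using db_pt[of j l' p r' "l @ u # v # r" "Suc q" g] l' ms p that by simp
  have "dd (Suc p) q i (db p q j (pt gs as)) = dd (Suc p) q i (H.D (A (Suc p) q) g (\<lambda>x y. pt (l' @ x # y # r') as))"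
    using db_pt[of j l' p r' as q g] l' as ms p by simp
  also have "\<dots> = H.D ?L g (\<lambda>x y. dd (Suc p) q i (pt (l' @ x # y # r') as))"
    using i as ms p by (intro H.D_commute[OF dd_lin A_module A_module] A_closed) auto
  also have "\<dots> = H.D ?L g (\<lambda>x y. C.D ?L a (\<lambda>u v. pt (l' @ x # y # r') (l @ u # v # r)))"
    using ms by (intro H.D_cong dd) auto
  also have "\<dots> = C.D ?L a (\<lambda>u v. H.D ?L g (\<lambda>x y. pt (l' @ x # y # r') (l @ u # v # r)))"
    using ms p by (intro DC_DH_swap[OF A_module, symmetric] A_closed) auto
  also have "\<dots> = C.D ?L a (\<lambda>u v. db p (Suc q) j (pt gs (l @ u # v # r)))"
    using ms by (intro C.D_cong db[symmetric]) auto
  also have "\<dots> = db p (Suc q) j (C.D (A p (Suc q)) a (\<lambda>u v. pt gs (l @ u # v # r)))"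
    using i gs ms p by (intro C.D_commute[OF db_lin A_module A_module, symmetric] A_closed) auto
  also have "\<dots> = db p (Suc q) j (dd p q i (pt gs as))"
    using dd_pt[of i l q r gs p a] l gs ms p by simp
  finally show "dd (Suc p) q i (db p q j (pt gs as)) = db p (Suc q) j (dd p q i (pt gs as))" .
next
  show "(\<lambda>x. dd (Suc p) q i (db p q j x)) \<in> lin_maps k (A p q) (A (Suc p) (Suc q))"
    using i by (intro lin_comp[OF dd_lin db_lin])
  show "(\<lambda>x. db p (Suc q) j (dd p q i x)) \<in> lin_maps k (A p q) (A (Suc p) (Suc q))"
    using i by (intro lin_comp[OF db_lin dd_lin])
qed (rule A_module x)+

lemma DC_smult:
  "\<lbrakk>c \<in> carrier k; a \<in> carrier C; \<And>h b. \<lbrakk>h \<in> carrier C; b \<in> carrier C\<rbrakk> \<Longrightarrow> G h b \<in> carrier (A p q)\<rbrakk> \<Longrightarrow>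
    C.D (A p q) a (\<lambda>h b. c \<odot>\<^bsub>A p q\<^esub> G h b) = c \<odot>\<^bsub>A p q\<^esub> C.D (A p q) a G"
  by (intro C.D_commute[OF lin_smult_right[OF A_module lin_ident] A_module A_module, symmetric]) auto

lemma DH_smult:
  "\<lbrakk>c \<in> carrier k; a \<in> carrier H; \<And>h b. \<lbrakk>h \<in> carrier H; b \<in> carrier H\<rbrakk> \<Longrightarrow> G h b \<in> carrier (A p q)\<rbrakk> \<Longrightarrow>
    H.D (A p q) a (\<lambda>h b. c \<odot>\<^bsub>A p q\<^esub> G h b) = c \<odot>\<^bsub>A p q\<^esub> H.D (A p q) a G"
  by (intro H.D_commute[OF lin_smult_right[OF A_module lin_ident] A_module A_module, symmetric]) auto

lemma dd_sb_0:
  assumes i: "i \<le> q" "j \<le> p" and x: "x \<in> carrier (A (Suc p) q)"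
  shows "dd p q i (sb (Suc p) q j x) = sb (Suc p) (Suc q) j (dd (Suc p) q i x)"
proof (rule A_eqI[where f = "\<lambda>x. dd p q i (sb (Suc p) q j x)" and g = "\<lambda>x. sb (Suc p) (Suc q) j (dd (Suc p) q i x)"])
  fix gs as assume gs: "length gs = Suc (Suc p)" "set gs \<subseteq> carrier H" and as: "length as = Suc q" "set as \<subseteq> carrier C"
  have "i < length as" "Suc j < length gs" using i gs as by auto
  then obtain l a r l' g r' where l: "as = l @ a # r" "length l = i" and l': "gs = l' @ g # r'" "length l' = Suc j"
    by (metis split_list_at)
  have p: "q = length l + length r" "Suc p = length l' + length r'" using gs as l l' by auto
  note ms = as(2)[unfolded l, simplified] gs(2)[unfolded l', simplified]
  let ?L = "A p (Suc q)"
  have sb: "sb (Suc p) (Suc q) j (pt gs (l @ u # v # r)) = \<epsilon>\<^bsub>H\<^esub> g \<odot>\<^bsub>?L\<^esub> pt (l' @ r') (l @ u # v # r)"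
    if "u \<in> carrier C" "v \<in> carrier C" for u v
    using sb_pt[of l' j p r' "l @ u # v # r" "Suc q" g] l' ms p that by simp
  have "sb (Suc p) (Suc q) j (dd (Suc p) q i (pt gs as))
    = sb (Suc p) (Suc q) j (C.D (A (Suc p) (Suc q)) a (\<lambda>u v. pt gs (l @ u # v # r)))"
    using dd_pt[of i l q r gs "Suc p" a] l gs ms p(1) by simp
  also have "\<dots> = C.D ?L a (\<lambda>u v. sb (Suc p) (Suc q) j (pt gs (l @ u # v # r)))"
    using i gs ms p(1) by (intro C.D_commute[OF sb_lin A_module A_module] A_closed) auto
  also have "\<dots> = C.D ?L a (\<lambda>u v. \<epsilon>\<^bsub>H\<^esub> g \<odot>\<^bsub>?L\<^esub> pt (l' @ r') (l @ u # v # r))"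
    using ms by (intro C.D_cong sb) auto
  also have "\<dots> = \<epsilon>\<^bsub>H\<^esub> g \<odot>\<^bsub>?L\<^esub> C.D ?L a (\<lambda>u v. pt (l' @ r') (l @ u # v # r))"
    using ms p by (intro DC_smult A_closed) auto
  also have "C.D ?L a (\<lambda>u v. pt (l' @ r') (l @ u # v # r)) = dd p q i (pt (l' @ r') as)"
    using dd_pt[of i l q r "l' @ r'" p a] l ms p by simp
  also have "\<epsilon>\<^bsub>H\<^esub> g \<odot>\<^bsub>?L\<^esub> dd p q i (pt (l' @ r') as) = dd p q i (\<epsilon>\<^bsub>H\<^esub> g \<odot>\<^bsub>A p q\<^esub> pt (l' @ r') as)"
    using i as ms p by (intro lin_smult[OF dd_lin, symmetric] pt_closed) auto
  also have "\<dots> = dd p q i (sb (Suc p) q j (pt gs as))"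
    using sb_pt[of l' j p r' as q g] l' as ms p by simp
  finally show "dd p q i (sb (Suc p) q j (pt gs as)) = sb (Suc p) (Suc q) j (dd (Suc p) q i (pt gs as))" by simp
next
  show "(\<lambda>x. dd p q i (sb (Suc p) q j x)) \<in> lin_maps k (A (Suc p) q) (A p (Suc q))"
    using i by (intro lin_comp[OF dd_lin sb_lin]) auto
  show "(\<lambda>x. sb (Suc p) (Suc q) j (dd (Suc p) q i x)) \<in> lin_maps k (A (Suc p) q) (A p (Suc q))"
    using i by (intro lin_comp[OF sb_lin dd_lin]) auto
qed (rule A_module x)+

lemma ss_db_0:
  assumes i: "i \<le> q" "j \<le> p" and x: "x \<in> carrier (A p (Suc q))"
  shows "ss (Suc p) (Suc q) i (db p (Suc q) j x) = db p q j (ss p (Suc q) i x)"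
proof (rule A_eqI[where f = "\<lambda>x. ss (Suc p) (Suc q) i (db p (Suc q) j x)" and g = "\<lambda>x. db p q j (ss p (Suc q) i x)"])
  fix gs as assume gs: "length gs = Suc p" "set gs \<subseteq> carrier H" and as: "length as = Suc (Suc q)" "set as \<subseteq> carrier C"
  have "Suc i < length as" "j < length gs" using i gs as by auto
  then obtain l a r l' g r' where l: "as = l @ a # r" "length l = Suc i" and l': "gs = l' @ g # r'" "length l' = j"
    by (metis split_list_at)
  have p: "Suc q = length l + length r" "p = length l' + length r'" using gs as l l' by auto
  note ms = as(2)[unfolded l, simplified] gs(2)[unfolded l', simplified]
  let ?L = "A (Suc p) q"
  have ss: "ss (Suc p) (Suc q) i (pt (l' @ u # v # r') as) = \<epsilon>\<^bsub>C\<^esub> a \<odot>\<^bsub>?L\<^esub> pt (l' @ u # v # r') (l @ r)"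
    if "u \<in> carrier H" "v \<in> carrier H" for u v
    using ss_pt[of l i q r "l' @ u # v # r'" "Suc p" a] l ms p that by simp
  have "ss (Suc p) (Suc q) i (db p (Suc q) j (pt gs as))
    = ss (Suc p) (Suc q) i (H.D (A (Suc p) (Suc q)) g (\<lambda>u v. pt (l' @ u # v # r') as))"
    using db_pt[of j l' p r' as "Suc q" g] l' as ms p(2) by simp
  also have "\<dots> = H.D ?L g (\<lambda>u v. ss (Suc p) (Suc q) i (pt (l' @ u # v # r') as))"
    using i as ms p(2) by (intro H.D_commute[OF ss_lin A_module A_module] A_closed) auto
  also have "\<dots> = H.D ?L g (\<lambda>u v. \<epsilon>\<^bsub>C\<^esub> a \<odot>\<^bsub>?L\<^esub> pt (l' @ u # v # r') (l @ r))"
    using ms by (intro H.D_cong ss) auto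
  also have "\<dots> = \<epsilon>\<^bsub>C\<^esub> a \<odot>\<^bsub>?L\<^esub> H.D ?L g (\<lambda>u v. pt (l' @ u # v # r') (l @ r))"
    using ms p by (intro DH_smult A_closed) auto
  also have "H.D ?L g (\<lambda>u v. pt (l' @ u # v # r') (l @ r)) = db p q j (pt gs (l @ r))"
    using db_pt[of j l' p r' "l @ r" q g] l' ms p by simp
  also have "\<epsilon>\<^bsub>C\<^esub> a \<odot>\<^bsub>?L\<^esub> db p q j (pt gs (l @ r)) = db p q j (\<epsilon>\<^bsub>C\<^esub> a \<odot>\<^bsub>A p q\<^esub> pt gs (l @ r))"
    using i gs ms p by (intro lin_smult[OF db_lin, symmetric] pt_closed) auto
  also have "\<dots> = db p q j (ss p (Suc q) i (pt gs as))"
    using ss_pt[of l i q r gs p a] l gs ms p by simp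
  finally show "ss (Suc p) (Suc q) i (db p (Suc q) j (pt gs as)) = db p q j (ss p (Suc q) i (pt gs as))" .
next
  show "(\<lambda>x. ss (Suc p) (Suc q) i (db p (Suc q) j x)) \<in> lin_maps k (A p (Suc q)) (A (Suc p) q)"
    using i by (intro lin_comp[OF ss_lin db_lin]) auto
  show "(\<lambda>x. db p q j (ss p (Suc q) i x)) \<in> lin_maps k (A p (Suc q)) (A (Suc p) q)"
    using i by (intro lin_comp[OF db_lin ss_lin]) auto
qed (rule A_module x)+

lemma ss_sb:
  assumes i: "i \<le> q" "j \<le> p" and x: "x \<in> carrier (A (Suc p) (Suc q))"
  shows "ss p (Suc q) i (sb (Suc p) (Suc q) j x) = sb (Suc p) q j (ss (Suc p) (Suc q) i x)"
proof (rule A_eqI[where f = "\<lambda>x. ss p (Suc q) i (sb (Suc p) (Suc q) j x)" and g = "\<lambda>x. sb (Suc p) q j (ss (Suc p) (Suc q) i x)"])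
  fix gs as assume gs: "length gs = Suc (Suc p)" "set gs \<subseteq> carrier H" and as: "length as = Suc (Suc q)" "set as \<subseteq> carrier C"
  have "Suc i < length as" "Suc j < length gs" using i gs as by auto
  then obtain l a r l' g r' where l: "as = l @ a # r" "length l = Suc i" and l': "gs = l' @ g # r'" "length l' = Suc j"
    by (metis split_list_at)
  have p: "Suc q = length l + length r" "Suc p = length l' + length r'" using gs as l l' by auto
  note ms = as(2)[unfolded l, simplified] gs(2)[unfolded l', simplified]
  have 1: "ss p (Suc q) i (sb (Suc p) (Suc q) j (pt gs as)) = \<epsilon>\<^bsub>H\<^esub> g \<odot>\<^bsub>A p q\<^esub> (\<epsilon>\<^bsub>C\<^esub> a \<odot>\<^bsub>A p q\<^esub> pt (l' @ r') (l @ r))"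
  proof -
    have "sb (Suc p) (Suc q) j (pt gs as) = \<epsilon>\<^bsub>H\<^esub> g \<odot>\<^bsub>A p (Suc q)\<^esub> pt (l' @ r') as"
      unfolding l'(1) using l'(2) as ms p(2) by (intro sb_pt) auto
    moreover have "ss p (Suc q) i (\<epsilon>\<^bsub>H\<^esub> g \<odot>\<^bsub>A p (Suc q)\<^esub> pt (l' @ r') as) = \<epsilon>\<^bsub>H\<^esub> g \<odot>\<^bsub>A p q\<^esub> ss p (Suc q) i (pt (l' @ r') as)"
      using i as ms p(2) by (intro lin_smult[OF ss_lin] pt_closed) auto
    moreover have "ss p (Suc q) i (pt (l' @ r') as) = \<epsilon>\<^bsub>C\<^esub> a \<odot>\<^bsub>A p q\<^esub> pt (l' @ r') (l @ r)"
      unfolding l(1) using l(2) ms p by (intro ss_pt) auto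
    ultimately show ?thesis by simp
  qed
  have 2: "sb (Suc p) q j (ss (Suc p) (Suc q) i (pt gs as)) = \<epsilon>\<^bsub>C\<^esub> a \<odot>\<^bsub>A p q\<^esub> (\<epsilon>\<^bsub>H\<^esub> g \<odot>\<^bsub>A p q\<^esub> pt (l' @ r') (l @ r))"
  proof -
    have "ss (Suc p) (Suc q) i (pt gs as) = \<epsilon>\<^bsub>C\<^esub> a \<odot>\<^bsub>A (Suc p) q\<^esub> pt gs (l @ r)"
      unfolding l(1) using l(2) gs ms p(1) by (intro ss_pt) auto
    moreover have "sb (Suc p) q j (\<epsilon>\<^bsub>C\<^esub> a \<odot>\<^bsub>A (Suc p) q\<^esub> pt gs (l @ r)) = \<epsilon>\<^bsub>C\<^esub> a \<odot>\<^bsub>A p q\<^esub> sb (Suc p) q j (pt gs (l @ r))"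
      using i gs ms p(1) by (intro lin_smult[OF sb_lin] pt_closed) auto
    moreover have "sb (Suc p) q j (pt gs (l @ r)) = \<epsilon>\<^bsub>H\<^esub> g \<odot>\<^bsub>A p q\<^esub> pt (l' @ r') (l @ r)"
      unfolding l'(1) using l'(2) ms p by (intro sb_pt) auto
    ultimately show ?thesis by simp
  qed
  have "pt (l' @ r') (l @ r) \<in> carrier (A p q)" using ms p by (intro pt_closed) auto
  then show "ss p (Suc q) i (sb (Suc p) (Suc q) j (pt gs as)) = sb (Suc p) q j (ss (Suc p) (Suc q) i (pt gs as))"
    unfolding 1 2 using ms by (simp add: module.smult_assoc1[OF A_module, symmetric] H.R.m_comm)
next
  show "(\<lambda>x. ss p (Suc q) i (sb (Suc p) (Suc q) j x)) \<in> lin_maps k (A (Suc p) (Suc q)) (A p q)"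
    using i by (intro lin_comp[OF ss_lin sb_lin]) auto
  show "(\<lambda>x. sb (Suc p) q j (ss (Suc p) (Suc q) i x)) \<in> lin_maps k (A (Suc p) (Suc q)) (A p q)"
    using i by (intro lin_comp[OF sb_lin ss_lin]) auto
qed (rule A_module x)+

section \<open>Cylindricity\<close>

text \<open>The block m is consumed from its right end and each step multiplies the new leg on the
  left, so the legs end up multiplied in the order of m, as in \<open>co\<close>. The untouched
  block l is kept general because the induction moves the head of m into it.\<close>

lemma om_pow:
  "\<lbrakk>length m + length l = Suc q; length gs = Suc p; set gs \<subseteq> carrier H; set l \<subseteq> carrier C; set m \<subseteq> carrier C\<rbrakk> \<Longrightarrow>
    (om p q ^^ length m) (pt gs (l @ m)) = co (A p q) m (\<lambda>u bs. H.act (A p q) gs u (\<lambda>r. pt r (bs @ l)))"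
proof (induction m arbitrary: l)
  case Nil
  then show ?case by (simp add: H.act_one[OF A_module] mlin_pt1)
next
  case (Cons a m)
  let ?L = "A p q"
  have IH: "(om p q ^^ length m) (pt gs (l @ a # m)) = co ?L m (\<lambda>u bs. H.act ?L gs u (\<lambda>r. pt r (bs @ l @ [a])))"
    using Cons.IH[of "l @ [a]"] Cons.prems by simp
  have om: "om p q (H.act ?L gs u (\<lambda>r. pt r (bs @ l @ [a]))) = R ?L a (\<lambda>h b. H.act ?L gs (h \<otimes>\<^bsub>H\<^esub> u) (\<lambda>s. pt s (b # bs @ l)))"
    if "u \<in> carrier H" "length bs = length m" "set bs \<subseteq> carrier C" for u bs
    using om_act[of q "bs @ l" gs p u a] Cons.prems that by simp
  have "(om p q ^^ length (a # m)) (pt gs (l @ a # m)) = om p q (co ?L m (\<lambda>u bs. H.act ?L gs u (\<lambda>r. pt r (bs @ l @ [a]))))"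
    using IH by simp
  also have "\<dots> = co ?L m (\<lambda>u bs. om p q (H.act ?L gs u (\<lambda>r. pt r (bs @ l @ [a]))))"
    using Cons.prems by (intro co_commute[OF om_lin A_module A_module] A_closed) auto
  also have "\<dots> = co ?L m (\<lambda>u bs. R ?L a (\<lambda>h b. H.act ?L gs (h \<otimes>\<^bsub>H\<^esub> u) (\<lambda>s. pt s (b # bs @ l))))"
    using Cons.prems by (intro co_cong om) auto
  also have "\<dots> = R ?L a (\<lambda>h b. co ?L m (\<lambda>u bs. H.act ?L gs (h \<otimes>\<^bsub>H\<^esub> u) (\<lambda>s. pt s (b # bs @ l))))"
    using Cons.prems by (intro co_R_swap[OF A_module] A_closed) auto
  finally show ?case by simp
qed

text \<open>Entries are consumed from the left, so the latest rotation concerns the last entry of m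
  and the induction runs from the right. Each rotation coacts anew; \<open>co_coassoc\<close> turns
  this into one coaction with comultiplied leg, whose second half goes to the new entry.\<close>

lemma tb_pow:
  "\<lbrakk>length m + length l = Suc p; length as = Suc q; set as \<subseteq> carrier C; set l \<subseteq> carrier H; set m \<subseteq> carrier H\<rbrakk> \<Longrightarrow>
    (tb p q ^^ length m) (pt (m @ l) as) = co (A p q) as (\<lambda>u bs. H.act (A p q) m u (\<lambda>r. pt (l @ r) bs))"
proof (induction m arbitrary: l rule: rev_induct)
  case Nil
  then show ?case by (simp add: co_counit[OF A_module] mlin_pt2)
next
  case (snoc g m)
  let ?L = "A p q"
  have IH: "(tb p q ^^ length m) (pt (m @ g # l) as) = co ?L as (\<lambda>u bs. H.act ?L m u (\<lambda>r. pt (g # l @ r) bs))"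
    using snoc.IH[of "g # l"] snoc.prems by simp
  have tb: "tb p q (pt (g # l @ r) bs) = co ?L bs (\<lambda>v cs. pt (l @ r @ [v \<otimes>\<^bsub>H\<^esub> g]) cs)"
    if "length r = length m" "set r \<subseteq> carrier H" "length bs = length as" "set bs \<subseteq> carrier C" for r bs
    using tb_pt[of p "l @ r" bs q g] snoc.prems that by (simp add: add.commute)
  have act: "H.act ?L (m @ [g]) u (\<lambda>r. pt (l @ r) bs) = H.D ?L u (\<lambda>x y. H.act ?L m x (\<lambda>r. pt (l @ r @ [y \<otimes>\<^bsub>H\<^esub> g]) bs))"
    if "u \<in> carrier H" "length bs = length as" "set bs \<subseteq> carrier C" for u bs
  proof -
    have "H.act ?L (m @ [g]) u (\<lambda>r. pt (l @ r) bs) = H.D ?L u (\<lambda>x y. H.act ?L m x (\<lambda>r. H.act ?L [g] y (\<lambda>s. pt (l @ r @ s) bs)))"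
      using snoc.prems that
      by (intro H.act_append[OF A_module, where K = "\<lambda>r. pt (l @ r) bs"] mlinI lin_pt1 slot_append2 slot_here lin_ident pt_closed) auto
    also have "\<dots> = H.D ?L u (\<lambda>x y. H.act ?L m x (\<lambda>r. pt (l @ r @ [y \<otimes>\<^bsub>H\<^esub> g]) bs))"
      using snoc.prems that
      by (intro H.D_cong H.act_cong H.act_single[OF A_module, where K = "\<lambda>s. pt (l @ r @ s) bs" for r])
        (auto intro!: mlinI lin_pt1 slot_append2 slot_here lin_ident pt_closed)
    finally show ?thesis .
  qed
  have "(tb p q ^^ length (m @ [g])) (pt ((m @ [g]) @ l) as) = tb p q (co ?L as (\<lambda>u bs. H.act ?L m u (\<lambda>r. pt (g # l @ r) bs)))"
    using IH by simp
  also have "\<dots> = co ?L as (\<lambda>u bs. tb p q (H.act ?L m u (\<lambda>r. pt (g # l @ r) bs)))"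
    using snoc.prems by (intro co_commute[OF tb_lin A_module A_module] A_closed) auto
  also have "\<dots> = co ?L as (\<lambda>u bs. H.act ?L m u (\<lambda>r. tb p q (pt (g # l @ r) bs)))"
    using snoc.prems by (intro co_cong H.act_commute[OF tb_lin A_module A_module] A_closed) auto
  also have "\<dots> = co ?L as (\<lambda>u bs. H.act ?L m u (\<lambda>r. co ?L bs (\<lambda>v cs. pt (l @ r @ [v \<otimes>\<^bsub>H\<^esub> g]) cs)))"
    using snoc.prems by (intro co_cong H.act_cong tb) auto
  also have "\<dots> = co ?L as (\<lambda>u bs. co ?L bs (\<lambda>v cs. H.act ?L m u (\<lambda>r. pt (l @ r @ [v \<otimes>\<^bsub>H\<^esub> g]) cs)))"
    using snoc.prems by (intro co_cong act_co_swap[OF A_module] A_closed) auto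
  also have "\<dots> = co ?L as (\<lambda>u bs. H.D ?L u (\<lambda>x y. H.act ?L m x (\<lambda>r. pt (l @ r @ [y \<otimes>\<^bsub>H\<^esub> g]) bs)))"
  proof (intro co_coassoc[OF A_module, where K = "\<lambda>u v cs. H.act ?L m u (\<lambda>r. pt (l @ r @ [v \<otimes>\<^bsub>H\<^esub> g]) cs)"])
    fix u v assume "u \<in> carrier H" "v \<in> carrier H"
    then show "mlin k C (length as) ?L (\<lambda>cs. H.act ?L m u (\<lambda>r. pt (l @ r @ [v \<otimes>\<^bsub>H\<^esub> g]) cs))"
      using snoc.prems
      by (intro mlinI H.lin_act_param[OF A_module C.module_axioms] A_closed lin_pt2 slot_append2 slot_here lin_ident) auto
  next
    fix v bs assume "v \<in> carrier H" "length bs = length as" "set bs \<subseteq> carrier C"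
    then show "(\<lambda>u. H.act ?L m u (\<lambda>r. pt (l @ r @ [v \<otimes>\<^bsub>H\<^esub> g]) bs)) \<in> lin_maps k H ?L"
      using snoc.prems
      by (intro H.lin_act_id[OF A_module] mlinI lin_pt1 slot_append1 slot_append2 slot_here lin_ident pt_closed) auto
  next
    fix u bs assume "u \<in> carrier H" "length bs = length as" "set bs \<subseteq> carrier C"
    then show "(\<lambda>v. H.act ?L m u (\<lambda>r. pt (l @ r @ [v \<otimes>\<^bsub>H\<^esub> g]) bs)) \<in> lin_maps k H ?L"
      using snoc.prems
      by (intro H.lin_act_param[OF A_module H.module_axioms] lin_pt1 slot_append2 slot_here H.lin_mult_left lin_ident) auto
  qed (use snoc.prems in auto)
  also have "\<dots> = co ?L as (\<lambda>u bs. H.act ?L (m @ [g]) u (\<lambda>r. pt (l @ r) bs))"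
    using snoc.prems by (intro co_cong act[symmetric]) auto
  finally show ?case .
qed

lemma lin_funpow: "f \<in> lin_maps k M M \<Longrightarrow> (f ^^ n) \<in> lin_maps k M M"
  by (induction n) (auto simp: id_def comp_def intro: lin_ident lin_comp)

text \<open>Both sides send $(g \mid a)$ to $(u \cdot g \mid a^{(\bar 0)})$, where $u \otimes a^{(\bar 0)}$ is the diagonal coaction of $a$.\<close>

lemma tb_pow_om_pow:
  assumes x: "x \<in> carrier (A p q)"
  shows "(tb p q ^^ Suc p) x = (om p q ^^ Suc q) x"
proof (rule A_eqI[where f = "tb p q ^^ Suc p" and g = "om p q ^^ Suc q"])
  fix gs as assume gs: "length gs = Suc p" "set gs \<subseteq> carrier H" and as: "length as = Suc q" "set as \<subseteq> carrier C"
  then show "(tb p q ^^ Suc p) (pt gs as) = (om p q ^^ Suc q) (pt gs as)"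
    using tb_pow[of gs "[]" p as q] om_pow[of as "[]" q gs p] by simp
qed (use x in \<open>auto intro!: lin_funpow tb_lin om_lin A_module simp del: funpow.simps\<close>)

section \<open>Assembly of the cocylindrical structure\<close>

lemmas dd_cl = lin_closed[OF dd_lin] and ss_cl = lin_closed[OF ss_lin] and tt_cl = lin_closed[OF tt_lin]
  and db_cl = lin_closed[OF db_lin] and sb_cl = lin_closed[OF sb_lin] and tb_cl = lin_closed[OF tb_lin]
  and om_cl = lin_closed[OF om_lin]

lemma slot_C: "slot_cosimplicial k C (A p) (dd p) (ss p) pt {gs. length gs = Suc p \<and> set gs \<subseteq> carrier H}"
proof (intro slot_cosimplicial.intro slot_cosimplicial_axioms.intro C.coalgebra_axioms)
  fix n i :: nat assume "i < n"
  then obtain m where m: "n = Suc m" by (cases n) auto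
  show "ss p n i \<in> lin_maps k (A p n) (A p (n - 1))"
    using ss_lin[of i m p] \<open>i < n\<close> m by simp
  fix gs xs assume "gs \<in> {gs. length gs = Suc p \<and> set gs \<subseteq> carrier H}" "length xs = Suc n" "set xs \<subseteq> carrier C"
  then show "ss p n i (pt gs xs) = \<epsilon>\<^bsub>C\<^esub> (xs ! Suc i) \<odot>\<^bsub>A p (n - 1)\<^esub> pt gs (take (Suc i) xs @ drop (Suc (Suc i)) xs)"
    using \<open>i < n\<close> unfolding m by (simp add: ss_nth)
next
  fix n m f g x
  assume *: "f \<in> lin_maps k (A p n) (A p m)" "g \<in> lin_maps k (A p n) (A p m)"
    and eq: "\<And>gs xs. \<lbrakk>gs \<in> {gs. length gs = Suc p \<and> set gs \<subseteq> carrier H}; length xs = Suc n; set xs \<subseteq> carrier C\<rbrakk> \<Longrightarrow> f (pt gs xs) = g (pt gs xs)"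
    and x: "x \<in> carrier (A p n)"
  show "f x = g x" by (rule A_eqI[OF * A_module _ x]) (rule eq, simp_all)
next
  fix n i gs xs
  assume "i \<le> n" "gs \<in> {gs. length gs = Suc p \<and> set gs \<subseteq> carrier H}" "length xs = Suc n" "set xs \<subseteq> carrier C"
  then show "dd p n i (pt gs xs) = C.D (A p (Suc n)) (xs ! i) (\<lambda>x y. pt gs (take i xs @ x # y # drop (Suc i) xs))"
    by (intro dd_nth) auto
qed (auto intro: A_module mlin_pt2 dd_lin)

text \<open>Here the coalgebra entries are the spectators, so \<open>pt\<close> appears with its
  arguments exchanged.\<close>

lemma slot_H: "slot_cosimplicial k H (\<lambda>p. A p q) (\<lambda>p. db p q) (\<lambda>p. sb p q) (\<lambda>as gs. pt gs as)
  {as. length as = Suc q \<and> set as \<subseteq> carrier C}"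
proof (intro slot_cosimplicial.intro slot_cosimplicial_axioms.intro H.coalgebra_axioms)
  fix n i :: nat assume "i < n"
  then obtain m where m: "n = Suc m" by (cases n) auto
  show "sb n q i \<in> lin_maps k (A n q) (A (n - 1) q)"
    using sb_lin[of i m q] \<open>i < n\<close> m by simp
  fix as xs assume "as \<in> {as. length as = Suc q \<and> set as \<subseteq> carrier C}" "length xs = Suc n" "set xs \<subseteq> carrier H"
  then show "sb n q i (pt xs as) = \<epsilon>\<^bsub>H\<^esub> (xs ! Suc i) \<odot>\<^bsub>A (n - 1) q\<^esub> pt (take (Suc i) xs @ drop (Suc (Suc i)) xs) as"
    using \<open>i < n\<close> unfolding m by (simp add: sb_nth)
next
  fix n m f g x
  assume *: "f \<in> lin_maps k (A n q) (A m q)" "g \<in> lin_maps k (A n q) (A m q)"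
    and eq: "\<And>as xs. \<lbrakk>as \<in> {as. length as = Suc q \<and> set as \<subseteq> carrier C}; length xs = Suc n; set xs \<subseteq> carrier H\<rbrakk> \<Longrightarrow> f (pt xs as) = g (pt xs as)"
    and x: "x \<in> carrier (A n q)"
  show "f x = g x" by (rule A_eqI[OF * A_module _ x]) (rule eq, simp_all)
next
  fix n i as xs
  assume "i \<le> n" "as \<in> {as. length as = Suc q \<and> set as \<subseteq> carrier C}" "length xs = Suc n" "set xs \<subseteq> carrier H"
  then show "db n q i (pt xs as) = H.D (A (Suc n) q) (xs ! i) (\<lambda>x y. pt (take i xs @ x # y # drop (Suc i) xs) as)"
    by (intro db_nth) auto
qed (auto intro: A_module mlin_pt1 db_lin)

lemma om_bij: "bij_betw (om p q) (carrier (A p q)) (carrier (A p q))"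
  by (rule bij_betw_byWitness[where f' = "tt p q"]) (auto simp: om_tt tt_om om_cl tt_cl)

lemma tt_bij: "bij_betw (tt p q) (carrier (A p q)) (carrier (A p q))"
  by (rule bij_betw_byWitness[where f' = "om p q"]) (auto simp: om_tt tt_om om_cl tt_cl)

lemma tb_bij: "bij_betw (tb p q) (carrier (A p q)) (carrier (A p q))"
proof -
  let ?X = "carrier (A p q)"
  have om: "bij_betw (om p q ^^ Suc q) ?X ?X" by (rule bij_betw_funpow[OF om_bij])
  have tb: "(tb p q ^^ n) x \<in> ?X" if "x \<in> ?X" for n x
    by (rule lin_closed[OF lin_funpow[OF tb_lin] that])
  have "inj_on (tb p q) ?X"
  proof (rule inj_onI)
    fix x y assume xy: "x \<in> ?X" "y \<in> ?X" "tb p q x = tb p q y"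
    \<comment> \<open>Equality after one application propagates to the power, which is injective
      because it agrees with a power of \<omega>.\<close>
    then have "(tb p q ^^ Suc p) x = (tb p q ^^ Suc p) y" by (simp only: funpow_Suc_right comp_def)
    then have "(om p q ^^ Suc q) x = (om p q ^^ Suc q) y" using xy by (simp only: tb_pow_om_pow)
    then show "x = y" using om xy by (meson bij_betw_imp_inj_on inj_onD)
  qed
  moreover have "tb p q ` ?X = ?X"
  proof
    show "tb p q ` ?X \<subseteq> ?X" by (auto intro: tb_cl)
    show "?X \<subseteq> tb p q ` ?X"
    proof
      fix y assume "y \<in> ?X"
      then obtain z where z: "z \<in> ?X" "y = (om p q ^^ Suc q) z" using om by (auto simp: bij_betw_def)
      then have "y = tb p q ((tb p q ^^ p) z)" using tb_pow_om_pow[of z p q] by simp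
      then show "y \<in> tb p q ` ?X" using tb z by blast
    qed
  qed
  ultimately show ?thesis by (simp add: bij_betw_def)
qed

text \<open>Commutation with an invertible operator passes to its inverse: insert \<omega> \<tau>
  next to x, move \<omega> past f, and cancel it against the outer \<tau>.\<close>

lemma tt_commute:
  assumes f: "f \<in> lin_maps k (A p q) (A p' q')" and x: "x \<in> carrier (A p q)"
    and om: "\<And>x. x \<in> carrier (A p q) \<Longrightarrow> om p' q' (f x) = f (om p q x)"
  shows "tt p' q' (f x) = f (tt p q x)"
proof -
  have "tt p' q' (f x) = tt p' q' (f (om p q (tt p q x)))" using x by (simp add: om_tt)
  also have "\<dots> = tt p' q' (om p' q' (f (tt p q x)))" using om[of "tt p q x"] x by (simp add: tt_cl)
  also have "\<dots> = f (tt p q x)" using x by (intro tt_om lin_closed[OF f] tt_cl)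
  finally show ?thesis .
qed

lemma paracocyclic: "paracocyclic_module k (A p) (dd p) (ss p) (tt p)"
proof -
  interpret slot_cosimplicial k C "A p" "dd p" "ss p" pt "{gs. length gs = Suc p \<and> set gs \<subseteq> carrier H}"
    by (rule slot_C)
  show ?thesis
  proof (rule paracocyclic_module_reduced)
    fix n i x assume i: "1 \<le> i" "i \<le> n" and x: "x \<in> carrier (A p n)"
    have "tt p (Suc n) (dd p n i x) = tt p (Suc n) (dd p n i (om p n (tt p n x)))"
      using x by (simp add: om_tt)
    also have "\<dots> = tt p (Suc n) (om p (Suc n) (dd p n (i - 1) (tt p n x)))"
      using om_dd[OF i, of "tt p n x" p] x by (simp add: tt_cl)
    also have "\<dots> = dd p n (i - 1) (tt p n x)"
      using x i by (intro tt_om dd_cl tt_cl) auto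
    finally show "tt p (Suc n) (dd p n i x) = dd p n (i - 1) (tt p n x)" .
  next
    fix n x assume x: "x \<in> carrier (A p n)"
    \<comment> \<open>This is \<open>om_om_dd\<close> at \<tau> x; afterwards both copies of
      \<omega> are cancelled from the left.\<close>
    have "dd p n 0 x = om p (Suc n) (om p (Suc n) (dd p n n (tt p n x)))"
      using om_om_dd[of "tt p n x" p n] x by (simp add: tt_cl om_tt)
    then show "tt p (Suc n) (tt p (Suc n) (dd p n 0 x)) = dd p n n (tt p n x)"
      using x by (simp add: tt_om om_cl dd_cl tt_cl)
  next
    fix n i x assume i: "1 \<le> i" "i < n" and x: "x \<in> carrier (A p n)"
    then obtain m where m: "n = Suc m" by (cases n) auto
    have "tt p m (ss p n i x) = tt p m (ss p n i (om p n (tt p n x)))"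
      using x by (simp add: om_tt)
    also have "\<dots> = tt p m (om p m (ss p n (i - 1) (tt p n x)))"
      using om_ss[of i m "tt p n x" p] i x m by (simp add: tt_cl)
    also have "\<dots> = ss p n (i - 1) (tt p n x)"
      using x i unfolding m by (intro tt_om ss_cl tt_cl) auto
    finally show "tt p (n - 1) (ss p n i x) = ss p n (i - 1) (tt p n x)" using m by simp
  next
    fix n x assume n: "1 \<le> n" and x: "x \<in> carrier (A p n)"
    then obtain m where m: "n = Suc m" by (cases n) auto
    have "om p m (ss p n m (tt p n (tt p n x))) = ss p n 0 x"
      using om_ss_last[of "tt p n (tt p n x)" p m] x m by (simp add: tt_cl om_tt)
    then have "tt p m (ss p n 0 x) = tt p m (om p m (ss p n m (tt p n (tt p n x))))" by simp
    also have "\<dots> = ss p n m (tt p n (tt p n x))"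
      using x unfolding m by (intro tt_om ss_cl tt_cl) auto
    finally show "tt p (n - 1) (ss p n 0 x) = ss p n (n - 1) (tt p n (tt p n x))" using m by simp
  qed (fact A_module d_lin s_lin tt_lin tt_bij dd_last d_d s_s s_d_less s_d_id s_d_greater ss_tt_dd_0)+
qed

lemma paracocyclic_bar: "paracocyclic_module k (\<lambda>p. A p q) (\<lambda>p. db p q) (\<lambda>p. sb p q) (\<lambda>p. tb p q)"
proof -
  interpret slot_cosimplicial k H "\<lambda>p. A p q" "\<lambda>p. db p q" "\<lambda>p. sb p q" "\<lambda>as gs. pt gs as"
    "{as. length as = Suc q \<and> set as \<subseteq> carrier C}"
    by (rule slot_H)
  show ?thesis
  proof (rule paracocyclic_module_reduced)
    fix n i x assume i: "1 \<le> i" "i < n" and x: "x \<in> carrier (A n q)"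
    then obtain m where m: "n = Suc m" by (cases n) auto
    show "tb (n - 1) q (sb n q i x) = sb n q (i - 1) (tb n q x)"
      using tb_sb[of i m x q] i x m by simp
  next
    fix n x assume n: "1 \<le> n" and x: "x \<in> carrier (A n q)"
    then obtain m where m: "n = Suc m" by (cases n) auto
    show "tb (n - 1) q (sb n q 0 x) = sb n q (n - 1) (tb n q (tb n q x))"
      using tb_sb_0[of x m q] x m by simp
  qed (fact A_module d_lin s_lin tb_lin tb_bij db_last d_d s_s s_d_less s_d_id s_d_greater sb_tb_db_0 tb_db tb_tb_db)+
qed

lemma tt_tb: "x \<in> carrier (A p q) \<Longrightarrow> tt p q (tb p q x) = tb p q (tt p q x)"
  by (rule tt_commute[OF tb_lin _ om_tb])

lemma tt_sb: "\<lbrakk>j \<le> p; x \<in> carrier (A (Suc p) q)\<rbrakk> \<Longrightarrow> tt p q (sb (Suc p) q j x) = sb (Suc p) q j (tt (Suc p) q x)"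
  by (rule tt_commute[OF sb_lin _ om_sb]) auto

text \<open>The last barred coface is the barred cyclic operator after coface 0, and \<tau> commutes
  with both factors.\<close>

lemma tt_db:
  assumes j: "j \<le> Suc p" and x: "x \<in> carrier (A p q)"
  shows "tt (Suc p) q (db p q j x) = db p q j (tt p q x)"
proof -
  have *: "tt (Suc p) q (db p q j x) = db p q j (tt p q x)" if "j \<le> p" for j
    by (rule tt_commute[OF db_lin x om_db]) (use that in auto)
  show ?thesis
  proof (cases "j = Suc p")
    case True
    then show ?thesis using x by (simp add: db_last tt_tb db_cl tt_cl *)
  qed (use * j in auto)
qed

lemma dd_tb':
  assumes i: "i \<le> Suc q" and x: "x \<in> carrier (A p q)"
  shows "dd p q i (tb p q x) = tb p (Suc q) (dd p q i x)"
proof (cases "i = Suc q")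
  case True
  then show ?thesis using x by (simp add: dd_last tt_tb dd_cl tb_cl dd_tb)
qed (use dd_tb assms in auto)

text \<open>A last coface in either direction factors through the zeroth one. The barred last coface
  is resolved first, for i at most q; the unbarred one then follows because \<tau> commutes with
  every barred coface.\<close>

lemma dd_db:
  assumes i: "i \<le> Suc q" and j: "j \<le> Suc p" and x: "x \<in> carrier (A p q)"
  shows "dd (Suc p) q i (db p q j x) = db p (Suc q) j (dd p q i x)"
proof -
  have *: "dd (Suc p) q i (db p q j x) = db p (Suc q) j (dd p q i x)" if "i \<le> q" "j \<le> Suc p" for i j
  proof (cases "j = Suc p")
    case True
    then show ?thesis using x that by (simp add: db_last dd_tb dd_db_0 db_cl dd_cl)
  qed (use dd_db_0 x that in auto)
  show ?thesis
  proof (cases "i = Suc q")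
    case True
    have "db p q j x \<in> carrier (A (Suc p) q)"
    proof (cases "j = Suc p")
      case True
      then show ?thesis using x by (simp add: db_last tb_cl db_cl)
    qed (use j x db_cl in auto)
    then show ?thesis using True x j by (simp add: dd_last * tt_db dd_cl)
  qed (use * i j in auto)
qed

lemma dd_sb:
  assumes i: "i \<le> Suc q" and j: "j \<le> p" and x: "x \<in> carrier (A (Suc p) q)"
  shows "dd p q i (sb (Suc p) q j x) = sb (Suc p) (Suc q) j (dd (Suc p) q i x)"
proof (cases "i = Suc q")
  case True
  then show ?thesis using x j by (simp add: dd_last dd_sb_0 tt_sb sb_cl dd_cl)
qed (use dd_sb_0 assms in auto)

lemma ss_db:
  assumes i: "i \<le> q" and j: "j \<le> Suc p" and x: "x \<in> carrier (A p (Suc q))"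
  shows "ss (Suc p) (Suc q) i (db p (Suc q) j x) = db p q j (ss p (Suc q) i x)"
proof (cases "j = Suc p")
  case True
  then show ?thesis using x i by (simp add: db_last ss_db_0 ss_tb ss_cl db_cl)
qed (use ss_db_0 assms in auto)

lemma bi_paracocyclic: "bi_paracocyclic_module k A dd ss tt db sb tb"
proof (rule bi_paracocyclic_module.intro)
  fix p q i j and x
  show "paracocyclic_module k (A p) (dd p) (ss p) (tt p)" by (rule paracocyclic)
  show "paracocyclic_module k (\<lambda>p. A p q) (\<lambda>p. db p q) (\<lambda>p. sb p q) (\<lambda>p. tb p q)" by (rule paracocyclic_bar)
  show "\<lbrakk>i \<le> q + 1; j \<le> p + 1; x \<in> carrier (A p q)\<rbrakk> \<Longrightarrow> dd (p + 1) q i (db p q j x) = db p (q + 1) j (dd p q i x)"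
    using dd_db[of i q j p x] by simp
  show "\<lbrakk>i \<le> q + 1; x \<in> carrier (A p q)\<rbrakk> \<Longrightarrow> dd p q i (tb p q x) = tb p (q + 1) (dd p q i x)"
    using dd_tb'[of i q x p] by simp
  show "\<lbrakk>j \<le> p + 1; x \<in> carrier (A p q)\<rbrakk> \<Longrightarrow> tt (p + 1) q (db p q j x) = db p q j (tt p q x)"
    using tt_db[of j p x q] by simp
  show "x \<in> carrier (A p q) \<Longrightarrow> tt p q (tb p q x) = tb p q (tt p q x)"
    by (rule tt_tb)
  show "\<lbrakk>i \<le> q + 1; j < p; x \<in> carrier (A p q)\<rbrakk> \<Longrightarrow> dd (p - 1) q i (sb p q j x) = sb p (q + 1) j (dd p q i x)"
    using dd_sb[of i q j "p - 1" x] by (cases p) auto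
  show "\<lbrakk>j < p; x \<in> carrier (A p q)\<rbrakk> \<Longrightarrow> tt (p - 1) q (sb p q j x) = sb p q j (tt p q x)"
    using tt_sb[of j "p - 1" x q] by (cases p) auto
  show "\<lbrakk>i < q; j \<le> p + 1; x \<in> carrier (A p q)\<rbrakk> \<Longrightarrow> ss (p + 1) q i (db p q j x) = db p (q - 1) j (ss p q i x)"
    using ss_db[of i "q - 1" j p x] by (cases q) auto
  show "\<lbrakk>i < q; x \<in> carrier (A p q)\<rbrakk> \<Longrightarrow> ss p q i (tb p q x) = tb p (q - 1) (ss p q i x)"
    using ss_tb[of i "q - 1" x p] by (cases q) auto
  show "\<lbrakk>i < q; j < p; x \<in> carrier (A p q)\<rbrakk> \<Longrightarrow> ss (p - 1) q i (sb p q j x) = sb p (q - 1) j (ss p q i x)"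
    using ss_sb[of i "q - 1" j "p - 1" x] by (cases q; cases p) auto
qed

lemma om_pow_tt_pow: "x \<in> carrier (A p q) \<Longrightarrow> (om p q ^^ n) ((tt p q ^^ n) x) = x"
proof (induction n)
  case (Suc n)
  have "(tt p q ^^ n) x \<in> carrier (A p q)"
    by (rule lin_closed[OF lin_funpow[OF tt_lin] Suc.prems])
  \<comment> \<open>The innermost \<omega> is split off on the right and the outermost \<tau> on the
    left, so that the two meet and cancel.\<close>
  moreover have "(om p q ^^ Suc n) ((tt p q ^^ Suc n) x) = (om p q ^^ n) (om p q (tt p q ((tt p q ^^ n) x)))"
    by (simp only: funpow_Suc_right[where f = "om p q"] funpow.simps(2)[where f = "tt p q"] comp_def)
  ultimately show ?case using Suc by (simp only: om_tt)
qed simp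

lemma cocylindrical: "cocylindrical_module k (CH k H C) dd ss tt db sb tb"
proof -
  have CH: "CH k H C = A" by (intro ext) (rule CH_A)
  show ?thesis
    unfolding CH
  proof (rule cocylindrical_module.intro[OF bi_paracocyclic cocylindrical_module_axioms.intro])
    fix p q x assume x: "x \<in> carrier (A p q)"
    have "(tt p q ^^ Suc q) x \<in> carrier (A p q)"
      by (rule lin_closed[OF lin_funpow[OF tt_lin] x])
    then show "(tb p q ^^ (p + 1)) ((tt p q ^^ (q + 1)) x) = x"
      using om_pow_tt_pow[OF x, of "Suc q"] by (simp only: tb_pow_om_pow Suc_eq_plus1[symmetric])
  qed
qed

end

theorem theorem3p1:
  fixes k :: "('k, 'x) ring_scheme"
    and H :: "('k, 'h, 'y) hopf_algebra_scheme"
    and C :: "('k, 'h, 'c, 'z) comodule_coalgebra_scheme"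
  assumes "cring k"
    and "hopf_algebra k H"
    and "bij_betw (antipode H) (carrier H) (carrier H)"
    and "comodule_coalgebra k H C"
  shows "cocylindrical_module k (CH k H C)
    (CH_partial k H C) (CH_sigma k H C) (CH_tau k H C)
    (CH_partial_bar k H C) (CH_sigma_bar k H C) (CH_tau_bar k H C)"
proof -
  interpret crossed_product k H C
    by (intro crossed_product.intro crossed_product_axioms.intro assms)
  show ?thesis by (rule cocylindrical)
qed

end
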